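(* Let $k$ be a commutative ring with unit. For $a\in\mathbb{N}$ there is an isomorphism of cosimplicial objects in $\mathcal{F}(\mathbf{\Sigma}^{\mathrm{op}};k)$: $$\mathrm{Hom}_{\mathcal{F}(\Gamma;k)}\big((t^* )^{\otimes a},(\perp^\Gamma)^\bullet t^{*\otimes}\big)\cong\big[\mathfrak{C}^\bullet\,k\,\mathrm{Hom}_{\mathbf{\Omega}}(-,\mathbf{a})\big]^{\mathrm{op}}.$$
   Context: $\Gamma$ is the category of finite pointed sets; $\mathbf{\Omega}$, $\mathbf{FI}$, $\mathbf{\Sigma}$ are the categories of finite sets and surjections, injections, bijections respectively. $\mathcal{F}(\mathcal{C};k)$ is the category of functors from $\mathcal{C}$ to $k$-modules with pointwise tensor product. $\mathbf{n}=\{1,\dots,n\}$. Left-hand side. $t^*\in\mathcal{F}(\Gamma;k)$ is $t^*(Z,z)=k[Z]/k[z]$, identified with $\ker(k[Z]\to k)$ via the class of $y$ corresponding to $[y]-[z]$. $t^{*\otimes}$ is the functor $\mathbf{b}\mapsto(t^* )^{\otimes b}$ in $\mathcal{F}(\Gamma\times\mathbf{\Sigma}^{\mathrm{op}};k)$, with $\mathfrak{S}_b$ acting on the right by place permutations. $\perp^\Gamma$ is the comonad on $\mathcal{F}(\Gamma;k)$ with $\perp^\Gamma F(Y)=F(Y_+)$, where $Y_+$ is the underlying set of $Y$ with an added basepoint $+$. Its counit $F(Y_+)\to F(Y)$ is induced by the pointed map that is the identity on $Y$ and sends $+$ to the basepoint $y$ of $Y$. Its comultiplication $\Delta:F(Y_+)\to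 F((Y_{+_1})_{+_2})$ is induced by the map that is the identity on $Y$ and sends $+$ to $+_2$. The functor $(t^* )^{\otimes n}$ is a $\perp^\Gamma$-comodule with structure map $\psi$ given on $Y$ by the $n$-th tensor power of the map $t^*(Y)=\ker(k[Y]\to k)\to t^*(Y_+)=\ker(k[Y_+]\to k)$ induced by the (unpointed) inclusion $Y\subset Y_+$. For a comonad $(\perp,\Delta,\epsilon)$ and $\perp$-comodules $M,N$, the cosimplicial object $\mathrm{Hom}(M,\perp^\bullet N)$ is $\mathrm{Hom}(M,\perp^tN)$ in degree $t$, with cofaces $\mathrm{Hom}(M,\perp^tN)\to\mathrm{Hom}(M,\perp^{t+1}N)$: $d^0\gamma=(\perp\gamma)\circ\psi_M$, $d^i\gamma=(\perp^{i-1}\Delta_{\perp^{t-i}N})\circ\gamma$ for $0<i<t+1$, $d^{t+1}\gamma=(\perp^t\psi_N)\circ\gamma$, and codegeneracies $s^j\gamma=(\perp^j\epsilon_{\perp^{t-j}N})\circ\gamma$ from degree $t+1$ to degree $t$, $0\le j\le t$. The left-hand side is this construction with $M=(t^* )^{\otimes a}$, $N=(t^* )^{\otimes b}$, $\perp=\perp^\Gamma$, considered as a $\mathbf{\Sigma}^{\mathrm{op}}$-module in $\mathbf{b}$. Right-hand side. The $\mathbf{FI}^{\mathrm{op}}$-module $k\,\mathrm{Hom}_{\mathbf{\Omega}}(-,\mathbf{a})$ sends $\mathbf{b}$ to the free $k$-module on surjections $\mathbf{b}\to\mathbf{a}$; an injection $i$ sends $[f]$ to $[f\circ i]$ if $f\circ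 i$ is surjective, else to $0$. Let $\perp$ now denote the comonad on $\mathcal{F}(\mathbf{\Sigma}^{\mathrm{op}};k)$ with $\perp G(\mathbf{b})=\bigoplus_{\mathbf{b}'\subseteq\mathbf{b}}G(\mathbf{b}')$ (a bijection $f:\mathbf{l}\to\mathbf{b}$ sends $G(\mathbf{b}')$ to $G(f^{-1}(\mathbf{b}'))$ via $f|_{f^{-1}(\mathbf{b}')}$), counit $\epsilon_G$ the projection onto the summand $\mathbf{b}'=\mathbf{b}$, comultiplication $\Delta_G:\bigoplus_{\mathbf{l}'\subseteq\mathbf{b}}G(\mathbf{l}')\to\bigoplus_{\mathbf{b}''\subseteq\mathbf{b}'\subseteq\mathbf{b}}G(\mathbf{b}'')$ with component $G(\mathbf{l}')\to G(\mathbf{b}'')$ the identity if $\mathbf{l}'=\mathbf{b}''$ and zero otherwise, and coaugmentation $\eta_G:G\to\perp G$ the inclusion of the summand $\mathbf{b}'=\mathbf{b}$. For an $\mathbf{FI}^{\mathrm{op}}$-module $F$, $\psi_F:F(\mathbf{b})\to\bigoplus_{\mathbf{b}'\subseteq\mathbf{b}}F(\mathbf{b}')$ has components induced by the inclusions $\mathbf{b}'\subseteq\mathbf{b}$. Then $\mathfrak{C}^\bullet F$ is the cosimplicial $\mathbf{\Sigma}^{\mathrm{op}}$-module with $\mathfrak{C}^nF=\perp^nF$, cofaces $d^0=\eta_{\perp^nF}$, $d^i=\perp^{i-1}\Delta_{\perp^{n-i}F}$ ($0<i<n+1$), $d^{n+1}=\perp^n\psi_F$ from degree $n$ to degree $n+1$,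 and codegeneracies $s^j=\perp^j\epsilon_{\perp^{n-j}F}$ from degree $n+1$ to degree $n$. The opposite $(-)^{\mathrm{op}}$ of a cosimplicial object has the same terms with $\tilde d^i=d^{n+1-i}$, $\tilde s^j=s^{n-j}$. *)

theory Defs
  imports "HOL-Algebra.Module" "HOL-Algebra.AbelCoset" "HOL-Library.FuncSet"
    "HOL-Library.Infinite_Typeclass"
begin

section \<open>Modules over a commutative ring\<close>

text \<open>Modules are records of HOL-Algebra. The fields \<open>mult\<close> and \<open>one\<close>, which those records inherit
  from rings and which the locale \<^locale>\<open>Module.module\<close> ignores, are left undefined.\<close>

definition mod_hom ::
  "('k, 'r) ring_scheme \<Rightarrow> ('k, 'e) module \<Rightarrow> ('k, 'f) module \<Rightarrow> ('e \<Rightarrow> 'f) set" where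
  "mod_hom k M N = {\<phi> \<in> carrier M \<rightarrow> carrier N.
     (\<forall>x \<in> carrier M. \<forall>y \<in> carrier M. \<phi> (x \<oplus>\<^bsub>M\<^esub> y) = \<phi> x \<oplus>\<^bsub>N\<^esub> \<phi> y) \<and>
     (\<forall>c \<in> carrier k. \<forall>x \<in> carrier M. \<phi> (c \<odot>\<^bsub>M\<^esub> x) = c \<odot>\<^bsub>N\<^esub> \<phi> x)}"

definition mod_span :: "('k, 'r) ring_scheme \<Rightarrow> ('k, 'e) module \<Rightarrow> 'e set \<Rightarrow> 'e set" where
  "mod_span k M S = \<Inter> {H. submodule H k M \<and> S \<subseteq> H}"

definition quot_mod :: "('k, 'e) module \<Rightarrow> 'e set \<Rightarrow> ('k, 'e set) module" where
  "quot_mod M H = \<lparr>carrier = a_rcosets\<^bsub>M\<^esub> H, mult = undefined, one = undefined,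
     zero = H, add = (\<lambda>C D. C <+>\<^bsub>M\<^esub> D),
     smult = (\<lambda>c C. \<Union>x \<in> C. H +>\<^bsub>M\<^esub> (c \<odot>\<^bsub>M\<^esub> x))\<rparr>"

text \<open>The map into \<open>quot_mod N H\<close> induced by \<open>\<phi>\<close>; when \<open>\<phi>\<close> is compatible with the
  submodules divided out, all the cosets in the union coincide.\<close>

definition quot_map :: "('k, 'f) module \<Rightarrow> 'f set \<Rightarrow> ('e \<Rightarrow> 'f) \<Rightarrow> 'e set \<Rightarrow> 'f set" where
  "quot_map N H \<phi> C = (\<Union>x \<in> C. H +>\<^bsub>N\<^esub> \<phi> x)"

subsection \<open>Free modules\<close>

text \<open>\<open>k[X]\<close>: finitely supported functions on \<open>X\<close>, extended by zero outside \<open>X\<close>.\<close>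

definition free_mod :: "('k, 'r) ring_scheme \<Rightarrow> 'x set \<Rightarrow> ('k, 'x \<Rightarrow> 'k) module" where
  "free_mod k X = \<lparr>carrier = {x. (\<forall>w. x w \<in> carrier k) \<and> (\<forall>w. w \<notin> X \<longrightarrow> x w = \<zero>\<^bsub>k\<^esub>) \<and>
       finite {w. x w \<noteq> \<zero>\<^bsub>k\<^esub>}},
     mult = undefined, one = undefined, zero = (\<lambda>w. \<zero>\<^bsub>k\<^esub>),
     add = (\<lambda>x y w. x w \<oplus>\<^bsub>k\<^esub> y w), smult = (\<lambda>c x w. c \<otimes>\<^bsub>k\<^esub> x w)\<rparr>"

definition gen :: "('k, 'r) ring_scheme \<Rightarrow> 'x \<Rightarrow> 'x \<Rightarrow> 'k" where
  "gen k y = (\<lambda>w. if w = y then \<one>\<^bsub>k\<^esub> else \<zero>\<^bsub>k\<^esub>)"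

text \<open>The \<open>k\<close>-linear map from a free module to \<open>M\<close> that sends the generator \<open>[w]\<close> to \<open>\<phi> w\<close>.\<close>

definition lin_ext ::
  "('k, 'r) ring_scheme \<Rightarrow> ('k, 'e) module \<Rightarrow> ('x \<Rightarrow> 'e) \<Rightarrow> ('x \<Rightarrow> 'k) \<Rightarrow> 'e" where
  "lin_ext k M \<phi> x = (\<Oplus>\<^bsub>M\<^esub> w \<in> {w. x w \<noteq> \<zero>\<^bsub>k\<^esub>}. x w \<odot>\<^bsub>M\<^esub> \<phi> w)"

definition free_map ::
  "('k, 'r) ring_scheme \<Rightarrow> 'y set \<Rightarrow> ('x \<Rightarrow> 'y) \<Rightarrow> ('x \<Rightarrow> 'k) \<Rightarrow> ('y \<Rightarrow> 'k)" where
  "free_map k Y f = lin_ext k (free_mod k Y) (\<lambda>w. gen k (f w))"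

subsection \<open>Tensor powers\<close>

text \<open>The tensor power of \<open>M\<close> over a finite index set \<open>I\<close>, with one factor for each \<open>i \<in> I\<close>:
  the free module on \<open>I\<close>-tuples modulo the multilinearity relations.\<close>

definition tensor_rel ::
  "('k, 'r) ring_scheme \<Rightarrow> 'i set \<Rightarrow> ('k, 'e) module \<Rightarrow> (('i \<Rightarrow> 'e) \<Rightarrow> 'k) set" where
  "tensor_rel k I M = (let F = free_mod k (I \<rightarrow>\<^sub>E carrier M) in mod_span k F
     ({gen k (x(i := u \<oplus>\<^bsub>M\<^esub> v)) \<ominus>\<^bsub>F\<^esub> (gen k (x(i := u)) \<oplus>\<^bsub>F\<^esub> gen k (x(i := v))) | x i u v.
         x \<in> I \<rightarrow>\<^sub>E carrier M \<and> i \<in> I \<and> u \<in> carrier M \<and> v \<in> carrier M} \<union>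
      {gen k (x(i := c \<odot>\<^bsub>M\<^esub> u)) \<ominus>\<^bsub>F\<^esub> (c \<odot>\<^bsub>F\<^esub> gen k (x(i := u))) | x i c u.
         x \<in> I \<rightarrow>\<^sub>E carrier M \<and> i \<in> I \<and> c \<in> carrier k \<and> u \<in> carrier M}))"

definition tensor_pow ::
  "('k, 'r) ring_scheme \<Rightarrow> 'i set \<Rightarrow> ('k, 'e) module \<Rightarrow> ('k, (('i \<Rightarrow> 'e) \<Rightarrow> 'k) set) module" where
  "tensor_pow k I M = quot_mod (free_mod k (I \<rightarrow>\<^sub>E carrier M)) (tensor_rel k I M)"

definition tensor_map ::
  "('k, 'r) ring_scheme \<Rightarrow> 'i set \<Rightarrow> ('k, 'f) module \<Rightarrow> ('e \<Rightarrow> 'f) \<Rightarrow>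
   (('i \<Rightarrow> 'e) \<Rightarrow> 'k) set \<Rightarrow> (('i \<Rightarrow> 'f) \<Rightarrow> 'k) set" where
  "tensor_map k I N \<phi> = quot_map (free_mod k (I \<rightarrow>\<^sub>E carrier N)) (tensor_rel k I N)
     (free_map k (I \<rightarrow>\<^sub>E carrier N) (\<lambda>x. \<lambda>i\<in>I. \<phi> (x i)))"

text \<open>Place permutation along a bijection \<open>f : L \<rightarrow> I\<close>, from the tensor power over \<open>I\<close> to the one
  over \<open>L\<close>: the tensor of \<open>(x i)\<close>, \<open>i \<in> I\<close>, goes to the tensor of \<open>(x (f j))\<close>, \<open>j \<in> L\<close>.\<close>

definition tensor_perm ::
  "('k, 'r) ring_scheme \<Rightarrow> 'l set \<Rightarrow> ('k, 'e) module \<Rightarrow> ('l \<Rightarrow> 'i) \<Rightarrow>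
   (('i \<Rightarrow> 'e) \<Rightarrow> 'k) set \<Rightarrow> (('l \<Rightarrow> 'e) \<Rightarrow> 'k) set" where
  "tensor_perm k L M f = quot_map (free_mod k (L \<rightarrow>\<^sub>E carrier M)) (tensor_rel k L M)
     (free_map k (L \<rightarrow>\<^sub>E carrier M) (\<lambda>x. \<lambda>j\<in>L. x (f j)))"

section \<open>Functor categories\<close>

text \<open>\<open>cmp C X Y Z g f\<close> is the composite of \<open>f : X \<rightarrow> Y\<close> and \<open>g : Y \<rightarrow> Z\<close>.\<close>

record ('o, 'm) cat =
  obj :: "'o set"
  arr :: "'o \<Rightarrow> 'o \<Rightarrow> 'm set"
  idn :: "'o \<Rightarrow> 'm"
  cmp :: "'o \<Rightarrow> 'o \<Rightarrow> 'o \<Rightarrow> 'm \<Rightarrow> 'm \<Rightarrow> 'm"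

definition op_cat :: "('o, 'm) cat \<Rightarrow> ('o, 'm) cat" where
  "op_cat C = \<lparr>obj = obj C, arr = (\<lambda>X Y. arr C Y X), idn = idn C,
     cmp = (\<lambda>X Y Z g f. cmp C Z Y X f g)\<rparr>"

record ('o, 'm, 'k, 'e) functr =
  fob :: "'o \<Rightarrow> ('k, 'e) module"
  far :: "'o \<Rightarrow> 'o \<Rightarrow> 'm \<Rightarrow> 'e \<Rightarrow> 'e"

definition is_functor ::
  "('o, 'm) cat \<Rightarrow> ('k, 'r) ring_scheme \<Rightarrow> ('o, 'm, 'k, 'e) functr \<Rightarrow> bool" where
  "is_functor C k F \<longleftrightarrow>
     (\<forall>X \<in> obj C. Module.module k (fob F X)) \<and>
     (\<forall>X \<in> obj C. \<forall>Y \<in> obj C. \<forall>f \<in> arr C X Y. far F X Y f \<in> mod_hom k (fob F X) (fob F Y)) \<and>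
     (\<forall>X \<in> obj C. \<forall>x \<in> carrier (fob F X). far F X X (idn C X) x = x) \<and>
     (\<forall>X \<in> obj C. \<forall>Y \<in> obj C. \<forall>Z \<in> obj C. \<forall>f \<in> arr C X Y. \<forall>g \<in> arr C Y Z.
        \<forall>x \<in> carrier (fob F X). far F X Z (cmp C X Y Z g f) x = far F Y Z g (far F X Y f x))"

definition is_nat ::
  "('o, 'm) cat \<Rightarrow> ('k, 'r) ring_scheme \<Rightarrow> ('o, 'm, 'k, 'e) functr \<Rightarrow> ('o, 'm, 'k, 'f) functr \<Rightarrow>
   ('o \<Rightarrow> 'e \<Rightarrow> 'f) \<Rightarrow> bool" where
  "is_nat C k F G \<eta> \<longleftrightarrow>
     (\<forall>X \<in> obj C. \<eta> X \<in> mod_hom k (fob F X) (fob G X)) \<and>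
     (\<forall>X \<in> obj C. \<forall>Y \<in> obj C. \<forall>f \<in> arr C X Y. \<forall>x \<in> carrier (fob F X).
        \<eta> Y (far F X Y f x) = far G X Y f (\<eta> X x))"

definition nat_eq ::
  "('o, 'm) cat \<Rightarrow> ('o, 'm, 'k, 'e) functr \<Rightarrow> ('o \<Rightarrow> 'e \<Rightarrow> 'f) \<Rightarrow> ('o \<Rightarrow> 'e \<Rightarrow> 'f) \<Rightarrow> bool" where
  "nat_eq C F \<theta> \<eta> \<longleftrightarrow> (\<forall>X \<in> obj C. \<forall>x \<in> carrier (fob F X). \<theta> X x = \<eta> X x)"

definition nat_id :: "'o \<Rightarrow> 'e \<Rightarrow> 'e" where
  "nat_id = (\<lambda>X x. x)"

definition nat_comp :: "('o \<Rightarrow> 'f \<Rightarrow> 'g) \<Rightarrow> ('o \<Rightarrow> 'e \<Rightarrow> 'f) \<Rightarrow> 'o \<Rightarrow> 'e \<Rightarrow> 'g" (infixl "\<bullet>" 55) where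
  "\<theta> \<bullet> \<eta> = (\<lambda>X x. \<theta> X (\<eta> X x))"

text \<open>Elements of the \<open>k\<close>-module \<open>Hom(F, G)\<close> are made extensional, so that equality of elements is
  equality of natural transformations.\<close>

definition nat_restrict ::
  "('o, 'm) cat \<Rightarrow> ('o, 'm, 'k, 'e) functr \<Rightarrow> ('o \<Rightarrow> 'e \<Rightarrow> 'f) \<Rightarrow> 'o \<Rightarrow> 'e \<Rightarrow> 'f" where
  "nat_restrict C F \<eta> = (\<lambda>X\<in>obj C. \<lambda>x\<in>carrier (fob F X). \<eta> X x)"

definition nat_mod ::
  "('o, 'm) cat \<Rightarrow> ('k, 'r) ring_scheme \<Rightarrow> ('o, 'm, 'k, 'e) functr \<Rightarrow> ('o, 'm, 'k, 'f) functr \<Rightarrow>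
   ('k, 'o \<Rightarrow> 'e \<Rightarrow> 'f) module" where
  "nat_mod C k F G = \<lparr>carrier = {\<eta>. is_nat C k F G \<eta> \<and> nat_restrict C F \<eta> = \<eta>},
     mult = undefined, one = undefined,
     zero = nat_restrict C F (\<lambda>X x. \<zero>\<^bsub>fob G X\<^esub>),
     add = (\<lambda>\<eta> \<theta>. nat_restrict C F (\<lambda>X x. \<eta> X x \<oplus>\<^bsub>fob G X\<^esub> \<theta> X x)),
     smult = (\<lambda>c \<eta>. nat_restrict C F (\<lambda>X x. c \<odot>\<^bsub>fob G X\<^esub> \<eta> X x))\<rparr>"

definition tensor_functor ::
  "('k, 'r) ring_scheme \<Rightarrow> ('o, 'm, 'k, 'e) functr \<Rightarrow> 'i set \<Rightarrow>
   ('o, 'm, 'k, (('i \<Rightarrow> 'e) \<Rightarrow> 'k) set) functr" where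
  "tensor_functor k F I = \<lparr>fob = (\<lambda>X. tensor_pow k I (fob F X)),
     far = (\<lambda>X Y f. tensor_map k I (fob F Y) (far F X Y f))\<rparr>"

section \<open>Cosimplicial objects in a functor category\<close>

text \<open>\<open>coface X n i\<close> goes from degree \<open>n\<close> to degree \<open>n + 1\<close> and is relevant for \<open>i \<le> n + 1\<close>;
  \<open>codeg X n j\<close> goes from degree \<open>n + 1\<close> to degree \<open>n\<close> and is relevant for \<open>j \<le> n\<close>.\<close>

record ('o, 'm, 'k, 'e) cosimp =
  level :: "nat \<Rightarrow> ('o, 'm, 'k, 'e) functr"
  coface :: "nat \<Rightarrow> nat \<Rightarrow> 'o \<Rightarrow> 'e \<Rightarrow> 'e"
  codeg :: "nat \<Rightarrow> nat \<Rightarrow> 'o \<Rightarrow> 'e \<Rightarrow> 'e"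

definition is_cosimplicial ::
  "('o, 'm) cat \<Rightarrow> ('k, 'r) ring_scheme \<Rightarrow> ('o, 'm, 'k, 'e) cosimp \<Rightarrow> bool" where
  "is_cosimplicial C k X \<longleftrightarrow>
     (\<forall>n. is_functor C k (level X n)) \<and>
     (\<forall>n. \<forall>i \<le> n + 1. is_nat C k (level X n) (level X (n + 1)) (coface X n i)) \<and>
     (\<forall>n. \<forall>j \<le> n. is_nat C k (level X (n + 1)) (level X n) (codeg X n j)) \<and>
     (\<forall>n i j. i < j \<and> j \<le> n + 2 \<longrightarrow> nat_eq C (level X n)
        (coface X (n + 1) j \<bullet> coface X n i) (coface X (n + 1) i \<bullet> coface X n (j - 1))) \<and>
     (\<forall>n i j. i \<le> j \<and> j \<le> n \<longrightarrow> nat_eq C (level X (n + 2))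
        (codeg X n j \<bullet> codeg X (n + 1) i) (codeg X n i \<bullet> codeg X (n + 1) (j + 1))) \<and>
     (\<forall>n i j. j \<le> n \<and> (i = j \<or> i = j + 1) \<longrightarrow> nat_eq C (level X n)
        (codeg X n j \<bullet> coface X n i) nat_id) \<and>
     (\<forall>n i j. i < j \<and> j \<le> n + 1 \<longrightarrow> nat_eq C (level X (n + 1))
        (codeg X (n + 1) j \<bullet> coface X (n + 1) i) (coface X n i \<bullet> codeg X n (j - 1))) \<and>
     (\<forall>n i j. j + 1 < i \<and> i \<le> n + 2 \<longrightarrow> nat_eq C (level X (n + 1))
        (codeg X (n + 1) j \<bullet> coface X (n + 1) i) (coface X n (i - 1) \<bullet> codeg X n j))"

definition is_cosimp_map ::
  "('o, 'm) cat \<Rightarrow> ('k, 'r) ring_scheme \<Rightarrow> ('o, 'm, 'k, 'e) cosimp \<Rightarrow> ('o, 'm, 'k, 'f) cosimp \<Rightarrow>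
   (nat \<Rightarrow> 'o \<Rightarrow> 'e \<Rightarrow> 'f) \<Rightarrow> bool" where
  "is_cosimp_map C k X Y \<Phi> \<longleftrightarrow>
     (\<forall>n. is_nat C k (level X n) (level Y n) (\<Phi> n)) \<and>
     (\<forall>n. \<forall>i \<le> n + 1. nat_eq C (level X n)
        (\<Phi> (n + 1) \<bullet> coface X n i) (coface Y n i \<bullet> \<Phi> n)) \<and>
     (\<forall>n. \<forall>j \<le> n. nat_eq C (level X (n + 1))
        (\<Phi> n \<bullet> codeg X n j) (codeg Y n j \<bullet> \<Phi> (n + 1)))"

definition cosimp_isomorphic ::
  "('o, 'm) cat \<Rightarrow> ('k, 'r) ring_scheme \<Rightarrow> ('o, 'm, 'k, 'e) cosimp \<Rightarrow> ('o, 'm, 'k, 'f) cosimp \<Rightarrow>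
   bool" where
  "cosimp_isomorphic C k X Y \<longleftrightarrow> is_cosimplicial C k X \<and> is_cosimplicial C k Y \<and>
     (\<exists>\<Phi> \<Psi>. is_cosimp_map C k X Y \<Phi> \<and> is_cosimp_map C k Y X \<Psi> \<and>
        (\<forall>n. nat_eq C (level X n) (\<Psi> n \<bullet> \<Phi> n) nat_id) \<and>
        (\<forall>n. nat_eq C (level Y n) (\<Phi> n \<bullet> \<Psi> n) nat_id))"

definition cosimp_op :: "('o, 'm, 'k, 'e) cosimp \<Rightarrow> ('o, 'm, 'k, 'e) cosimp" where
  "cosimp_op X = \<lparr>level = level X, coface = (\<lambda>n i. coface X n (n + 1 - i)),
     codeg = (\<lambda>n j. codeg X n (n - j))\<rparr>"

section \<open>Functors on finite pointed sets\<close>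

text \<open>Finite pointed sets are taken inside an arbitrary infinite type, so that every finite pointed
  set is isomorphic to an object. Maps between finite sets are extensional functions.\<close>

type_synonym 'u pset = "'u set \<times> 'u"

definition Gamma :: "('u::infinite pset, 'u \<Rightarrow> 'u) cat" where
  "Gamma = \<lparr>obj = {(Y, y). finite Y \<and> y \<in> Y},
     arr = (\<lambda>X Y. {f \<in> fst X \<rightarrow>\<^sub>E fst Y. f (snd X) = snd Y}),
     idn = (\<lambda>X. \<lambda>w\<in>fst X. w), cmp = (\<lambda>X Y Z g f. compose (fst X) g f)\<rparr>"

definition fresh :: "'u::infinite set \<Rightarrow> 'u" where
  "fresh Y = (SOME w. w \<notin> Y)"

lemma fresh_notin: "finite Y \<Longrightarrow> fresh Y \<notin> Y"
  unfolding fresh_def using someI_ex[OF arb_element] .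

text \<open>\<open>plus_pt X\<close> is \<open>X\<^sub>+\<close>: the underlying set of \<open>X\<close> (old base point included) together with one new
  element, which becomes the base point.\<close>

definition plus_pt :: "'u::infinite pset \<Rightarrow> 'u pset" where
  "plus_pt X = (insert (fresh (fst X)) (fst X), fresh (fst X))"

definition plus_map :: "'u::infinite pset \<Rightarrow> 'u pset \<Rightarrow> ('u \<Rightarrow> 'u) \<Rightarrow> 'u \<Rightarrow> 'u" where
  "plus_map X Y f = (\<lambda>w\<in>fst (plus_pt X). if w = snd (plus_pt X) then snd (plus_pt Y) else f w)"

definition fold_pt :: "'u::infinite pset \<Rightarrow> 'u \<Rightarrow> 'u" where
  "fold_pt X = (\<lambda>w\<in>fst (plus_pt X). if w = snd (plus_pt X) then snd X else w)"

definition shift_pt :: "'u::infinite pset \<Rightarrow> 'u \<Rightarrow> 'u" where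
  "shift_pt X = (\<lambda>w\<in>fst (plus_pt X).
     if w = snd (plus_pt X) then snd (plus_pt (plus_pt X)) else w)"

subsection \<open>The comonad\<close>

definition botG ::
  "('u::infinite pset, 'u \<Rightarrow> 'u, 'k, 'e) functr \<Rightarrow> ('u pset, 'u \<Rightarrow> 'u, 'k, 'e) functr" where
  "botG F = \<lparr>fob = (\<lambda>X. fob F (plus_pt X)),
     far = (\<lambda>X Y f. far F (plus_pt X) (plus_pt Y) (plus_map X Y f))\<rparr>"

definition botG_map :: "('u::infinite pset \<Rightarrow> 'e \<Rightarrow> 'f) \<Rightarrow> 'u pset \<Rightarrow> 'e \<Rightarrow> 'f" where
  "botG_map \<eta> = (\<lambda>X. \<eta> (plus_pt X))"

definition epsG :: "('u::infinite pset, 'u \<Rightarrow> 'u, 'k, 'e) functr \<Rightarrow> 'u pset \<Rightarrow> 'e \<Rightarrow> 'e" where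
  "epsG F = (\<lambda>X. far F (plus_pt X) X (fold_pt X))"

definition DeltaG :: "('u::infinite pset, 'u \<Rightarrow> 'u, 'k, 'e) functr \<Rightarrow> 'u pset \<Rightarrow> 'e \<Rightarrow> 'e" where
  "DeltaG F = (\<lambda>X. far F (plus_pt X) (plus_pt (plus_pt X)) (shift_pt X))"

subsection \<open>The functor \<open>t\<^sup>*\<close> and the coaction on its tensor powers\<close>

text \<open>\<open>t\<^sup>*(Y, y)\<close> is realised as the kernel of the augmentation \<open>k[Y] \<rightarrow> k\<close>.\<close>

definition tstar ::
  "('k, 'r) ring_scheme \<Rightarrow> ('u::infinite pset, 'u \<Rightarrow> 'u, 'k, 'u \<Rightarrow> 'k) functr" where
  "tstar k = \<lparr>fob = (\<lambda>X. (free_mod k (fst X))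
       \<lparr>carrier := {x \<in> carrier (free_mod k (fst X)). (\<Oplus>\<^bsub>k\<^esub> w \<in> fst X. x w) = \<zero>\<^bsub>k\<^esub>}\<rparr>),
     far = (\<lambda>X Y f. free_map k (fst Y) f)\<rparr>"

definition tstar_coact ::
  "('k, 'r) ring_scheme \<Rightarrow> 'i set \<Rightarrow> 'u::infinite pset \<Rightarrow>
   (('i \<Rightarrow> 'u \<Rightarrow> 'k) \<Rightarrow> 'k) set \<Rightarrow> (('i \<Rightarrow> 'u \<Rightarrow> 'k) \<Rightarrow> 'k) set" where
  "tstar_coact k I X =
     tensor_map k I (fob (tstar k) (plus_pt X)) (free_map k (fst (plus_pt X)) (\<lambda>w. w))"

section \<open>Modules over the category of finite sets and bijections\<close>

definition Sigma_cat :: "('v::infinite set, 'v \<Rightarrow> 'v) cat" where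
  "Sigma_cat = \<lparr>obj = {b. finite b}, arr = (\<lambda>l b. {f \<in> l \<rightarrow>\<^sub>E b. bij_betw f l b}),
     idn = (\<lambda>b. \<lambda>j\<in>b. j), cmp = (\<lambda>b c d g f. compose b g f)\<rparr>"

subsection \<open>The cosimplicial module \<open>Hom(M, \<bottom>\<^sup>t N)\<close>\<close>

text \<open>\<open>M\<close> is a comodule with structure map \<open>\<psi>M\<close>; \<open>N\<close> is a functor on the product of \<open>Gamma\<close> and
  the opposite of \<open>Sigma_cat\<close>, given by functors \<open>N b\<close> on \<open>Gamma\<close> and the maps \<open>act b l f\<close> from
  \<open>N b\<close> to \<open>N l\<close> for bijections \<open>f : l \<rightarrow> b\<close>; \<open>\<psi>N b\<close> is the comodule structure map of \<open>N b\<close>.\<close>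

definition hom_cosimp ::
  "('k, 'r) ring_scheme \<Rightarrow>
   ('u::infinite pset, 'u \<Rightarrow> 'u, 'k, 'e) functr \<Rightarrow> ('u pset \<Rightarrow> 'e \<Rightarrow> 'e) \<Rightarrow>
   ('v::infinite set \<Rightarrow> ('u pset, 'u \<Rightarrow> 'u, 'k, 'f) functr) \<Rightarrow>
   ('v set \<Rightarrow> 'v set \<Rightarrow> ('v \<Rightarrow> 'v) \<Rightarrow> 'u pset \<Rightarrow> 'f \<Rightarrow> 'f) \<Rightarrow>
   ('v set \<Rightarrow> 'u pset \<Rightarrow> 'f \<Rightarrow> 'f) \<Rightarrow>
   ('v set, 'v \<Rightarrow> 'v, 'k, 'u pset \<Rightarrow> 'e \<Rightarrow> 'f) cosimp" where
  "hom_cosimp k M \<psi>M N act \<psi>N = \<lparr>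
     level = (\<lambda>t. \<lparr>fob = (\<lambda>b. nat_mod Gamma k M ((botG ^^ t) (N b))),
        far = (\<lambda>b l f \<gamma>. nat_restrict Gamma M ((botG_map ^^ t) (act b l f) \<bullet> \<gamma>))\<rparr>),
     coface = (\<lambda>t i b \<gamma>. nat_restrict Gamma M
        (if i = 0 then botG_map \<gamma> \<bullet> \<psi>M
         else if i = t + 1 then (botG_map ^^ t) (\<psi>N b) \<bullet> \<gamma>
         else (botG_map ^^ (i - 1)) (DeltaG ((botG ^^ (t - i)) (N b))) \<bullet> \<gamma>)),
     codeg = (\<lambda>t j b \<gamma>. nat_restrict Gamma M
        ((botG_map ^^ j) (epsG ((botG ^^ (t - j)) (N b))) \<bullet> \<gamma>))\<rparr>"

definition tstar_hom_cosimp ::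
  "('k, 'r) ring_scheme \<Rightarrow> 'i set \<Rightarrow>
   ('v::infinite set, 'v \<Rightarrow> 'v, 'k,
    'u::infinite pset \<Rightarrow> (('i \<Rightarrow> 'u \<Rightarrow> 'k) \<Rightarrow> 'k) set \<Rightarrow> (('v \<Rightarrow> 'u \<Rightarrow> 'k) \<Rightarrow> 'k) set) cosimp" where
  "tstar_hom_cosimp k A = hom_cosimp k
     (tensor_functor k (tstar k) A) (tstar_coact k A)
     (\<lambda>b. tensor_functor k (tstar k) b) (\<lambda>b l f X. tensor_perm k l (fob (tstar k) X) f)
     (tstar_coact k)"

subsection \<open>The comonad \<open>\<bottom>G(b) = \<Oplus>b' \<subseteq> b. G(b')\<close>\<close>

text \<open>To iterate the comonad within a single type, the elements of its values are trees: \<open>Fam x\<close> is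
  the family with components \<open>x i\<close>, and \<open>Leaf e\<close> is an element of the module at the start.\<close>

datatype ('i, 'e) nest = Leaf (the_leaf: 'e) | Fam (component: "'i \<Rightarrow> ('i, 'e) nest")

definition leaf_mod :: "('k, 'e) module \<Rightarrow> ('k, ('i, 'e) nest) module" where
  "leaf_mod M = \<lparr>carrier = Leaf ` carrier M, mult = undefined, one = undefined,
     zero = Leaf \<zero>\<^bsub>M\<^esub>, add = (\<lambda>u v. Leaf (the_leaf u \<oplus>\<^bsub>M\<^esub> the_leaf v)),
     smult = (\<lambda>c u. Leaf (c \<odot>\<^bsub>M\<^esub> the_leaf u))\<rparr>"

definition leaf_functor :: "('o, 'm, 'k, 'e) functr \<Rightarrow> ('o, 'm, 'k, ('i, 'e) nest) functr" where
  "leaf_functor F = \<lparr>fob = (\<lambda>X. leaf_mod (fob F X)),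
     far = (\<lambda>X Y f u. Leaf (far F X Y f (the_leaf u)))\<rparr>"

text \<open>The direct sum over a finite index set.\<close>

definition dir_sum :: "'i set \<Rightarrow> ('i \<Rightarrow> ('k, ('i, 'e) nest) module) \<Rightarrow> ('k, ('i, 'e) nest) module" where
  "dir_sum I M = \<lparr>carrier = Fam ` (\<Pi>\<^sub>E i\<in>I. carrier (M i)), mult = undefined, one = undefined,
     zero = Fam (\<lambda>i\<in>I. \<zero>\<^bsub>M i\<^esub>),
     add = (\<lambda>u v. Fam (\<lambda>i\<in>I. component u i \<oplus>\<^bsub>M i\<^esub> component v i)),
     smult = (\<lambda>c u. Fam (\<lambda>i\<in>I. c \<odot>\<^bsub>M i\<^esub> component u i))\<rparr>"

text \<open>A bijection \<open>f : l \<rightarrow> b\<close> sends the summand of \<open>b' \<subseteq> b\<close> to that of its preimage; hence the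
  component at \<open>l' \<subseteq> l\<close> comes from the component at \<open>f ` l'\<close>.\<close>

definition botS ::
  "('v set, 'v \<Rightarrow> 'v, 'k, ('v set, 'e) nest) functr \<Rightarrow>
   ('v set, 'v \<Rightarrow> 'v, 'k, ('v set, 'e) nest) functr" where
  "botS G = \<lparr>fob = (\<lambda>b. dir_sum (Pow b) (fob G)),
     far = (\<lambda>b l f u. Fam (\<lambda>l'\<in>Pow l. far G (f ` l') l' (restrict f l') (component u (f ` l'))))\<rparr>"

definition botS_map ::
  "('v set \<Rightarrow> ('v set, 'e) nest \<Rightarrow> ('v set, 'e) nest) \<Rightarrow>
   'v set \<Rightarrow> ('v set, 'e) nest \<Rightarrow> ('v set, 'e) nest" where
  "botS_map \<eta> = (\<lambda>b u. Fam (\<lambda>b'\<in>Pow b. \<eta> b' (component u b')))"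

text \<open>The counit and the comultiplication do not refer to the functor they are taken at. In the
  comultiplication, the component at \<open>b'' \<subseteq> b' \<subseteq> b\<close> is the component at \<open>b''\<close> of the argument.\<close>

definition epsS :: "'v set \<Rightarrow> ('v set, 'e) nest \<Rightarrow> ('v set, 'e) nest" where
  "epsS = (\<lambda>b u. component u b)"

definition DeltaS :: "'v set \<Rightarrow> ('v set, 'e) nest \<Rightarrow> ('v set, 'e) nest" where
  "DeltaS = (\<lambda>b u. Fam (\<lambda>b'\<in>Pow b. Fam (\<lambda>b''\<in>Pow b'. component u b'')))"

definition etaS ::
  "('v set, 'v \<Rightarrow> 'v, 'k, ('v set, 'e) nest) functr \<Rightarrow>
   'v set \<Rightarrow> ('v set, 'e) nest \<Rightarrow> ('v set, 'e) nest" where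
  "etaS G = (\<lambda>b u. Fam (\<lambda>b'\<in>Pow b. if b' = b then u else \<zero>\<^bsub>fob G b'\<^esub>))"

text \<open>For a contravariant functor \<open>F\<close> on finite sets and injections.\<close>

definition psiS ::
  "('v set, 'v \<Rightarrow> 'v, 'k, ('v set, 'e) nest) functr \<Rightarrow>
   'v set \<Rightarrow> ('v set, 'e) nest \<Rightarrow> ('v set, 'e) nest" where
  "psiS F = (\<lambda>b u. Fam (\<lambda>b'\<in>Pow b. far F b b' (\<lambda>j\<in>b'. j) u))"

text \<open>The complex of a contravariant functor on finite sets and injections. Its restriction to
  bijections is given by the same record.\<close>

definition C_cosimp ::
  "('v set, 'v \<Rightarrow> 'v, 'k, 'e) functr \<Rightarrow> ('v set, 'v \<Rightarrow> 'v, 'k, ('v set, 'e) nest) cosimp" where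
  "C_cosimp F = (let F' = leaf_functor F in \<lparr>
     level = (\<lambda>n. (botS ^^ n) F'),
     coface = (\<lambda>n i. if i = 0 then etaS ((botS ^^ n) F')
        else if i = n + 1 then (botS_map ^^ n) (psiS F')
        else (botS_map ^^ (i - 1)) DeltaS),
     codeg = (\<lambda>n j. (botS_map ^^ j) epsS)\<rparr>)"

subsection \<open>The functor spanned by surjections\<close>

definition Surj :: "'v set \<Rightarrow> 'i set \<Rightarrow> ('v \<Rightarrow> 'i) set" where
  "Surj b A = {f \<in> b \<rightarrow>\<^sub>E A. f ` b = A}"

text \<open>\<open>b \<mapsto> k[Surj b A]\<close>, contravariant in \<open>b\<close>: an injection \<open>i\<close> from \<open>b'\<close> to \<open>b\<close> sends \<open>[f]\<close>
  to \<open>[f \<circ> i]\<close> if this is surjective and to zero otherwise.\<close>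

definition k_Surj ::
  "('k, 'r) ring_scheme \<Rightarrow> 'i set \<Rightarrow> ('v::infinite set, 'v \<Rightarrow> 'v, 'k, ('v \<Rightarrow> 'i) \<Rightarrow> 'k) functr" where
  "k_Surj k A = \<lparr>fob = (\<lambda>b. free_mod k (Surj b A)),
     far = (\<lambda>b b' i. lin_ext k (free_mod k (Surj b' A))
        (\<lambda>f. if compose b' f i \<in> Surj b' A then gen k (compose b' f i)
             else \<zero>\<^bsub>free_mod k (Surj b' A)\<^esub>))\<rparr>"

end

theory Submission
  imports Defs
begin

text \<open>A natural transformation out of \<open>(t\<^sup>*)\<^bsup>\<otimes>a\<^esup>\<close> is determined by one value. Let \<open>Y\<close> be a pointed set
  whose points other than the base point \<open>y\<close> are named \<open>\<iota> i\<close> for \<open>i \<in> A = {1..a}\<close>, and let the generic tensor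
  \<open>univ\<close> be the tensor product of the differences \<open>[\<iota> i] - [y]\<close>. The tensors of differences
  \<open>[g i] - [x]\<close> span \<open>(t\<^sup>*)\<^bsup>\<otimes>a\<^esup>(X, x)\<close>, and each of them is the image of the generic tensor under a
  pointed map \<open>Y \<rightarrow> X\<close> (\<open>push_univ\<close>). Hence \<open>\<gamma>\<close> in \<open>Hom((t\<^sup>*)\<^bsup>\<otimes>a\<^esup>, \<bottom>\<^sup>n (t\<^sup>*)\<^bsup>\<otimes>b\<^esup>)\<close> amounts to the element \<open>\<gamma>(univ)\<close> of
  \<open>(t\<^sup>*)\<^bsup>\<otimes>b\<^esup>(Y\<^sub>+\<^sub>\<dots>\<^sub>+)\<close>, with \<open>n\<close> added points, which has to vanish whenever some \<open>\<iota> i\<close> is collapsed to \<open>y\<close>.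

  The next step is a choice of coordinates for such elements. The kernel of the augmentation of \<open>k[Y\<^sub>+\<^sub>\<dots>\<^sub>+]\<close>
  has the basis of the \<open>[\<iota> i] - [y]\<close> and of the differences of consecutive base points
  \<open>y, +\<^sub>1, \<dots>, +\<^sub>n\<close>. The dual basis consists of sums of coefficients over subsets: over \<open>{\<iota> i}\<close>, labelled \<open>Inl i\<close>,
  and over \<open>Y\<close> with the first \<open>s - 1\<close> added points, labelled \<open>Inr s\<close>, for \<open>1 \<le> s \<le> n\<close>
  (\<open>dual_basis_reduced\<close>). So \<open>\<gamma>\<close> has one coordinate for each labelling of \<open>b\<close>, and the vanishing
  condition says exactly that a coordinate is zero unless every \<open>Inl i\<close> occurs (\<open>coef_nonsurj\<close>,
  \<open>exists_homs_with_coef\<close>). On the other side, \<open>\<bottom>\<^sup>n k Hom(-, A)\<close> has a basis of chains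
  \<open>b\<^sub>0 \<subseteq> \<dots> \<subseteq> b\<^sub>n = b\<close> together with a surjection \<open>b\<^sub>0 \<rightarrow> A\<close>. This is the same thing as a labelling in which
  every \<open>Inl i\<close> occurs: points of \<open>b\<^sub>0\<close> carry their image in \<open>A\<close>, and points of \<open>b\<^sub>s\<close> outside \<open>b\<^sub>s\<^sub>-\<^sub>1\<close>
  carry \<open>Inr s\<close> (\<open>nestify\<close>). The outermost functor of the iterated comonad governs the largest label;
  therefore the indices of the cofaces and codegeneracies are reversed, which accounts for the opposite.

  A sum over a subset of the target of a map is a sum over its preimage (\<open>form_push\<close>), so a structure map acts on
  coordinates by taking preimages of the labelled subsets. For \<open>\<Delta>\<close>, for \<open>\<epsilon>\<close> and for the coaction on the target,
  the preimages are labelled subsets again, and the effect is a shift of the labels \<open>Inr s\<close>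
  (\<open>coef_coface_pos\<close>, \<open>coef_codeg\<close>) that matches \<open>\<eta>\<close>, \<open>\<Delta>\<close> and \<open>\<epsilon>\<close> on the other side
  (\<open>etaS_nestify\<close>, \<open>DeltaS_nestify\<close>, \<open>epsS_nestify\<close>). The remaining coface evaluates \<open>\<gamma>\<close> on the image of
  the generic tensor in \<open>Y\<^sub>+\<close>, where \<open>y\<close> is no longer the base point. Expanding that image, only the term without \<open>y\<close>
  survives, and its effect is that the set labelled \<open>Inr 1\<close>, which is \<open>Y\<close>, is replaced by \<open>Y\<close> without \<open>y\<close>
  (\<open>coef_coface_0\<close>). This is the union of the \<open>{\<iota> i}\<close>, so the new coordinate is the sum over all ways to
  replace each \<open>Inr 1\<close> by some \<open>Inl i\<close>: the sum over the extensions of a surjection from a subset to the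
  whole set, as in the map \<open>\<psi>\<close> of the functor of surjections (\<open>psiS_nestify\<close>).

  The cosimplicial identities are verified for the natural transformations, where they reduce to
  identities between renumberings of the added points and, for the zeroth coface, to the naturality of
  \<open>\<gamma>\<close>; the bijection carries them over to the other side (\<open>cosimp_isomorphic_by_transport\<close>).\<close>

section \<open>Linear maps\<close>

lemma mod_homI:
  assumes "\<And>x. x \<in> carrier M \<Longrightarrow> \<phi> x \<in> carrier N"
    and "\<And>x y. x \<in> carrier M \<Longrightarrow> y \<in> carrier M \<Longrightarrow> \<phi> (x \<oplus>\<^bsub>M\<^esub> y) = \<phi> x \<oplus>\<^bsub>N\<^esub> \<phi> y"
    and "\<And>c x. c \<in> carrier k \<Longrightarrow> x \<in> carrier M \<Longrightarrow> \<phi> (c \<odot>\<^bsub>M\<^esub> x) = c \<odot>\<^bsub>N\<^esub> \<phi> x"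
  shows "\<phi> \<in> mod_hom k M N"
  using assms by (auto simp: mod_hom_def)

lemma mod_hom_closed: "\<phi> \<in> mod_hom k M N \<Longrightarrow> x \<in> carrier M \<Longrightarrow> \<phi> x \<in> carrier N"
  by (auto simp: mod_hom_def)

lemma mod_hom_add:
  "\<phi> \<in> mod_hom k M N \<Longrightarrow> x \<in> carrier M \<Longrightarrow> y \<in> carrier M \<Longrightarrow> \<phi> (x \<oplus>\<^bsub>M\<^esub> y) = \<phi> x \<oplus>\<^bsub>N\<^esub> \<phi> y"
  by (auto simp: mod_hom_def)

lemma mod_hom_smult:
  "\<phi> \<in> mod_hom k M N \<Longrightarrow> c \<in> carrier k \<Longrightarrow> x \<in> carrier M \<Longrightarrow> \<phi> (c \<odot>\<^bsub>M\<^esub> x) = c \<odot>\<^bsub>N\<^esub> \<phi> x"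
  by (auto simp: mod_hom_def)

lemma mod_hom_comp:
  "\<phi> \<in> mod_hom k M N \<Longrightarrow> \<psi> \<in> mod_hom k N P \<Longrightarrow> (\<lambda>x. \<psi> (\<phi> x)) \<in> mod_hom k M P"
  by (auto simp: mod_hom_def Pi_iff)

lemma mod_hom_cong:
  "\<phi> \<in> mod_hom k M N \<Longrightarrow> Module.module k M \<Longrightarrow> (\<And>x. x \<in> carrier M \<Longrightarrow> \<psi> x = \<phi> x) \<Longrightarrow> \<psi> \<in> mod_hom k M N"
proof -
  assume a: "\<phi> \<in> mod_hom k M N" "Module.module k M" and e: "\<And>x. x \<in> carrier M \<Longrightarrow> \<psi> x = \<phi> x"
  interpret  Module.module k M by fact
  show ?thesis
    using a by (intro mod_homI) (auto simp: e mod_hom_closed mod_hom_add mod_hom_smult)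
qed

lemma (in Module.module) smult_minus_one: "x \<in> carrier M \<Longrightarrow> (\<ominus> \<one>) \<odot>\<^bsub>M\<^esub> x = \<ominus>\<^bsub>M\<^esub> x"
  by (simp add: smult_l_minus)

lemma mod_hom_zero:
  assumes "Module.module k M" "Module.module k N" "\<phi> \<in> mod_hom k M N"
  shows "\<phi> \<zero>\<^bsub>M\<^esub> = \<zero>\<^bsub>N\<^esub>"
proof -
  interpret M: Module.module k M by fact
  interpret N: Module.module k N by fact
  have "\<phi> \<zero>\<^bsub>M\<^esub> = \<phi> (\<zero>\<^bsub>k\<^esub> \<odot>\<^bsub>M\<^esub> \<zero>\<^bsub>M\<^esub>)" by simp
  also have "\<dots> = \<zero>\<^bsub>k\<^esub> \<odot>\<^bsub>N\<^esub> \<phi> \<zero>\<^bsub>M\<^esub>" using assms(3) by (subst mod_hom_smult) auto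
  finally show ?thesis using mod_hom_closed[OF assms(3)] by simp
qed

lemma mod_hom_uminus:
  assumes "Module.module k M" "Module.module k N" "\<phi> \<in> mod_hom k M N" "x \<in> carrier M"
  shows "\<phi> (\<ominus>\<^bsub>M\<^esub> x) = \<ominus>\<^bsub>N\<^esub> \<phi> x"
proof -
  interpret M: Module.module k M by fact
  interpret N: Module.module k N by fact
  show ?thesis
    using assms(3,4) by (simp flip: M.smult_minus_one N.smult_minus_one add: mod_hom_smult mod_hom_closed)
qed

lemma mod_hom_minus:
  assumes "Module.module k M" "Module.module k N" "\<phi> \<in> mod_hom k M N" "x \<in> carrier M" "y \<in> carrier M"
  shows "\<phi> (x \<ominus>\<^bsub>M\<^esub> y) = \<phi> x \<ominus>\<^bsub>N\<^esub> \<phi> y"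
proof -
  interpret M: Module.module k M by fact
  interpret N: Module.module k N by fact
  show ?thesis
    using assms by (simp add: a_minus_def mod_hom_add[OF assms(3)] mod_hom_uminus)
qed

lemma mod_hom_finsum:
  assumes "Module.module k M" "Module.module k N" "\<phi> \<in> mod_hom k M N" "f \<in> A \<rightarrow> carrier M"
  shows "\<phi> (\<Oplus>\<^bsub>M\<^esub>i\<in>A. f i) = (\<Oplus>\<^bsub>N\<^esub>i\<in>A. \<phi> (f i))"
proof -
  interpret M: Module.module k M by fact
  interpret N: Module.module k N by fact
  show ?thesis using assms(4)
  proof (induction A rule: infinite_finite_induct)
    case (infinite A)
    then show ?case using mod_hom_zero[OF assms(1-3)] by simp
  next
    case empty
    then show ?case using mod_hom_zero[OF assms(1-3)] by simp
  next
    case (insert x F)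
    then have *: "(\<lambda>i. \<phi> (f i)) \<in> F \<rightarrow> carrier N" "\<phi> (f x) \<in> carrier N"
      using mod_hom_closed[OF assms(3)] by auto
    show ?case using insert * by (simp add: mod_hom_add[OF assms(3)] Pi_iff)
  qed
qed

lemma finsum_hom:
  assumes "Module.module k M" "Module.module k N" "\<And>i. i \<in> A \<Longrightarrow> \<phi> i \<in> mod_hom k M N"
  shows "(\<lambda>x. \<Oplus>\<^bsub>N\<^esub>i\<in>A. \<phi> i x) \<in> mod_hom k M N"
proof -
  interpret M: Module.module k M by fact
  interpret N: Module.module k N by fact
  have cl: "(\<lambda>i. \<phi> i x) \<in> A \<rightarrow> carrier N" if "x \<in> carrier M" for x
    using mod_hom_closed[OF assms(3) that] by blast
  show ?thesis
  proof (rule mod_homI)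
    fix x assume x: "x \<in> carrier M"
    show "(\<Oplus>\<^bsub>N\<^esub>i\<in>A. \<phi> i x) \<in> carrier N"
      by (rule N.finsum_closed[OF cl[OF x]])
    fix y assume y: "y \<in> carrier M"
    have "(\<Oplus>\<^bsub>N\<^esub>i\<in>A. \<phi> i (x \<oplus>\<^bsub>M\<^esub> y)) = (\<Oplus>\<^bsub>N\<^esub>i\<in>A. \<phi> i x \<oplus>\<^bsub>N\<^esub> \<phi> i y)"
      using cl[OF x] cl[OF y] mod_hom_add[OF assms(3) x y] by (intro N.finsum_cong') auto
    also have "\<dots> = (\<Oplus>\<^bsub>N\<^esub>i\<in>A. \<phi> i x) \<oplus>\<^bsub>N\<^esub> (\<Oplus>\<^bsub>N\<^esub>i\<in>A. \<phi> i y)"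
      by (rule N.finsum_addf[OF cl[OF x] cl[OF y]])
    finally show "(\<Oplus>\<^bsub>N\<^esub>i\<in>A. \<phi> i (x \<oplus>\<^bsub>M\<^esub> y)) = (\<Oplus>\<^bsub>N\<^esub>i\<in>A. \<phi> i x) \<oplus>\<^bsub>N\<^esub> (\<Oplus>\<^bsub>N\<^esub>i\<in>A. \<phi> i y)" .
  next
    fix c x assume c: "c \<in> carrier k" and x: "x \<in> carrier M"
    show "(\<Oplus>\<^bsub>N\<^esub>i\<in>A. \<phi> i (c \<odot>\<^bsub>M\<^esub> x)) = c \<odot>\<^bsub>N\<^esub> (\<Oplus>\<^bsub>N\<^esub>i\<in>A. \<phi> i x)"
    proof (cases "finite A")
      case True
      have "(\<Oplus>\<^bsub>N\<^esub>i\<in>A. \<phi> i (c \<odot>\<^bsub>M\<^esub> x)) = (\<Oplus>\<^bsub>N\<^esub>i\<in>A. c \<odot>\<^bsub>N\<^esub> \<phi> i x)"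
        using cl[OF x] mod_hom_smult[OF assms(3) c x] c by (intro N.finsum_cong') auto
      then show ?thesis using N.finsum_smult_ldistr[OF True c cl[OF x]] by simp
    next
      case False
      then show ?thesis using c by simp
    qed
  qed
qed

lemma smult_hom:
  assumes "Module.module k M" "Module.module k N" "\<phi> \<in> mod_hom k M N" "c \<in> carrier k"
  shows "(\<lambda>x. c \<odot>\<^bsub>N\<^esub> \<phi> x) \<in> mod_hom k M N"
proof -
  interpret M: Module.module k M by fact
  interpret N: Module.module k N by fact
  show ?thesis using assms(3,4)
    by (intro mod_homI)
      (auto simp: mod_hom_closed mod_hom_add mod_hom_smult N.smult_r_distr M.R.m_comm
        simp flip: N.smult_assoc1)
qed

text \<open>The module axioms hold in any image, so that quotients need no separate verification.\<close>

lemma module_image: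
  fixes k :: "('k, 'r) ring_scheme" and M :: "('k, 'e) module" and N :: "('k, 'f) module"
  assumes "Module.module k M" "\<pi> \<in> mod_hom k M N" "\<pi> ` carrier M = carrier N" "\<pi> \<zero>\<^bsub>M\<^esub> = \<zero>\<^bsub>N\<^esub>"
  shows "Module.module k N"
proof -
  interpret M: Module.module k M by fact
  have ex: "\<exists>x \<in> carrier M. y = \<pi> x" if "y \<in> carrier N" for y
    using that assms(3) by auto
  note h = mod_hom_add[OF assms(2), symmetric] mod_hom_smult[OF assms(2), symmetric]
    mod_hom_closed[OF assms(2)]
  show ?thesis
  proof (rule moduleI)
    show "cring k" by (rule M.R.is_cring)
    show "abelian_group N"
    proof (rule abelian_groupI)
      show "\<zero>\<^bsub>N\<^esub> \<in> carrier N" using assms(3,4) by (metis M.zero_closed imageI)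
      fix x y assume xy: "x \<in> carrier N" "y \<in> carrier N"
      then obtain x' y' where *: "x' \<in> carrier M" "x = \<pi> x'" "y' \<in> carrier M" "y = \<pi> y'"
        using ex by metis
      then show "x \<oplus>\<^bsub>N\<^esub> y \<in> carrier N" by (simp add: h)
      from * show "x \<oplus>\<^bsub>N\<^esub> y = y \<oplus>\<^bsub>N\<^esub> x" by (simp add: h M.add.m_comm)
      from * show "\<zero>\<^bsub>N\<^esub> \<oplus>\<^bsub>N\<^esub> x = x" by (simp add: h flip: assms(4))
      have "\<pi> (\<ominus>\<^bsub>M\<^esub> x') \<oplus>\<^bsub>N\<^esub> x = \<zero>\<^bsub>N\<^esub>" using * by (simp add: h M.l_neg assms(4))
      then show "\<exists>y\<in>carrier N. y \<oplus>\<^bsub>N\<^esub> x = \<zero>\<^bsub>N\<^esub>"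
        using h(3)[of "\<ominus>\<^bsub>M\<^esub> x'"] * by (intro bexI) auto
      fix z assume "z \<in> carrier N"
      then obtain z' where "z' \<in> carrier M" "z = \<pi> z'" using ex by blast
      with * show "x \<oplus>\<^bsub>N\<^esub> y \<oplus>\<^bsub>N\<^esub> z = x \<oplus>\<^bsub>N\<^esub> (y \<oplus>\<^bsub>N\<^esub> z)" by (simp add: h M.add.m_assoc)
    qed
  next
    fix c x assume cx: "c \<in> carrier k" "x \<in> carrier N"
    then obtain x' where *: "x' \<in> carrier M" "x = \<pi> x'" using ex by blast
    then show "c \<odot>\<^bsub>N\<^esub> x \<in> carrier N" using cx by (simp add: h)
    fix d assume d: "d \<in> carrier k"
    show "(c \<oplus>\<^bsub>k\<^esub> d) \<odot>\<^bsub>N\<^esub> x = c \<odot>\<^bsub>N\<^esub> x \<oplus>\<^bsub>N\<^esub> d \<odot>\<^bsub>N\<^esub> x"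
      using * cx d by (simp add: h M.smult_l_distr)
    show "c \<otimes>\<^bsub>k\<^esub> d \<odot>\<^bsub>N\<^esub> x = c \<odot>\<^bsub>N\<^esub> (d \<odot>\<^bsub>N\<^esub> x)"
      using * cx d by (simp add: h M.smult_assoc1)
  next
    fix c x y assume cx: "c \<in> carrier k" "x \<in> carrier N" "y \<in> carrier N"
    then obtain x' y' where *: "x' \<in> carrier M" "x = \<pi> x'" "y' \<in> carrier M" "y = \<pi> y'"
      using ex by metis
    then show "c \<odot>\<^bsub>N\<^esub> (x \<oplus>\<^bsub>N\<^esub> y) = c \<odot>\<^bsub>N\<^esub> x \<oplus>\<^bsub>N\<^esub> c \<odot>\<^bsub>N\<^esub> y"
      using cx by (simp add: h M.smult_r_distr)
  next
    fix x assume "x \<in> carrier N"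
    then obtain x' where *: "x' \<in> carrier M" "x = \<pi> x'" using ex by blast
    then show "\<one>\<^bsub>k\<^esub> \<odot>\<^bsub>N\<^esub> x = x" by (simp add: h)
  qed
qed

section \<open>Free modules\<close>

context cring
begin

lemma free_mod_carrier:
  "x \<in> carrier (free_mod R X) \<longleftrightarrow>
     (\<forall>w. x w \<in> carrier R) \<and> (\<forall>w. w \<notin> X \<longrightarrow> x w = \<zero>) \<and> finite {w. x w \<noteq> \<zero>}"
  by (auto simp: free_mod_def)

lemma free_mod_ops [simp]:
  "\<zero>\<^bsub>free_mod R X\<^esub> = (\<lambda>w. \<zero>)"
  "x \<oplus>\<^bsub>free_mod R X\<^esub> y = (\<lambda>w. x w \<oplus> y w)"
  "c \<odot>\<^bsub>free_mod R X\<^esub> x = (\<lambda>w. c \<otimes> x w)"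
  by (auto simp: free_mod_def)

lemma gen_carrier: "y \<in> X \<Longrightarrow> gen R y \<in> carrier (free_mod R X)"
proof -
  have "{w. gen R y w \<noteq> \<zero>} \<subseteq> {y}" by (auto simp: gen_def)
  then show "y \<in> X \<Longrightarrow> ?thesis" by (auto simp: free_mod_carrier gen_def intro: finite_subset)
qed

lemma module_free_mod: "Module.module R (free_mod R X)"
proof -
  have fin: "finite {w. x w \<oplus> y w \<noteq> \<zero>}"
    if "finite {w. x w \<noteq> \<zero>}" "finite {w. y w \<noteq> \<zero>}" for x y :: "'c \<Rightarrow> 'a"
  proof -
    have "{w. x w \<oplus> y w \<noteq> \<zero>} \<subseteq> {w. x w \<noteq> \<zero>} \<union> {w. y w \<noteq> \<zero>}" by auto
    then show ?thesis using that by (auto intro: finite_subset)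
  qed
  have fin': "finite {w. c \<otimes> x w \<noteq> \<zero>}"
    if "finite {w. x w \<noteq> \<zero>}" "c \<in> carrier R" for x :: "'c \<Rightarrow> 'a" and c
  proof -
    have "{w. c \<otimes> x w \<noteq> \<zero>} \<subseteq> {w. x w \<noteq> \<zero>}" using that by auto
    then show ?thesis using that by (auto intro: finite_subset)
  qed
  have "abelian_group (free_mod R X)"
  proof (rule abelian_groupI)
    fix x assume x: "x \<in> carrier (free_mod R X)"
    have e: "{w. \<ominus> x w \<noteq> \<zero>} \<subseteq> {w. x w \<noteq> \<zero>}" by auto
    have "(\<lambda>w. \<ominus> x w) \<in> carrier (free_mod R X)"
      using x finite_subset[OF e] by (auto simp: free_mod_carrier)
    moreover have "(\<lambda>w. \<ominus> x w) \<oplus>\<^bsub>free_mod R X\<^esub> x = \<zero>\<^bsub>free_mod R X\<^esub>"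
      using x by (auto simp: free_mod_carrier l_neg)
    ultimately show "\<exists>y\<in>carrier (free_mod R X). y \<oplus>\<^bsub>free_mod R X\<^esub> x = \<zero>\<^bsub>free_mod R X\<^esub>" by blast
  qed (auto simp: free_mod_carrier fin a_ac)
  then show ?thesis
    by (rule moduleI[OF is_cring]) (auto simp: free_mod_carrier fin' l_distr r_distr m_assoc)
qed

text \<open>Terms with coefficient zero may be added, so that values at arguments with different supports can be
  compared as sums over one index set.\<close>

lemma lin_ext_superset:
  assumes "Module.module R N" "finite S" "{w. x w \<noteq> \<zero>} \<subseteq> S" "\<And>w. w \<in> S \<Longrightarrow> \<phi> w \<in> carrier N"
    "\<And>w. x w \<in> carrier R"
  shows "lin_ext R N \<phi> x = (\<Oplus>\<^bsub>N\<^esub>w\<in>S. x w \<odot>\<^bsub>N\<^esub> \<phi> w)"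
proof -
  interpret N: Module.module R N by fact
  show ?thesis unfolding lin_ext_def
    by (rule N.add.finprod_mono_neutral_cong_left) (use assms in auto)
qed

lemma lin_ext_hom:
  assumes "Module.module R N" "\<And>w. w \<in> X \<Longrightarrow> \<phi> w \<in> carrier N"
  shows "lin_ext R N \<phi> \<in> mod_hom R (free_mod R X) N"
proof (rule mod_homI)
  interpret N: Module.module R N by fact
  interpret F: Module.module R "free_mod R X" by (rule module_free_mod)
  note sup = lin_ext_superset[OF assms(1)]
  fix x assume x: "x \<in> carrier (free_mod R X)"
  define S where "S = {w. x w \<noteq> \<zero>}"
  have S: "finite S" "S \<subseteq> X" "\<And>w. x w \<in> carrier R" using x by (auto simp: free_mod_carrier S_def)
  then have \<phi>S: "\<And>w. w \<in> S \<Longrightarrow> \<phi> w \<in> carrier N" using assms(2) by blast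
  have e: "lin_ext R N \<phi> x = (\<Oplus>\<^bsub>N\<^esub>w\<in>S. x w \<odot>\<^bsub>N\<^esub> \<phi> w)"
    by (rule sup) (use S \<phi>S in \<open>auto simp: S_def\<close>)
  then show "lin_ext R N \<phi> x \<in> carrier N" using S \<phi>S by (auto intro!: N.finsum_closed)
  {
    fix c assume c: "c \<in> carrier R"
    have "lin_ext R N \<phi> (\<lambda>w. c \<otimes> x w) = (\<Oplus>\<^bsub>N\<^esub>w\<in>S. (c \<otimes> x w) \<odot>\<^bsub>N\<^esub> \<phi> w)"
      by (rule sup) (use S \<phi>S c in \<open>auto simp: S_def\<close>)
    also have "\<dots> = c \<odot>\<^bsub>N\<^esub> lin_ext R N \<phi> x"
      unfolding e using S \<phi>S c
      by (subst N.finsum_smult_ldistr) (auto intro!: N.finsum_cong' simp: N.smult_assoc1)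
    finally show "lin_ext R N \<phi> (c \<odot>\<^bsub>free_mod R X\<^esub> x) = c \<odot>\<^bsub>N\<^esub> lin_ext R N \<phi> x" by simp
  }
  fix y assume y: "y \<in> carrier (free_mod R X)"
  define S' where "S' = S \<union> {w. y w \<noteq> \<zero>}"
  have S': "finite S'" "S' \<subseteq> X" "\<And>w. y w \<in> carrier R"
    using y S by (auto simp: free_mod_carrier S'_def)
  then have \<phi>S': "\<And>w. w \<in> S' \<Longrightarrow> \<phi> w \<in> carrier N" using assms(2) by blast
  have "lin_ext R N \<phi> (\<lambda>w. x w \<oplus> y w) = (\<Oplus>\<^bsub>N\<^esub>w\<in>S'. (x w \<oplus> y w) \<odot>\<^bsub>N\<^esub> \<phi> w)"
    by (rule sup) (use S S' \<phi>S' in \<open>auto simp: S'_def S_def\<close>)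
  also have "\<dots> = (\<Oplus>\<^bsub>N\<^esub>w\<in>S'. x w \<odot>\<^bsub>N\<^esub> \<phi> w) \<oplus>\<^bsub>N\<^esub> (\<Oplus>\<^bsub>N\<^esub>w\<in>S'. y w \<odot>\<^bsub>N\<^esub> \<phi> w)"
  proof -
    have "(\<Oplus>\<^bsub>N\<^esub>w\<in>S'. (x w \<oplus> y w) \<odot>\<^bsub>N\<^esub> \<phi> w) = (\<Oplus>\<^bsub>N\<^esub>w\<in>S'. x w \<odot>\<^bsub>N\<^esub> \<phi> w \<oplus>\<^bsub>N\<^esub> y w \<odot>\<^bsub>N\<^esub> \<phi> w)"
      using S S' \<phi>S' by (intro N.finsum_cong') (auto simp: N.smult_l_distr)
    then show ?thesis using S S' \<phi>S' by (subst N.finsum_addf[symmetric]) auto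
  qed
  also have "(\<Oplus>\<^bsub>N\<^esub>w\<in>S'. x w \<odot>\<^bsub>N\<^esub> \<phi> w) = lin_ext R N \<phi> x"
    by (rule sup[symmetric]) (use S S' \<phi>S' in \<open>auto simp: S'_def S_def\<close>)
  also have "(\<Oplus>\<^bsub>N\<^esub>w\<in>S'. y w \<odot>\<^bsub>N\<^esub> \<phi> w) = lin_ext R N \<phi> y"
    by (rule sup[symmetric]) (use S S' \<phi>S' in \<open>auto simp: S'_def S_def\<close>)
  finally show "lin_ext R N \<phi> (x \<oplus>\<^bsub>free_mod R X\<^esub> y) = lin_ext R N \<phi> x \<oplus>\<^bsub>N\<^esub> lin_ext R N \<phi> y"
    by simp
qed

lemma lin_ext_gen:
  assumes "Module.module R N" "\<phi> y \<in> carrier N"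
  shows "lin_ext R N \<phi> (gen R y) = \<phi> y"
proof -
  interpret N: Module.module R N by fact
  have "lin_ext R N \<phi> (gen R y) = (\<Oplus>\<^bsub>N\<^esub>w\<in>{y}. gen R y w \<odot>\<^bsub>N\<^esub> \<phi> w)"
    by (rule lin_ext_superset) (use assms in \<open>auto simp: gen_def\<close>)
  then show ?thesis using assms by (simp add: gen_def)
qed

lemma free_mod_induct [consumes 1, case_names zero gen add smult]:
  assumes "x \<in> carrier (free_mod R X)"
    and "P (\<lambda>w. \<zero>)"
    and "\<And>y. y \<in> X \<Longrightarrow> P (gen R y)"
    and "\<And>x y. x \<in> carrier (free_mod R X) \<Longrightarrow> y \<in> carrier (free_mod R X) \<Longrightarrow> P x \<Longrightarrow> P y \<Longrightarrow>
           P (x \<oplus>\<^bsub>free_mod R X\<^esub> y)"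
    and "\<And>c x. c \<in> carrier R \<Longrightarrow> x \<in> carrier (free_mod R X) \<Longrightarrow> P x \<Longrightarrow> P (c \<odot>\<^bsub>free_mod R X\<^esub> x)"
  shows "P x"
proof -
  have "\<forall>x. x \<in> carrier (free_mod R X) \<and> {w. x w \<noteq> \<zero>} \<subseteq> S \<longrightarrow> P x" if "finite S" for S
    using that
  proof (induction S)
    case empty
    have "x = (\<lambda>w. \<zero>)" if "{w. x w \<noteq> \<zero>} \<subseteq> {}" for x :: "'c \<Rightarrow> 'a"
      using that by auto
    then show ?case using assms(2) by blast
  next
    case (insert v S)
    show ?case
    proof safe
      fix x assume x: "x \<in> carrier (free_mod R X)" "{w. x w \<noteq> \<zero>} \<subseteq> insert v S"
      define x' where "x' = x(v := \<zero>)"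
      have s: "{w. x' w \<noteq> \<zero>} \<subseteq> S" using x by (auto simp: x'_def)
      have x': "x' \<in> carrier (free_mod R X)"
        using x finite_subset[OF s insert(1)] by (auto simp: free_mod_carrier x'_def)
      have Px': "P x'" using insert.IH x' s by blast
      show "P x"
      proof (cases "v \<in> X")
        case True
        have "x = (x v \<odot>\<^bsub>free_mod R X\<^esub> gen R v) \<oplus>\<^bsub>free_mod R X\<^esub> x'"
          using x by (auto simp: x'_def gen_def free_mod_carrier)
        moreover have "P \<dots>"
          using x Px' x' True gen_carrier[OF True]
          by (intro assms(3-5) Module.module.smult_closed[OF module_free_mod])
            (auto simp: free_mod_carrier[of x])
        ultimately show ?thesis by metis
      next
        case False
        then have "x' = x" using x by (auto simp: x'_def free_mod_carrier)
        then show ?thesis using Px' by simp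
      qed
    qed
  qed
  from this[of "{w. x w \<noteq> \<zero>}"] show ?thesis using assms(1) by (auto simp: free_mod_carrier)
qed

lemma free_mod_hom_eq:
  assumes "Module.module R N" "\<phi> \<in> mod_hom R (free_mod R X) N" "\<psi> \<in> mod_hom R (free_mod R X) N"
    "\<And>y. y \<in> X \<Longrightarrow> \<phi> (gen R y) = \<psi> (gen R y)" "x \<in> carrier (free_mod R X)"
  shows "\<phi> x = \<psi> x"
  using assms(5)
proof (induction rule: free_mod_induct)
  case zero
  then show ?case
    using mod_hom_zero[OF module_free_mod assms(1,2)] mod_hom_zero[OF module_free_mod assms(1,3)] by simp
next
  case (gen y)
  then show ?case by (rule assms(4))
next
  case (add x y)
  show ?case
    unfolding mod_hom_add[OF assms(2) add(1,2)] mod_hom_add[OF assms(3) add(1,2)] using add by simp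
next
  case (smult c x)
  show ?case
    unfolding mod_hom_smult[OF assms(2) smult(1,2)] mod_hom_smult[OF assms(3) smult(1,2)] using smult by simp
qed

lemma free_map_hom:
  assumes "f \<in> X \<rightarrow> Y"
  shows "free_map R Y f \<in> mod_hom R (free_mod R X) (free_mod R Y)"
  unfolding free_map_def
proof (rule lin_ext_hom[OF module_free_mod])
  fix w assume "w \<in> X"
  then show "gen R (f w) \<in> carrier (free_mod R Y)" using assms by (intro gen_carrier) auto
qed

lemma free_map_gen: "f w \<in> Y \<Longrightarrow> free_map R Y f (gen R w) = gen R (f w)"
  unfolding free_map_def by (rule lin_ext_gen[OF module_free_mod]) (rule gen_carrier)

end

section \<open>Quotient modules\<close>

locale quotable_module = Module.module R M
  for R :: "('a, 'b) ring_scheme" (structure) and M :: "('a, 'c) module" (structure)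
begin

lemma coset_eqI:
  assumes "submodule H R M" "x \<in> carrier M" "h \<in> H"
  shows "H +>\<^bsub>M\<^esub> (h \<oplus>\<^bsub>M\<^esub> x) = H +>\<^bsub>M\<^esub> x"
proof -
  interpret H: submodule H R M by fact
  have "h \<oplus>\<^bsub>M\<^esub> x \<in> H +>\<^bsub>M\<^esub> x" using assms(3) by (auto simp: a_r_coset_def')
  then show ?thesis using M.a_repr_independence[OF _ assms(2) H.subgroup_axioms] by blast
qed

lemma quot_mod_carrier: "carrier (quot_mod M H) = (\<lambda>x. H +>\<^bsub>M\<^esub> x) ` carrier M"
  by (auto simp: quot_mod_def A_RCOSETS_def')

lemma quot_mod_zero: "\<zero>\<^bsub>quot_mod M H\<^esub> = H"
  by (simp add: quot_mod_def)

lemma coset_zero: "submodule H R M \<Longrightarrow> H +>\<^bsub>M\<^esub> \<zero>\<^bsub>M\<^esub> = H"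
  using submoduleE(1) by (simp add: M.a_coset_add_zero)

lemma coset_hom:
  assumes "submodule H R M"
  shows "(\<lambda>x. H +>\<^bsub>M\<^esub> x) \<in> mod_hom R M (quot_mod M H)"
proof (rule mod_homI)
  interpret H: submodule H R M by fact
  interpret H: abelian_subgroup H M
    by (intro abelian_subgroupI3 additive_subgroupI H.subgroup_axioms M.abelian_group_axioms)
  show "H +>\<^bsub>M\<^esub> x \<in> carrier (quot_mod M H)" if "x \<in> carrier M" for x
    using that by (auto simp: quot_mod_carrier)
  show "H +>\<^bsub>M\<^esub> (x \<oplus>\<^bsub>M\<^esub> y) = (H +>\<^bsub>M\<^esub> x) \<oplus>\<^bsub>quot_mod M H\<^esub> (H +>\<^bsub>M\<^esub> y)"
    if "x \<in> carrier M" "y \<in> carrier M" for x y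
    using that by (simp add: quot_mod_def H.a_rcos_sum)
  fix c x assume c: "c \<in> carrier R" and x: "x \<in> carrier M"
  have "H +>\<^bsub>M\<^esub> (c \<odot>\<^bsub>M\<^esub> y) = H +>\<^bsub>M\<^esub> (c \<odot>\<^bsub>M\<^esub> x)" if yx: "y \<in> H +>\<^bsub>M\<^esub> x" for y
  proof -
    obtain h where h: "h \<in> H" "y = h \<oplus>\<^bsub>M\<^esub> x" using yx by (auto simp: a_r_coset_def')
    then have "c \<odot>\<^bsub>M\<^esub> y = c \<odot>\<^bsub>M\<^esub> h \<oplus>\<^bsub>M\<^esub> c \<odot>\<^bsub>M\<^esub> x"
      using c x H.a_subset by (auto simp: smult_r_distr)
    then show ?thesis using coset_eqI[OF assms] c x h(1) H.smult_closed by simp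
  qed
  moreover have "x \<in> H +>\<^bsub>M\<^esub> x" using x by (rule H.a_rcos_self)
  ultimately have "(\<Union>y\<in>H +>\<^bsub>M\<^esub> x. H +>\<^bsub>M\<^esub> (c \<odot>\<^bsub>M\<^esub> y)) = H +>\<^bsub>M\<^esub> (c \<odot>\<^bsub>M\<^esub> x)"
    by blast
  then show "H +>\<^bsub>M\<^esub> (c \<odot>\<^bsub>M\<^esub> x) = c \<odot>\<^bsub>quot_mod M H\<^esub> (H +>\<^bsub>M\<^esub> x)"
    by (simp add: quot_mod_def)
qed

lemma module_quot_mod: "submodule H R M \<Longrightarrow> Module.module R (quot_mod M H)"
  by (rule module_image[OF module_axioms coset_hom]) (auto simp: quot_mod_carrier quot_mod_zero coset_zero)

lemma quot_map_coset:
  assumes "quotable_module R N" "submodule H R M" "submodule K R N" "\<phi> \<in> mod_hom R M N"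
    "\<And>h. h \<in> H \<Longrightarrow> \<phi> h \<in> K" "x \<in> carrier M"
  shows "quot_map N K \<phi> (H +>\<^bsub>M\<^esub> x) = K +>\<^bsub>N\<^esub> \<phi> x"
proof -
  interpret N: quotable_module R N by fact
  interpret H: submodule H R M by fact
  interpret H: abelian_subgroup H M
    by (intro abelian_subgroupI3 additive_subgroupI H.subgroup_axioms M.abelian_group_axioms)
  have "K +>\<^bsub>N\<^esub> \<phi> y = K +>\<^bsub>N\<^esub> \<phi> x" if yx: "y \<in> H +>\<^bsub>M\<^esub> x" for y
  proof -
    obtain h where h: "h \<in> H" "y = h \<oplus>\<^bsub>M\<^esub> x" using yx by (auto simp: a_r_coset_def')
    then have "\<phi> y = \<phi> h \<oplus>\<^bsub>N\<^esub> \<phi> x"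
      using assms(6) H.a_subset mod_hom_add[OF assms(4)] by auto
    then show ?thesis using N.coset_eqI[OF assms(3)] h(1) assms(5) mod_hom_closed[OF assms(4,6)] by simp
  qed
  moreover have "x \<in> H +>\<^bsub>M\<^esub> x" using assms(6) by (rule H.a_rcos_self)
  ultimately show ?thesis unfolding quot_map_def by blast
qed

lemma mod_span_least: "submodule H R M \<Longrightarrow> S \<subseteq> H \<Longrightarrow> mod_span R M S \<subseteq> H"
  by (auto simp: mod_span_def)

lemma mod_span_base: "S \<subseteq> mod_span R M S"
  by (auto simp: mod_span_def)

lemma submodule_mod_span:
  assumes "S \<subseteq> carrier M"
  shows "submodule (mod_span R M S) R M"
proof (rule submoduleI)
  show "mod_span R M S \<subseteq> carrier M"
    using mod_span_least[OF carrier_is_submodule assms] .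
  show "\<zero>\<^bsub>M\<^esub> \<in> mod_span R M S"
    using subgroup.one_closed[OF submodule.axioms(1)] by (fastforce simp: mod_span_def)
qed (auto simp: mod_span_def submoduleE)

lemma submodule_kernel:
  assumes "Module.module R N" "\<phi> \<in> mod_hom R M N"
  shows "submodule {x \<in> carrier M. \<phi> x = \<zero>\<^bsub>N\<^esub>} R M"
proof -
  interpret N: Module.module R N by fact
  show ?thesis
    using mod_hom_zero[OF module_axioms assms] mod_hom_uminus[OF module_axioms assms]
    by (intro submoduleI) (auto simp: mod_hom_add[OF assms(2)] mod_hom_smult[OF assms(2)])
qed

end

section \<open>Tensor powers\<close>

context cring
begin

definition multilinear ::
  "'i set \<Rightarrow> ('a, 'e) module \<Rightarrow> ('a, 'f) module \<Rightarrow> (('i \<Rightarrow> 'e) \<Rightarrow> 'f) \<Rightarrow> bool" where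
  "multilinear I M N L \<longleftrightarrow>
     (\<forall>x \<in> I \<rightarrow>\<^sub>E carrier M. L x \<in> carrier N) \<and>
     (\<forall>x \<in> I \<rightarrow>\<^sub>E carrier M. \<forall>i \<in> I. (\<lambda>u. L (x(i := u))) \<in> mod_hom R M N)"

definition pure_tensor :: "'i set \<Rightarrow> ('a, 'e) module \<Rightarrow> ('i \<Rightarrow> 'e) \<Rightarrow> (('i \<Rightarrow> 'e) \<Rightarrow> 'a) set" where
  "pure_tensor I M x = tensor_rel R I M +>\<^bsub>free_mod R (I \<rightarrow>\<^sub>E carrier M)\<^esub> gen R x"

lemma PiE_upd: "x \<in> I \<rightarrow>\<^sub>E S \<Longrightarrow> i \<in> I \<Longrightarrow> u \<in> S \<Longrightarrow> x(i := u) \<in> I \<rightarrow>\<^sub>E S"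
  by (auto simp: PiE_iff extensional_def)

lemma submodule_tensor_rel:
  assumes "Module.module R M"
  shows "submodule (tensor_rel R I M) R (free_mod R (I \<rightarrow>\<^sub>E carrier M))"
proof -
  interpret M: Module.module R M by fact
  interpret F: quotable_module R "free_mod R (I \<rightarrow>\<^sub>E carrier M)"
    by (rule quotable_module.intro[OF module_free_mod])
  have g: "gen R (x(i := u)) \<in> carrier (free_mod R (I \<rightarrow>\<^sub>E carrier M))"
    if "x \<in> I \<rightarrow>\<^sub>E carrier M" "i \<in> I" "u \<in> carrier M" for x i u
    using that by (intro gen_carrier PiE_upd)
  show ?thesis
    unfolding tensor_rel_def Let_def
    by (rule F.submodule_mod_span)
      (use g in \<open>auto simp del: free_mod_ops intro!: F.minus_closed F.add.m_closed F.smult_closed\<close>)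
qed

text \<open>Each of the two families of relations is killed by one half of multilinearity, and the kernel of a
  linear map is a submodule.\<close>

lemma lin_ext_tensor_rel:
  assumes M: "Module.module R M" and N: "Module.module R N" and L: "multilinear I M N L"
    and z: "z \<in> tensor_rel R I M"
  shows "lin_ext R N L z = \<zero>\<^bsub>N\<^esub>"
proof -
  interpret M: Module.module R M by fact
  interpret N: Module.module R N by fact
  let ?F = "free_mod R (I \<rightarrow>\<^sub>E carrier M)"
  interpret F: quotable_module R ?F by (rule quotable_module.intro[OF module_free_mod])
  have hom: "lin_ext R N L \<in> mod_hom R ?F N"
    by (rule lin_ext_hom[OF N]) (use L in \<open>auto simp: multilinear_def\<close>)
  have nz: "v \<ominus>\<^bsub>N\<^esub> v = \<zero>\<^bsub>N\<^esub>" if "v \<in> carrier N" for v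
    using that by (simp add: a_minus_def N.r_neg)
  have Lc: "L x \<in> carrier N" if "x \<in> I \<rightarrow>\<^sub>E carrier M" for x
    using L that by (auto simp: multilinear_def)
  have le: "lin_ext R N L (gen R x) = L x" if "x \<in> I \<rightarrow>\<^sub>E carrier M" for x
    by (rule lin_ext_gen[where \<phi> = L and y = x, OF N Lc[OF that]])
  have g: "gen R x \<in> carrier ?F" if "x \<in> I \<rightarrow>\<^sub>E carrier M" for x
    using that by (intro gen_carrier)
  have Lm: "(\<lambda>u. L (x(i := u))) \<in> mod_hom R M N" if "x \<in> I \<rightarrow>\<^sub>E carrier M" "i \<in> I" for x i
    using L that by (auto simp: multilinear_def)
  have "tensor_rel R I M \<subseteq> {x \<in> carrier ?F. lin_ext R N L x = \<zero>\<^bsub>N\<^esub>}"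
    unfolding tensor_rel_def Let_def
  proof (rule F.mod_span_least[OF F.submodule_kernel[OF N hom]], safe, goal_cases)
    case (1 y x i u v)
    then have "x(i := u) \<in> I \<rightarrow>\<^sub>E carrier M" "x(i := v) \<in> I \<rightarrow>\<^sub>E carrier M"
      "x(i := u \<oplus>\<^bsub>M\<^esub> v) \<in> I \<rightarrow>\<^sub>E carrier M"
      by (auto intro!: PiE_upd)
    then show ?case by (intro F.minus_closed F.add.m_closed g)
  next
    case (2 y x i u v)
    then have "x(i := u) \<in> I \<rightarrow>\<^sub>E carrier M" "x(i := v) \<in> I \<rightarrow>\<^sub>E carrier M"
      "x(i := u \<oplus>\<^bsub>M\<^esub> v) \<in> I \<rightarrow>\<^sub>E carrier M"
      by (auto intro!: PiE_upd)
    note m = this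
    have e: "L (x(i := u \<oplus>\<^bsub>M\<^esub> v)) = L (x(i := u)) \<oplus>\<^bsub>N\<^esub> L (x(i := v))"
      by (rule mod_hom_add[OF Lm[OF 2(1,2)] 2(3,4)])
    show ?case
      using m Lc[OF m(1)] Lc[OF m(2)]
      by (simp del: free_mod_ops add: mod_hom_minus[OF F.module_axioms N hom] mod_hom_add[OF hom]
          g le F.add.m_closed e nz)
  next
    case (3 y x i c u)
    then have "x(i := u) \<in> I \<rightarrow>\<^sub>E carrier M" "x(i := c \<odot>\<^bsub>M\<^esub> u) \<in> I \<rightarrow>\<^sub>E carrier M"
      by (auto intro!: PiE_upd)
    then show ?case using 3 by (intro F.minus_closed F.smult_closed g)
  next
    case (4 y x i c u)
    then have "x(i := u) \<in> I \<rightarrow>\<^sub>E carrier M" "x(i := c \<odot>\<^bsub>M\<^esub> u) \<in> I \<rightarrow>\<^sub>E carrier M"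
      by (auto intro!: PiE_upd)
    note m = this
    have e: "L (x(i := c \<odot>\<^bsub>M\<^esub> u)) = c \<odot>\<^bsub>N\<^esub> L (x(i := u))"
      by (rule mod_hom_smult[OF Lm[OF 4(1,2)] 4(3,4)])
    show ?case
      using m 4 Lc[OF m(1)]
      by (simp del: free_mod_ops add: mod_hom_minus[OF F.module_axioms N hom] mod_hom_smult[OF hom]
          g le F.smult_closed e nz)
  qed
  then show ?thesis using z by blast
qed

lemma module_tensor_pow: "Module.module R M \<Longrightarrow> Module.module R (tensor_pow R I M)"
  unfolding tensor_pow_def
  by (rule quotable_module.module_quot_mod[OF quotable_module.intro[OF module_free_mod] submodule_tensor_rel])

lemma pure_tensor_closed:
  "x \<in> I \<rightarrow>\<^sub>E carrier M \<Longrightarrow> pure_tensor I M x \<in> carrier (tensor_pow R I M)"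
  unfolding tensor_pow_def pure_tensor_def quotable_module.quot_mod_carrier[OF quotable_module.intro[OF module_free_mod]]
  by (intro imageI gen_carrier)

lemma tensor_induct [consumes 2, case_names zero pure add smult]:
  assumes M: "Module.module R M" and t: "t \<in> carrier (tensor_pow R I M)"
    and zero: "P \<zero>\<^bsub>tensor_pow R I M\<^esub>"
    and pure: "\<And>x. x \<in> I \<rightarrow>\<^sub>E carrier M \<Longrightarrow> P (pure_tensor I M x)"
    and add: "\<And>s t. s \<in> carrier (tensor_pow R I M) \<Longrightarrow> t \<in> carrier (tensor_pow R I M) \<Longrightarrow>
      P s \<Longrightarrow> P t \<Longrightarrow> P (s \<oplus>\<^bsub>tensor_pow R I M\<^esub> t)"
    and smult: "\<And>c t. c \<in> carrier R \<Longrightarrow> t \<in> carrier (tensor_pow R I M) \<Longrightarrow> P t \<Longrightarrow>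
      P (c \<odot>\<^bsub>tensor_pow R I M\<^esub> t)"
  shows "P t"
proof -
  let ?F = "free_mod R (I \<rightarrow>\<^sub>E carrier M)" and ?H = "tensor_rel R I M"
  interpret F: quotable_module R ?F by (rule quotable_module.intro[OF module_free_mod])
  note H = submodule_tensor_rel[OF M, of I]
  note hom = F.coset_hom[OF H, folded tensor_pow_def]
  obtain z where z: "z \<in> carrier ?F" "t = ?H +>\<^bsub>?F\<^esub> z"
    using t unfolding tensor_pow_def F.quot_mod_carrier by blast
  from z(1) have "P (?H +>\<^bsub>?F\<^esub> z)"
  proof (induction rule: free_mod_induct)
    case zero
    then show ?case
      using assms(3) mod_hom_zero[OF F.module_axioms module_tensor_pow[OF M] hom] by simp
  next
    case (gen x)
    then show ?case using pure by (simp add: pure_tensor_def)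
  next
    case (add x y)
    then show ?case
      unfolding mod_hom_add[OF hom add(1,2)] using assms(5) mod_hom_closed[OF hom] by blast
  next
    case (smult c x)
    then show ?case
      unfolding mod_hom_smult[OF hom smult(1,2)] using assms(6) mod_hom_closed[OF hom] by blast
  qed
  then show ?thesis using z by simp
qed

lemma tensor_hom_eq:
  assumes M: "Module.module R M" and N: "Module.module R N"
    and "\<phi> \<in> mod_hom R (tensor_pow R I M) N" "\<psi> \<in> mod_hom R (tensor_pow R I M) N"
    "\<And>x. x \<in> I \<rightarrow>\<^sub>E carrier M \<Longrightarrow> \<phi> (pure_tensor I M x) = \<psi> (pure_tensor I M x)"
    "t \<in> carrier (tensor_pow R I M)"
  shows "\<phi> t = \<psi> t"
  using assms(1,6)
proof (induction rule: tensor_induct)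
  case zero
  show ?case
    using mod_hom_zero[OF module_tensor_pow[OF M] N assms(3)]
      mod_hom_zero[OF module_tensor_pow[OF M] N assms(4)] by simp
next
  case (pure x)
  then show ?case by (rule assms(5))
next
  case (add s t)
  then show ?case by (simp add: mod_hom_add[OF assms(3)] mod_hom_add[OF assms(4)])
next
  case (smult s t)
  then show ?case by (simp add: mod_hom_smult[OF assms(3)] mod_hom_smult[OF assms(4)])
qed

text \<open>The universal property. Any representative of the coset may be used, because the linear
  extension of a multilinear map vanishes on the relations.\<close>

definition tensor_lift :: "('a, 'f) module \<Rightarrow> (('i \<Rightarrow> 'e) \<Rightarrow> 'f) \<Rightarrow> (('i \<Rightarrow> 'e) \<Rightarrow> 'a) set \<Rightarrow> 'f" where
  "tensor_lift N L C = lin_ext R N L (SOME z. z \<in> C)"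

lemma tensor_lift_coset:
  assumes M: "Module.module R M" and N: "Module.module R N" and L: "multilinear I M N L"
    and z: "z \<in> carrier (free_mod R (I \<rightarrow>\<^sub>E carrier M))"
  shows "tensor_lift N L (tensor_rel R I M +>\<^bsub>free_mod R (I \<rightarrow>\<^sub>E carrier M)\<^esub> z) = lin_ext R N L z"
proof -
  interpret N: Module.module R N by fact
  let ?F = "free_mod R (I \<rightarrow>\<^sub>E carrier M)"
  interpret F: quotable_module R ?F by (rule quotable_module.intro[OF module_free_mod])
  note H = submodule_tensor_rel[OF M, of I]
  interpret H: submodule "tensor_rel R I M" R ?F by (rule H)
  have hom: "lin_ext R N L \<in> mod_hom R ?F N"
    by (rule lin_ext_hom[OF N]) (use L in \<open>auto simp: multilinear_def\<close>)
  let ?C = "tensor_rel R I M +>\<^bsub>?F\<^esub> z"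
  have "\<zero>\<^bsub>?F\<^esub> \<oplus>\<^bsub>?F\<^esub> z \<in> ?C"
    unfolding a_r_coset_def' using H.one_closed by fastforce
  then have "(SOME y. y \<in> ?C) \<in> ?C" by (rule someI[where P = "\<lambda>y. y \<in> ?C"])
  then obtain h where h: "h \<in> tensor_rel R I M" "(SOME y. y \<in> ?C) = h \<oplus>\<^bsub>?F\<^esub> z"
    unfolding a_r_coset_def' by auto
  have hc: "h \<in> carrier ?F" using h(1) F.submoduleE(1)[OF H] by blast
  have "lin_ext R N L z \<in> carrier N" by (rule mod_hom_closed[OF hom z])
  then show ?thesis
    unfolding tensor_lift_def h(2) mod_hom_add[OF hom hc z] lin_ext_tensor_rel[OF M N L h(1)]
    by simp
qed

lemma tensor_lift_pure:
  assumes "Module.module R M" "Module.module R N" "multilinear I M N L" "x \<in> I \<rightarrow>\<^sub>E carrier M"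
  shows "tensor_lift N L (pure_tensor I M x) = L x"
  unfolding pure_tensor_def tensor_lift_coset[OF assms(1-3) gen_carrier[OF assms(4)]]
  by (rule lin_ext_gen[OF assms(2)]) (use assms(3,4) in \<open>auto simp: multilinear_def\<close>)

lemma tensor_lift_hom:
  assumes M: "Module.module R M" and N: "Module.module R N" and L: "multilinear I M N L"
  shows "tensor_lift N L \<in> mod_hom R (tensor_pow R I M) N"
proof -
  let ?F = "free_mod R (I \<rightarrow>\<^sub>E carrier M)" and ?H = "tensor_rel R I M"
  interpret F: quotable_module R ?F by (rule quotable_module.intro[OF module_free_mod])
  have hom: "lin_ext R N L \<in> mod_hom R ?F N"
    by (rule lin_ext_hom[OF N]) (use L in \<open>auto simp: multilinear_def\<close>)
  note q = F.coset_hom[OF submodule_tensor_rel[OF M, of I], folded tensor_pow_def]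
  note l = tensor_lift_coset[OF M N L]
  have ex: "\<exists>z \<in> carrier ?F. t = ?H +>\<^bsub>?F\<^esub> z" if "t \<in> carrier (tensor_pow R I M)" for t
    using that unfolding tensor_pow_def F.quot_mod_carrier by blast
  show ?thesis
  proof (rule mod_homI)
    fix s assume "s \<in> carrier (tensor_pow R I M)"
    then obtain y where y: "y \<in> carrier ?F" "s = ?H +>\<^bsub>?F\<^esub> y" using ex by blast
    show "tensor_lift N L s \<in> carrier N"
      unfolding y(2) l[OF y(1)] by (rule mod_hom_closed[OF hom y(1)])
    show "tensor_lift N L (c \<odot>\<^bsub>tensor_pow R I M\<^esub> s) = c \<odot>\<^bsub>N\<^esub> tensor_lift N L s"
      if "c \<in> carrier R" for c
      unfolding y(2) mod_hom_smult[OF q that y(1), symmetric] l[OF y(1)]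
        l[OF F.smult_closed[OF that y(1)]]
      by (rule mod_hom_smult[OF hom that y(1)])
    fix t assume "t \<in> carrier (tensor_pow R I M)"
    then obtain z where z: "z \<in> carrier ?F" "t = ?H +>\<^bsub>?F\<^esub> z" using ex by blast
    show "tensor_lift N L (s \<oplus>\<^bsub>tensor_pow R I M\<^esub> t) = tensor_lift N L s \<oplus>\<^bsub>N\<^esub> tensor_lift N L t"
      unfolding y(2) z(2) mod_hom_add[OF q y(1) z(1), symmetric] l[OF y(1)] l[OF z(1)]
        l[OF F.add.m_closed[OF y(1) z(1)]]
      by (rule mod_hom_add[OF hom y(1) z(1)])
  qed
qed

lemma multilinear_pure:
  assumes M: "Module.module R M"
  shows "multilinear I M (tensor_pow R I M) (pure_tensor I M)"
  unfolding multilinear_def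
proof (intro conjI ballI mod_homI)
  let ?F = "free_mod R (I \<rightarrow>\<^sub>E carrier M)" and ?H = "tensor_rel R I M"
  interpret M: Module.module R M by fact
  interpret F: quotable_module R ?F by (rule quotable_module.intro[OF module_free_mod])
  note H = submodule_tensor_rel[OF M, of I]
  note q = F.coset_hom[OF H, folded tensor_pow_def]
  have rel: "?H +>\<^bsub>?F\<^esub> y = ?H +>\<^bsub>?F\<^esub> z"
    if "y \<ominus>\<^bsub>?F\<^esub> z \<in> ?H" "y \<in> carrier ?F" "z \<in> carrier ?F" for y z
  proof -
    have "y = (y \<ominus>\<^bsub>?F\<^esub> z) \<oplus>\<^bsub>?F\<^esub> z"
      using that(2,3) by (simp del: free_mod_ops add: a_minus_def F.add.m_assoc F.l_neg)
    then show ?thesis using F.coset_eqI[OF H that(3,1)] by simp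
  qed
  fix x assume x: "x \<in> I \<rightarrow>\<^sub>E carrier M"
  show "pure_tensor I M x \<in> carrier (tensor_pow R I M)" by (rule pure_tensor_closed[OF x])
  fix i u assume i: "i \<in> I" and u: "u \<in> carrier M"
  note gx = gen_carrier[OF PiE_upd[OF x i]]
  show "pure_tensor I M (x(i := u)) \<in> carrier (tensor_pow R I M)"
    by (intro pure_tensor_closed PiE_upd x i u)
  show "pure_tensor I M (x(i := c \<odot>\<^bsub>M\<^esub> u)) = c \<odot>\<^bsub>tensor_pow R I M\<^esub> pure_tensor I M (x(i := u))"
    if c: "c \<in> carrier R" for c
  proof -
    have "gen R (x(i := c \<odot>\<^bsub>M\<^esub> u)) \<ominus>\<^bsub>?F\<^esub> (c \<odot>\<^bsub>?F\<^esub> gen R (x(i := u))) \<in> ?H"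
      unfolding tensor_rel_def Let_def
      by (rule subsetD[OF F.mod_span_base]) (use x i u c in blast)
    then show ?thesis
      unfolding pure_tensor_def mod_hom_smult[OF q c gx[OF u], symmetric]
      by (intro rel F.smult_closed c gx u M.smult_closed)
  qed
  fix v assume v: "v \<in> carrier M"
  have "gen R (x(i := u \<oplus>\<^bsub>M\<^esub> v)) \<ominus>\<^bsub>?F\<^esub> (gen R (x(i := u)) \<oplus>\<^bsub>?F\<^esub> gen R (x(i := v))) \<in> ?H"
    unfolding tensor_rel_def Let_def
    by (rule subsetD[OF F.mod_span_base]) (use x i u v in blast)
  then show "pure_tensor I M (x(i := u \<oplus>\<^bsub>M\<^esub> v)) =
      pure_tensor I M (x(i := u)) \<oplus>\<^bsub>tensor_pow R I M\<^esub> pure_tensor I M (x(i := v))"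
    unfolding pure_tensor_def mod_hom_add[OF q gx[OF u] gx[OF v], symmetric]
    by (intro rel F.add.m_closed gx u v M.add.m_closed)
qed

lemma pure_tensor_zero:
  assumes M: "Module.module R M" and x: "x \<in> I \<rightarrow>\<^sub>E carrier M" and i: "i \<in> I" "x i = \<zero>\<^bsub>M\<^esub>"
  shows "pure_tensor I M x = \<zero>\<^bsub>tensor_pow R I M\<^esub>"
proof -
  have "(\<lambda>u. pure_tensor I M (x(i := u))) \<in> mod_hom R M (tensor_pow R I M)"
    using multilinear_pure[OF M, of I] x i by (auto simp: multilinear_def)
  from mod_hom_zero[OF M module_tensor_pow[OF M] this] show ?thesis
    by (simp flip: i(2))
qed

subsection \<open>Induced maps\<close>

text \<open>Functoriality of the tensor power in the module and in the index set has a common source: both are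
  induced by a map \<open>\<tau>\<close> of tuples, and such a map passes to the quotients as soon as it is multilinear modulo
  the relations of the target.\<close>

lemma quot_map_tensor:
  fixes \<tau> :: "('i \<Rightarrow> 'e) \<Rightarrow> 'l \<Rightarrow> 'f"
  assumes M: "Module.module R M" and N: "Module.module R N"
    and \<tau>: "\<tau> \<in> (I \<rightarrow>\<^sub>E carrier M) \<rightarrow> (L \<rightarrow>\<^sub>E carrier N)"
    and ml: "multilinear I M (tensor_pow R L N) (\<lambda>x. pure_tensor L N (\<tau> x))"
  defines "T \<equiv> quot_map (free_mod R (L \<rightarrow>\<^sub>E carrier N)) (tensor_rel R L N)
    (free_map R (L \<rightarrow>\<^sub>E carrier N) \<tau>)"
  shows "T \<in> mod_hom R (tensor_pow R I M) (tensor_pow R L N)"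
    and "x \<in> I \<rightarrow>\<^sub>E carrier M \<Longrightarrow> T (pure_tensor I M x) = pure_tensor L N (\<tau> x)"
proof -
  let ?F = "free_mod R (I \<rightarrow>\<^sub>E carrier M)" and ?H = "tensor_rel R I M"
  let ?G = "free_mod R (L \<rightarrow>\<^sub>E carrier N)" and ?K = "tensor_rel R L N"
  let ?T = "tensor_pow R L N"
  interpret F: quotable_module R ?F by (rule quotable_module.intro[OF module_free_mod])
  interpret G: quotable_module R ?G by (rule quotable_module.intro[OF module_free_mod])
  note H = submodule_tensor_rel[OF M, of I] and K = submodule_tensor_rel[OF N, of L]
  note mT = module_tensor_pow[OF N, of L]
  interpret K: submodule ?K R ?G by (rule K)
  interpret K: abelian_subgroup ?K ?G
    by (intro abelian_subgroupI3 additive_subgroupI K.subgroup_axioms G.M.abelian_group_axioms)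
  note f = free_map_hom[OF \<tau>] and q = G.coset_hom[OF K, folded tensor_pow_def]
  let ?L = "\<lambda>x. pure_tensor L N (\<tau> x)"
  have le: "?K +>\<^bsub>?G\<^esub> free_map R (L \<rightarrow>\<^sub>E carrier N) \<tau> z = lin_ext R ?T ?L z" if "z \<in> carrier ?F" for z
  proof (rule free_mod_hom_eq[OF mT mod_hom_comp[OF f q] lin_ext_hom[OF mT] _ that])
    show "pure_tensor L N (\<tau> w) \<in> carrier ?T" if "w \<in> I \<rightarrow>\<^sub>E carrier M" for w
      using \<tau> that by (intro pure_tensor_closed) auto
    show "?K +>\<^bsub>?G\<^esub> free_map R (L \<rightarrow>\<^sub>E carrier N) \<tau> (gen R y) = lin_ext R ?T ?L (gen R y)"
      if "y \<in> I \<rightarrow>\<^sub>E carrier M" for y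
    proof -
      have ty: "\<tau> y \<in> L \<rightarrow>\<^sub>E carrier N" using \<tau> that by auto
      show ?thesis
        unfolding free_map_gen[where f = \<tau> and w = y and Y = "L \<rightarrow>\<^sub>E carrier N", OF ty]
          lin_ext_gen[where \<phi> = ?L and y = y, OF mT pure_tensor_closed[OF ty]]
        by (simp add: pure_tensor_def)
    qed
  qed
  have inK: "free_map R (L \<rightarrow>\<^sub>E carrier N) \<tau> h \<in> ?K" if h: "h \<in> ?H" for h
  proof -
    have hc: "h \<in> carrier ?F" using h F.submoduleE(1)[OF H] by blast
    have "?K +>\<^bsub>?G\<^esub> free_map R (L \<rightarrow>\<^sub>E carrier N) \<tau> h = \<zero>\<^bsub>?T\<^esub>"
      unfolding le[OF hc] by (rule lin_ext_tensor_rel[OF M mT ml h])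
    also have "\<dots> = ?K" by (simp add: tensor_pow_def G.quot_mod_zero)
    finally show ?thesis using K.a_rcos_self[OF mod_hom_closed[OF f hc]] by simp
  qed
  have T: "T (?H +>\<^bsub>?F\<^esub> z) = tensor_lift ?T ?L (?H +>\<^bsub>?F\<^esub> z)" if "z \<in> carrier ?F" for z
  proof -
    have "T (?H +>\<^bsub>?F\<^esub> z) = ?K +>\<^bsub>?G\<^esub> free_map R (L \<rightarrow>\<^sub>E carrier N) \<tau> z"
      unfolding T_def by (rule F.quot_map_coset[OF G.quotable_module_axioms H K f inK that])
    also have "\<dots> = lin_ext R ?T ?L z" by (rule le[OF that])
    also have "\<dots> = tensor_lift ?T ?L (?H +>\<^bsub>?F\<^esub> z)"
      by (rule tensor_lift_coset[OF M mT ml that, symmetric])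
    finally show ?thesis .
  qed
  have T': "T t = tensor_lift ?T ?L t" if "t \<in> carrier (tensor_pow R I M)" for t
    using that T unfolding tensor_pow_def F.quot_mod_carrier by blast
  show "T \<in> mod_hom R (tensor_pow R I M) (tensor_pow R L N)"
    by (rule mod_hom_cong[OF tensor_lift_hom[OF M mT ml] module_tensor_pow[OF M] T'])
  show "T (pure_tensor I M x) = pure_tensor L N (\<tau> x)" if "x \<in> I \<rightarrow>\<^sub>E carrier M"
    unfolding T'[OF pure_tensor_closed[OF that]] by (rule tensor_lift_pure[OF M mT ml that])
qed

lemma tensor_map:
  assumes M: "Module.module R M" and N: "Module.module R N" and \<phi>: "\<phi> \<in> mod_hom R M N"
  shows tensor_map_hom: "tensor_map R I N \<phi> \<in> mod_hom R (tensor_pow R I M) (tensor_pow R I N)"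
    and tensor_map_pure: "x \<in> I \<rightarrow>\<^sub>E carrier M \<Longrightarrow>
      tensor_map R I N \<phi> (pure_tensor I M x) = pure_tensor I N (\<lambda>i\<in>I. \<phi> (x i))"
proof -
  interpret M: Module.module R M by fact
  have t: "(\<lambda>x. \<lambda>i\<in>I. \<phi> (x i)) \<in> (I \<rightarrow>\<^sub>E carrier M) \<rightarrow> (I \<rightarrow>\<^sub>E carrier N)"
    by (intro Pi_I) (auto simp: restrict_PiE_iff intro: mod_hom_closed[OF \<phi>] dest: PiE_mem)
  have ml: "multilinear I M (tensor_pow R I N) (\<lambda>x. pure_tensor I N (\<lambda>i\<in>I. \<phi> (x i)))"
    unfolding multilinear_def
  proof (intro conjI ballI)
    fix x assume x: "x \<in> I \<rightarrow>\<^sub>E carrier M"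
    have tx: "(\<lambda>i\<in>I. \<phi> (x i)) \<in> I \<rightarrow>\<^sub>E carrier N" using t x by blast
    then show "pure_tensor I N (\<lambda>i\<in>I. \<phi> (x i)) \<in> carrier (tensor_pow R I N)"
      by (rule pure_tensor_closed)
    fix i assume i: "i \<in> I"
    have "(\<lambda>u. pure_tensor I N ((\<lambda>i\<in>I. \<phi> (x i))(i := u))) \<in> mod_hom R N (tensor_pow R I N)"
      using multilinear_pure[OF N, of I] tx i by (auto simp: multilinear_def)
    from mod_hom_comp[OF \<phi> this] show
      "(\<lambda>u. pure_tensor I N (\<lambda>j\<in>I. \<phi> ((x(i := u)) j))) \<in> mod_hom R M (tensor_pow R I N)"
    proof (rule mod_hom_cong[OF _ M])
      fix u
      have "(\<lambda>j\<in>I. \<phi> ((x(i := u)) j)) = (\<lambda>i\<in>I. \<phi> (x i))(i := \<phi> u)" using i by auto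
      then show "pure_tensor I N (\<lambda>j\<in>I. \<phi> ((x(i := u)) j)) =
        pure_tensor I N ((\<lambda>i\<in>I. \<phi> (x i))(i := \<phi> u))" by simp
    qed
  qed
  show "tensor_map R I N \<phi> \<in> mod_hom R (tensor_pow R I M) (tensor_pow R I N)"
    unfolding tensor_map_def by (rule quot_map_tensor[OF M N t ml])
  show "tensor_map R I N \<phi> (pure_tensor I M x) = pure_tensor I N (\<lambda>i\<in>I. \<phi> (x i))"
    if "x \<in> I \<rightarrow>\<^sub>E carrier M"
    unfolding tensor_map_def by (rule quot_map_tensor(2)[OF M N t ml that])
qed

lemma tensor_perm:
  fixes M :: "('a, 'e) module" and I :: "'i set" and L :: "'l set"
  assumes M: "Module.module R M" and f: "bij_betw f L I"
  shows tensor_perm_hom: "tensor_perm R L M f \<in> mod_hom R (tensor_pow R I M) (tensor_pow R L M)"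
    and tensor_perm_pure: "x \<in> I \<rightarrow>\<^sub>E carrier M \<Longrightarrow>
      tensor_perm R L M f (pure_tensor I M x) = pure_tensor L M (\<lambda>j\<in>L. x (f j))"
proof -
  interpret M: Module.module R M by fact
  have t: "(\<lambda>x. \<lambda>j\<in>L. x (f j)) \<in> (I \<rightarrow>\<^sub>E carrier M) \<rightarrow> (L \<rightarrow>\<^sub>E carrier M)"
    using f by (auto simp: bij_betw_def)
  have ml: "multilinear I M (tensor_pow R L M) (\<lambda>x. pure_tensor L M (\<lambda>j\<in>L. x (f j)))"
    unfolding multilinear_def
  proof (intro conjI ballI)
    fix x assume x: "x \<in> I \<rightarrow>\<^sub>E carrier M"
    have tx: "(\<lambda>j\<in>L. x (f j)) \<in> L \<rightarrow>\<^sub>E carrier M" using t x by blast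
    then show "pure_tensor L M (\<lambda>j\<in>L. x (f j)) \<in> carrier (tensor_pow R L M)"
      by (rule pure_tensor_closed)
    fix i assume "i \<in> I"
    then obtain l where l: "l \<in> L" "f l = i" using f by (auto simp: bij_betw_def)
    have "(\<lambda>u. pure_tensor L M ((\<lambda>j\<in>L. x (f j))(l := u))) \<in> mod_hom R M (tensor_pow R L M)"
      using multilinear_pure[OF M, of L] tx l by (auto simp: multilinear_def)
    then show "(\<lambda>u. pure_tensor L M (\<lambda>j\<in>L. (x(i := u)) (f j))) \<in> mod_hom R M (tensor_pow R L M)"
    proof (rule mod_hom_cong[OF _ M])
      fix u
      have "(\<lambda>j\<in>L. (x(i := u)) (f j)) = (\<lambda>j\<in>L. x (f j))(l := u)"
        using l f by (auto simp: bij_betw_def inj_on_def)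
      then show "pure_tensor L M (\<lambda>j\<in>L. (x(i := u)) (f j)) =
        pure_tensor L M ((\<lambda>j\<in>L. x (f j))(l := u))" by simp
    qed
  qed
  show "tensor_perm R L M f \<in> mod_hom R (tensor_pow R I M) (tensor_pow R L M)"
    unfolding tensor_perm_def by (rule quot_map_tensor[OF M M t ml])
  show "tensor_perm R L M f (pure_tensor I M x) = pure_tensor L M (\<lambda>j\<in>L. x (f j))"
    if "x \<in> I \<rightarrow>\<^sub>E carrier M"
    unfolding tensor_perm_def by (rule quot_map_tensor(2)[OF M M t ml that])
qed

section \<open>Coordinates on tensor powers\<close>

text \<open>The ring as a module over itself, so that linear forms are elements of \<open>mod_hom\<close>.\<close>

definition scalar_mod :: "('a, 'a) module" where
  "scalar_mod = \<lparr>carrier = carrier R, mult = undefined, one = undefined, zero = \<zero>,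
     add = (\<lambda>x y. x \<oplus> y), smult = (\<lambda>x y. x \<otimes> y)\<rparr>"

lemma scalar_mod_simps [simp]:
  "carrier scalar_mod = carrier R" "\<zero>\<^bsub>scalar_mod\<^esub> = \<zero>"
  "x \<oplus>\<^bsub>scalar_mod\<^esub> y = x \<oplus> y" "x \<odot>\<^bsub>scalar_mod\<^esub> y = x \<otimes> y"
  by (auto simp: scalar_mod_def)

lemma module_scalar_mod: "Module.module R scalar_mod"
  by (rule moduleI[OF is_cring abelian_groupI])
    (auto simp: a_ac l_distr r_distr m_assoc intro: l_neg)

lemma finsum_scalar_mod [simp]: "finsum scalar_mod f A = finsum R f A"
  by (simp add: finsum_def finprod_def scalar_mod_def)

lemma finprod_indicator:
  assumes "finite I"
  shows "(\<Otimes>i\<in>I. if P i then \<one> else \<zero>) = (if \<forall>i\<in>I. P i then \<one> else \<zero>)"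
  using assms by (induction I rule: finite_induct) auto

definition tensor_form :: "'i set \<Rightarrow> ('i \<Rightarrow> 'e \<Rightarrow> 'a) \<Rightarrow> (('i \<Rightarrow> 'e) \<Rightarrow> 'a) set \<Rightarrow> 'a" where
  "tensor_form I \<xi> = tensor_lift scalar_mod (\<lambda>x. \<Otimes>i\<in>I. \<xi> i (x i))"

lemma multilinear_product:
  assumes M: "Module.module R M" and I: "finite I" and \<xi>: "\<And>i. i \<in> I \<Longrightarrow> \<xi> i \<in> mod_hom R M scalar_mod"
  shows "multilinear I M scalar_mod (\<lambda>x. \<Otimes>i\<in>I. \<xi> i (x i))"
  unfolding multilinear_def
proof (intro conjI ballI)
  interpret M: Module.module R M by fact
  fix x assume x: "x \<in> I \<rightarrow>\<^sub>E carrier M"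
  have cl: "\<xi> j (x j) \<in> carrier R" if "j \<in> I" for j
    using mod_hom_closed[OF \<xi>[OF that]] x that by auto
  then show "(\<Otimes>i\<in>I. \<xi> i (x i)) \<in> carrier scalar_mod"
    by auto
  fix i assume i: "i \<in> I"
  let ?r = "\<Otimes>j\<in>I - {i}. \<xi> j (x j)"
  have r: "?r \<in> carrier R" using cl by auto
  have e: "(\<Otimes>j\<in>I. \<xi> j ((x(i := u)) j)) = \<xi> i u \<otimes> ?r" if u: "u \<in> carrier M" for u
  proof -
    have "I = insert i (I - {i})" using i by auto
    then have "(\<Otimes>j\<in>I. \<xi> j ((x(i := u)) j)) = (\<Otimes>j\<in>insert i (I - {i}). \<xi> j ((x(i := u)) j))"
      by simp
    also have "\<dots> = \<xi> i ((x(i := u)) i) \<otimes> (\<Otimes>j\<in>I - {i}. \<xi> j ((x(i := u)) j))"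
      using cl I mod_hom_closed[OF \<xi>[OF i] u] by (intro finprod_insert) auto
    also have "(\<Otimes>j\<in>I - {i}. \<xi> j ((x(i := u)) j)) = ?r"
      using cl by (intro finprod_cong') auto
    finally show ?thesis by simp
  qed
  show "(\<lambda>u. \<Otimes>j\<in>I. \<xi> j ((x(i := u)) j)) \<in> mod_hom R M scalar_mod"
    using mod_hom_closed[OF \<xi>[OF i]] r
    by (intro mod_homI)
      (simp_all add: e mod_hom_add[OF \<xi>[OF i]] mod_hom_smult[OF \<xi>[OF i]] l_distr m_assoc
        del: fun_upd_apply)
qed

lemma
  assumes M: "Module.module R M" and I: "finite I" and \<xi>: "\<And>i. i \<in> I \<Longrightarrow> \<xi> i \<in> mod_hom R M scalar_mod"
  shows tensor_form_hom: "tensor_form I \<xi> \<in> mod_hom R (tensor_pow R I M) scalar_mod"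
    and tensor_form_pure: "x \<in> I \<rightarrow>\<^sub>E carrier M \<Longrightarrow>
      tensor_form I \<xi> (pure_tensor I M x) = (\<Otimes>i\<in>I. \<xi> i (x i))"
  unfolding tensor_form_def
  by (intro tensor_lift_hom tensor_lift_pure multilinear_product module_scalar_mod assms; assumption)+

lemma tensor_form_eqI:
  assumes M: "Module.module R M" and I: "finite I" and \<xi>: "\<And>i. i \<in> I \<Longrightarrow> \<xi> i \<in> mod_hom R M scalar_mod"
    and \<phi>: "\<phi> \<in> mod_hom R (tensor_pow R I M) scalar_mod"
    and eq: "\<And>x. x \<in> I \<rightarrow>\<^sub>E carrier M \<Longrightarrow> \<phi> (pure_tensor I M x) = (\<Otimes>i\<in>I. \<xi> i (x i))"
    and t: "t \<in> carrier (tensor_pow R I M)"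
  shows "\<phi> t = tensor_form I \<xi> t"
  by (rule tensor_hom_eq[OF M module_scalar_mod \<phi> tensor_form_hom[OF M I \<xi>] _ t])
    (simp_all add: eq tensor_form_pure[OF M I \<xi>])

lemma tensor_form_cong:
  assumes M: "Module.module R M" and I: "finite I" and \<xi>: "\<And>i. i \<in> I \<Longrightarrow> \<xi> i \<in> mod_hom R M scalar_mod"
    and eq: "\<And>i v. i \<in> I \<Longrightarrow> v \<in> carrier M \<Longrightarrow> \<xi>' i v = \<xi> i v"
    and t: "t \<in> carrier (tensor_pow R I M)"
  shows "tensor_form I \<xi>' t = tensor_form I \<xi> t"
proof -
  have \<xi>': "\<xi>' i \<in> mod_hom R M scalar_mod" if "i \<in> I" for i
    by (rule mod_hom_cong[OF \<xi>[OF that] M eq[OF that]])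
  show ?thesis
  proof (rule tensor_form_eqI[OF M I \<xi> tensor_form_hom[OF M I \<xi>'] _ t])
    fix x assume x: "x \<in> I \<rightarrow>\<^sub>E carrier M"
    then have "(\<Otimes>i\<in>I. \<xi>' i (x i)) = (\<Otimes>i\<in>I. \<xi> i (x i))"
      using mod_hom_closed[OF \<xi>] by (intro finprod_cong' refl Pi_I) (auto simp: eq[OF _ PiE_mem[OF x]] PiE_mem)
    then show "tensor_form I \<xi>' (pure_tensor I M x) = (\<Otimes>i\<in>I. \<xi> i (x i))"
      using tensor_form_pure[OF M I \<xi>' x] by simp
  qed
qed

lemma tensor_form_zero:
  assumes M: "Module.module R M" and I: "finite I" and \<xi>: "\<And>i. i \<in> I \<Longrightarrow> \<xi> i \<in> mod_hom R M scalar_mod"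
    and i: "i \<in> I" "\<And>v. v \<in> carrier M \<Longrightarrow> \<xi> i v = \<zero>"
    and t: "t \<in> carrier (tensor_pow R I M)"
  shows "tensor_form I \<xi> t = \<zero>"
proof -
  have "(\<lambda>t. \<zero>) t = tensor_form I \<xi> t"
  proof (rule tensor_form_eqI[OF M I \<xi> _ _ t])
    show "(\<lambda>t. \<zero>) \<in> mod_hom R (tensor_pow R I M) scalar_mod" by (rule mod_homI) auto
    fix x assume x: "x \<in> I \<rightarrow>\<^sub>E carrier M"
    have cl: "\<xi> j (x j) \<in> carrier R" if "j \<in> I" for j
      using mod_hom_closed[OF \<xi>[OF that]] x that by auto
    have "I = insert i (I - {i})" using i by auto
    then have "(\<Otimes>j\<in>I. \<xi> j (x j)) = (\<Otimes>j\<in>insert i (I - {i}). \<xi> j (x j))" by simp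
    also have "\<dots> = \<xi> i (x i) \<otimes> (\<Otimes>j\<in>I - {i}. \<xi> j (x j))"
      using cl I i by (intro finprod_insert) auto
    also have "\<dots> = \<zero>" using i(2)[OF PiE_mem[OF x i(1)]] cl by (simp add: Pi_iff)
    finally show "\<zero> = (\<Otimes>j\<in>I. \<xi> j (x j))" by simp
  qed
  then show ?thesis by simp
qed

lemma tensor_form_map:
  assumes M: "Module.module R M" and N: "Module.module R N" and \<phi>: "\<phi> \<in> mod_hom R M N"
    and I: "finite I" and \<xi>: "\<And>i. i \<in> I \<Longrightarrow> \<xi> i \<in> mod_hom R N scalar_mod"
    and t: "t \<in> carrier (tensor_pow R I M)"
  shows "tensor_form I \<xi> (tensor_map R I N \<phi> t) = tensor_form I (\<lambda>i v. \<xi> i (\<phi> v)) t"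
proof (rule tensor_form_eqI[OF M I mod_hom_comp[OF \<phi> \<xi>]
      mod_hom_comp[OF tensor_map_hom[OF M N \<phi>] tensor_form_hom[OF N I \<xi>]] _ t])
  fix x assume x: "x \<in> I \<rightarrow>\<^sub>E carrier M"
  then have "(\<lambda>i\<in>I. \<phi> (x i)) \<in> I \<rightarrow>\<^sub>E carrier N"
    by (auto simp: restrict_PiE_iff intro: mod_hom_closed[OF \<phi>] dest: PiE_mem)
  then have "tensor_form I \<xi> (tensor_map R I N \<phi> (pure_tensor I M x)) =
      (\<Otimes>i\<in>I. \<xi> i ((\<lambda>i\<in>I. \<phi> (x i)) i))"
    by (simp add: tensor_map_pure[OF M N \<phi> x] tensor_form_pure[OF N I \<xi>])
  also have "\<dots> = (\<Otimes>i\<in>I. \<xi> i (\<phi> (x i)))"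
    using x by (intro finprod_cong' refl Pi_I) (auto intro!: mod_hom_closed[OF \<xi>, simplified] mod_hom_closed[OF \<phi>] dest: PiE_mem)
  finally show "tensor_form I \<xi> (tensor_map R I N \<phi> (pure_tensor I M x)) = (\<Otimes>i\<in>I. \<xi> i (\<phi> (x i)))" .
qed

lemma tensor_form_perm:
  assumes M: "Module.module R M" and f: "bij_betw f L I"
    and L: "finite L" and \<xi>: "\<And>i. i \<in> L \<Longrightarrow> \<xi> i \<in> mod_hom R M scalar_mod"
    and t: "t \<in> carrier (tensor_pow R I M)"
  shows "tensor_form L \<xi> (tensor_perm R L M f t) = tensor_form I (\<lambda>i. \<xi> (inv_into L f i)) t"
proof -
  have I: "finite I" using f L bij_betw_finite by blast
  have \<xi>': "\<xi> (inv_into L f i) \<in> mod_hom R M scalar_mod" if "i \<in> I" for i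
    using \<xi> bij_betw_apply[OF bij_betw_inv_into[OF f]] that by blast
  show ?thesis
  proof (rule tensor_form_eqI[OF M I \<xi>'
        mod_hom_comp[OF tensor_perm_hom[OF M f] tensor_form_hom[OF M L \<xi>]] _ t])
    fix x assume x: "x \<in> I \<rightarrow>\<^sub>E carrier M"
    then have x': "(\<lambda>j\<in>L. x (f j)) \<in> L \<rightarrow>\<^sub>E carrier M"
      using f by (auto simp: bij_betw_def)
    have "tensor_form L \<xi> (tensor_perm R L M f (pure_tensor I M x)) =
        (\<Otimes>j\<in>L. \<xi> j ((\<lambda>j\<in>L. x (f j)) j))"
      by (simp add: tensor_perm_pure[OF M f x] tensor_form_pure[OF M L \<xi> x'])
    also have "\<dots> = (\<Otimes>j\<in>L. \<xi> (inv_into L f (f j)) (x (f j)))"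
      using x' f by (intro finprod_cong' refl Pi_I)
        (auto intro!: mod_hom_closed[OF \<xi>, simplified] dest: PiE_mem simp: bij_betw_def)
    also have "\<dots> = (\<Otimes>i\<in>f ` L. \<xi> (inv_into L f i) (x i))"
    proof (rule finprod_reindex[symmetric])
      show "(\<lambda>i. \<xi> (inv_into L f i) (x i)) \<in> f ` L \<rightarrow> carrier R"
        using mod_hom_closed[OF \<xi>'] x f by (auto simp: bij_betw_def)
    qed (use f in \<open>simp add: bij_betw_def\<close>)
    finally show "tensor_form L \<xi> (tensor_perm R L M f (pure_tensor I M x)) =
        (\<Otimes>i\<in>I. \<xi> (inv_into L f i) (x i))"
      using f by (simp add: bij_betw_def)
  qed
qed

subsection \<open>Dual bases\<close>

text \<open>A finite basis \<open>\<epsilon>\<close> with its coordinate forms \<open>\<xi>\<close>. That \<open>\<epsilon>\<close> spans is expressed by submodules because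
  \<open>tensor_span\<close> applies it to the submodule of those vectors that may fill a given slot of a tensor.\<close>

definition dual_basis ::
  "('a, 'e) module \<Rightarrow> 'l set \<Rightarrow> ('l \<Rightarrow> 'e \<Rightarrow> 'a) \<Rightarrow> ('l \<Rightarrow> 'e) \<Rightarrow> bool" where
  "dual_basis M \<Lambda> \<xi> \<epsilon> \<longleftrightarrow> finite \<Lambda> \<and> (\<forall>l \<in> \<Lambda>. \<xi> l \<in> mod_hom R M scalar_mod \<and> \<epsilon> l \<in> carrier M) \<and>
     (\<forall>l \<in> \<Lambda>. \<forall>m \<in> \<Lambda>. \<xi> l (\<epsilon> m) = (if l = m then \<one> else \<zero>)) \<and>
     (\<forall>H. submodule H R M \<longrightarrow> \<epsilon> ` \<Lambda> \<subseteq> H \<longrightarrow> carrier M \<subseteq> H)"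

text \<open>Slots are released from the basis one at a time. With the other slots fixed, the vectors that may
  fill a slot form a submodule containing the basis, hence everything.\<close>

lemma tensor_span:
  assumes M: "Module.module R M" and I: "finite I" and d: "dual_basis M \<Lambda> \<xi> \<epsilon>"
    and K: "submodule K R (tensor_pow R I M)"
    and b: "\<And>l. l \<in> I \<rightarrow>\<^sub>E \<Lambda> \<Longrightarrow> pure_tensor I M (\<lambda>i\<in>I. \<epsilon> (l i)) \<in> K"
  shows "carrier (tensor_pow R I M) \<subseteq> K"
proof
  interpret M: Module.module R M by fact
  interpret T: Module.module R "tensor_pow R I M" by (rule module_tensor_pow[OF M])
  interpret K: submodule K R "tensor_pow R I M" by fact
  note Ks = T.submoduleE[OF K]
  \<comment> \<open>the slots in \<open>J\<close> are arbitrary, the others hold basis vectors\<close>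
  have slots: "\<forall>x \<in> I \<rightarrow>\<^sub>E carrier M. (\<forall>i \<in> I - J. x i \<in> \<epsilon> ` \<Lambda>) \<longrightarrow> pure_tensor I M x \<in> K"
    if "finite J" "J \<subseteq> I" for J
    using that
  proof (induction J)
    case empty
    show ?case
    proof safe
      fix x assume x: "x \<in> I \<rightarrow>\<^sub>E carrier M" "\<forall>i \<in> I - {}. x i \<in> \<epsilon> ` \<Lambda>"
      define l where "l = (\<lambda>i\<in>I. inv_into \<Lambda> \<epsilon> (x i))"
      have "l \<in> I \<rightarrow>\<^sub>E \<Lambda>" using x(2) by (auto simp: l_def inv_into_into)
      moreover have "(\<lambda>i\<in>I. \<epsilon> (l i)) = x"
      proof
        fix i show "(\<lambda>i\<in>I. \<epsilon> (l i)) i = x i"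
          using x by (cases "i \<in> I") (auto simp: l_def f_inv_into_f)
      qed
      ultimately show "pure_tensor I M x \<in> K" using b by metis
    qed
  next
    case (insert j J)
    show ?case
    proof safe
      fix x assume x: "x \<in> I \<rightarrow>\<^sub>E carrier M" "\<forall>i \<in> I - insert j J. x i \<in> \<epsilon> ` \<Lambda>"
      have j: "j \<in> I" using insert by auto
      have h: "(\<lambda>u. pure_tensor I M (x(j := u))) \<in> mod_hom R M (tensor_pow R I M)"
        using multilinear_pure[OF M, of I] x j by (auto simp: multilinear_def)
      let ?H = "{u \<in> carrier M. pure_tensor I M (x(j := u)) \<in> K}"
      have "submodule ?H R M"
      proof (rule M.submoduleI)
        show "\<zero>\<^bsub>M\<^esub> \<in> ?H"
          using mod_hom_zero[OF M T.module_axioms h] K.one_closed by simp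
        show "\<ominus>\<^bsub>M\<^esub> u \<in> ?H" if "u \<in> ?H" for u
          using mod_hom_uminus[OF M T.module_axioms h] Ks that by simp
        show "u \<oplus>\<^bsub>M\<^esub> v \<in> ?H" if "u \<in> ?H" "v \<in> ?H" for u v
          using mod_hom_add[OF h] Ks that by simp
        show "c \<odot>\<^bsub>M\<^esub> u \<in> ?H" if "c \<in> carrier R" "u \<in> ?H" for c u
          using mod_hom_smult[OF h] Ks that by simp
      qed auto
      moreover have "\<epsilon> ` \<Lambda> \<subseteq> ?H"
      proof
        fix u assume u: "u \<in> \<epsilon> ` \<Lambda>"
        then have uc: "u \<in> carrier M" using d by (auto simp: dual_basis_def)
        have "\<forall>i \<in> I - J. (x(j := u)) i \<in> \<epsilon> ` \<Lambda>" using x(2) u by auto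
        then have "pure_tensor I M (x(j := u)) \<in> K"
          using insert.IH insert.prems PiE_upd[OF x(1) j uc] by blast
        then show "u \<in> ?H" using uc by simp
      qed
      ultimately have "carrier M \<subseteq> ?H" using d by (simp add: dual_basis_def)
      moreover have "x j \<in> carrier M" using x j by auto
      ultimately have "x j \<in> ?H" by (rule subsetD)
      then show "pure_tensor I M x \<in> K" by simp
    qed
  qed
  fix t assume "t \<in> carrier (tensor_pow R I M)"
  with M show "t \<in> K"
  proof (induction rule: tensor_induct)
    case zero
    then show ?case using K.one_closed by simp
  next
    case (pure x)
    then show ?case using slots[OF I order_refl] by blast
  qed (use Ks in auto)
qed

lemma tensor_basis_hom_eq:
  assumes M: "Module.module R M" and I: "finite I" and d: "dual_basis M \<Lambda> \<xi> \<epsilon>"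
    and N: "Module.module R N"
    and h: "\<phi> \<in> mod_hom R (tensor_pow R I M) N" "\<psi> \<in> mod_hom R (tensor_pow R I M) N"
    and eq: "\<And>l. l \<in> I \<rightarrow>\<^sub>E \<Lambda> \<Longrightarrow>
      \<phi> (pure_tensor I M (\<lambda>i\<in>I. \<epsilon> (l i))) = \<psi> (pure_tensor I M (\<lambda>i\<in>I. \<epsilon> (l i)))"
    and t: "t \<in> carrier (tensor_pow R I M)"
  shows "\<phi> t = \<psi> t"
proof -
  interpret T: Module.module R "tensor_pow R I M" by (rule module_tensor_pow[OF M])
  let ?K = "{t \<in> carrier (tensor_pow R I M). \<phi> t = \<psi> t}"
  note hh = mod_hom_add[OF h(1)] mod_hom_add[OF h(2)] mod_hom_smult[OF h(1)] mod_hom_smult[OF h(2)]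
    mod_hom_uminus[OF T.module_axioms N h(1)] mod_hom_uminus[OF T.module_axioms N h(2)]
    mod_hom_zero[OF T.module_axioms N h(1)] mod_hom_zero[OF T.module_axioms N h(2)]
  have K: "submodule ?K R (tensor_pow R I M)"
    by (rule T.submoduleI) (auto simp: hh)
  have "pure_tensor I M (\<lambda>i\<in>I. \<epsilon> (l i)) \<in> ?K" if l: "l \<in> I \<rightarrow>\<^sub>E \<Lambda>" for l
  proof -
    have "(\<lambda>i\<in>I. \<epsilon> (l i)) \<in> I \<rightarrow>\<^sub>E carrier M"
      using l d by (auto simp: dual_basis_def restrict_PiE_iff dest: PiE_mem)
    then show ?thesis by (intro CollectI conjI eq[OF l] pure_tensor_closed)
  qed
  from tensor_span[OF M I d K this] show ?thesis using t by blast
qed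

lemma basis_tuple: "dual_basis M \<Lambda> \<xi> \<epsilon> \<Longrightarrow> l \<in> I \<rightarrow>\<^sub>E \<Lambda> \<Longrightarrow> (\<lambda>i\<in>I. \<epsilon> (l i)) \<in> I \<rightarrow>\<^sub>E carrier M"
  by (auto simp: dual_basis_def restrict_PiE_iff dest: PiE_mem)

lemma PiE_eq_iff:
  assumes "l \<in> I \<rightarrow>\<^sub>E A" "m \<in> I \<rightarrow>\<^sub>E B"
  shows "l = m \<longleftrightarrow> (\<forall>i\<in>I. l i = m i)"
  using assms by (auto simp: PiE_iff intro: extensionalityI[of l I m])

lemma tensor_form_basis:
  assumes M: "Module.module R M" and I: "finite I" and d: "dual_basis M \<Lambda> \<xi> \<epsilon>"
    and l: "l \<in> I \<rightarrow>\<^sub>E \<Lambda>" and m: "m \<in> I \<rightarrow>\<^sub>E \<Lambda>"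
  shows "tensor_form I (\<lambda>i. \<xi> (l i)) (pure_tensor I M (\<lambda>i\<in>I. \<epsilon> (m i))) = (if l = m then \<one> else \<zero>)"
proof -
  have \<xi>: "\<xi> (l i) \<in> mod_hom R M scalar_mod" if "i \<in> I" for i
    using d l that by (auto simp: dual_basis_def)
  have "tensor_form I (\<lambda>i. \<xi> (l i)) (pure_tensor I M (\<lambda>i\<in>I. \<epsilon> (m i))) =
      (\<Otimes>i\<in>I. \<xi> (l i) ((\<lambda>i\<in>I. \<epsilon> (m i)) i))"
    by (rule tensor_form_pure[OF M I \<xi> basis_tuple[OF d m]])
  also have "\<dots> = (\<Otimes>i\<in>I. if l i = m i then \<one> else \<zero>)"
  proof (rule finprod_cong'[OF refl])
    fix i assume "i \<in> I"
    then have "l i \<in> \<Lambda>" "m i \<in> \<Lambda>" using l m by auto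
    then show "\<xi> (l i) ((\<lambda>i\<in>I. \<epsilon> (m i)) i) = (if l i = m i then \<one> else \<zero>)"
      using d \<open>i \<in> I\<close> by (simp add: dual_basis_def)
  qed auto
  also have "\<dots> = (if l = m then \<one> else \<zero>)"
    by (simp add: finprod_indicator[OF I] PiE_eq_iff[OF l m])
  finally show ?thesis .
qed

lemma tensor_expansion:
  assumes M: "Module.module R M" and I: "finite I" and d: "dual_basis M \<Lambda> \<xi> \<epsilon>"
    and t: "t \<in> carrier (tensor_pow R I M)"
  shows "t = (\<Oplus>\<^bsub>tensor_pow R I M\<^esub>l \<in> I \<rightarrow>\<^sub>E \<Lambda>. tensor_form I (\<lambda>i. \<xi> (l i)) t
      \<odot>\<^bsub>tensor_pow R I M\<^esub> pure_tensor I M (\<lambda>i\<in>I. \<epsilon> (l i)))"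
proof -
  let ?T = "tensor_pow R I M"
  interpret T: Module.module R ?T by (rule module_tensor_pow[OF M])
  have fin: "finite (I \<rightarrow>\<^sub>E \<Lambda>)" using d I by (intro finite_PiE) (auto simp: dual_basis_def)
  have \<xi>: "\<xi> (l i) \<in> mod_hom R M scalar_mod" if "i \<in> I" "l \<in> I \<rightarrow>\<^sub>E \<Lambda>" for i l
    using d that by (auto simp: dual_basis_def)
  have pt: "pure_tensor I M (\<lambda>i\<in>I. \<epsilon> (l i)) \<in> carrier ?T" if "l \<in> I \<rightarrow>\<^sub>E \<Lambda>" for l
    by (rule pure_tensor_closed[OF basis_tuple[OF d that]])
  have hom: "(\<lambda>t. tensor_form I (\<lambda>i. \<xi> (l i)) t \<odot>\<^bsub>?T\<^esub> pure_tensor I M (\<lambda>i\<in>I. \<epsilon> (l i)))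
      \<in> mod_hom R ?T ?T" if l: "l \<in> I \<rightarrow>\<^sub>E \<Lambda>" for l
  proof -
    have f: "tensor_form I (\<lambda>i. \<xi> (l i)) \<in> mod_hom R ?T scalar_mod"
      using \<xi> l by (intro tensor_form_hom[OF M I])
    have fc: "tensor_form I (\<lambda>i. \<xi> (l i)) s \<in> carrier R" if "s \<in> carrier ?T" for s
      using mod_hom_closed[OF f that] by simp
    show ?thesis
      by (rule mod_homI)
        (simp_all add: fc pt[OF l] mod_hom_add[OF f] mod_hom_smult[OF f] T.smult_l_distr T.smult_assoc1)
  qed
  show ?thesis
  proof (rule tensor_basis_hom_eq[OF M I d T.module_axioms _ finsum_hom[OF T.module_axioms T.module_axioms hom] _ t])
    show "(\<lambda>t. t) \<in> mod_hom R ?T ?T" by (rule mod_homI) auto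
    fix m assume m: "m \<in> I \<rightarrow>\<^sub>E \<Lambda>"
    let ?e = "\<lambda>l. pure_tensor I M (\<lambda>i\<in>I. \<epsilon> (l i))"
    have "(\<Oplus>\<^bsub>?T\<^esub>l\<in>I \<rightarrow>\<^sub>E \<Lambda>. tensor_form I (\<lambda>i. \<xi> (l i)) (?e m) \<odot>\<^bsub>?T\<^esub> ?e l) =
        (\<Oplus>\<^bsub>?T\<^esub>l\<in>I \<rightarrow>\<^sub>E \<Lambda>. if m = l then ?e l else \<zero>\<^bsub>?T\<^esub>)"
      using pt by (intro T.finsum_cong' refl) (auto simp: tensor_form_basis[OF M I d _ m])
    also have "\<dots> = ?e m"
      using pt by (intro T.finsum_singleton[OF m fin]) auto
    finally show "?e m = (\<Oplus>\<^bsub>?T\<^esub>l\<in>I \<rightarrow>\<^sub>E \<Lambda>. tensor_form I (\<lambda>i. \<xi> (l i)) (?e m) \<odot>\<^bsub>?T\<^esub> ?e l)"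
      by simp
  qed
qed

lemma tensor_eqI:
  assumes M: "Module.module R M" and I: "finite I" and d: "dual_basis M \<Lambda> \<xi> \<epsilon>"
    and t: "t \<in> carrier (tensor_pow R I M)" "t' \<in> carrier (tensor_pow R I M)"
    and eq: "\<And>l. l \<in> I \<rightarrow>\<^sub>E \<Lambda> \<Longrightarrow> tensor_form I (\<lambda>i. \<xi> (l i)) t = tensor_form I (\<lambda>i. \<xi> (l i)) t'"
  shows "t = t'"
proof -
  let ?T = "tensor_pow R I M"
  interpret T: Module.module R ?T by (rule module_tensor_pow[OF M])
  have "(\<Oplus>\<^bsub>?T\<^esub>l \<in> I \<rightarrow>\<^sub>E \<Lambda>. tensor_form I (\<lambda>i. \<xi> (l i)) t \<odot>\<^bsub>?T\<^esub> pure_tensor I M (\<lambda>i\<in>I. \<epsilon> (l i))) =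
      (\<Oplus>\<^bsub>?T\<^esub>l \<in> I \<rightarrow>\<^sub>E \<Lambda>. tensor_form I (\<lambda>i. \<xi> (l i)) t' \<odot>\<^bsub>?T\<^esub> pure_tensor I M (\<lambda>i\<in>I. \<epsilon> (l i)))"
  proof (rule T.finsum_cong'[OF refl])
    show "(\<lambda>l. tensor_form I (\<lambda>i. \<xi> (l i)) t' \<odot>\<^bsub>?T\<^esub> pure_tensor I M (\<lambda>i\<in>I. \<epsilon> (l i))) \<in>
        (I \<rightarrow>\<^sub>E \<Lambda>) \<rightarrow> carrier ?T"
    proof
      fix l assume l: "l \<in> I \<rightarrow>\<^sub>E \<Lambda>"
      have "\<xi> (l i) \<in> mod_hom R M scalar_mod" if "i \<in> I" for i
        using d l that by (auto simp: dual_basis_def)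
      then have "tensor_form I (\<lambda>i. \<xi> (l i)) t' \<in> carrier R"
        using mod_hom_closed[OF tensor_form_hom[OF M I] t(2)] by simp
      then show "tensor_form I (\<lambda>i. \<xi> (l i)) t' \<odot>\<^bsub>?T\<^esub> pure_tensor I M (\<lambda>i\<in>I. \<epsilon> (l i)) \<in> carrier ?T"
        using pure_tensor_closed[OF basis_tuple[OF d l]] by simp
    qed
  qed (simp add: eq)
  then show ?thesis
    using tensor_expansion[OF M I d t(1)] tensor_expansion[OF M I d t(2)] by simp
qed

end

section \<open>Added base points\<close>

lemma obj_Gamma: "X \<in> obj Gamma \<longleftrightarrow> finite (fst X) \<and> snd X \<in> fst X"
  by (auto simp: Gamma_def)

lemma arr_Gamma: "f \<in> arr Gamma X Y \<longleftrightarrow> f \<in> fst X \<rightarrow>\<^sub>E fst Y \<and> f (snd X) = snd Y"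
  by (auto simp: Gamma_def)

lemma fst_plus_pt: "fst (plus_pt X) = insert (snd (plus_pt X)) (fst X)"
  by (simp add: plus_pt_def)

lemma snd_plus_pt: "finite (fst X) \<Longrightarrow> snd (plus_pt X) \<notin> fst X"
  by (simp add: plus_pt_def fresh_notin)

lemma plus_pt_obj: "X \<in> obj Gamma \<Longrightarrow> plus_pt X \<in> obj Gamma"
  by (simp add: obj_Gamma fst_plus_pt)

text \<open>The points \<open>mark X 1\<close>, \<open>mark X 2\<close>, \<dots> are the added base points in the order of their addition;
  \<open>mark X 0\<close> is the base point of \<open>X\<close>.\<close>

definition mark :: "'u::infinite pset \<Rightarrow> nat \<Rightarrow> 'u" where
  "mark X r = snd ((plus_pt ^^ r) X)"

lemma mark_0: "mark X 0 = snd X"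
  by (simp add: mark_def)

lemma mark_shift: "mark ((plus_pt ^^ m) X) r = mark X (m + r)"
  by (simp add: mark_def funpow_add add.commute[of m r])

lemma mark_plus_pt: "mark (plus_pt X) r = mark X (Suc r)"
  using mark_shift[of 1 X r] by simp

lemma iter_plus_obj: "X \<in> obj Gamma \<Longrightarrow> (plus_pt ^^ n) X \<in> obj Gamma"
  by (induction n) (auto intro: plus_pt_obj)

lemma fst_iter_plus_Suc: "fst ((plus_pt ^^ Suc n) X) = insert (mark X (Suc n)) (fst ((plus_pt ^^ n) X))"
  by (simp add: mark_def fst_plus_pt[of "(plus_pt ^^ n) X"])

lemma fst_iter_plus: "fst ((plus_pt ^^ n) X) = fst X \<union> mark X ` {1..n}"
proof (induction n)
  case (Suc n)
  have "{1..Suc n} = insert (Suc n) {1..n}" by auto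
  then show ?case unfolding fst_iter_plus_Suc Suc by auto
qed simp

lemma mark_notin:
  assumes "X \<in> obj Gamma" "n < m"
  shows "mark X m \<notin> fst ((plus_pt ^^ n) X)"
proof -
  obtain k where k: "m = Suc (n + k)" using assms(2) less_natE by blast
  have "fst ((plus_pt ^^ n) X) \<subseteq> fst ((plus_pt ^^ (n + k)) X)"
    unfolding fst_iter_plus by auto
  moreover have "mark X m \<notin> fst ((plus_pt ^^ (n + k)) X)"
    using snd_plus_pt[of "(plus_pt ^^ (n + k)) X"] iter_plus_obj[OF assms(1), of "n + k"]
    by (simp add: mark_def k obj_Gamma)
  ultimately show ?thesis by blast
qed

lemma mark_in_iff:
  assumes "X \<in> obj Gamma"
  shows "mark X m \<in> fst ((plus_pt ^^ n) X) \<longleftrightarrow> m \<le> n"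
proof
  show "mark X m \<in> fst ((plus_pt ^^ n) X) \<Longrightarrow> m \<le> n"
    using mark_notin[OF assms] by (meson not_le)
  show "m \<le> n \<Longrightarrow> mark X m \<in> fst ((plus_pt ^^ n) X)"
    using assms by (cases m) (auto simp: fst_iter_plus mark_0 obj_Gamma)
qed

lemma mark_notin_base: "X \<in> obj Gamma \<Longrightarrow> 0 < m \<Longrightarrow> mark X m \<notin> fst X"
  using mark_notin[of X 0 m] by simp

lemma mark_inj: "X \<in> obj Gamma \<Longrightarrow> mark X m = mark X n \<longleftrightarrow> m = n"
  by (metis mark_in_iff order_antisym_conv order_refl)

lemma fst_subset_iter_plus: "fst X \<subseteq> fst ((plus_pt ^^ n) X)"
  by (auto simp: fst_iter_plus)

section \<open>Tensor powers of the reduced free module on a pointed set\<close>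

text \<open>The subsets that serve as coordinates. \<open>Inr s\<close> stands for \<open>X\<close> with the points numbered up to \<open>s - 1\<close>,
  so that these sets increase with \<open>s\<close>. \<open>Inr 0\<close> is exceptional: it stands for the union of the sets labelled
  \<open>Inl i\<close>, and it arises from \<open>Inr 1\<close> under the zeroth coface only.\<close>

definition lab :: "('i \<Rightarrow> 'u::infinite) \<Rightarrow> 'u pset \<Rightarrow> 'i + nat \<Rightarrow> 'u set" where
  "lab \<iota> X l = (case l of Inl i \<Rightarrow> {\<iota> i}
     | Inr s \<Rightarrow> (if s = 0 then fst X - {snd X} else fst ((plus_pt ^^ (s - 1)) X)))"

lemma lab_simps:
  "lab \<iota> X (Inl i) = {\<iota> i}" "lab \<iota> X (Inr 0) = fst X - {snd X}"
  "lab \<iota> X (Inr (Suc s)) = fst ((plus_pt ^^ s) X)"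
  by (auto simp: lab_def)

lemma finite_lab: "X \<in> obj Gamma \<Longrightarrow> finite (lab \<iota> X l)"
  using iter_plus_obj[of X] by (auto simp: lab_def obj_Gamma split: sum.splits)

definition labels :: "'b set \<Rightarrow> nat \<Rightarrow> ('b + nat) set" where
  "labels B n = Inl ` B \<union> Inr ` {1..n}"

context cring
begin

definition psum :: "'x set \<Rightarrow> ('x \<Rightarrow> 'a) \<Rightarrow> 'a" where
  "psum P v = (\<Oplus>w\<in>P. v w)"

lemma psum_hom: "finite P \<Longrightarrow> psum P \<in> mod_hom R (free_mod R X) scalar_mod"
  by (rule mod_homI)
    (auto simp: psum_def free_mod_carrier finsum_rdistr intro!: finsum_addf)

lemma psum_gen: "finite P \<Longrightarrow> psum P (gen R y) = (if y \<in> P then \<one> else \<zero>)"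
proof -
  assume P: "finite P"
  have "psum P (gen R y) = (\<Oplus>w\<in>P. if y = w then \<one> else \<zero>)"
    unfolding psum_def by (rule finsum_cong') (auto simp: gen_def)
  also have "\<dots> = (if y \<in> P then \<one> else \<zero>)"
  proof (cases "y \<in> P")
    case True
    then show ?thesis using finsum_singleton[OF True P, of "\<lambda>_. \<one>"] by simp
  next
    case False
    then have "(\<Oplus>w\<in>P. if y = w then \<one> else \<zero>) = (\<Oplus>w\<in>P. \<zero>)"
      by (intro finsum_cong') auto
    then show ?thesis using False by simp
  qed
  finally show ?thesis .
qed

lemma psum_free_map:
  assumes "finite W" "finite W'" "f \<in> W \<rightarrow> W'" "Q \<subseteq> W'" "v \<in> carrier (free_mod R W)"
  shows "psum Q (free_map R W' f v) = psum {w \<in> W. f w \<in> Q} v"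
proof (rule free_mod_hom_eq[OF module_scalar_mod _ _ _ assms(5)])
  have Q: "finite Q" using assms finite_subset by blast
  show "(\<lambda>v. psum Q (free_map R W' f v)) \<in> mod_hom R (free_mod R W) scalar_mod"
    by (rule mod_hom_comp[OF free_map_hom[OF assms(3)] psum_hom[OF Q]])
  show "psum {w \<in> W. f w \<in> Q} \<in> mod_hom R (free_mod R W) scalar_mod"
    by (rule psum_hom) (use assms in auto)
  fix y assume y: "y \<in> W"
  then have fy: "f y \<in> W'" using assms by auto
  show "psum Q (free_map R W' f (gen R y)) = psum {w \<in> W. f w \<in> Q} (gen R y)"
    using y Q assms(1) by (simp add: free_map_gen[where f = f, OF fy] psum_gen)
qed

lemma free_map_comp:
  assumes "f \<in> X \<rightarrow> Y" "g \<in> Y \<rightarrow> Z" "v \<in> carrier (free_mod R X)"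
  shows "free_map R Z g (free_map R Y f v) = free_map R Z (\<lambda>w. g (f w)) v"
proof (rule free_mod_hom_eq[OF module_free_mod _ _ _ assms(3)])
  show "(\<lambda>v. free_map R Z g (free_map R Y f v)) \<in> mod_hom R (free_mod R X) (free_mod R Z)"
    by (rule mod_hom_comp[OF free_map_hom free_map_hom]) fact+
  show "free_map R Z (\<lambda>w. g (f w)) \<in> mod_hom R (free_mod R X) (free_mod R Z)"
    by (rule free_map_hom) (use assms in auto)
  fix y assume "y \<in> X"
  then have y: "f y \<in> Y" "g (f y) \<in> Z" using assms by auto
  show "free_map R Z g (free_map R Y f (gen R y)) = free_map R Z (\<lambda>w. g (f w)) (gen R y)"
    by (simp add: free_map_gen[where f = f, OF y(1)] free_map_gen[where f = g, OF y(2)]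
        free_map_gen[where f = "\<lambda>w. g (f w)", OF y(2)])
qed

lemma free_map_cong:
  assumes "f \<in> X \<rightarrow> Y" "\<And>w. w \<in> X \<Longrightarrow> g w = f w" "v \<in> carrier (free_mod R X)"
  shows "free_map R Y g v = free_map R Y f v"
proof (rule free_mod_hom_eq[OF module_free_mod _ _ _ assms(3)])
  show "free_map R Y g \<in> mod_hom R (free_mod R X) (free_mod R Y)"
    by (rule free_map_hom) (use assms in auto)
  show "free_map R Y f \<in> mod_hom R (free_mod R X) (free_mod R Y)"
    by (rule free_map_hom) fact
  fix y assume y: "y \<in> X"
  then have "f y \<in> Y" "g y \<in> Y" using assms by auto
  then show "free_map R Y g (gen R y) = free_map R Y f (gen R y)"
    using assms(2)[OF y] by (simp add: free_map_gen)
qed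

lemma free_map_id:
  assumes "\<And>w. w \<in> X \<Longrightarrow> f w = w" "v \<in> carrier (free_mod R X)"
  shows "free_map R X f v = v"
proof (rule free_mod_hom_eq[OF module_free_mod _ _ _ assms(2)])
  show "free_map R X f \<in> mod_hom R (free_mod R X) (free_mod R X)"
    by (rule free_map_hom) (use assms in auto)
  show "(\<lambda>v. v) \<in> mod_hom R (free_mod R X) (free_mod R X)" by (rule mod_homI) auto
  fix y assume y: "y \<in> X"
  then show "free_map R X f (gen R y) = gen R y"
    using assms(1)[OF y] by (simp add: free_map_gen)
qed

subsection \<open>Reduced free modules\<close>

abbreviation reduced :: "'u::infinite pset \<Rightarrow> ('a, 'u \<Rightarrow> 'a) module" where
  "reduced X \<equiv> fob (tstar R) X"

lemma reduced_carrier: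
  "v \<in> carrier (reduced X) \<longleftrightarrow> v \<in> carrier (free_mod R (fst X)) \<and> psum (fst X) v = \<zero>"
  by (auto simp: tstar_def psum_def)

lemma reduced_ops [simp]:
  "\<zero>\<^bsub>reduced X\<^esub> = (\<lambda>w. \<zero>)"
  "x \<oplus>\<^bsub>reduced X\<^esub> y = (\<lambda>w. x w \<oplus> y w)"
  "c \<odot>\<^bsub>reduced X\<^esub> x = (\<lambda>w. c \<otimes> x w)"
  by (auto simp: tstar_def free_mod_def)

lemma module_reduced: "finite (fst X) \<Longrightarrow> Module.module R (reduced X)"
proof -
  assume fin: "finite (fst X)"
  interpret F: Module.module R "free_mod R (fst X)" by (rule module_free_mod)
  interpret F: quotable_module R "free_mod R (fst X)"
    by (rule quotable_module.intro[OF module_free_mod])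
  have "{x \<in> carrier (free_mod R (fst X)). (\<Oplus>w\<in>fst X. x w) = \<zero>} =
      {x \<in> carrier (free_mod R (fst X)). psum (fst X) x = \<zero>\<^bsub>scalar_mod\<^esub>}"
    by (simp add: psum_def)
  then show ?thesis
    using submodule.submodule_is_module[OF
        F.submodule_kernel[OF module_scalar_mod psum_hom[OF fin]] F.module_axioms]
    by (simp add: tstar_def)
qed

lemma hom_from_reduced:
  assumes "\<phi> \<in> mod_hom R (free_mod R (fst X)) N"
  shows "\<phi> \<in> mod_hom R (reduced X) N"
  using mod_hom_closed[OF assms] mod_hom_add[OF assms] mod_hom_smult[OF assms]
  by (intro mod_homI) (auto simp: reduced_carrier)

lemma psum_reduced_hom: "finite P \<Longrightarrow> psum P \<in> mod_hom R (reduced X) scalar_mod"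
  by (intro hom_from_reduced psum_hom)

lemma free_map_reduced_hom:
  assumes "finite (fst X)" "finite (fst Y)" "f \<in> fst X \<rightarrow> fst Y"
  shows "free_map R (fst Y) f \<in> mod_hom R (reduced X) (reduced Y)"
proof -
  have "free_map R (fst Y) f v \<in> carrier (reduced Y)" if v: "v \<in> carrier (reduced X)" for v
  proof -
    have "{w \<in> fst X. f w \<in> fst Y} = fst X" using assms(3) by auto
    then show ?thesis
      using v mod_hom_closed[OF free_map_hom[OF assms(3)]] psum_free_map[OF assms order_refl]
      by (simp add: reduced_carrier)
  qed
  moreover note h = free_map_hom[OF assms(3)]
  ultimately show ?thesis
    using mod_hom_add[OF h] mod_hom_smult[OF h] by (intro mod_homI) (auto simp: reduced_carrier)
qed

definition diff :: "'u \<Rightarrow> 'u \<Rightarrow> 'u \<Rightarrow> 'a" where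
  "diff p q = (\<lambda>w. gen R p w \<ominus> gen R q w)"

lemma gen_closed [simp]: "gen R p w \<in> carrier R"
  by (simp add: gen_def)

lemma diff_eq:
  assumes "p \<in> X" "q \<in> X"
  shows "diff p q = gen R p \<oplus>\<^bsub>free_mod R X\<^esub> ((\<ominus> \<one>) \<odot>\<^bsub>free_mod R X\<^esub> gen R q)"
  by (auto simp: diff_def a_minus_def l_minus)

lemma hom_diff:
  assumes N: "Module.module R N" and h: "\<phi> \<in> mod_hom R (free_mod R X) N" and pq: "p \<in> X" "q \<in> X"
  shows "\<phi> (diff p q) = \<phi> (gen R p) \<ominus>\<^bsub>N\<^esub> \<phi> (gen R q)"
proof -
  interpret N: Module.module R N by fact
  interpret F: Module.module R "free_mod R X" by (rule module_free_mod)
  note g = gen_carrier[OF pq(1)] gen_carrier[OF pq(2)]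
  have m: "(\<ominus> \<one>) \<odot>\<^bsub>free_mod R X\<^esub> gen R q \<in> carrier (free_mod R X)"
    by (rule F.smult_closed) (simp_all add: g)
  show ?thesis
    unfolding diff_eq[OF pq] mod_hom_add[OF h g(1) m] mod_hom_smult[OF h a_inv_closed[OF one_closed] g(2)]
    by (simp add: a_minus_def N.smult_minus_one[OF mod_hom_closed[OF h g(2)]])
qed

lemma diff_free: "p \<in> X \<Longrightarrow> q \<in> X \<Longrightarrow> diff p q \<in> carrier (free_mod R X)"
proof -
  assume pq: "p \<in> X" "q \<in> X"
  interpret F: Module.module R "free_mod R X" by (rule module_free_mod)
  show ?thesis
    unfolding diff_eq[OF pq] by (intro F.add.m_closed F.smult_closed gen_carrier pq a_inv_closed one_closed)
qed

lemma psum_diff: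
  assumes "finite P"
  shows "psum P (diff p q) = (if p \<in> P then \<one> else \<zero>) \<ominus> (if q \<in> P then \<one> else \<zero>)"
proof -
  have "psum P (diff p q) = psum P (gen R p) \<ominus>\<^bsub>scalar_mod\<^esub> psum P (gen R q)"
    by (rule hom_diff[OF module_scalar_mod psum_hom[OF assms], of p UNIV q]) auto
  moreover have "x \<ominus>\<^bsub>scalar_mod\<^esub> y = x \<ominus> y" for x y
    by (simp add: a_minus_def a_inv_def m_inv_def scalar_mod_def)
  ultimately show ?thesis by (simp add: psum_gen[OF assms])
qed

lemma diff_closed: "finite (fst X) \<Longrightarrow> p \<in> fst X \<Longrightarrow> q \<in> fst X \<Longrightarrow> diff p q \<in> carrier (reduced X)"
  by (simp add: reduced_carrier diff_free psum_diff a_minus_def r_neg)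

lemma diff_self: "diff p p = (\<lambda>w. \<zero>)"
  by (simp add: diff_def a_minus_def r_neg)

lemma diff_add: "diff p q \<oplus>\<^bsub>reduced X\<^esub> diff q s = diff p s"
proof -
  have "(a \<ominus> b) \<oplus> (b \<ominus> c) = a \<ominus> c" if "a \<in> carrier R" "b \<in> carrier R" "c \<in> carrier R" for a b c
    using that by algebra
  then show ?thesis by (simp add: diff_def)
qed

lemma free_map_diff:
  assumes "f \<in> X \<rightarrow> Y" "p \<in> X" "q \<in> X"
  shows "free_map R Y f (diff p q) = diff (f p) (f q)"
proof -
  interpret F: Module.module R "free_mod R Y" by (rule module_free_mod)
  have fp: "f p \<in> Y" "f q \<in> Y" using assms by auto
  have "free_map R Y f (diff p q) = gen R (f p) \<ominus>\<^bsub>free_mod R Y\<^esub> gen R (f q)"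
    using hom_diff[OF module_free_mod free_map_hom[OF assms(1)] assms(2,3)]
    by (simp add: free_map_gen[where f = f, OF fp(1)] free_map_gen[where f = f, OF fp(2)])
  also have "\<dots> = diff (f p) (f q)"
    unfolding diff_eq[OF fp] a_minus_def F.smult_minus_one[OF gen_carrier[OF fp(2)]] ..
  finally show ?thesis .
qed

text \<open>Modulo \<open>[q]\<close> every element of the free module is a combination of differences; the error
  term is the augmentation.\<close>

lemma diff_span:
  assumes fin: "finite (fst X)" and H: "submodule H R (reduced X)"
    and d: "\<And>w. w \<in> fst X \<Longrightarrow> diff w q \<in> H" and v: "v \<in> carrier (reduced X)"
  shows "v \<in> H"
proof -
  interpret V: Module.module R "reduced X" by (rule module_reduced[OF fin])
  interpret H: submodule H R "reduced X" by fact
  note Hs = V.submoduleE[OF H]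
  note ps = psum_hom[OF fin, of "fst X"]
  have "v \<in> carrier (free_mod R (fst X))" using v by (simp add: reduced_carrier)
  then have "(\<lambda>w. v w \<ominus> psum (fst X) v \<otimes> gen R q w) \<in> H"
  proof (induction rule: free_mod_induct)
    case zero
    have "psum (fst X) (\<lambda>w. \<zero>) = \<zero>" by (simp add: psum_def)
    moreover have "\<zero> \<ominus> \<zero> = \<zero>" by (simp add: a_minus_def)
    ultimately show ?case using H.one_closed by simp
  next
    case (gen y)
    have "(\<lambda>w. gen R y w \<ominus> psum (fst X) (gen R y) \<otimes> gen R q w) = diff y q"
      using gen fin by (simp add: psum_gen diff_def)
    then show ?case using d gen by simp
  next
    case (add x y)
    have c: "x w \<in> carrier R" "y w \<in> carrier R" "psum (fst X) x \<in> carrier R" "psum (fst X) y \<in> carrier R" for w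
      using add(1,2) mod_hom_closed[OF ps] by (auto simp: free_mod_carrier)
    have "(a \<oplus> b) \<ominus> (s \<oplus> t) \<otimes> g = (a \<ominus> s \<otimes> g) \<oplus> (b \<ominus> t \<otimes> g)"
      if "a \<in> carrier R" "b \<in> carrier R" "s \<in> carrier R" "t \<in> carrier R" "g \<in> carrier R" for a b s t g
      using that by algebra
    then have "(\<lambda>w. (x \<oplus>\<^bsub>free_mod R (fst X)\<^esub> y) w \<ominus>
          psum (fst X) (x \<oplus>\<^bsub>free_mod R (fst X)\<^esub> y) \<otimes> gen R q w) =
        (\<lambda>w. x w \<ominus> psum (fst X) x \<otimes> gen R q w) \<oplus>\<^bsub>reduced X\<^esub>
        (\<lambda>w. y w \<ominus> psum (fst X) y \<otimes> gen R q w)"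
      using mod_hom_add[OF ps add(1,2)] c by simp
    then show ?case using Hs(5)[OF add(3,4)] by simp
  next
    case (smult e x)
    have c: "x w \<in> carrier R" "psum (fst X) x \<in> carrier R" for w
      using smult(2) mod_hom_closed[OF ps] by (auto simp: free_mod_carrier)
    have "e \<otimes> a \<ominus> (e \<otimes> s) \<otimes> g = e \<otimes> (a \<ominus> s \<otimes> g)"
      if "a \<in> carrier R" "s \<in> carrier R" "g \<in> carrier R" for a s g
      using that smult(1) by algebra
    then have "(\<lambda>w. (e \<odot>\<^bsub>free_mod R (fst X)\<^esub> x) w \<ominus>
          psum (fst X) (e \<odot>\<^bsub>free_mod R (fst X)\<^esub> x) \<otimes> gen R q w) =
        e \<odot>\<^bsub>reduced X\<^esub> (\<lambda>w. x w \<ominus> psum (fst X) x \<otimes> gen R q w)"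
      using mod_hom_smult[OF ps smult(1,2)] c by simp
    then show ?case using Hs(4)[OF smult(1,3)] by simp
  qed
  moreover have "(\<lambda>w. v w \<ominus> psum (fst X) v \<otimes> gen R q w) = v"
    using v by (auto simp: reduced_carrier free_mod_carrier a_minus_def)
  ultimately show ?thesis by simp
qed

subsection \<open>The basis adapted to the added base points\<close>

text \<open>The differences of consecutive base points replace the usual differences with the current base point,
  since they are dual to sums over an increasing chain of subsets.\<close>

definition bas :: "('i \<Rightarrow> 'u::infinite) \<Rightarrow> 'u pset \<Rightarrow> 'i + nat \<Rightarrow> 'u \<Rightarrow> 'a" where
  "bas \<iota> X l = (case l of Inl i \<Rightarrow> diff (\<iota> i) (snd X) | Inr s \<Rightarrow> diff (mark X (s - 1)) (mark X s))"

text \<open>The set labelled \<open>Inr s\<close> contains \<open>mark X (s - 1)\<close> but not \<open>mark X s\<close>, and it contains both or neither of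
  the two points in any other basis vector. The basis spans because every difference with \<open>mark X n\<close> is a
  telescoping sum of basis vectors.\<close>

lemma dual_basis_reduced:
  assumes X: "X \<in> obj Gamma" and B: "bij_betw \<iota> B (fst X - {snd X})"
  shows "dual_basis (reduced ((plus_pt ^^ n) X)) (labels B n) (\<lambda>l. psum (lab \<iota> X l)) (bas \<iota> X)"
  unfolding dual_basis_def
proof (intro conjI ballI allI impI)
  let ?Y = "(plus_pt ^^ n) X"
  have finY: "finite (fst ?Y)" using iter_plus_obj[OF X, of n] by (simp add: obj_Gamma)
  have "finite B" using B X bij_betw_finite[OF B] by (simp add: obj_Gamma)
  then show "finite (labels B n)" by (simp add: labels_def)
  have \<iota>: "\<iota> i \<in> fst X" "\<iota> i \<noteq> snd X" if "i \<in> B" for i using B that by (auto simp: bij_betw_def)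
  fix l assume l: "l \<in> labels B n"
  show "psum (lab \<iota> X l) \<in> mod_hom R (reduced ?Y) scalar_mod"
    by (rule psum_reduced_hom[OF finite_lab[OF X]])
  show "bas \<iota> X l \<in> carrier (reduced ?Y)"
  proof (cases l)
    case (Inl i)
    then have "i \<in> B" using l by (auto simp: labels_def)
    then show ?thesis
      using Inl \<iota> X fst_subset_iter_plus[of X n] finY by (auto simp: bas_def obj_Gamma intro!: diff_closed)
  next
    case (Inr s)
    then have "s \<in> {1..n}" using l by (auto simp: labels_def)
    then show ?thesis
      using Inr finY by (auto simp: bas_def mark_in_iff[OF X] intro!: diff_closed)
  qed
  fix m assume m: "m \<in> labels B n"
  have mz: "mark X r \<noteq> \<iota> i" if "i \<in> B" for r i
    using \<iota>[OF that] mark_notin_base[OF X, of r] by (cases r) (auto simp: mark_0)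
  have z: "\<one> \<ominus> \<zero> = \<one>" "\<zero> \<ominus> \<zero> = \<zero>" "\<one> \<ominus> \<one> = \<zero>" by (auto simp: a_minus_def r_neg)
  have in1: "\<iota> i \<in> fst ((plus_pt ^^ r) X)" "snd X \<in> fst ((plus_pt ^^ r) X)" if "i \<in> B" for r i
    using \<iota>(1)[OF that] fst_subset_iter_plus[of X r] X by (auto simp: obj_Gamma)
  show "psum (lab \<iota> X l) (bas \<iota> X m) = (if l = m then \<one> else \<zero>)"
  proof (cases m)
    case (Inl i)
    then have i: "i \<in> B" using m by (auto simp: labels_def)
    show ?thesis
    proof (cases l)
      case (Inl j)
      then have j: "j \<in> B" using l by (auto simp: labels_def)
      have "\<iota> i = \<iota> j \<longleftrightarrow> i = j" using B i j by (auto simp: bij_betw_def inj_on_def)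
      then show ?thesis using \<iota>[OF j] \<open>m = Inl i\<close> Inl z
        by (auto simp: bas_def psum_diff lab_simps)
    next
      case (Inr s)
      then obtain r where "s = Suc r" using l by (cases s) (auto simp: labels_def)
      then show ?thesis using \<open>m = Inl i\<close> Inr z in1[OF i] finite_lab[OF X, of \<iota> l]
        by (simp add: bas_def psum_diff lab_simps)
    qed
  next
    case (Inr s)
    then obtain r where r: "s = Suc r" using m by (cases s) (auto simp: labels_def)
    show ?thesis
    proof (cases l)
      case (Inl j)
      then have j: "j \<in> B" using l by (auto simp: labels_def)
      show ?thesis using mz[OF j] \<open>m = Inr s\<close> Inl z
        by (simp add: bas_def psum_diff lab_simps)
    next
      case Inr': (Inr s')
      then obtain r' where "s' = Suc r'" using l by (cases s') (auto simp: labels_def)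
      then show ?thesis using Inr Inr' r z finite_lab[OF X, of \<iota> l]
        by (auto simp: bas_def psum_diff lab_simps mark_in_iff[OF X])
    qed
  qed
next
  let ?Y = "(plus_pt ^^ n) X"
  have finY: "finite (fst ?Y)" using iter_plus_obj[OF X, of n] by (simp add: obj_Gamma)
  fix H assume H: "submodule H R (reduced ?Y)" and b: "bas \<iota> X ` labels B n \<subseteq> H"
  interpret V: Module.module R "reduced ?Y" by (rule module_reduced[OF finY])
  interpret H: submodule H R "reduced ?Y" by fact
  note Hs = V.submoduleE[OF H]
  have tr: "diff p s \<in> H" if "diff p q \<in> H" "diff q s \<in> H" for p q s
    using Hs(5)[OF that] unfolding diff_add .
  have self: "diff p p \<in> H" for p using H.one_closed by (simp add: diff_self)
  have m: "diff (mark X r) (mark X n) \<in> H" if "r \<le> n" for r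
    using that
  proof (induction rule: inc_induct)
    case base
    show ?case by (rule self)
  next
    case (step r)
    then have "bas \<iota> X (Inr (Suc r)) \<in> H" using b by (auto simp: labels_def)
    then have "diff (mark X r) (mark X (Suc r)) \<in> H" by (simp add: bas_def)
    from tr[OF this step.IH] show ?case .
  qed
  have "diff w (mark X n) \<in> H" if w: "w \<in> fst ?Y" for w
  proof -
    consider r where "r \<le> n" "w = mark X r" | i where "i \<in> B" "w = \<iota> i"
    proof -
      have "w = mark X 0 \<or> w \<in> \<iota> ` B \<or> w \<in> mark X ` {1..n}"
        using w B by (auto simp: fst_iter_plus mark_0 bij_betw_def)
      then show thesis using that by fastforce
    qed
    then show ?thesis
    proof cases
      case 1
      then show ?thesis using m by simp
    next
      case 2
      then have "bas \<iota> X (Inl i) \<in> H" using b by (auto simp: labels_def)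
      then have "diff w (mark X 0) \<in> H" using 2 by (simp add: bas_def mark_0)
      from tr[OF this m[OF le0]] show ?thesis .
    qed
  qed
  then show "carrier (reduced ?Y) \<subseteq> H" using diff_span[OF finY H] by blast
qed

subsection \<open>Push-forward along maps of sets and the forms of families of subsets\<close>

abbreviation tens :: "'i set \<Rightarrow> 'u::infinite pset \<Rightarrow> ('a, (('i \<Rightarrow> 'u \<Rightarrow> 'a) \<Rightarrow> 'a) set) module" where
  "tens b X \<equiv> tensor_pow R b (reduced X)"

definition push ::
  "'i set \<Rightarrow> 'u::infinite pset \<Rightarrow> ('v \<Rightarrow> 'u) \<Rightarrow> (('i \<Rightarrow> 'v \<Rightarrow> 'a) \<Rightarrow> 'a) set \<Rightarrow> (('i \<Rightarrow> 'u \<Rightarrow> 'a) \<Rightarrow> 'a) set" where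
  "push b Y f = tensor_map R b (reduced Y) (free_map R (fst Y) f)"

definition form :: "'i set \<Rightarrow> ('i \<Rightarrow> 'u set) \<Rightarrow> (('i \<Rightarrow> 'u \<Rightarrow> 'a) \<Rightarrow> 'a) set \<Rightarrow> 'a" where
  "form b p = tensor_form b (\<lambda>i. psum (p i))"

lemma push_hom:
  fixes X :: "'v::infinite pset" and Y :: "'u::infinite pset"
  assumes "finite (fst X)" "finite (fst Y)" "f \<in> fst X \<rightarrow> fst Y"
  shows "push b Y f \<in> mod_hom R (tens b X) (tens b Y)"
  unfolding push_def by (intro tensor_map_hom module_reduced free_map_reduced_hom assms)

lemma push_pure:
  fixes X :: "'v::infinite pset" and Y :: "'u::infinite pset"
  assumes "finite (fst X)" "finite (fst Y)" "f \<in> fst X \<rightarrow> fst Y" "x \<in> b \<rightarrow>\<^sub>E carrier (reduced X)"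
  shows "push b Y f (pure_tensor b (reduced X) x) =
    pure_tensor b (reduced Y) (\<lambda>i\<in>b. free_map R (fst Y) f (x i))"
  unfolding push_def by (intro tensor_map_pure module_reduced free_map_reduced_hom assms)

lemma push_diffs:
  fixes X :: "'v::infinite pset" and Y :: "'u::infinite pset"
  assumes "finite (fst X)" "finite (fst Y)" "f \<in> fst X \<rightarrow> fst Y"
    and "\<And>i. i \<in> b \<Longrightarrow> p i \<in> fst X \<and> q i \<in> fst X"
  shows "push b Y f (pure_tensor b (reduced X) (\<lambda>i\<in>b. diff (p i) (q i))) =
    pure_tensor b (reduced Y) (\<lambda>i\<in>b. diff (f (p i)) (f (q i)))"
proof -
  have "(\<lambda>i\<in>b. diff (p i) (q i)) \<in> b \<rightarrow>\<^sub>E carrier (reduced X)"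
    using assms(1,4) by (auto simp: restrict_PiE_iff intro!: diff_closed)
  from push_pure[OF assms(1-3) this] have "push b Y f (pure_tensor b (reduced X) (\<lambda>i\<in>b. diff (p i) (q i))) =
      pure_tensor b (reduced Y) (\<lambda>i\<in>b. free_map R (fst Y) f ((\<lambda>i\<in>b. diff (p i) (q i)) i))" .
  also have "(\<lambda>i\<in>b. free_map R (fst Y) f ((\<lambda>i\<in>b. diff (p i) (q i)) i)) = (\<lambda>i\<in>b. diff (f (p i)) (f (q i)))"
    using assms(4) by (intro restrict_ext) (simp add: free_map_diff[OF assms(3)])
  finally show ?thesis .
qed

lemma push_comp:
  fixes X :: "'v::infinite pset" and Y :: "'w::infinite pset" and Z :: "'u::infinite pset"
  assumes "finite (fst X)" "finite (fst Y)" "finite (fst Z)" "f \<in> fst X \<rightarrow> fst Y" "g \<in> fst Y \<rightarrow> fst Z"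
    and t: "t \<in> carrier (tens b X)"
  shows "push b Z g (push b Y f t) = push b Z (\<lambda>w. g (f w)) t"
proof (rule tensor_hom_eq[OF module_reduced module_tensor_pow[OF module_reduced] _ _ _ t])
  have gf: "(\<lambda>w. g (f w)) \<in> fst X \<rightarrow> fst Z" using assms by auto
  show "(\<lambda>t. push b Z g (push b Y f t)) \<in> mod_hom R (tens b X) (tens b Z)"
    by (rule mod_hom_comp[OF push_hom push_hom]) fact+
  show "push b Z (\<lambda>w. g (f w)) \<in> mod_hom R (tens b X) (tens b Z)"
    by (rule push_hom) fact+
  fix x assume x: "x \<in> b \<rightarrow>\<^sub>E carrier (reduced X)"
  have "(\<lambda>i\<in>b. free_map R (fst Y) f (x i)) \<in> b \<rightarrow>\<^sub>E carrier (reduced Y)"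
    using x mod_hom_closed[OF free_map_reduced_hom[OF assms(1,2,4)]] by (auto simp: restrict_PiE_iff)
  note e = push_pure[OF assms(1,2,4) x] push_pure[OF assms(2,3,5) this] push_pure[OF assms(1,3) gf x]
  have "(\<lambda>i\<in>b. free_map R (fst Z) g ((\<lambda>i\<in>b. free_map R (fst Y) f (x i)) i)) =
      (\<lambda>i\<in>b. free_map R (fst Z) (\<lambda>w. g (f w)) (x i))"
    using x by (intro restrict_ext) (auto simp: free_map_comp[OF assms(4,5)] reduced_carrier PiE_iff)
  then show "push b Z g (push b Y f (pure_tensor b (reduced X) x)) =
      push b Z (\<lambda>w. g (f w)) (pure_tensor b (reduced X) x)"
    unfolding e by simp
qed fact+

lemma push_cong:
  fixes X :: "'v::infinite pset" and Y :: "'u::infinite pset"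
  assumes "finite (fst X)" "finite (fst Y)" "f \<in> fst X \<rightarrow> fst Y" "\<And>w. w \<in> fst X \<Longrightarrow> g w = f w"
    and t: "t \<in> carrier (tens b X)"
  shows "push b Y g t = push b Y f t"
proof (rule tensor_hom_eq[OF module_reduced module_tensor_pow[OF module_reduced] _ _ _ t])
  have g: "g \<in> fst X \<rightarrow> fst Y" using assms by auto
  show "push b Y g \<in> mod_hom R (tens b X) (tens b Y)" "push b Y f \<in> mod_hom R (tens b X) (tens b Y)"
    by (rule push_hom; fact)+
  fix x assume x: "x \<in> b \<rightarrow>\<^sub>E carrier (reduced X)"
  have "(\<lambda>i\<in>b. free_map R (fst Y) g (x i)) = (\<lambda>i\<in>b. free_map R (fst Y) f (x i))"
    using x assms(4) by (intro restrict_ext free_map_cong[OF assms(3)]) (auto simp: reduced_carrier PiE_iff)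
  then show "push b Y g (pure_tensor b (reduced X) x) = push b Y f (pure_tensor b (reduced X) x)"
    by (simp add: push_pure[OF assms(1-3) x] push_pure[OF assms(1,2) g x])
qed fact+

lemma push_id:
  fixes X :: "'u::infinite pset"
  assumes "finite (fst X)" "\<And>w. w \<in> fst X \<Longrightarrow> f w = w" and t: "t \<in> carrier (tens b X)"
  shows "push b X f t = t"
proof (rule tensor_hom_eq[OF module_reduced module_tensor_pow[OF module_reduced] _ _ _ t])
  have f: "f \<in> fst X \<rightarrow> fst X" using assms by auto
  show "push b X f \<in> mod_hom R (tens b X) (tens b X)"
    by (rule push_hom; fact)+
  show "(\<lambda>t. t) \<in> mod_hom R (tens b X) (tens b X)" by (rule mod_homI) auto
  fix x assume x: "x \<in> b \<rightarrow>\<^sub>E carrier (reduced X)"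
  have "(\<lambda>i\<in>b. free_map R (fst X) f (x i)) = x"
  proof
    fix i show "(\<lambda>i\<in>b. free_map R (fst X) f (x i)) i = x i"
      using x by (cases "i \<in> b") (auto simp: free_map_id[OF assms(2)] reduced_carrier PiE_iff extensional_def)
  qed
  then show "push b X f (pure_tensor b (reduced X) x) = pure_tensor b (reduced X) x"
    by (simp add: push_pure[OF assms(1,1) f x])
qed fact+

lemma form_hom:
  fixes X :: "'u::infinite pset"
  assumes "finite (fst X)" "finite b" "\<And>i. i \<in> b \<Longrightarrow> p i \<subseteq> fst X"
  shows "form b p \<in> mod_hom R (tens b X) scalar_mod"
  unfolding form_def
  by (intro tensor_form_hom module_reduced psum_reduced_hom assms)
    (meson assms finite_subset)

text \<open>The reason for working with sums over subsets: they pull back along a map by taking preimages.\<close>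

lemma form_push:
  fixes X :: "'v::infinite pset" and Y :: "'u::infinite pset"
  assumes "finite (fst X)" "finite (fst Y)" "f \<in> fst X \<rightarrow> fst Y" "finite b" "\<And>i. i \<in> b \<Longrightarrow> p i \<subseteq> fst Y"
    and t: "t \<in> carrier (tens b X)"
  shows "form b p (push b Y f t) = form b (\<lambda>i. {w \<in> fst X. f w \<in> p i}) t"
proof -
  have fp: "finite (p i)" if "i \<in> b" for i using assms that finite_subset by meson
  have "form b p (push b Y f t) = tensor_form b (\<lambda>i v. psum (p i) (free_map R (fst Y) f v)) t"
    unfolding form_def push_def
    by (rule tensor_form_map[OF module_reduced module_reduced free_map_reduced_hom])
      (use assms fp in \<open>auto intro: psum_reduced_hom\<close>)
  also have "\<dots> = form b (\<lambda>i. {w \<in> fst X. f w \<in> p i}) t"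
    unfolding form_def
    by (rule tensor_form_cong[OF module_reduced _ _ _ t])
      (use assms in \<open>auto intro!: psum_reduced_hom psum_free_map simp: reduced_carrier\<close>)
  finally show ?thesis .
qed

text \<open>Coefficients of elements of \<open>t\<^sup>*\<close> add up to zero.\<close>

lemma form_whole:
  fixes X :: "'u::infinite pset"
  assumes "finite (fst X)" "finite b" "\<And>i. i \<in> b \<Longrightarrow> p i \<subseteq> fst X"
    and "i \<in> b" "p i = fst X" and t: "t \<in> carrier (tens b X)"
  shows "form b p t = \<zero>"
  unfolding form_def
proof (rule tensor_form_zero[OF module_reduced _ _ _ _ t])
  show "psum (p i) \<in> mod_hom R (reduced X) scalar_mod" if "i \<in> b" for i
    using assms(1,3) that by (meson finite_subset psum_reduced_hom)
  show "psum (p i) v = \<zero>" if "v \<in> carrier (reduced X)" for v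
    using that assms(5) by (simp add: reduced_carrier)
qed fact+

lemma form_perm:
  fixes X :: "'u::infinite pset"
  assumes "finite (fst X)" "bij_betw f l b" "finite l" "\<And>i. i \<in> l \<Longrightarrow> p i \<subseteq> fst X"
    and t: "t \<in> carrier (tens b X)"
  shows "form l p (tensor_perm R l (reduced X) f t) = form b (\<lambda>i. p (inv_into l f i)) t"
  unfolding form_def
  by (rule tensor_form_perm[OF module_reduced assms(2,3) _ t])
    (use assms in \<open>auto intro!: psum_reduced_hom intro: finite_subset\<close>)

end

section \<open>Modules of natural transformations\<close>

lemma nat_restrict_val:
  "X \<in> obj C \<Longrightarrow> x \<in> carrier (fob F X) \<Longrightarrow> nat_restrict C F \<eta> X x = \<eta> X x"
  by (simp add: nat_restrict_def)

lemma nat_restrict_eqI: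
  "(\<And>X x. X \<in> obj C \<Longrightarrow> x \<in> carrier (fob F X) \<Longrightarrow> \<eta> X x = \<theta> X x) \<Longrightarrow> nat_restrict C F \<eta> = nat_restrict C F \<theta>"
  unfolding nat_restrict_def by (intro restrict_ext) auto

lemma nat_restrict_idem: "nat_restrict C F (nat_restrict C F \<eta>) = nat_restrict C F \<eta>"
  by (rule nat_restrict_eqI) (rule nat_restrict_val)

lemma nat_mod_eqI:
  assumes "\<eta> \<in> carrier (nat_mod C k F G)" "\<theta> \<in> carrier (nat_mod C k F G)"
    and "\<And>X x. X \<in> obj C \<Longrightarrow> x \<in> carrier (fob F X) \<Longrightarrow> \<eta> X x = \<theta> X x"
  shows "\<eta> = \<theta>"
  using nat_restrict_eqI[of C F \<eta> \<theta>, OF assms(3)] assms(1,2) by (simp add: nat_mod_def)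

lemma is_nat_cong:
  assumes "is_nat C k F G \<theta>" and "\<And>X. X \<in> obj C \<Longrightarrow> Module.module k (fob F X)"
    and "\<And>X Y f. X \<in> obj C \<Longrightarrow> Y \<in> obj C \<Longrightarrow> f \<in> arr C X Y \<Longrightarrow> far F X Y f \<in> mod_hom k (fob F X) (fob F Y)"
    and "\<And>X x. X \<in> obj C \<Longrightarrow> x \<in> carrier (fob F X) \<Longrightarrow> \<eta> X x = \<theta> X x"
  shows "is_nat C k F G \<eta>"
  unfolding is_nat_def
proof (intro conjI ballI)
  fix X assume X: "X \<in> obj C"
  show "\<eta> X \<in> mod_hom k (fob F X) (fob G X)"
    by (rule mod_hom_cong[OF _ assms(2)[OF X] assms(4)[OF X]])
      (use assms(1) X in \<open>auto simp: is_nat_def\<close>)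
  fix Y f x assume a: "Y \<in> obj C" "f \<in> arr C X Y" "x \<in> carrier (fob F X)"
  have "far F X Y f x \<in> carrier (fob F Y)"
    by (rule mod_hom_closed[OF assms(3)[OF X a(1,2)] a(3)])
  then show "\<eta> Y (far F X Y f x) = far G X Y f (\<eta> X x)"
    using assms(1,4) X a by (simp add: is_nat_def)
qed

lemma nat_restrict_carrier:
  assumes "is_nat C k F G \<theta>" and "\<And>X. X \<in> obj C \<Longrightarrow> Module.module k (fob F X)"
    and "\<And>X Y f. X \<in> obj C \<Longrightarrow> Y \<in> obj C \<Longrightarrow> f \<in> arr C X Y \<Longrightarrow> far F X Y f \<in> mod_hom k (fob F X) (fob F Y)"
  shows "nat_restrict C F \<theta> \<in> carrier (nat_mod C k F G)"
  using is_nat_cong[OF assms, of "nat_restrict C F \<theta>"]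
  by (simp add: nat_mod_def nat_restrict_idem nat_restrict_val)

lemma nat_mod_is_nat: "\<eta> \<in> carrier (nat_mod C k F G) \<Longrightarrow> is_nat C k F G \<eta>"
  by (simp add: nat_mod_def)

lemma nat_mod_hom: "\<eta> \<in> carrier (nat_mod C k F G) \<Longrightarrow> X \<in> obj C \<Longrightarrow> \<eta> X \<in> mod_hom k (fob F X) (fob G X)"
  by (simp add: nat_mod_def is_nat_def)

lemma nat_mod_natural:
  "\<eta> \<in> carrier (nat_mod C k F G) \<Longrightarrow> X \<in> obj C \<Longrightarrow> Y \<in> obj C \<Longrightarrow> f \<in> arr C X Y \<Longrightarrow>
    x \<in> carrier (fob F X) \<Longrightarrow> \<eta> Y (far F X Y f x) = far G X Y f (\<eta> X x)"
  by (simp add: nat_mod_def is_nat_def)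

lemma
  assumes "X \<in> obj C" "x \<in> carrier (fob F X)"
  shows nat_mod_add_val: "(\<eta> \<oplus>\<^bsub>nat_mod C k F G\<^esub> \<theta>) X x = \<eta> X x \<oplus>\<^bsub>fob G X\<^esub> \<theta> X x"
    and nat_mod_smult_val: "(c \<odot>\<^bsub>nat_mod C k F G\<^esub> \<eta>) X x = c \<odot>\<^bsub>fob G X\<^esub> \<eta> X x"
    and nat_mod_zero_val: "\<zero>\<^bsub>nat_mod C k F G\<^esub> X x = \<zero>\<^bsub>fob G X\<^esub>"
  using assms by (simp_all add: nat_mod_def nat_restrict_def)

lemma module_nat_mod:
  fixes k :: "('k, 'r) ring_scheme"
  assumes k: "cring k"
    and F: "\<And>X. X \<in> obj C \<Longrightarrow> Module.module k (fob F X)"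
      "\<And>X Y f. X \<in> obj C \<Longrightarrow> Y \<in> obj C \<Longrightarrow> f \<in> arr C X Y \<Longrightarrow> far F X Y f \<in> mod_hom k (fob F X) (fob F Y)"
    and G: "\<And>X. X \<in> obj C \<Longrightarrow> Module.module k (fob G X)"
      "\<And>X Y f. X \<in> obj C \<Longrightarrow> Y \<in> obj C \<Longrightarrow> f \<in> arr C X Y \<Longrightarrow> far G X Y f \<in> mod_hom k (fob G X) (fob G Y)"
  shows "Module.module k (nat_mod C k F G)"
proof -
  interpret k: cring k by fact
  let ?N = "nat_mod C k F G"
  note val = nat_mod_add_val nat_mod_smult_val nat_mod_zero_val
  have cl: "\<eta> X x \<in> carrier (fob G X)"
    if "\<eta> \<in> carrier ?N" "X \<in> obj C" "x \<in> carrier (fob F X)" for \<eta> X x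
    using mod_hom_closed[OF nat_mod_hom[OF that(1,2)] that(3)] .
  have Fcl: "far F X Y f x \<in> carrier (fob F Y)"
    if "X \<in> obj C" "Y \<in> obj C" "f \<in> arr C X Y" "x \<in> carrier (fob F X)" for X Y f x
    using mod_hom_closed[OF F(2)[OF that(1-3)] that(4)] .
  have zero: "\<zero>\<^bsub>?N\<^esub> \<in> carrier ?N"
  proof -
    have "is_nat C k F G (\<lambda>X x. \<zero>\<^bsub>fob G X\<^esub>)"
      unfolding is_nat_def
    proof (intro conjI ballI)
      fix X assume X: "X \<in> obj C"
      interpret M: Module.module k "fob G X" by (rule G(1)[OF X])
      show "(\<lambda>x. \<zero>\<^bsub>fob G X\<^esub>) \<in> mod_hom k (fob F X) (fob G X)" by (rule mod_homI) auto
      fix Y f x assume "Y \<in> obj C" "f \<in> arr C X Y" "x \<in> carrier (fob F X)"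
      then show "\<zero>\<^bsub>fob G Y\<^esub> = far G X Y f \<zero>\<^bsub>fob G X\<^esub>"
        using mod_hom_zero[OF G(1)[OF X] G(1) G(2)[OF X]] by simp
    qed
    from nat_restrict_carrier[OF this F] show ?thesis by (simp add: nat_mod_def)
  qed
  have add: "\<eta> \<oplus>\<^bsub>?N\<^esub> \<theta> \<in> carrier ?N" if \<eta>: "\<eta> \<in> carrier ?N" and \<theta>: "\<theta> \<in> carrier ?N" for \<eta> \<theta>
  proof -
    have "is_nat C k F G (\<lambda>X x. \<eta> X x \<oplus>\<^bsub>fob G X\<^esub> \<theta> X x)"
      unfolding is_nat_def
    proof (intro conjI ballI)
      fix X assume X: "X \<in> obj C"
      interpret M: Module.module k "fob G X" by (rule G(1)[OF X])
      note h = nat_mod_hom[OF \<eta> X] nat_mod_hom[OF \<theta> X]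
      show "(\<lambda>x. \<eta> X x \<oplus>\<^bsub>fob G X\<^esub> \<theta> X x) \<in> mod_hom k (fob F X) (fob G X)"
        by (rule mod_homI)
          (auto simp: cl \<eta> \<theta> X mod_hom_add[OF h(1)] mod_hom_add[OF h(2)] mod_hom_smult[OF h(1)]
            mod_hom_smult[OF h(2)] M.add.m_ac M.smult_r_distr)
      fix Y f x assume a: "Y \<in> obj C" "f \<in> arr C X Y" "x \<in> carrier (fob F X)"
      show "\<eta> Y (far F X Y f x) \<oplus>\<^bsub>fob G Y\<^esub> \<theta> Y (far F X Y f x) =
          far G X Y f (\<eta> X x \<oplus>\<^bsub>fob G X\<^esub> \<theta> X x)"
        using mod_hom_add[OF G(2)[OF X a(1,2)] cl[OF \<eta> X a(3)] cl[OF \<theta> X a(3)]]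
        by (simp add: nat_mod_natural[OF \<eta> X a] nat_mod_natural[OF \<theta> X a])
    qed
    from nat_restrict_carrier[OF this F] show ?thesis by (simp add: nat_mod_def)
  qed
  have smult: "c \<odot>\<^bsub>?N\<^esub> \<eta> \<in> carrier ?N" if \<eta>: "\<eta> \<in> carrier ?N" and c: "c \<in> carrier k" for c \<eta>
  proof -
    have "is_nat C k F G (\<lambda>X x. c \<odot>\<^bsub>fob G X\<^esub> \<eta> X x)"
      unfolding is_nat_def
    proof (intro conjI ballI)
      fix X assume X: "X \<in> obj C"
      show "(\<lambda>x. c \<odot>\<^bsub>fob G X\<^esub> \<eta> X x) \<in> mod_hom k (fob F X) (fob G X)"
        by (rule smult_hom[OF F(1)[OF X] G(1)[OF X] nat_mod_hom[OF \<eta> X] c])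
      fix Y f x assume a: "Y \<in> obj C" "f \<in> arr C X Y" "x \<in> carrier (fob F X)"
      show "c \<odot>\<^bsub>fob G Y\<^esub> \<eta> Y (far F X Y f x) = far G X Y f (c \<odot>\<^bsub>fob G X\<^esub> \<eta> X x)"
        using mod_hom_smult[OF G(2)[OF X a(1,2)] c cl[OF \<eta> X a(3)]]
        by (simp add: nat_mod_natural[OF \<eta> X a])
    qed
    from nat_restrict_carrier[OF this F] show ?thesis by (simp add: nat_mod_def)
  qed
  note close = zero add smult
  note eqI = nat_mod_eqI[where C = C and k = k and F = F and G = G]
  show ?thesis
  proof (rule moduleI[OF k abelian_groupI])
    fix \<eta> \<theta> \<kappa> assume n: "\<eta> \<in> carrier ?N" "\<theta> \<in> carrier ?N" "\<kappa> \<in> carrier ?N"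
    show "\<eta> \<oplus>\<^bsub>?N\<^esub> \<theta> \<oplus>\<^bsub>?N\<^esub> \<kappa> = \<eta> \<oplus>\<^bsub>?N\<^esub> (\<theta> \<oplus>\<^bsub>?N\<^esub> \<kappa>)"
    proof (intro eqI close n)
      fix X x assume x: "X \<in> obj C" "x \<in> carrier (fob F X)"
      interpret M: Module.module k "fob G X" by (rule G(1)[OF x(1)])
      show "(\<eta> \<oplus>\<^bsub>?N\<^esub> \<theta> \<oplus>\<^bsub>?N\<^esub> \<kappa>) X x = (\<eta> \<oplus>\<^bsub>?N\<^esub> (\<theta> \<oplus>\<^bsub>?N\<^esub> \<kappa>)) X x"
        by (simp add: val[OF x] cl n x M.add.m_assoc)
    qed
  next
    fix \<eta> \<theta> assume n: "\<eta> \<in> carrier ?N" "\<theta> \<in> carrier ?N"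
    show "\<eta> \<oplus>\<^bsub>?N\<^esub> \<theta> = \<theta> \<oplus>\<^bsub>?N\<^esub> \<eta>"
    proof (intro eqI close n)
      fix X x assume x: "X \<in> obj C" "x \<in> carrier (fob F X)"
      interpret M: Module.module k "fob G X" by (rule G(1)[OF x(1)])
      show "(\<eta> \<oplus>\<^bsub>?N\<^esub> \<theta>) X x = (\<theta> \<oplus>\<^bsub>?N\<^esub> \<eta>) X x"
        by (simp add: val[OF x] cl n x M.add.m_comm)
    qed
    fix c assume c: "c \<in> carrier k"
    show "c \<odot>\<^bsub>?N\<^esub> (\<eta> \<oplus>\<^bsub>?N\<^esub> \<theta>) = c \<odot>\<^bsub>?N\<^esub> \<eta> \<oplus>\<^bsub>?N\<^esub> c \<odot>\<^bsub>?N\<^esub> \<theta>"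
    proof (intro eqI close n c)
      fix X x assume x: "X \<in> obj C" "x \<in> carrier (fob F X)"
      interpret M: Module.module k "fob G X" by (rule G(1)[OF x(1)])
      show "(c \<odot>\<^bsub>?N\<^esub> (\<eta> \<oplus>\<^bsub>?N\<^esub> \<theta>)) X x = (c \<odot>\<^bsub>?N\<^esub> \<eta> \<oplus>\<^bsub>?N\<^esub> c \<odot>\<^bsub>?N\<^esub> \<theta>) X x"
        by (simp add: val[OF x] cl n x M.smult_r_distr c)
    qed
  next
    fix \<eta> assume n: "\<eta> \<in> carrier ?N"
    show "\<zero>\<^bsub>?N\<^esub> \<oplus>\<^bsub>?N\<^esub> \<eta> = \<eta>"
    proof (intro eqI close n)
      fix X x assume x: "X \<in> obj C" "x \<in> carrier (fob F X)"
      interpret M: Module.module k "fob G X" by (rule G(1)[OF x(1)])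
      show "(\<zero>\<^bsub>?N\<^esub> \<oplus>\<^bsub>?N\<^esub> \<eta>) X x = \<eta> X x"
        by (simp add: val[OF x] cl n x)
    qed
    have "(\<ominus>\<^bsub>k\<^esub> \<one>\<^bsub>k\<^esub>) \<odot>\<^bsub>?N\<^esub> \<eta> \<oplus>\<^bsub>?N\<^esub> \<eta> = \<zero>\<^bsub>?N\<^esub>"
    proof (intro eqI close n)
      fix X x assume x: "X \<in> obj C" "x \<in> carrier (fob F X)"
      interpret M: Module.module k "fob G X" by (rule G(1)[OF x(1)])
      show "((\<ominus>\<^bsub>k\<^esub> \<one>\<^bsub>k\<^esub>) \<odot>\<^bsub>?N\<^esub> \<eta> \<oplus>\<^bsub>?N\<^esub> \<eta>) X x = \<zero>\<^bsub>?N\<^esub> X x"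
        by (simp add: val[OF x] cl n x M.smult_minus_one M.l_neg)
    qed simp
    then show "\<exists>\<theta>\<in>carrier ?N. \<theta> \<oplus>\<^bsub>?N\<^esub> \<eta> = \<zero>\<^bsub>?N\<^esub>"
      using smult[OF n, of "\<ominus>\<^bsub>k\<^esub> \<one>\<^bsub>k\<^esub>"] by (intro bexI) auto
    show "\<one>\<^bsub>k\<^esub> \<odot>\<^bsub>?N\<^esub> \<eta> = \<eta>"
    proof (intro eqI close n k.one_closed)
      fix X x assume x: "X \<in> obj C" "x \<in> carrier (fob F X)"
      interpret M: Module.module k "fob G X" by (rule G(1)[OF x(1)])
      show "(\<one>\<^bsub>k\<^esub> \<odot>\<^bsub>?N\<^esub> \<eta>) X x = \<eta> X x"
        by (simp add: val[OF x] cl n x)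
    qed
    fix c d assume c: "c \<in> carrier k" "d \<in> carrier k"
    show "(c \<oplus>\<^bsub>k\<^esub> d) \<odot>\<^bsub>?N\<^esub> \<eta> = c \<odot>\<^bsub>?N\<^esub> \<eta> \<oplus>\<^bsub>?N\<^esub> d \<odot>\<^bsub>?N\<^esub> \<eta>"
    proof (intro eqI close n k.add.m_closed c)
      fix X x assume x: "X \<in> obj C" "x \<in> carrier (fob F X)"
      interpret M: Module.module k "fob G X" by (rule G(1)[OF x(1)])
      show "((c \<oplus>\<^bsub>k\<^esub> d) \<odot>\<^bsub>?N\<^esub> \<eta>) X x = (c \<odot>\<^bsub>?N\<^esub> \<eta> \<oplus>\<^bsub>?N\<^esub> d \<odot>\<^bsub>?N\<^esub> \<eta>) X x"
        by (simp add: val[OF x] cl n x M.smult_l_distr c)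
    qed
    show "(c \<otimes>\<^bsub>k\<^esub> d) \<odot>\<^bsub>?N\<^esub> \<eta> = c \<odot>\<^bsub>?N\<^esub> (d \<odot>\<^bsub>?N\<^esub> \<eta>)"
    proof (intro eqI close n k.m_closed c)
      fix X x assume x: "X \<in> obj C" "x \<in> carrier (fob F X)"
      interpret M: Module.module k "fob G X" by (rule G(1)[OF x(1)])
      show "((c \<otimes>\<^bsub>k\<^esub> d) \<odot>\<^bsub>?N\<^esub> \<eta>) X x = (c \<odot>\<^bsub>?N\<^esub> (d \<odot>\<^bsub>?N\<^esub> \<eta>)) X x"
        by (simp add: val[OF x] cl n x M.smult_assoc1 c)
    qed
  qed (use close in auto)
qed

section \<open>Iterating the comonad on functors of pointed sets\<close>

lemma botG_simps:
  "fob (botG F) X = fob F (plus_pt X)"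
  "far (botG F) X Y f = far F (plus_pt X) (plus_pt Y) (plus_map X Y f)"
  by (simp_all add: botG_def)

lemma botG_map_val: "botG_map \<eta> X = \<eta> (plus_pt X)"
  by (simp add: botG_map_def)

lemma botG_iter_fob: "fob ((botG ^^ n) F) X = fob F ((plus_pt ^^ n) X)"
  by (induction n arbitrary: X) (simp_all add: botG_simps funpow_swap1[of plus_pt])

primrec plus_iter :: "nat \<Rightarrow> 'u::infinite pset \<Rightarrow> 'u pset \<Rightarrow> ('u \<Rightarrow> 'u) \<Rightarrow> 'u \<Rightarrow> 'u" where
  "plus_iter 0 X Y f = f"
| "plus_iter (Suc n) X Y f = plus_iter n (plus_pt X) (plus_pt Y) (plus_map X Y f)"

lemma botG_iter_far:
  "far ((botG ^^ n) F) X Y f = far F ((plus_pt ^^ n) X) ((plus_pt ^^ n) Y) (plus_iter n X Y f)"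
  by (induction n arbitrary: X Y f) (simp_all add: botG_simps funpow_swap1[of plus_pt])

lemma botG_map_iter: "(botG_map ^^ n) \<eta> X = \<eta> ((plus_pt ^^ n) X)"
  by (induction n arbitrary: X) (simp_all add: botG_map_val funpow_swap1[of plus_pt])

lemma plus_map_values:
  assumes "X \<in> obj Gamma" "Y \<in> obj Gamma"
  shows "w \<in> fst X \<Longrightarrow> plus_map X Y f w = f w" "plus_map X Y f (snd (plus_pt X)) = snd (plus_pt Y)"
  using assms snd_plus_pt[of X] by (auto simp: plus_map_def fst_plus_pt obj_Gamma)

lemma plus_iter_values:
  assumes "X \<in> obj Gamma" "Y \<in> obj Gamma"
  shows "w \<in> fst X \<Longrightarrow> plus_iter n X Y f w = f w"
    and "1 \<le> r \<Longrightarrow> r \<le> n \<Longrightarrow> plus_iter n X Y f (mark X r) = mark Y r"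
proof -
  have "(\<forall>w \<in> fst X. plus_iter n X Y f w = f w) \<and>
      (\<forall>r. 1 \<le> r \<and> r \<le> n \<longrightarrow> plus_iter n X Y f (mark X r) = mark Y r)"
    using assms
  proof (induction n arbitrary: X Y f)
    case (Suc n)
    note IH = Suc.IH[OF plus_pt_obj[OF Suc.prems(1)] plus_pt_obj[OF Suc.prems(2)], of "plus_map X Y f"]
    show ?case
    proof (intro conjI ballI allI impI)
      fix w assume "w \<in> fst X"
      then show "plus_iter (Suc n) X Y f w = f w"
        using IH by (simp add: fst_plus_pt plus_map_values[OF Suc.prems])
    next
      fix r assume r: "1 \<le> r \<and> r \<le> Suc n"
      show "plus_iter (Suc n) X Y f (mark X r) = mark Y r"
      proof (cases "r = 1")
        case True
        have "plus_iter n (plus_pt X) (plus_pt Y) (plus_map X Y f) (snd (plus_pt X)) =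
            plus_map X Y f (snd (plus_pt X))"
          using IH by (simp add: fst_plus_pt)
        then show ?thesis using True by (simp add: mark_def plus_map_values[OF Suc.prems])
      next
        case False
        then obtain q where "r = Suc q" "1 \<le> q" "q \<le> n" using r by (cases r) auto
        then show ?thesis using IH by (simp flip: mark_plus_pt)
      qed
    qed
  qed simp
  then show "w \<in> fst X \<Longrightarrow> plus_iter n X Y f w = f w"
    "1 \<le> r \<Longrightarrow> r \<le> n \<Longrightarrow> plus_iter n X Y f (mark X r) = mark Y r" by auto
qed

lemma iter_plus_cases:
  assumes "w \<in> fst ((plus_pt ^^ n) X)"
  obtains "w \<in> fst X" | r where "1 \<le> r" "r \<le> n" "w = mark X r"
  using assms by (auto simp: fst_iter_plus)

lemma plus_iter_funcset:
  assumes "X \<in> obj Gamma" "Y \<in> obj Gamma" "f \<in> fst X \<rightarrow> fst Y"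
  shows "plus_iter n X Y f \<in> fst ((plus_pt ^^ n) X) \<rightarrow> fst ((plus_pt ^^ n) Y)"
proof
  fix w assume "w \<in> fst ((plus_pt ^^ n) X)"
  then show "plus_iter n X Y f w \<in> fst ((plus_pt ^^ n) Y)"
  proof (cases rule: iter_plus_cases)
    case 1
    then show ?thesis using assms fst_subset_iter_plus[of Y n] by (auto simp: plus_iter_values)
  next
    case (2 r)
    then show ?thesis by (simp add: plus_iter_values[OF assms(1,2)] mark_in_iff[OF assms(2)])
  qed
qed

text \<open>Every structure map to be considered fixes the original set and renumbers the added points.\<close>

definition renum :: "'u::infinite pset \<Rightarrow> (nat \<Rightarrow> nat) \<Rightarrow> 'u \<Rightarrow> 'u" where
  "renum X \<phi> w = (if w \<in> fst X then w else mark X (\<phi> (THE r. w = mark X r)))"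

lemma renum_base: "w \<in> fst X \<Longrightarrow> renum X \<phi> w = w"
  by (simp add: renum_def)

lemma renum_mark: "X \<in> obj Gamma \<Longrightarrow> 0 < r \<Longrightarrow> renum X \<phi> (mark X r) = mark X (\<phi> r)"
  by (simp add: renum_def mark_notin_base mark_inj)

lemma renum_mark': "X \<in> obj Gamma \<Longrightarrow> \<phi> 0 = 0 \<Longrightarrow> renum X \<phi> (mark X r) = mark X (\<phi> r)"
  by (cases "r = 0") (simp_all add: renum_mark mark_0 renum_base obj_Gamma)

lemma renum_funcset:
  assumes X: "X \<in> obj Gamma" and \<phi>: "\<And>r. 1 \<le> r \<Longrightarrow> r \<le> n \<Longrightarrow> \<phi> r \<le> m"
  shows "renum X \<phi> \<in> fst ((plus_pt ^^ n) X) \<rightarrow> fst ((plus_pt ^^ m) X)"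
proof
  fix w assume "w \<in> fst ((plus_pt ^^ n) X)"
  then show "renum X \<phi> w \<in> fst ((plus_pt ^^ m) X)"
  proof (cases rule: iter_plus_cases)
    case 1
    then show ?thesis using fst_subset_iter_plus[of X m] by (auto simp: renum_base)
  next
    case (2 r)
    then show ?thesis using \<phi> by (simp add: renum_mark[OF X] mark_in_iff[OF X])
  qed
qed

text \<open>Renumberings of the added points by the cofaces and codegeneracies: \<open>face i\<close> leaves out the value \<open>i\<close>, and \<open>degen j\<close>
  takes the value \<open>j\<close> twice. The number 0 belongs to the original base point.\<close>

definition face :: "nat \<Rightarrow> nat \<Rightarrow> nat" where
  "face i r = (if r < i then r else Suc r)"

definition degen :: "nat \<Rightarrow> nat \<Rightarrow> nat" where
  "degen j r = (if r \<le> j then r else r - 1)"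

lemma renum_natural:
  assumes X: "X \<in> obj Gamma" and Y: "Y \<in> obj Gamma" and f: "f \<in> arr Gamma X Y"
    and \<phi>: "\<And>r. 1 \<le> r \<Longrightarrow> r \<le> n \<Longrightarrow> \<phi> r \<le> m"
    and w: "w \<in> fst ((plus_pt ^^ n) X)"
  shows "plus_iter m X Y f (renum X \<phi> w) = renum Y \<phi> (plus_iter n X Y f w)"
  using w
proof (cases rule: iter_plus_cases)
  case 1
  moreover have "f w \<in> fst Y" using f 1 by (auto simp: arr_Gamma)
  ultimately show ?thesis by (simp add: renum_base plus_iter_values[OF X Y])
next
  case (2 r)
  show ?thesis
  proof (cases "\<phi> r = 0")
    case True
    have "plus_iter m X Y f (snd X) = f (snd X)" using X by (simp add: obj_Gamma plus_iter_values[OF X Y])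
    then show ?thesis using 2 True f
      by (simp add: renum_mark[OF X] renum_mark[OF Y] plus_iter_values[OF X Y] mark_0 arr_Gamma)
  next
    case False
    then show ?thesis using 2 \<phi>[of r]
      by (simp add: renum_mark[OF X] renum_mark[OF Y] plus_iter_values[OF X Y])
  qed
qed

lemma renum_plus_pt:
  assumes X: "X \<in> obj Gamma" and w: "w \<in> fst ((plus_pt ^^ Suc n) X)"
    and \<phi>: "\<phi> 1 = 1" "\<And>r. 1 \<le> r \<Longrightarrow> r \<le> n \<Longrightarrow> \<phi> (Suc r) = Suc (\<psi> r)"
  shows "renum (plus_pt X) \<psi> w = renum X \<phi> w"
  using w
proof (cases rule: iter_plus_cases)
  case 1
  then show ?thesis by (simp add: renum_base fst_plus_pt)
next
  case (2 r)
  show ?thesis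
  proof (cases "r = 1")
    case True
    then have "w \<in> fst (plus_pt X)" using 2 by (simp add: mark_def fst_plus_pt)
    then show ?thesis using 2 True \<phi>(1) by (simp add: renum_base renum_mark[OF X])
  next
    case False
    then obtain q where q: "r = Suc q" "1 \<le> q" "q \<le> n" using 2 by (cases r) auto
    then have "renum (plus_pt X) \<psi> (mark (plus_pt X) q) = mark (plus_pt X) (\<psi> q)"
      by (intro renum_mark plus_pt_obj X) auto
    then show ?thesis using 2 q \<phi>(2)[of q] by (simp add: mark_plus_pt renum_mark[OF X])
  qed
qed

lemma shift_pt_values:
  assumes "X \<in> obj Gamma"
  shows "w \<in> fst X \<Longrightarrow> shift_pt X w = w" "shift_pt X (mark X 1) = mark X 2"
  using assms snd_plus_pt[of X] by (auto simp: shift_pt_def fst_plus_pt obj_Gamma mark_def numeral_2_eq_2)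

lemma fold_pt_values:
  assumes "X \<in> obj Gamma"
  shows "w \<in> fst X \<Longrightarrow> fold_pt X w = w" "fold_pt X (mark X 1) = mark X 0"
  using assms snd_plus_pt[of X] by (auto simp: fold_pt_def fst_plus_pt obj_Gamma mark_def)

lemma shift_pt_arr: "X \<in> obj Gamma \<Longrightarrow> shift_pt X \<in> arr Gamma (plus_pt X) (plus_pt (plus_pt X))"
  using snd_plus_pt[of X] by (auto simp: arr_Gamma shift_pt_def fst_plus_pt PiE_iff)

lemma fold_pt_arr: "X \<in> obj Gamma \<Longrightarrow> fold_pt X \<in> arr Gamma (plus_pt X) X"
  using snd_plus_pt[of X] by (auto simp: arr_Gamma fold_pt_def fst_plus_pt PiE_iff obj_Gamma)

text \<open>In the \<open>i\<close>-th coface the comultiplication acts at the stage where \<open>i - 1\<close> points have been added, and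
  the \<open>t - i\<close> points added afterwards are carried along.\<close>

lemma shift_iter:
  assumes X: "X \<in> obj Gamma" and i: "1 \<le> i" "i \<le> t" and w: "w \<in> fst ((plus_pt ^^ t) X)"
  defines "Z \<equiv> (plus_pt ^^ (i - 1)) X"
  shows "plus_iter (t - i) (plus_pt Z) (plus_pt (plus_pt Z)) (shift_pt Z) w = renum X (face i) w"
proof -
  have Z: "Z \<in> obj Gamma" unfolding Z_def by (rule iter_plus_obj[OF X])
  have ZZ: "plus_pt Z \<in> obj Gamma" "plus_pt (plus_pt Z) \<in> obj Gamma"
    by (intro plus_pt_obj Z)+
  note pv = plus_iter_values[OF ZZ] and sv = shift_pt_values[OF Z]
  have mZ: "mark Z r = mark X (i - 1 + r)" for r unfolding Z_def by (rule mark_shift)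
  from w show ?thesis
  proof (cases rule: iter_plus_cases)
    case 1
    then have "w \<in> fst Z" using fst_subset_iter_plus[of X] by (auto simp: Z_def)
    then show ?thesis using 1 by (simp add: pv sv fst_plus_pt renum_base)
  next
    case (2 r)
    consider "r < i" | "r = i" | "i < r" by linarith
    then show ?thesis
    proof cases
      case 1
      then have "w \<in> fst Z" using 2 i by (simp add: Z_def mark_in_iff[OF X])
      then show ?thesis using 1 2 by (simp add: pv sv fst_plus_pt renum_mark[OF X] face_def)
    next
      case r: 2
      then have w': "w = mark Z 1" using 2 i by (simp add: mZ)
      then have "w \<in> fst (plus_pt Z)" by (simp add: mark_def fst_plus_pt)
      then have "plus_iter (t - i) (plus_pt Z) (plus_pt (plus_pt Z)) (shift_pt Z) w = mark Z 2"
        using w' by (simp only: pv sv)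
      then show ?thesis using 2 r i by (simp add: mZ renum_mark[OF X] face_def)
    next
      case 3
      then have w': "w = mark (plus_pt Z) (r - i)" using 2 i by (simp add: mark_plus_pt mZ)
      have "plus_iter (t - i) (plus_pt Z) (plus_pt (plus_pt Z)) (shift_pt Z) w =
          mark (plus_pt (plus_pt Z)) (r - i)"
        unfolding w' by (rule pv) (use 2 3 in auto)
      also have "\<dots> = mark X (Suc r)" using 3 i by (simp add: mark_plus_pt mZ)
      finally show ?thesis using 2 3 by (simp add: renum_mark[OF X] face_def)
    qed
  qed
qed

lemma fold_iter:
  assumes X: "X \<in> obj Gamma" and j: "j \<le> t" and w: "w \<in> fst ((plus_pt ^^ Suc t) X)"
  defines "Z \<equiv> (plus_pt ^^ j) X"
  shows "plus_iter (t - j) (plus_pt Z) Z (fold_pt Z) w = renum X (degen j) w"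
proof -
  have Z: "Z \<in> obj Gamma" unfolding Z_def by (rule iter_plus_obj[OF X])
  have ZZ: "plus_pt Z \<in> obj Gamma"
    by (intro plus_pt_obj Z)
  note pv = plus_iter_values[OF ZZ Z] and fv = fold_pt_values[OF Z]
  have mZ: "mark Z r = mark X (j + r)" for r unfolding Z_def by (rule mark_shift)
  from w show ?thesis
  proof (cases rule: iter_plus_cases)
    case 1
    then have "w \<in> fst Z" using fst_subset_iter_plus[of X] by (auto simp: Z_def)
    then show ?thesis using 1 by (simp add: pv fv fst_plus_pt renum_base)
  next
    case (2 r)
    consider "r \<le> j" | "r = Suc j" | "Suc j < r" by linarith
    then show ?thesis
    proof cases
      case 1
      then have "w \<in> fst Z" using 2 by (simp add: Z_def mark_in_iff[OF X])
      then show ?thesis using 1 2 by (simp add: pv fv fst_plus_pt renum_mark[OF X] degen_def)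
    next
      case r: 2
      then have w': "w = mark Z 1" using 2 by (simp add: mZ)
      then have "w \<in> fst (plus_pt Z)" by (simp add: mark_def fst_plus_pt)
      then have "plus_iter (t - j) (plus_pt Z) Z (fold_pt Z) w = mark Z 0"
        using w' by (simp only: pv fv)
      then show ?thesis using 2 r by (simp add: mZ renum_mark[OF X] degen_def)
    next
      case 3
      then have w': "w = mark (plus_pt Z) (r - Suc j)" using 2 by (simp add: mark_plus_pt mZ)
      have "plus_iter (t - j) (plus_pt Z) Z (fold_pt Z) w = mark Z (r - Suc j)"
        unfolding w' by (rule pv) (use 2 3 in auto)
      also have "\<dots> = mark X (r - 1)" using 3 by (simp add: mZ)
      finally show ?thesis using 2 3 by (simp add: renum_mark[OF X] degen_def)
    qed
  qed
qed

section \<open>The cosimplicial module of natural transformations\<close>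

lemma is_nat_comp:
  assumes "is_nat C k F G \<eta>" "is_nat C k G H \<theta>"
  shows "is_nat C k F H (\<theta> \<bullet> \<eta>)"
  unfolding is_nat_def nat_comp_def
proof (intro conjI ballI)
  fix X assume X: "X \<in> obj C"
  have h: "\<eta> X \<in> mod_hom k (fob F X) (fob G X)" "\<theta> X \<in> mod_hom k (fob G X) (fob H X)"
    using assms X by (auto simp: is_nat_def)
  from mod_hom_comp[OF this] show "(\<lambda>x. \<theta> X (\<eta> X x)) \<in> mod_hom k (fob F X) (fob H X)" .
  fix Y f x assume a: "Y \<in> obj C" "f \<in> arr C X Y" "x \<in> carrier (fob F X)"
  show "\<theta> Y (\<eta> Y (far F X Y f x)) = far H X Y f (\<theta> X (\<eta> X x))"
    using assms X a mod_hom_closed[OF h(1) a(3)] by (simp add: is_nat_def)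
qed

lemma postcompose_hom:
  assumes F: "\<And>X. X \<in> obj C \<Longrightarrow> Module.module k (fob F X)"
      "\<And>X Y f. X \<in> obj C \<Longrightarrow> Y \<in> obj C \<Longrightarrow> f \<in> arr C X Y \<Longrightarrow> far F X Y f \<in> mod_hom k (fob F X) (fob F Y)"
    and \<theta>: "is_nat C k G H \<theta>"
  shows "(\<lambda>\<gamma>. nat_restrict C F (\<theta> \<bullet> \<gamma>)) \<in> mod_hom k (nat_mod C k F G) (nat_mod C k F H)"
proof (rule mod_homI)
  have \<theta>h: "\<theta> X \<in> mod_hom k (fob G X) (fob H X)" if "X \<in> obj C" for X
    using \<theta> that by (simp add: is_nat_def)
  fix \<gamma> assume \<gamma>: "\<gamma> \<in> carrier (nat_mod C k F G)"
  show "nat_restrict C F (\<theta> \<bullet> \<gamma>) \<in> carrier (nat_mod C k F H)"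
    by (rule nat_restrict_carrier[OF is_nat_comp[OF nat_mod_is_nat[OF \<gamma>] \<theta>] F])
  note cl = mod_hom_closed[OF nat_mod_hom]
  {
    fix \<gamma>' assume \<gamma>': "\<gamma>' \<in> carrier (nat_mod C k F G)"
    have "nat_restrict C F (\<theta> \<bullet> (\<gamma> \<oplus>\<^bsub>nat_mod C k F G\<^esub> \<gamma>')) =
        nat_restrict C F (\<lambda>X x. nat_restrict C F (\<theta> \<bullet> \<gamma>) X x \<oplus>\<^bsub>fob H X\<^esub> nat_restrict C F (\<theta> \<bullet> \<gamma>') X x)"
      by (rule nat_restrict_eqI)
        (simp add: nat_comp_def nat_mod_add_val nat_restrict_val
          mod_hom_add[OF \<theta>h cl[OF \<gamma>] cl[OF \<gamma>']])
    then show "nat_restrict C F (\<theta> \<bullet> (\<gamma> \<oplus>\<^bsub>nat_mod C k F G\<^esub> \<gamma>')) =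
        nat_restrict C F (\<theta> \<bullet> \<gamma>) \<oplus>\<^bsub>nat_mod C k F H\<^esub> nat_restrict C F (\<theta> \<bullet> \<gamma>')"
      by (simp add: nat_mod_def)
  }
  fix c assume c: "c \<in> carrier k"
  have "nat_restrict C F (\<theta> \<bullet> (c \<odot>\<^bsub>nat_mod C k F G\<^esub> \<gamma>)) =
      nat_restrict C F (\<lambda>X x. c \<odot>\<^bsub>fob H X\<^esub> nat_restrict C F (\<theta> \<bullet> \<gamma>) X x)"
    by (rule nat_restrict_eqI)
      (simp add: nat_comp_def nat_mod_smult_val nat_restrict_val mod_hom_smult[OF \<theta>h c cl[OF \<gamma>]])
  then show "nat_restrict C F (\<theta> \<bullet> (c \<odot>\<^bsub>nat_mod C k F G\<^esub> \<gamma>)) =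
      c \<odot>\<^bsub>nat_mod C k F H\<^esub> nat_restrict C F (\<theta> \<bullet> \<gamma>)"
    by (simp add: nat_mod_def)
qed

lemma iter_plus_plus: "(plus_pt ^^ n) (plus_pt X) = (plus_pt ^^ Suc n) X"
  by (simp add: funpow_swap1)

lemma finite_iter_plus: "X \<in> obj Gamma \<Longrightarrow> finite (fst ((plus_pt ^^ n) X))"
  using iter_plus_obj[of X n] by (simp add: obj_Gamma)

lemma plus_map_arr: "X \<in> obj Gamma \<Longrightarrow> Y \<in> obj Gamma \<Longrightarrow> f \<in> arr Gamma X Y \<Longrightarrow>
    plus_map X Y f \<in> arr Gamma (plus_pt X) (plus_pt Y)"
  using snd_plus_pt[of X] by (auto simp: arr_Gamma plus_map_def fst_plus_pt PiE_iff obj_Gamma)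

lemma obj_Sigma: "b \<in> obj (op_cat Sigma_cat) \<longleftrightarrow> finite b"
  by (simp add: op_cat_def Sigma_cat_def)

lemma arr_Sigma: "f \<in> arr (op_cat Sigma_cat) b l \<longleftrightarrow> f \<in> l \<rightarrow>\<^sub>E b \<and> bij_betw f l b"
  by (simp add: op_cat_def Sigma_cat_def)

lemma idn_Sigma: "idn (op_cat Sigma_cat) b = (\<lambda>j\<in>b. j)"
  by (simp add: op_cat_def Sigma_cat_def)

lemma cmp_Sigma: "cmp (op_cat Sigma_cat) b l m g f = compose m f g"
  by (simp add: op_cat_def Sigma_cat_def)

context cring
begin

abbreviation tfun :: "'i set \<Rightarrow> ('u::infinite pset, 'u \<Rightarrow> 'u, 'a, (('i \<Rightarrow> 'u \<Rightarrow> 'a) \<Rightarrow> 'a) set) functr" where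
  "tfun b \<equiv> tensor_functor R (tstar R) b"

abbreviation homs where
  "homs A n b \<equiv> nat_mod Gamma R (tfun A) ((botG ^^ n) (tfun b))"

lemma tfun_fob: "fob (tfun b) X = tens b X"
  by (simp add: tensor_functor_def)

lemma tfun_far: "far (tfun b) X Y f = push b Y f"
  by (simp add: tensor_functor_def push_def tstar_def)

lemma tfun_iter_fob: "fob ((botG ^^ n) (tfun b)) X = tens b ((plus_pt ^^ n) X)"
  by (simp add: botG_iter_fob tfun_fob)

lemma tfun_iter_far:
  "far ((botG ^^ n) (tfun b)) X Y f = push b ((plus_pt ^^ n) Y) (plus_iter n X Y f)"
  by (simp add: botG_iter_far tfun_far)

lemma module_tens: "X \<in> obj Gamma \<Longrightarrow> Module.module R (tens b ((plus_pt ^^ n) X))"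
  by (intro module_tensor_pow module_reduced finite_iter_plus)

lemma module_tens_0: "X \<in> obj Gamma \<Longrightarrow> Module.module R (tens b X)"
  using module_tens[of X b 0] by simp

lemma push_iter_hom:
  assumes "X \<in> obj Gamma" "Y \<in> obj Gamma" "f \<in> arr Gamma X Y"
  shows "push b ((plus_pt ^^ n) Y) (plus_iter n X Y f) \<in>
    mod_hom R (tens b ((plus_pt ^^ n) X)) (tens b ((plus_pt ^^ n) Y))"
  using assms by (intro push_hom finite_iter_plus plus_iter_funcset) (auto simp: arr_Gamma)

lemma push_arr_hom:
  assumes "X \<in> obj Gamma" "Y \<in> obj Gamma" "f \<in> arr Gamma X Y"
  shows "push b Y f \<in> mod_hom R (tens b X) (tens b Y)"
  using push_iter_hom[OF assms, of b 0] by simp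

lemma tfun_conditions:
  "X \<in> obj Gamma \<Longrightarrow> Module.module R (fob (tfun b) X)"
  "X \<in> obj Gamma \<Longrightarrow> Y \<in> obj Gamma \<Longrightarrow> f \<in> arr Gamma X Y \<Longrightarrow>
    far (tfun b) X Y f \<in> mod_hom R (fob (tfun b) X) (fob (tfun b) Y)"
  by (auto simp: tfun_fob tfun_far intro: module_tens_0 push_arr_hom)

lemma tfun_iter_conditions:
  "X \<in> obj Gamma \<Longrightarrow> Module.module R (fob ((botG ^^ n) (tfun b)) X)"
  "X \<in> obj Gamma \<Longrightarrow> Y \<in> obj Gamma \<Longrightarrow> f \<in> arr Gamma X Y \<Longrightarrow>
    far ((botG ^^ n) (tfun b)) X Y f \<in>
      mod_hom R (fob ((botG ^^ n) (tfun b)) X) (fob ((botG ^^ n) (tfun b)) Y)"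
  by (auto simp: tfun_iter_fob tfun_iter_far intro: module_tens push_iter_hom)

lemma module_homs: "Module.module R (homs A n b)"
  by (rule module_nat_mod[OF is_cring tfun_conditions tfun_iter_conditions])

lemma homs_hom:
  "\<gamma> \<in> carrier (homs A n b) \<Longrightarrow> X \<in> obj Gamma \<Longrightarrow> \<gamma> X \<in> mod_hom R (tens A X) (tens b ((plus_pt ^^ n) X))"
  using nat_mod_hom[of \<gamma> Gamma R "tfun A" "(botG ^^ n) (tfun b)" X] by (simp add: tfun_fob tfun_iter_fob)

lemma homs_closed:
  "\<gamma> \<in> carrier (homs A n b) \<Longrightarrow> X \<in> obj Gamma \<Longrightarrow> x \<in> carrier (tens A X) \<Longrightarrow>
    \<gamma> X x \<in> carrier (tens b ((plus_pt ^^ n) X))"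
  by (rule mod_hom_closed[OF homs_hom])

lemma homs_natural:
  "\<gamma> \<in> carrier (homs A n b) \<Longrightarrow> X \<in> obj Gamma \<Longrightarrow> Y \<in> obj Gamma \<Longrightarrow> f \<in> arr Gamma X Y \<Longrightarrow>
    x \<in> carrier (tens A X) \<Longrightarrow>
    \<gamma> Y (push A Y f x) = push b ((plus_pt ^^ n) Y) (plus_iter n X Y f) (\<gamma> X x)"
  using nat_mod_natural[of \<gamma> Gamma R "tfun A" "(botG ^^ n) (tfun b)" X Y f x]
  by (simp add: tfun_fob tfun_far tfun_iter_far)

lemma homs_eqI:
  assumes "\<gamma> \<in> carrier (homs A n b)" "\<gamma>' \<in> carrier (homs A n b)"
    and "\<And>X x. X \<in> obj Gamma \<Longrightarrow> x \<in> carrier (tens A X) \<Longrightarrow> \<gamma> X x = \<gamma>' X x"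
  shows "\<gamma> = \<gamma>'"
  by (rule nat_mod_eqI[OF assms(1,2)]) (simp add: assms(3) tfun_fob)

lemma restrict_val:
  "X \<in> obj Gamma \<Longrightarrow> x \<in> carrier (tens A X) \<Longrightarrow> nat_restrict Gamma (tfun A) \<eta> X x = \<eta> X x"
  by (simp add: nat_restrict_val tfun_fob)

lemma push_renum_comp:
  assumes X: "X \<in> obj Gamma" and t: "t \<in> carrier (tens b ((plus_pt ^^ n) X))"
    and "\<And>r. 1 \<le> r \<Longrightarrow> r \<le> n \<Longrightarrow> \<phi> r \<le> m" "\<And>r. 1 \<le> r \<Longrightarrow> r \<le> m \<Longrightarrow> \<psi> r \<le> p" "\<psi> 0 = 0"
    and "\<And>r. 1 \<le> r \<Longrightarrow> r \<le> n \<Longrightarrow> \<chi> r = \<psi> (\<phi> r)"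
  shows "push b ((plus_pt ^^ p) X) (renum X \<psi>) (push b ((plus_pt ^^ m) X) (renum X \<phi>) t) =
    push b ((plus_pt ^^ p) X) (renum X \<chi>) t"
proof -
  note f = finite_iter_plus[OF X]
  have fs: "renum X \<phi> \<in> fst ((plus_pt ^^ n) X) \<rightarrow> fst ((plus_pt ^^ m) X)"
    "renum X \<psi> \<in> fst ((plus_pt ^^ m) X) \<rightarrow> fst ((plus_pt ^^ p) X)"
    by (rule renum_funcset[OF X]; fact)+
  have "push b ((plus_pt ^^ p) X) (renum X \<psi>) (push b ((plus_pt ^^ m) X) (renum X \<phi>) t) =
      push b ((plus_pt ^^ p) X) (\<lambda>w. renum X \<psi> (renum X \<phi> w)) t"
    by (rule push_comp[OF f f f fs t])
  also have "\<dots> = push b ((plus_pt ^^ p) X) (renum X \<chi>) t"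
  proof (rule push_cong[OF f f _ _ t])
    have "\<chi> r \<le> p" if "1 \<le> r" "r \<le> n" for r
      using assms(3-6) that by (cases "\<phi> r = 0") auto
    then show "renum X \<chi> \<in> fst ((plus_pt ^^ n) X) \<rightarrow> fst ((plus_pt ^^ p) X)"
      by (rule renum_funcset[OF X])
    fix w assume "w \<in> fst ((plus_pt ^^ n) X)"
    then show "renum X \<psi> (renum X \<phi> w) = renum X \<chi> w"
    proof (cases rule: iter_plus_cases)
      case 1
      then show ?thesis by (simp add: renum_base)
    next
      case (2 r)
      then show ?thesis using assms(5,6) by (simp add: renum_mark[OF X] renum_mark'[OF X])
    qed
  qed
  finally show ?thesis .
qed

lemma push_renum_cong:
  assumes X: "X \<in> obj Gamma" and t: "t \<in> carrier (tens b ((plus_pt ^^ n) X))"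
    and "\<And>r. 1 \<le> r \<Longrightarrow> r \<le> n \<Longrightarrow> \<phi> r \<le> m"
    and "\<And>w. w \<in> fst ((plus_pt ^^ n) X) \<Longrightarrow> f w = renum X \<phi> w"
  shows "push b ((plus_pt ^^ m) X) f t = push b ((plus_pt ^^ m) X) (renum X \<phi>) t"
  by (rule push_cong[OF finite_iter_plus[OF X] finite_iter_plus[OF X] renum_funcset[OF X] assms(4) t])
    (use assms(3) in auto)

lemma push_renum_id:
  assumes X: "X \<in> obj Gamma" and t: "t \<in> carrier (tens b ((plus_pt ^^ n) X))"
    and "\<And>r. 1 \<le> r \<Longrightarrow> r \<le> n \<Longrightarrow> \<phi> r = r"
  shows "push b ((plus_pt ^^ n) X) (renum X \<phi>) t = t"
proof (rule push_id[OF finite_iter_plus[OF X] _ t])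
  fix w assume "w \<in> fst ((plus_pt ^^ n) X)"
  then show "renum X \<phi> w = w"
    by (cases rule: iter_plus_cases) (simp_all add: renum_base renum_mark[OF X] assms(3))
qed

lemma is_nat_renum:
  assumes \<phi>: "\<And>r. 1 \<le> r \<Longrightarrow> r \<le> n \<Longrightarrow> \<phi> r \<le> m"
  shows "is_nat Gamma R ((botG ^^ n) (tfun b)) ((botG ^^ m) (tfun b))
    (\<lambda>X :: 'u::infinite pset. push b ((plus_pt ^^ m) X) (renum X \<phi>))"
  unfolding is_nat_def tfun_iter_fob tfun_iter_far
proof (intro conjI ballI)
  fix X :: "'u pset" assume X: "X \<in> obj Gamma"
  note f = finite_iter_plus[OF X]
  have rX: "renum X \<phi> \<in> fst ((plus_pt ^^ n) X) \<rightarrow> fst ((plus_pt ^^ m) X)"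
    by (rule renum_funcset[OF X]) (rule \<phi>)
  show "push b ((plus_pt ^^ m) X) (renum X \<phi>) \<in>
      mod_hom R (tens b ((plus_pt ^^ n) X)) (tens b ((plus_pt ^^ m) X))"
    by (intro push_hom f rX)
  fix Y g t assume Y: "Y \<in> obj Gamma" and g: "g \<in> arr Gamma X Y"
    and t: "t \<in> carrier (tens b ((plus_pt ^^ n) X))"
  note fY = finite_iter_plus[OF Y]
  have rY: "renum Y \<phi> \<in> fst ((plus_pt ^^ n) Y) \<rightarrow> fst ((plus_pt ^^ m) Y)"
    by (rule renum_funcset[OF Y]) (rule \<phi>)
  have g': "g \<in> fst X \<rightarrow> fst Y" using g by (auto simp: arr_Gamma)
  note p = plus_iter_funcset[OF X Y g']
  have "push b ((plus_pt ^^ m) Y) (renum Y \<phi>) (push b ((plus_pt ^^ n) Y) (plus_iter n X Y g) t) =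
      push b ((plus_pt ^^ m) Y) (\<lambda>w. renum Y \<phi> (plus_iter n X Y g w)) t"
    by (rule push_comp[OF f fY fY p rY t])
  also have "\<dots> = push b ((plus_pt ^^ m) Y) (\<lambda>w. plus_iter m X Y g (renum X \<phi> w)) t"
  proof (rule push_cong[OF f fY _ _ t])
    show "(\<lambda>w. plus_iter m X Y g (renum X \<phi> w)) \<in> fst ((plus_pt ^^ n) X) \<rightarrow> fst ((plus_pt ^^ m) Y)"
      using Pi_mem[OF rX] Pi_mem[OF plus_iter_funcset[OF X Y g', of m]] by blast
    show "renum Y \<phi> (plus_iter n X Y g w) = plus_iter m X Y g (renum X \<phi> w)"
      if "w \<in> fst ((plus_pt ^^ n) X)" for w
      by (rule renum_natural[OF X Y g \<phi> that, symmetric])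
  qed
  also have "\<dots> = push b ((plus_pt ^^ m) Y) (plus_iter m X Y g) (push b ((plus_pt ^^ m) X) (renum X \<phi>) t)"
    by (rule push_comp[OF f f fY rX p t, symmetric])
  finally show "push b ((plus_pt ^^ m) Y) (renum Y \<phi>) (push b ((plus_pt ^^ n) Y) (plus_iter n X Y g) t) =
      push b ((plus_pt ^^ m) Y) (plus_iter m X Y g) (push b ((plus_pt ^^ m) X) (renum X \<phi>) t)" .
qed

subsection \<open>Place permutations\<close>

lemma perm_push:
  fixes X Y :: "'u::infinite pset"
  assumes "finite (fst X)" "finite (fst Y)" "g \<in> fst X \<rightarrow> fst Y" "bij_betw f l b"
    and t: "t \<in> carrier (tens b X)"
  shows "tensor_perm R l (reduced Y) f (push b Y g t) = push l Y g (tensor_perm R l (reduced X) f t)"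
proof (rule tensor_hom_eq[OF module_reduced module_tensor_pow[OF module_reduced] _ _ _ t])
  note p = tensor_perm_hom[OF module_reduced assms(4)]
  show "(\<lambda>t. tensor_perm R l (reduced Y) f (push b Y g t)) \<in> mod_hom R (tens b X) (tens l Y)"
    by (rule mod_hom_comp[OF push_hom p]) fact+
  show "(\<lambda>t. push l Y g (tensor_perm R l (reduced X) f t)) \<in> mod_hom R (tens b X) (tens l Y)"
    by (rule mod_hom_comp[OF p push_hom]) fact+
  fix x assume x: "x \<in> b \<rightarrow>\<^sub>E carrier (reduced X)"
  have x1: "(\<lambda>i\<in>b. free_map R (fst Y) g (x i)) \<in> b \<rightarrow>\<^sub>E carrier (reduced Y)"
    using x mod_hom_closed[OF free_map_reduced_hom[OF assms(1-3)]] by (auto simp: restrict_PiE_iff)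
  have x2: "(\<lambda>j\<in>l. x (f j)) \<in> l \<rightarrow>\<^sub>E carrier (reduced X)"
    using x assms(4) by (auto simp: bij_betw_def)
  have "(\<lambda>j\<in>l. (\<lambda>i\<in>b. free_map R (fst Y) g (x i)) (f j)) =
      (\<lambda>j\<in>l. free_map R (fst Y) g ((\<lambda>j\<in>l. x (f j)) j))"
    using assms(4) by (intro restrict_ext) (auto simp: bij_betw_def)
  then show "tensor_perm R l (reduced Y) f (push b Y g (pure_tensor b (reduced X) x)) =
      push l Y g (tensor_perm R l (reduced X) f (pure_tensor b (reduced X) x))"
    unfolding push_pure[OF assms(1-3) x] push_pure[OF assms(1-3) x2]
      tensor_perm_pure[OF module_reduced[OF assms(2)] assms(4) x1]
      tensor_perm_pure[OF module_reduced[OF assms(1)] assms(4) x]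
    by (rule arg_cong)
qed fact+

lemma perm_id:
  fixes X :: "'u::infinite pset"
  assumes "finite (fst X)" and t: "t \<in> carrier (tens b X)"
  shows "tensor_perm R b (reduced X) (\<lambda>j\<in>b. j) t = t"
proof (rule tensor_hom_eq[OF module_reduced module_tensor_pow[OF module_reduced] _ _ _ t])
  have bij: "bij_betw (\<lambda>j\<in>b. j) b b" by (auto simp: bij_betw_def inj_on_def)
  show "tensor_perm R b (reduced X) (\<lambda>j\<in>b. j) \<in> mod_hom R (tens b X) (tens b X)"
    by (rule tensor_perm_hom[OF module_reduced bij]) fact
  show "(\<lambda>t. t) \<in> mod_hom R (tens b X) (tens b X)" by (rule mod_homI) auto
  fix x assume x: "x \<in> b \<rightarrow>\<^sub>E carrier (reduced X)"
  have "(\<lambda>j\<in>b. x ((\<lambda>j\<in>b. j) j)) = x" using x by (auto simp: PiE_iff extensional_def)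
  then show "tensor_perm R b (reduced X) (\<lambda>j\<in>b. j) (pure_tensor b (reduced X) x) = pure_tensor b (reduced X) x"
    by (simp add: tensor_perm_pure[OF module_reduced bij] assms(1) x)
qed fact+

lemma perm_comp:
  fixes X :: "'u::infinite pset"
  assumes "finite (fst X)" "bij_betw f l b" "bij_betw g m l" and t: "t \<in> carrier (tens b X)"
  shows "tensor_perm R m (reduced X) (compose m f g) t =
    tensor_perm R m (reduced X) g (tensor_perm R l (reduced X) f t)"
proof (rule tensor_hom_eq[OF module_reduced module_tensor_pow[OF module_reduced] _ _ _ t])
  have bij: "bij_betw (compose m f g) m b" by (rule bij_betw_compose[OF assms(3,2)])
  note p = tensor_perm_hom[OF module_reduced]
  show "tensor_perm R m (reduced X) (compose m f g) \<in> mod_hom R (tens b X) (tens m X)"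
    by (rule p[OF _ bij]) fact
  show "(\<lambda>t. tensor_perm R m (reduced X) g (tensor_perm R l (reduced X) f t)) \<in> mod_hom R (tens b X) (tens m X)"
    by (rule mod_hom_comp[OF p p]) fact+
  fix x assume x: "x \<in> b \<rightarrow>\<^sub>E carrier (reduced X)"
  have x1: "(\<lambda>j\<in>l. x (f j)) \<in> l \<rightarrow>\<^sub>E carrier (reduced X)"
    using x assms(2) by (auto simp: bij_betw_def)
  have "(\<lambda>j\<in>m. x (compose m f g j)) = (\<lambda>j\<in>m. (\<lambda>j\<in>l. x (f j)) (g j))"
    using assms(3) by (intro restrict_ext) (auto simp: bij_betw_def compose_def)
  then show "tensor_perm R m (reduced X) (compose m f g) (pure_tensor b (reduced X) x) =
      tensor_perm R m (reduced X) g (tensor_perm R l (reduced X) f (pure_tensor b (reduced X) x))"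
    unfolding tensor_perm_pure[OF module_reduced[OF assms(1)] bij x]
      tensor_perm_pure[OF module_reduced[OF assms(1)] assms(2) x]
      tensor_perm_pure[OF module_reduced[OF assms(1)] assms(3) x1]
    by (rule arg_cong)
qed fact+

lemma is_nat_perm:
  assumes "bij_betw f l b"
  shows "is_nat Gamma R ((botG ^^ n) (tfun b)) ((botG ^^ n) (tfun l))
    (\<lambda>X :: 'u::infinite pset. tensor_perm R l (reduced ((plus_pt ^^ n) X)) f)"
  unfolding is_nat_def tfun_iter_fob tfun_iter_far
proof (intro conjI ballI)
  fix X :: "'u pset" assume X: "X \<in> obj Gamma"
  note f = finite_iter_plus[OF X]
  show "tensor_perm R l (reduced ((plus_pt ^^ n) X)) f \<in>
      mod_hom R (tens b ((plus_pt ^^ n) X)) (tens l ((plus_pt ^^ n) X))"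
    by (intro tensor_perm_hom module_reduced f assms)
  fix Y g t assume Y: "Y \<in> obj Gamma" and g: "g \<in> arr Gamma X Y"
    and t: "t \<in> carrier (tens b ((plus_pt ^^ n) X))"
  have "g \<in> fst X \<rightarrow> fst Y" using g by (auto simp: arr_Gamma)
  note p = plus_iter_funcset[OF X Y this]
  show "tensor_perm R l (reduced ((plus_pt ^^ n) Y)) f (push b ((plus_pt ^^ n) Y) (plus_iter n X Y g) t) =
      push l ((plus_pt ^^ n) Y) (plus_iter n X Y g) (tensor_perm R l (reduced ((plus_pt ^^ n) X)) f t)"
    by (rule perm_push[OF f finite_iter_plus[OF Y] p assms t])
qed

subsection \<open>The structure maps\<close>

abbreviation lhs where
  "lhs A \<equiv> tstar_hom_cosimp R A"

lemma lhs_fob: "fob (level (lhs A) n) b = homs A n b"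
  by (simp add: tstar_hom_cosimp_def hom_cosimp_def)

lemma lhs_far: "far (level (lhs A) n) b l f \<gamma> =
    nat_restrict Gamma (tfun A) ((\<lambda>X. tensor_perm R l (reduced ((plus_pt ^^ n) X)) f) \<bullet> \<gamma>)"
  by (simp add: tstar_hom_cosimp_def hom_cosimp_def botG_map_iter nat_comp_def)

lemma tstar_coact_push: "tstar_coact R b X = push b (plus_pt X) (\<lambda>w. w)"
  by (simp add: tstar_coact_def push_def)

lemma lhs_coface_0: "coface (lhs A) n 0 b \<gamma> =
    nat_restrict Gamma (tfun A) (\<lambda>X x. \<gamma> (plus_pt X) (push A (plus_pt X) (\<lambda>w. w) x))"
  by (simp add: tstar_hom_cosimp_def hom_cosimp_def botG_map_val nat_comp_def tstar_coact_push)

text \<open>The last coface fits the pattern of the comultiplications: the coaction on the target is the inclusion,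
  and \<open>face (Suc n)\<close> is the identity on the numbers up to \<open>n\<close>.\<close>

lemma lhs_coface_val:
  assumes i: "1 \<le> i" "i \<le> Suc n" and \<gamma>: "\<gamma> \<in> carrier (homs A n b)"
    and X: "X \<in> obj Gamma" and x: "x \<in> carrier (tens A X)"
  shows "coface (lhs A) n i b \<gamma> X x = push b ((plus_pt ^^ Suc n) X) (renum X (face i)) (\<gamma> X x)"
proof -
  note t = homs_closed[OF \<gamma> X x]
  have fl: "\<And>r. 1 \<le> r \<Longrightarrow> r \<le> n \<Longrightarrow> face i r \<le> Suc n" by (auto simp: face_def)
  show ?thesis
  proof (cases "i = Suc n")
    case True
    have "coface (lhs A) n i b \<gamma> X x = push b ((plus_pt ^^ Suc n) X) (\<lambda>w. w) (\<gamma> X x)"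
      using True X x by (simp add: tstar_hom_cosimp_def hom_cosimp_def restrict_val nat_comp_def
          botG_map_iter tstar_coact_push)
    also have "\<dots> = push b ((plus_pt ^^ Suc n) X) (renum X (face i)) (\<gamma> X x)"
    proof (rule push_renum_cong[OF X t fl])
      fix w assume "w \<in> fst ((plus_pt ^^ n) X)"
      then show "w = renum X (face i) w"
        by (cases rule: iter_plus_cases) (simp_all add: renum_base renum_mark[OF X] face_def True)
    qed
    finally show ?thesis .
  next
    case False
    then have i': "1 \<le> i" "i \<le> n" using i by auto
    let ?Z = "(plus_pt ^^ (i - 1)) X"
    have e: "(plus_pt ^^ (n - i)) (plus_pt (plus_pt ?Z)) = (plus_pt ^^ Suc n) X"
    proof -
      have "Suc n = (n - i) + (2 + (i - 1))" using i' by simp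
      then show ?thesis by (simp only: funpow_add o_apply) (simp add: numeral_2_eq_2)
    qed
    have "coface (lhs A) n i b \<gamma> X x =
        push b ((plus_pt ^^ (n - i)) (plus_pt (plus_pt ?Z)))
          (plus_iter (n - i) (plus_pt ?Z) (plus_pt (plus_pt ?Z)) (shift_pt ?Z)) (\<gamma> X x)"
      using i' X x by (simp add: tstar_hom_cosimp_def hom_cosimp_def restrict_val nat_comp_def
          botG_map_iter DeltaG_def tfun_iter_far)
    also have "\<dots> = push b ((plus_pt ^^ Suc n) X) (renum X (face i)) (\<gamma> X x)"
      unfolding e by (rule push_renum_cong[OF X t fl shift_iter[OF X i']])
    finally show ?thesis .
  qed
qed

lemma lhs_codeg_val:
  assumes j: "j \<le> n" and \<gamma>: "\<gamma> \<in> carrier (homs A (Suc n) b)"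
    and X: "X \<in> obj Gamma" and x: "x \<in> carrier (tens A X)"
  shows "codeg (lhs A) n j b \<gamma> X x = push b ((plus_pt ^^ n) X) (renum X (degen j)) (\<gamma> X x)"
proof -
  note t = homs_closed[OF \<gamma> X x]
  have fl: "\<And>r. 1 \<le> r \<Longrightarrow> r \<le> Suc n \<Longrightarrow> degen j r \<le> n" using j by (auto simp: degen_def)
  let ?Z = "(plus_pt ^^ j) X"
  have e: "(plus_pt ^^ (n - j)) ?Z = (plus_pt ^^ n) X"
    using j by (metis funpow_add le_add_diff_inverse2 o_apply)
  have "codeg (lhs A) n j b \<gamma> X x =
      push b ((plus_pt ^^ (n - j)) ?Z) (plus_iter (n - j) (plus_pt ?Z) ?Z (fold_pt ?Z)) (\<gamma> X x)"
    using X x by (simp add: tstar_hom_cosimp_def hom_cosimp_def restrict_val nat_comp_def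
        botG_map_iter epsG_def tfun_iter_far)
  also have "\<dots> = push b ((plus_pt ^^ n) X) (renum X (degen j)) (\<gamma> X x)"
    unfolding e by (rule push_renum_cong[OF X t fl fold_iter[OF X j]])
  finally show ?thesis .
qed

lemma lhs_coface_restrict:
  assumes "1 \<le> i" "i \<le> Suc n" "\<gamma> \<in> carrier (homs A n b)"
  shows "coface (lhs A) n i b \<gamma> =
    nat_restrict Gamma (tfun A) ((\<lambda>X. push b ((plus_pt ^^ Suc n) X) (renum X (face i))) \<bullet> \<gamma>)"
proof -
  have "coface (lhs A) n i b \<gamma> = nat_restrict Gamma (tfun A) (coface (lhs A) n i b \<gamma>)"
    by (simp add: tstar_hom_cosimp_def hom_cosimp_def nat_restrict_idem)
  also have "\<dots> = nat_restrict Gamma (tfun A) ((\<lambda>X. push b ((plus_pt ^^ Suc n) X) (renum X (face i))) \<bullet> \<gamma>)"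
    by (rule nat_restrict_eqI) (simp only: tfun_fob lhs_coface_val[OF assms] nat_comp_def)
  finally show ?thesis .
qed

lemma lhs_codeg_restrict:
  assumes "j \<le> n" "\<gamma> \<in> carrier (homs A (Suc n) b)"
  shows "codeg (lhs A) n j b \<gamma> =
    nat_restrict Gamma (tfun A) ((\<lambda>X. push b ((plus_pt ^^ n) X) (renum X (degen j))) \<bullet> \<gamma>)"
proof -
  have "codeg (lhs A) n j b \<gamma> = nat_restrict Gamma (tfun A) (codeg (lhs A) n j b \<gamma>)"
    by (simp add: tstar_hom_cosimp_def hom_cosimp_def nat_restrict_idem)
  also have "\<dots> = nat_restrict Gamma (tfun A) ((\<lambda>X. push b ((plus_pt ^^ n) X) (renum X (degen j))) \<bullet> \<gamma>)"
    by (rule nat_restrict_eqI) (simp only: tfun_fob lhs_codeg_val[OF assms] nat_comp_def)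
  finally show ?thesis .
qed

lemma lhs_far_val:
  "X \<in> obj Gamma \<Longrightarrow> x \<in> carrier (tens A X) \<Longrightarrow>
    far (level (lhs A) n) b l f \<gamma> X x = tensor_perm R l (reduced ((plus_pt ^^ n) X)) f (\<gamma> X x)"
  by (simp add: lhs_far restrict_val nat_comp_def)

lemma lhs_coface_0_val:
  "X \<in> obj Gamma \<Longrightarrow> x \<in> carrier (tens A X) \<Longrightarrow>
    coface (lhs A) n 0 b \<gamma> X x = \<gamma> (plus_pt X) (push A (plus_pt X) (\<lambda>w. w) x)"
  by (simp add: lhs_coface_0 restrict_val)

lemma incl_hom:
  fixes X :: "'u::infinite pset"
  shows "X \<in> obj Gamma \<Longrightarrow> push A (plus_pt X) (\<lambda>w. w) \<in> mod_hom R (tens A X) (tens A (plus_pt X))"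
  using plus_pt_obj[of X] by (intro push_hom) (auto simp: obj_Gamma fst_plus_pt)

lemma incl_natural:
  fixes X Y :: "'u::infinite pset"
  assumes X: "X \<in> obj Gamma" and Y: "Y \<in> obj Gamma" and f: "f \<in> arr Gamma X Y"
    and x: "x \<in> carrier (tens A X)"
  shows "push A (plus_pt Y) (\<lambda>w. w) (push A Y f x) =
    push A (plus_pt Y) (plus_map X Y f) (push A (plus_pt X) (\<lambda>w. w) x)"
proof -
  note X' = plus_pt_obj[OF X] and Y' = plus_pt_obj[OF Y]
  have fin: "finite (fst X)" "finite (fst Y)" "finite (fst (plus_pt X))" "finite (fst (plus_pt Y))"
    using X Y X' Y' by (auto simp: obj_Gamma)
  have fs: "f \<in> fst X \<rightarrow> fst Y" "(\<lambda>w. w) \<in> fst X \<rightarrow> fst (plus_pt X)"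
    "(\<lambda>w. w) \<in> fst Y \<rightarrow> fst (plus_pt Y)" "plus_map X Y f \<in> fst (plus_pt X) \<rightarrow> fst (plus_pt Y)"
    using f plus_map_arr[OF X Y f] by (auto simp: arr_Gamma fst_plus_pt)
  have "push A (plus_pt Y) (\<lambda>w. w) (push A Y f x) = push A (plus_pt Y) f x"
    by (rule push_comp[OF fin(1,2,4) fs(1,3) x])
  also have "\<dots> = push A (plus_pt Y) (\<lambda>w. plus_map X Y f w) x"
  proof (rule push_cong[OF fin(1,4) _ _ x])
    show "(\<lambda>w. plus_map X Y f w) \<in> fst X \<rightarrow> fst (plus_pt Y)"
      using fs(4) by (auto simp: fst_plus_pt)
  qed (simp add: plus_map_values[OF X Y])
  also have "\<dots> = push A (plus_pt Y) (plus_map X Y f) (push A (plus_pt X) (\<lambda>w. w) x)"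
    by (rule push_comp[OF fin(1,3,4) fs(2,4) x, symmetric])
  finally show ?thesis .
qed

lemma lhs_coface_0_hom: "coface (lhs A) n 0 b \<in> mod_hom R (homs A n b) (homs A (Suc n) b)"
proof (rule mod_homI)
  fix \<gamma> :: "'u::infinite pset \<Rightarrow> _" assume \<gamma>: "\<gamma> \<in> carrier (homs A n b)"
  have "is_nat Gamma R (tfun A) ((botG ^^ Suc n) (tfun b))
      (\<lambda>X x. \<gamma> (plus_pt X) (push A (plus_pt X) (\<lambda>w. w) x))"
    unfolding is_nat_def tfun_fob tfun_far tfun_iter_fob tfun_iter_far
  proof (intro conjI ballI)
    fix X :: "'u pset" assume X: "X \<in> obj Gamma"
    note X' = plus_pt_obj[OF X]
    from mod_hom_comp[OF incl_hom[OF X] homs_hom[OF \<gamma> X']]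
    show "(\<lambda>x. \<gamma> (plus_pt X) (push A (plus_pt X) (\<lambda>w. w) x)) \<in>
        mod_hom R (tens A X) (tens b ((plus_pt ^^ Suc n) X))"
      unfolding iter_plus_plus .
    fix Y f x assume Y: "Y \<in> obj Gamma" and f: "f \<in> arr Gamma X Y" and x: "x \<in> carrier (tens A X)"
    show "\<gamma> (plus_pt Y) (push A (plus_pt Y) (\<lambda>w. w) (push A Y f x)) =
        push b ((plus_pt ^^ Suc n) Y) (plus_iter (Suc n) X Y f)
          (\<gamma> (plus_pt X) (push A (plus_pt X) (\<lambda>w. w) x))"
      unfolding incl_natural[OF X Y f x]
        homs_natural[OF \<gamma> X' plus_pt_obj[OF Y] plus_map_arr[OF X Y f] mod_hom_closed[OF incl_hom[OF X] x]]
        iter_plus_plus plus_iter.simps ..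
  qed
  from nat_restrict_carrier[OF this tfun_conditions]
  show "coface (lhs A) n 0 b \<gamma> \<in> carrier (homs A (Suc n) b)"
    unfolding lhs_coface_0 .
  {
    fix \<gamma>' :: "'u pset \<Rightarrow> _" assume \<gamma>': "\<gamma>' \<in> carrier (homs A n b)"
    have "coface (lhs A) n 0 b (\<gamma> \<oplus>\<^bsub>homs A n b\<^esub> \<gamma>') = nat_restrict Gamma (tfun A) (\<lambda>X x.
        coface (lhs A) n 0 b \<gamma> X x \<oplus>\<^bsub>fob ((botG ^^ Suc n) (tfun b)) X\<^esub> coface (lhs A) n 0 b \<gamma>' X x)"
      unfolding lhs_coface_0[of A n b "\<gamma> \<oplus>\<^bsub>homs A n b\<^esub> \<gamma>'"]
    proof (rule nat_restrict_eqI)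
      fix X :: "'u pset" and x assume X: "X \<in> obj Gamma" and x: "x \<in> carrier (fob (tfun A) X)"
      then have x': "x \<in> carrier (tens A X)" by (simp add: tfun_fob)
      have y: "push A (plus_pt X) (\<lambda>w. w) x \<in> carrier (fob (tfun A) (plus_pt X))"
        using mod_hom_closed[OF incl_hom[OF X] x'] by (simp add: tfun_fob)
      show "(\<gamma> \<oplus>\<^bsub>homs A n b\<^esub> \<gamma>') (plus_pt X) (push A (plus_pt X) (\<lambda>w. w) x) =
          coface (lhs A) n 0 b \<gamma> X x \<oplus>\<^bsub>fob ((botG ^^ Suc n) (tfun b)) X\<^esub> coface (lhs A) n 0 b \<gamma>' X x"
        unfolding nat_mod_add_val[OF plus_pt_obj[OF X] y] lhs_coface_0_val[OF X x']
        by (simp only: botG_iter_fob iter_plus_plus)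
    qed
    then show "coface (lhs A) n 0 b (\<gamma> \<oplus>\<^bsub>homs A n b\<^esub> \<gamma>') =
        coface (lhs A) n 0 b \<gamma> \<oplus>\<^bsub>homs A (Suc n) b\<^esub> coface (lhs A) n 0 b \<gamma>'"
      by (simp add: nat_mod_def)
  }
  fix c assume c: "c \<in> carrier R"
  have "coface (lhs A) n 0 b (c \<odot>\<^bsub>homs A n b\<^esub> \<gamma>) = nat_restrict Gamma (tfun A) (\<lambda>X x.
      c \<odot>\<^bsub>fob ((botG ^^ Suc n) (tfun b)) X\<^esub> coface (lhs A) n 0 b \<gamma> X x)"
    unfolding lhs_coface_0[of A n b "c \<odot>\<^bsub>homs A n b\<^esub> \<gamma>"]
  proof (rule nat_restrict_eqI)
    fix X :: "'u pset" and x assume X: "X \<in> obj Gamma" and x: "x \<in> carrier (fob (tfun A) X)"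
    then have x': "x \<in> carrier (tens A X)" by (simp add: tfun_fob)
    have y: "push A (plus_pt X) (\<lambda>w. w) x \<in> carrier (fob (tfun A) (plus_pt X))"
      using mod_hom_closed[OF incl_hom[OF X] x'] by (simp add: tfun_fob)
    show "(c \<odot>\<^bsub>homs A n b\<^esub> \<gamma>) (plus_pt X) (push A (plus_pt X) (\<lambda>w. w) x) =
        c \<odot>\<^bsub>fob ((botG ^^ Suc n) (tfun b)) X\<^esub> coface (lhs A) n 0 b \<gamma> X x"
      unfolding nat_mod_smult_val[OF plus_pt_obj[OF X] y] lhs_coface_0_val[OF X x']
      by (simp only: botG_iter_fob iter_plus_plus)
  qed
  then show "coface (lhs A) n 0 b (c \<odot>\<^bsub>homs A n b\<^esub> \<gamma>) = c \<odot>\<^bsub>homs A (Suc n) b\<^esub> coface (lhs A) n 0 b \<gamma>"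
    by (simp add: nat_mod_def)
qed

lemma face_bound: "r \<le> n \<Longrightarrow> face i r \<le> Suc n"
  by (simp add: face_def)

lemma degen_bound: "j \<le> n \<Longrightarrow> r \<le> Suc n \<Longrightarrow> degen j r \<le> n"
  by (auto simp: degen_def)

lemma lhs_coface_hom:
  assumes "i \<le> Suc n"
  shows "coface (lhs A) n i b \<in> mod_hom R (homs A n b) (homs A (Suc n) b)"
proof (cases "i = 0")
  case True
  then show ?thesis using lhs_coface_0_hom by simp
next
  case False
  then have i: "1 \<le> i" by simp
  show ?thesis
    by (rule mod_hom_cong[OF postcompose_hom[OF tfun_conditions is_nat_renum[OF face_bound]] module_homs
          lhs_coface_restrict[OF i assms]])
qed

lemma lhs_codeg_hom:
  assumes "j \<le> n"
  shows "codeg (lhs A) n j b \<in> mod_hom R (homs A (Suc n) b) (homs A n b)"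
  by (rule mod_hom_cong[OF postcompose_hom[OF tfun_conditions is_nat_renum[OF degen_bound[OF assms]]] module_homs
        lhs_codeg_restrict[OF assms]])

lemma lhs_far_hom:
  assumes "bij_betw f l b"
  shows "far (level (lhs A) n) b l f \<in> mod_hom R (homs A n b) (homs A n l)"
  by (rule mod_hom_cong[OF postcompose_hom[OF tfun_conditions is_nat_perm[OF assms]] module_homs lhs_far])

lemma lhs_is_functor: "is_functor (op_cat Sigma_cat) R (level (lhs A) n)"
  unfolding is_functor_def lhs_fob
proof (intro conjI ballI, goal_cases)
  case (1 b)
  show ?case by (rule module_homs)
next
  case (2 b l f)
  then show ?case by (intro lhs_far_hom) (simp add: arr_Sigma)
next
  case (3 b \<gamma>)
  have bij: "bij_betw (\<lambda>j\<in>b. j) b b" by (auto simp: bij_betw_def inj_on_def)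
  show ?case unfolding idn_Sigma
  proof (rule homs_eqI[OF mod_hom_closed[OF lhs_far_hom[OF bij] 3(2)] 3(2)], goal_cases)
    case X: (1 X x)
    show ?case
      unfolding lhs_far_val[OF X] by (rule perm_id[OF finite_iter_plus[OF X(1)] homs_closed[OF 3(2) X]])
  qed
next
  case (4 b l m f g \<gamma>)
  then have bij: "bij_betw f l b" "bij_betw g m l" by (auto simp: arr_Sigma)
  have bij': "bij_betw (compose m f g) m b" by (rule bij_betw_compose[OF bij(2,1)])
  note cl = mod_hom_closed[OF lhs_far_hom]
  show ?case unfolding cmp_Sigma
  proof (rule homs_eqI[OF cl[OF bij' 4(6)] cl[OF bij(2) cl[OF bij(1) 4(6)]]], goal_cases)
    case X: (1 X x)
    show ?case
      unfolding lhs_far_val[OF X]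
      by (rule perm_comp[OF finite_iter_plus[OF X(1)] bij homs_closed[OF 4(6) X]])
  qed
qed

lemma lhs_coface_nat:
  assumes i: "i \<le> Suc n"
  shows "is_nat (op_cat Sigma_cat) R (level (lhs A) n) (level (lhs A) (Suc n)) (coface (lhs A) n i)"
  unfolding is_nat_def lhs_fob
proof (intro conjI ballI)
  fix b show "coface (lhs A) n i b \<in> mod_hom R (homs A n b) (homs A (Suc n) b)"
    by (rule lhs_coface_hom[OF i])
  fix l f \<gamma> assume "f \<in> arr (op_cat Sigma_cat) b l" and \<gamma>: "\<gamma> \<in> carrier (homs A n b)"
  then have bij: "bij_betw f l b" by (simp add: arr_Sigma)
  note cf = mod_hom_closed[OF lhs_far_hom[OF bij]] and cc = mod_hom_closed[OF lhs_coface_hom[OF i]]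
  show "coface (lhs A) n i l (far (level (lhs A) n) b l f \<gamma>) =
      far (level (lhs A) (Suc n)) b l f (coface (lhs A) n i b \<gamma>)"
  proof (rule homs_eqI[OF cc[OF cf[OF \<gamma>]] cf[OF cc[OF \<gamma>]]], goal_cases)
    case (1 X x)
    note X = 1(1) and x = 1(2)
    show ?case
    proof (cases "i = 0")
      case True
      show ?thesis
        unfolding True lhs_far_val[OF X x] lhs_coface_0_val[OF X x]
          lhs_far_val[OF plus_pt_obj[OF X] mod_hom_closed[OF incl_hom[OF X] x]] iter_plus_plus ..
    next
      case False
      then have i1: "1 \<le> i" by simp
      show ?thesis
        unfolding lhs_coface_val[OF i1 i cf[OF \<gamma>] X x] lhs_far_val[OF X x] lhs_coface_val[OF i1 i \<gamma> X x]
        by (rule perm_push[OF _ _ _ bij homs_closed[OF \<gamma> X x], symmetric])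
          (intro finite_iter_plus X renum_funcset face_bound; assumption)+
    qed
  qed
qed

lemma lhs_codeg_nat:
  assumes j: "j \<le> n"
  shows "is_nat (op_cat Sigma_cat) R (level (lhs A) (Suc n)) (level (lhs A) n) (codeg (lhs A) n j)"
  unfolding is_nat_def lhs_fob
proof (intro conjI ballI)
  fix b show "codeg (lhs A) n j b \<in> mod_hom R (homs A (Suc n) b) (homs A n b)"
    by (rule lhs_codeg_hom[OF j])
  fix l f \<gamma> assume "f \<in> arr (op_cat Sigma_cat) b l" and \<gamma>: "\<gamma> \<in> carrier (homs A (Suc n) b)"
  then have bij: "bij_betw f l b" by (simp add: arr_Sigma)
  note cf = mod_hom_closed[OF lhs_far_hom[OF bij]] and cc = mod_hom_closed[OF lhs_codeg_hom[OF j]]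
  show "codeg (lhs A) n j l (far (level (lhs A) (Suc n)) b l f \<gamma>) =
      far (level (lhs A) n) b l f (codeg (lhs A) n j b \<gamma>)"
  proof (rule homs_eqI[OF cc[OF cf[OF \<gamma>]] cf[OF cc[OF \<gamma>]]], goal_cases)
    case (1 X x)
    note X = 1(1) and x = 1(2)
    show ?case
      unfolding lhs_codeg_val[OF j cf[OF \<gamma>] X x] lhs_far_val[OF X x] lhs_codeg_val[OF j \<gamma> X x]
      by (rule perm_push[OF _ _ _ bij homs_closed[OF \<gamma> X x], symmetric])
        (intro finite_iter_plus X renum_funcset degen_bound[OF j]; assumption)+
  qed
qed

subsection \<open>The cosimplicial identities\<close>

text \<open>The zeroth coface evaluates at \<open>X\<^sub>+\<close> instead of \<open>X\<close>. There the point \<open>mark X 1\<close> counts as the original base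
  point, so all numbers are shifted by one.\<close>

lemma push_plus_renum:
  assumes X: "X \<in> obj Gamma" and t: "t \<in> carrier (tens b ((plus_pt ^^ Suc n) X))"
    and \<phi>: "\<phi> 1 = 1" "\<And>r. 1 \<le> r \<Longrightarrow> r \<le> n \<Longrightarrow> \<phi> (Suc r) = Suc (\<psi> r)"
    and le: "\<And>r. 1 \<le> r \<Longrightarrow> r \<le> n \<Longrightarrow> \<psi> r \<le> m"
  shows "push b ((plus_pt ^^ Suc m) X) (renum (plus_pt X) \<psi>) t = push b ((plus_pt ^^ Suc m) X) (renum X \<phi>) t"
proof (rule push_renum_cong[OF X t])
  fix r assume r: "1 \<le> r" "r \<le> Suc n"
  show "\<phi> r \<le> Suc m"
  proof (cases "r = 1")
    case True
    then show ?thesis using \<phi>(1) by simp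
  next
    case False
    then obtain q where "r = Suc q" "1 \<le> q" "q \<le> n" using r by (cases r) auto
    then show ?thesis using \<phi>(2)[of q] le[of q] by simp
  qed
qed (rule renum_plus_pt[OF X _ \<phi>])

text \<open>When \<open>i\<close> is positive both sides are renumberings and the identity is one between maps of numbers. When
  \<open>i = 0\<close> the other coface acts at \<open>X\<^sub>+\<close>; if in addition \<open>j = 1\<close>, it is the naturality of \<open>\<gamma>\<close> along
  \<open>shift_pt X\<close> that compares the two sides.\<close>

lemma lhs_coface_coface:
  assumes ij: "i < j" "j \<le> Suc (Suc n)" and \<gamma>: "\<gamma> \<in> carrier (homs A n b)"
    and X: "X \<in> obj Gamma" and x: "x \<in> carrier (tens A X)"
  shows "coface (lhs A) (Suc n) j b (coface (lhs A) n i b \<gamma>) X x =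
    coface (lhs A) (Suc n) i b (coface (lhs A) n (j - 1) b \<gamma>) X x"
proof -
  have le: "i \<le> Suc n" "j - 1 \<le> Suc n" "1 \<le> j" using ij by auto
  note c = mod_hom_closed[OF lhs_coface_hom[OF le(1)] \<gamma>] mod_hom_closed[OF lhs_coface_hom[OF le(2)] \<gamma>]
  note t = homs_closed[OF \<gamma> X x]
  show ?thesis
  proof (cases "i = 0")
    case False
    then have i: "1 \<le> i" "i \<le> Suc (Suc n)" "1 \<le> j - 1" using ij by auto
    let ?h = "\<lambda>r. face j (face i r)"
    have "push b ((plus_pt ^^ Suc (Suc n)) X) (renum X (face j))
        (push b ((plus_pt ^^ Suc n) X) (renum X (face i)) (\<gamma> X x)) =
        push b ((plus_pt ^^ Suc (Suc n)) X) (renum X ?h) (\<gamma> X x)"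
      by (rule push_renum_comp[OF X t]) (use i ij in \<open>auto simp: face_def\<close>)
    moreover have "push b ((plus_pt ^^ Suc (Suc n)) X) (renum X (face i))
        (push b ((plus_pt ^^ Suc n) X) (renum X (face (j - 1))) (\<gamma> X x)) =
        push b ((plus_pt ^^ Suc (Suc n)) X) (renum X ?h) (\<gamma> X x)"
      by (rule push_renum_comp[OF X t]) (use i ij in \<open>auto simp: face_def\<close>)
    ultimately show ?thesis
      unfolding lhs_coface_val[OF le(3) ij(2) c(1) X x] lhs_coface_val[OF i(1) le(1) \<gamma> X x]
        lhs_coface_val[OF i(1,2) c(2) X x] lhs_coface_val[OF i(3) le(2) \<gamma> X x] by simp
  next
    case i0: True
    note X' = plus_pt_obj[OF X]
    define y where "y = push A (plus_pt X) (\<lambda>w. w) x"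
    have y: "y \<in> carrier (tens A (plus_pt X))" unfolding y_def by (rule mod_hom_closed[OF incl_hom[OF X] x])
    have t': "\<gamma> (plus_pt X) y \<in> carrier (tens b ((plus_pt ^^ Suc n) X))"
      using homs_closed[OF \<gamma> X' y] unfolding iter_plus_plus .
    have l: "coface (lhs A) (Suc n) j b (coface (lhs A) n i b \<gamma>) X x =
        push b ((plus_pt ^^ Suc (Suc n)) X) (renum X (face j)) (\<gamma> (plus_pt X) y)"
      unfolding lhs_coface_val[OF le(3) ij(2) c(1) X x] unfolding i0 lhs_coface_0_val[OF X x] y_def ..
    have r: "coface (lhs A) (Suc n) i b (coface (lhs A) n (j - 1) b \<gamma>) X x =
        coface (lhs A) n (j - 1) b \<gamma> (plus_pt X) y"
      unfolding i0 lhs_coface_0_val[OF X x] y_def ..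
    show ?thesis
    proof (cases "j = 1")
      case True
      have s: "shift_pt X \<in> arr Gamma (plus_pt X) (plus_pt (plus_pt X))" by (rule shift_pt_arr[OF X])
      have X'': "plus_pt (plus_pt X) \<in> obj Gamma" by (rule plus_pt_obj[OF X'])
      have fin: "finite (fst X)" "finite (fst (plus_pt X))" "finite (fst (plus_pt (plus_pt X)))"
        using X X' X'' by (auto simp: obj_Gamma)
      have fs: "(\<lambda>w. w) \<in> fst X \<rightarrow> fst (plus_pt X)" "(\<lambda>w. w) \<in> fst (plus_pt X) \<rightarrow> fst (plus_pt (plus_pt X))"
        "shift_pt X \<in> fst (plus_pt X) \<rightarrow> fst (plus_pt (plus_pt X))"
        using s by (auto simp: arr_Gamma fst_plus_pt)
      \<comment> \<open>the two maps from \<open>X\<^sub>+\<close> agree on the image of \<open>X\<close>, which is all that \<open>y\<close> sees\<close>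
      have "push A (plus_pt (plus_pt X)) (\<lambda>w. w) y = push A (plus_pt (plus_pt X)) (\<lambda>w. w) x"
        unfolding y_def by (rule push_comp[OF fin fs(1,2) x])
      also have "\<dots> = push A (plus_pt (plus_pt X)) (\<lambda>w. shift_pt X w) x"
        by (rule push_cong[OF fin(1,3) _ _ x])
          (use fs in \<open>auto simp: shift_pt_values[OF X] fst_plus_pt\<close>)
      also have "\<dots> = push A (plus_pt (plus_pt X)) (shift_pt X) y"
        unfolding y_def by (rule push_comp[OF fin fs(1,3) x, symmetric])
      finally have yy: "push A (plus_pt (plus_pt X)) (\<lambda>w. w) y = push A (plus_pt (plus_pt X)) (shift_pt X) y" .
      have "coface (lhs A) n (j - 1) b \<gamma> (plus_pt X) y =
          \<gamma> (plus_pt (plus_pt X)) (push A (plus_pt (plus_pt X)) (shift_pt X) y)"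
        unfolding True diff_self_eq_0 lhs_coface_0_val[OF X' y] yy ..
      also have "\<dots> = push b ((plus_pt ^^ Suc (Suc n)) X)
          (plus_iter n (plus_pt X) (plus_pt (plus_pt X)) (shift_pt X)) (\<gamma> (plus_pt X) y)"
        unfolding homs_natural[OF \<gamma> X' X'' s y] iter_plus_plus ..
      also have "\<dots> = push b ((plus_pt ^^ Suc (Suc n)) X) (renum X (face 1)) (\<gamma> (plus_pt X) y)"
      proof (rule push_renum_cong[OF X t' face_bound])
        fix w assume "w \<in> fst ((plus_pt ^^ Suc n) X)"
        from shift_iter[OF X _ _ this, of 1]
        show "plus_iter n (plus_pt X) (plus_pt (plus_pt X)) (shift_pt X) w = renum X (face 1) w" by simp
      qed
      finally show ?thesis using l r True by simp
    next
      case False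
      then have j1: "1 \<le> j - 1" using le(3) by simp
      show ?thesis
        unfolding l r lhs_coface_val[OF j1 le(2) \<gamma> X' y] iter_plus_plus
        by (rule push_plus_renum[OF X t', symmetric]) (use j1 in \<open>auto simp: face_def\<close>)
    qed
  qed
qed

lemma lhs_codeg_codeg:
  assumes ij: "i \<le> j" "j \<le> n" and \<gamma>: "\<gamma> \<in> carrier (homs A (Suc (Suc n)) b)"
    and X: "X \<in> obj Gamma" and x: "x \<in> carrier (tens A X)"
  shows "codeg (lhs A) n j b (codeg (lhs A) (Suc n) i b \<gamma>) X x =
    codeg (lhs A) n i b (codeg (lhs A) (Suc n) (j + 1) b \<gamma>) X x"
proof -
  have le: "i \<le> Suc n" "j + 1 \<le> Suc n" "i \<le> n" using ij by auto
  note c = mod_hom_closed[OF lhs_codeg_hom[OF le(1)] \<gamma>] mod_hom_closed[OF lhs_codeg_hom[OF le(2)] \<gamma>]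
  note t = homs_closed[OF \<gamma> X x]
  let ?h = "\<lambda>r. degen j (degen i r)"
  have "push b ((plus_pt ^^ n) X) (renum X (degen j))
      (push b ((plus_pt ^^ Suc n) X) (renum X (degen i)) (\<gamma> X x)) =
      push b ((plus_pt ^^ n) X) (renum X ?h) (\<gamma> X x)"
    by (rule push_renum_comp[OF X t]) (use ij in \<open>auto simp: degen_def\<close>)
  moreover have "push b ((plus_pt ^^ n) X) (renum X (degen i))
      (push b ((plus_pt ^^ Suc n) X) (renum X (degen (j + 1))) (\<gamma> X x)) =
      push b ((plus_pt ^^ n) X) (renum X ?h) (\<gamma> X x)"
    by (rule push_renum_comp[OF X t]) (use ij in \<open>auto simp: degen_def\<close>)
  ultimately show ?thesis
    unfolding lhs_codeg_val[OF ij(2) c(1) X x] lhs_codeg_val[OF le(1) \<gamma> X x]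
      lhs_codeg_val[OF le(3) c(2) X x] lhs_codeg_val[OF le(2) \<gamma> X x] by simp
qed

lemma lhs_codeg_coface_id:
  assumes j: "j \<le> n" "i = j \<or> i = j + 1" and \<gamma>: "\<gamma> \<in> carrier (homs A n b)"
    and X: "X \<in> obj Gamma" and x: "x \<in> carrier (tens A X)"
  shows "codeg (lhs A) n j b (coface (lhs A) n i b \<gamma>) X x = \<gamma> X x"
proof -
  have le: "i \<le> Suc n" using j by auto
  note c = mod_hom_closed[OF lhs_coface_hom[OF le] \<gamma>]
  note t = homs_closed[OF \<gamma> X x]
  show ?thesis
  proof (cases "i = 0")
    case False
    then have i: "1 \<le> i" by simp
    let ?h = "\<lambda>r. degen j (face i r)"
    have "push b ((plus_pt ^^ n) X) (renum X (degen j))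
        (push b ((plus_pt ^^ Suc n) X) (renum X (face i)) (\<gamma> X x)) =
        push b ((plus_pt ^^ n) X) (renum X ?h) (\<gamma> X x)"
      by (rule push_renum_comp[OF X t]) (use j in \<open>auto simp: degen_def face_def\<close>)
    also have "\<dots> = \<gamma> X x"
      by (rule push_renum_id[OF X t]) (use j in \<open>auto simp: degen_def face_def\<close>)
    finally show ?thesis
      unfolding lhs_codeg_val[OF j(1) c X x] lhs_coface_val[OF i le \<gamma> X x] .
  next
    case True
    then have j0: "j = 0" using j by auto
    note X' = plus_pt_obj[OF X]
    define y where "y = push A (plus_pt X) (\<lambda>w. w) x"
    have y: "y \<in> carrier (tens A (plus_pt X))" unfolding y_def by (rule mod_hom_closed[OF incl_hom[OF X] x])
    have t': "\<gamma> (plus_pt X) y \<in> carrier (tens b ((plus_pt ^^ Suc n) X))"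
      using homs_closed[OF \<gamma> X' y] unfolding iter_plus_plus .
    have s: "fold_pt X \<in> arr Gamma (plus_pt X) X" by (rule fold_pt_arr[OF X])
    have fin: "finite (fst X)" "finite (fst (plus_pt X))" using X X' by (auto simp: obj_Gamma)
    have fs: "(\<lambda>w. w) \<in> fst X \<rightarrow> fst (plus_pt X)" "fold_pt X \<in> fst (plus_pt X) \<rightarrow> fst X"
      using s X by (auto simp: arr_Gamma fst_plus_pt obj_Gamma)
    have "push A X (fold_pt X) y = push A X (\<lambda>w. fold_pt X w) x"
      unfolding y_def by (rule push_comp[OF fin fin(1) fs x])
    also have "\<dots> = x" by (rule push_id[OF fin(1) _ x]) (simp add: fold_pt_values[OF X])
    finally have "\<gamma> X x = \<gamma> X (push A X (fold_pt X) y)" by simp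
    also have "\<dots> = push b ((plus_pt ^^ n) X) (plus_iter n (plus_pt X) X (fold_pt X)) (\<gamma> (plus_pt X) y)"
      by (rule homs_natural[OF \<gamma> X' X s y])
    also have "\<dots> = push b ((plus_pt ^^ n) X) (renum X (degen 0)) (\<gamma> (plus_pt X) y)"
    proof (rule push_renum_cong[OF X t' degen_bound[OF le0]])
      fix w assume "w \<in> fst ((plus_pt ^^ Suc n) X)"
      from fold_iter[OF X le0 this]
      show "plus_iter n (plus_pt X) X (fold_pt X) w = renum X (degen 0) w" by simp
    qed
    also have "\<dots> = codeg (lhs A) n j b (coface (lhs A) n i b \<gamma>) X x"
      unfolding lhs_codeg_val[OF j(1) c X x] unfolding True j0 lhs_coface_0_val[OF X x] y_def ..
    finally show ?thesis by simp
  qed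
qed

lemma lhs_codeg_coface_less:
  assumes ij: "i < j" "j \<le> Suc n" and \<gamma>: "\<gamma> \<in> carrier (homs A (Suc n) b)"
    and X: "X \<in> obj Gamma" and x: "x \<in> carrier (tens A X)"
  shows "codeg (lhs A) (Suc n) j b (coface (lhs A) (Suc n) i b \<gamma>) X x =
    coface (lhs A) n i b (codeg (lhs A) n (j - 1) b \<gamma>) X x"
proof -
  have le: "i \<le> Suc (Suc n)" "j - 1 \<le> n" "i \<le> Suc n" using ij by auto
  note c = mod_hom_closed[OF lhs_coface_hom[OF le(1)] \<gamma>] mod_hom_closed[OF lhs_codeg_hom[OF le(2)] \<gamma>]
  note t = homs_closed[OF \<gamma> X x]
  show ?thesis
  proof (cases "i = 0")
    case False
    then have i: "1 \<le> i" by simp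
    let ?h = "\<lambda>r. degen j (face i r)"
    have "push b ((plus_pt ^^ Suc n) X) (renum X (degen j))
        (push b ((plus_pt ^^ Suc (Suc n)) X) (renum X (face i)) (\<gamma> X x)) =
        push b ((plus_pt ^^ Suc n) X) (renum X ?h) (\<gamma> X x)"
      by (rule push_renum_comp[OF X t]) (use ij i in \<open>auto simp: degen_def face_def\<close>)
    moreover have "push b ((plus_pt ^^ Suc n) X) (renum X (face i))
        (push b ((plus_pt ^^ n) X) (renum X (degen (j - 1))) (\<gamma> X x)) =
        push b ((plus_pt ^^ Suc n) X) (renum X ?h) (\<gamma> X x)"
      by (rule push_renum_comp[OF X t]) (use ij i in \<open>auto simp: degen_def face_def\<close>)
    ultimately show ?thesis
      unfolding lhs_codeg_val[OF ij(2) c(1) X x] lhs_coface_val[OF i le(1) \<gamma> X x]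
        lhs_coface_val[OF i le(3) c(2) X x] lhs_codeg_val[OF le(2) \<gamma> X x] by simp
  next
    case True
    note X' = plus_pt_obj[OF X]
    define y where "y = push A (plus_pt X) (\<lambda>w. w) x"
    have y: "y \<in> carrier (tens A (plus_pt X))" unfolding y_def by (rule mod_hom_closed[OF incl_hom[OF X] x])
    have t': "\<gamma> (plus_pt X) y \<in> carrier (tens b ((plus_pt ^^ Suc (Suc n)) X))"
      using homs_closed[OF \<gamma> X' y] unfolding iter_plus_plus .
    have l: "codeg (lhs A) (Suc n) j b (coface (lhs A) (Suc n) i b \<gamma>) X x =
        push b ((plus_pt ^^ Suc n) X) (renum X (degen j)) (\<gamma> (plus_pt X) y)"
      unfolding lhs_codeg_val[OF ij(2) c(1) X x] unfolding True lhs_coface_0_val[OF X x] y_def ..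
    have r: "coface (lhs A) n i b (codeg (lhs A) n (j - 1) b \<gamma>) X x =
        codeg (lhs A) n (j - 1) b \<gamma> (plus_pt X) y"
      unfolding True lhs_coface_0_val[OF X x] y_def ..
    show ?thesis
      unfolding l r lhs_codeg_val[OF le(2) \<gamma> X' y] iter_plus_plus
      by (rule push_plus_renum[OF X t', symmetric]) (use ij True in \<open>auto simp: degen_def\<close>)
  qed
qed

lemma lhs_codeg_coface_greater:
  assumes ij: "j + 1 < i" "i \<le> Suc (Suc n)" and \<gamma>: "\<gamma> \<in> carrier (homs A (Suc n) b)"
    and X: "X \<in> obj Gamma" and x: "x \<in> carrier (tens A X)"
  shows "codeg (lhs A) (Suc n) j b (coface (lhs A) (Suc n) i b \<gamma>) X x =
    coface (lhs A) n (i - 1) b (codeg (lhs A) n j b \<gamma>) X x"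
proof -
  have le: "j \<le> n" "j \<le> Suc n" "1 \<le> i" "1 \<le> i - 1" "i - 1 \<le> Suc n" using ij by auto
  note c = mod_hom_closed[OF lhs_coface_hom[OF ij(2)] \<gamma>] mod_hom_closed[OF lhs_codeg_hom[OF le(1)] \<gamma>]
  note t = homs_closed[OF \<gamma> X x]
  let ?h = "\<lambda>r. degen j (face i r)"
  have "push b ((plus_pt ^^ Suc n) X) (renum X (degen j))
      (push b ((plus_pt ^^ Suc (Suc n)) X) (renum X (face i)) (\<gamma> X x)) =
      push b ((plus_pt ^^ Suc n) X) (renum X ?h) (\<gamma> X x)"
    by (rule push_renum_comp[OF X t]) (use ij in \<open>auto simp: degen_def face_def\<close>)
  moreover have "push b ((plus_pt ^^ Suc n) X) (renum X (face (i - 1)))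
      (push b ((plus_pt ^^ n) X) (renum X (degen j)) (\<gamma> X x)) =
      push b ((plus_pt ^^ Suc n) X) (renum X ?h) (\<gamma> X x)"
    by (rule push_renum_comp[OF X t]) (use ij in \<open>auto simp: degen_def face_def\<close>)
  ultimately show ?thesis
    unfolding lhs_codeg_val[OF le(2) c(1) X x] lhs_coface_val[OF le(3) ij(2) \<gamma> X x]
      lhs_coface_val[OF le(4,5) c(2) X x] lhs_codeg_val[OF le(1) \<gamma> X x] by simp
qed

lemma lhs_is_cosimplicial: "is_cosimplicial (op_cat Sigma_cat) R (lhs A)"
proof -
  note fc = mod_hom_closed[OF lhs_coface_hom] and dc = mod_hom_closed[OF lhs_codeg_hom]
  show ?thesis
    unfolding is_cosimplicial_def nat_eq_def nat_comp_def nat_id_def lhs_fob Suc_eq_plus1[symmetric]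
      add_2_eq_Suc'
  proof (intro conjI allI impI ballI, goal_cases)
    case (1 n)
    show ?case by (rule lhs_is_functor)
  next
    case (2 n i)
    then show ?case by (rule lhs_coface_nat)
  next
    case (3 n j)
    then show ?case by (rule lhs_codeg_nat)
  next
    case (4 n i j b \<gamma>)
    then have ij: "i < j" "j \<le> Suc (Suc n)" "i \<le> Suc n" "i \<le> Suc (Suc n)" "j - 1 \<le> Suc n" by auto
    show ?case
      by (rule homs_eqI[OF fc[OF ij(2) fc[OF ij(3) 4(3)]] fc[OF ij(4) fc[OF ij(5) 4(3)]]
            lhs_coface_coface[OF ij(1,2) 4(3)]])
  next
    case (5 n i j b \<gamma>)
    then have ij: "i \<le> j" "j \<le> n" "i \<le> Suc n" "i \<le> n" "Suc j \<le> Suc n" by auto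
    show ?case
      by (rule homs_eqI[OF dc[OF ij(2) dc[OF ij(3) 5(3)]] dc[OF ij(4) dc[OF ij(5) 5(3)]]
            lhs_codeg_codeg[unfolded Suc_eq_plus1[symmetric], OF ij(1,2) 5(3)]])
  next
    case (6 n i j b \<gamma>)
    then have ij: "j \<le> n" "i = j \<or> i = Suc j" "i \<le> Suc n" by auto
    show ?case
      by (rule homs_eqI[OF dc[OF ij(1) fc[OF ij(3) 6(3)]] 6(3)
            lhs_codeg_coface_id[unfolded Suc_eq_plus1[symmetric], OF ij(1,2) 6(3)]])
  next
    case (7 n i j b \<gamma>)
    then have ij: "i < j" "j \<le> Suc n" "i \<le> Suc (Suc n)" "i \<le> Suc n" "j - 1 \<le> n" by auto
    show ?case
      by (rule homs_eqI[OF dc[OF ij(2) fc[OF ij(3) 7(3)]] fc[OF ij(4) dc[OF ij(5) 7(3)]]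
            lhs_codeg_coface_less[OF ij(1,2) 7(3)]])
  next
    case (8 n i j b \<gamma>)
    then have ij: "Suc j < i" "i \<le> Suc (Suc n)" "j \<le> Suc n" "i - 1 \<le> Suc n" "j \<le> n" by auto
    show ?case
      by (rule homs_eqI[OF dc[OF ij(3) fc[OF ij(2) 8(3)]] fc[OF ij(4) dc[OF ij(5) 8(3)]]
            lhs_codeg_coface_greater[unfolded Suc_eq_plus1[symmetric], OF ij(1,2) 8(3)]])
  qed
qed

end

section \<open>Labellings and nested families\<close>

definition ext_lab :: "'v set \<Rightarrow> 'v set \<Rightarrow> nat \<Rightarrow> ('v \<Rightarrow> 'i + nat) \<Rightarrow> 'v \<Rightarrow> 'i + nat" where
  "ext_lab b b' m l = (\<lambda>x\<in>b. if x \<in> b' then l x else Inr m)"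

definition relab :: "'v set \<Rightarrow> (nat \<Rightarrow> nat) \<Rightarrow> ('v \<Rightarrow> 'i + nat) \<Rightarrow> 'v \<Rightarrow> 'i + nat" where
  "relab b \<phi> l = (\<lambda>x\<in>b. map_sum id \<phi> (l x))"

definition surj_labels :: "'i set \<Rightarrow> nat \<Rightarrow> 'v set \<Rightarrow> ('v \<Rightarrow> 'i + nat) set" where
  "surj_labels A n b = {l \<in> b \<rightarrow>\<^sub>E labels A n. Inl ` A \<subseteq> l ` b}"

text \<open>For positive \<open>i\<close>, the preimage of the set labelled \<open>Inr s\<close> under the renumbering \<open>face i\<close> carries the label
  \<open>Inr (coface_relab i s)\<close>, and under \<open>degen j\<close> it carries \<open>Inr (codeg_relab j s)\<close>: the added points
  that are sent to those up to \<open>s - 1\<close> are again those up to some number. The zeroth coface, which is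
  not a renumbering, turns \<open>Inr 1\<close> into the exceptional \<open>Inr 0\<close>.\<close>

definition coface_relab :: "nat \<Rightarrow> nat \<Rightarrow> nat" where
  "coface_relab i s = (if s \<le> i then s else s - 1)"

definition codeg_relab :: "nat \<Rightarrow> nat \<Rightarrow> nat" where
  "codeg_relab j s = (if s \<le> j then s else Suc s)"

lemma labels_Suc: "labels A (Suc n) = insert (Inr (Suc n)) (labels A n)"
  by (auto simp: labels_def)

lemma Inr_Suc_notin_labels: "Inr (Suc n) \<notin> labels A n"
  by (auto simp: labels_def)

lemma ext_lab_surj:
  assumes "l \<in> surj_labels A n b'" "b' \<subseteq> b"
  shows "ext_lab b b' (Suc n) l \<in> surj_labels A (Suc n) b"
proof -
  have "Inl i \<in> ext_lab b b' (Suc n) l ` b" if i: "i \<in> A" for i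
  proof -
    have "Inl i \<in> l ` b'" using assms(1) i by (auto simp: surj_labels_def)
    then obtain x where "x \<in> b'" "l x = Inl i" by fastforce
    then have "ext_lab b b' (Suc n) l x = Inl i" "x \<in> b" using assms(2) by (auto simp: ext_lab_def)
    then show ?thesis by force
  qed
  moreover have "l \<in> b' \<rightarrow>\<^sub>E labels A n" using assms(1) by (simp add: surj_labels_def)
  then have "ext_lab b b' (Suc n) l \<in> b \<rightarrow>\<^sub>E labels A (Suc n)"
    using PiE_mem by (fastforce simp: ext_lab_def labels_Suc restrict_PiE_iff)
  ultimately show ?thesis by (auto simp: surj_labels_def)
qed

lemma restrict_surj:
  assumes "l \<in> surj_labels A (Suc n) b"
  defines "b' \<equiv> {x \<in> b. l x \<noteq> Inr (Suc n)}"
  shows "restrict l b' \<in> surj_labels A n b'" "ext_lab b b' (Suc n) (restrict l b') = l"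
proof -
  have l: "l \<in> b \<rightarrow>\<^sub>E labels A (Suc n)" using assms(1) by (simp add: surj_labels_def)
  have "Inl i \<in> restrict l b' ` b'" if i: "i \<in> A" for i
  proof -
    have "Inl i \<in> l ` b" using assms(1) i by (auto simp: surj_labels_def)
    then obtain x where "x \<in> b" "l x = Inl i" by fastforce
    then have "x \<in> b'" "restrict l b' x = Inl i" by (auto simp: b'_def)
    then show ?thesis by force
  qed
  moreover have "restrict l b' \<in> b' \<rightarrow>\<^sub>E labels A n"
    using PiE_mem[OF l] by (auto simp: b'_def labels_Suc restrict_PiE_iff)
  ultimately show "restrict l b' \<in> surj_labels A n b'" by (auto simp: surj_labels_def)
  show "ext_lab b b' (Suc n) (restrict l b') = l"
  proof
    fix x show "ext_lab b b' (Suc n) (restrict l b') x = l x"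
      using l by (cases "x \<in> b") (auto simp: ext_lab_def b'_def PiE_iff extensional_def)
  qed
qed

lemma ext_lab_restrict:
  assumes "l \<in> b' \<rightarrow>\<^sub>E labels A n" "b' \<subseteq> b"
  shows "{x \<in> b. ext_lab b b' (Suc n) l x \<noteq> Inr (Suc n)} = b'"
    "restrict (ext_lab b b' (Suc n) l) b' = l"
proof -
  have "l x \<noteq> Inr (Suc n)" if "x \<in> b'" for x
    using PiE_mem[OF assms(1) that] Inr_Suc_notin_labels[of n A] by metis
  then show "{x \<in> b. ext_lab b b' (Suc n) l x \<noteq> Inr (Suc n)} = b'"
    using assms(2) by (auto simp: ext_lab_def)
  show "restrict (ext_lab b b' (Suc n) l) b' = l"
  proof
    fix x show "restrict (ext_lab b b' (Suc n) l) b' x = l x"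
      using assms by (cases "x \<in> b'") (auto simp: ext_lab_def PiE_iff extensional_def)
  qed
qed

lemma Inl_surj: "s \<in> Surj b A \<Longrightarrow> (\<lambda>x\<in>b. Inl (s x)) \<in> surj_labels A 0 b"
  by (auto simp: Surj_def surj_labels_def labels_def restrict_PiE_iff image_iff)

lemma projl_surj:
  assumes "l \<in> surj_labels A 0 b"
  shows "(\<lambda>x\<in>b. projl (l x)) \<in> Surj b A" "(\<lambda>x\<in>b. Inl ((\<lambda>x\<in>b. projl (l x)) x)) = l"
proof -
  have l: "\<exists>i \<in> A. l x = Inl i" if "x \<in> b" for x
    using assms that by (auto simp: surj_labels_def labels_def)
  have e: "l \<in> extensional b" using assms by (auto simp: surj_labels_def PiE_iff)
  have "i \<in> (\<lambda>x\<in>b. projl (l x)) ` b" if i: "i \<in> A" for i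
  proof -
    have "Inl i \<in> l ` b" using assms i by (auto simp: surj_labels_def)
    then obtain x where "x \<in> b" "l x = Inl i" by fastforce
    then show ?thesis by force
  qed
  moreover have "projl (l x) \<in> A" if "x \<in> b" for x using l[OF that] by auto
  ultimately show "(\<lambda>x\<in>b. projl (l x)) \<in> Surj b A" by (auto simp: Surj_def restrict_PiE_iff)
  show "(\<lambda>x\<in>b. Inl ((\<lambda>x\<in>b. projl (l x)) x)) = l"
  proof
    fix x show "(\<lambda>x\<in>b. Inl ((\<lambda>x\<in>b. projl (l x)) x)) x = l x"
      using l[of x] e by (cases "x \<in> b") (auto simp: extensional_def)
  qed
qed

context cring
begin

text \<open>The index of a component of an element of \<open>\<bottom>\<^sup>n k Hom(-, A)\<close> consists of nested subsets of \<open>b\<close> and a surjection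
  from the smallest one onto \<open>A\<close>. Points that leave with the passage to the outermost subset get the largest label
  \<open>Inr n\<close>, those that leave in the next step get \<open>Inr (n - 1)\<close>, and so on; points that remain to the end
  are labelled by their image under the surjection. Thus a function on labellings becomes a nested family.\<close>

primrec nestify ::
  "'i set \<Rightarrow> nat \<Rightarrow> 'v set \<Rightarrow> (('v \<Rightarrow> 'i + nat) \<Rightarrow> 'a) \<Rightarrow> ('v set, ('v \<Rightarrow> 'i) \<Rightarrow> 'a) nest" where
  "nestify A 0 b c = Leaf (\<lambda>s. if s \<in> Surj b A then c (\<lambda>x\<in>b. Inl (s x)) else \<zero>)"
| "nestify A (Suc n) b c = Fam (\<lambda>b'\<in>Pow b. nestify A n b' (\<lambda>l. c (ext_lab b b' (Suc n) l)))"

primrec unnest ::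
  "nat \<Rightarrow> 'v set \<Rightarrow> ('v set, ('v \<Rightarrow> 'i) \<Rightarrow> 'a) nest \<Rightarrow> ('v \<Rightarrow> 'i + nat) \<Rightarrow> 'a" where
  "unnest 0 b u l = the_leaf u (\<lambda>x\<in>b. projl (l x))"
| "unnest (Suc n) b u l = (let b' = {x \<in> b. l x \<noteq> Inr (Suc n)} in
     unnest n b' (component u b') (restrict l b'))"

lemma nestify_cong:
  assumes "\<And>l. l \<in> surj_labels A n b \<Longrightarrow> c l = c' l"
  shows "nestify A n b c = nestify A n b c'"
  using assms
proof (induction n arbitrary: b c c')
  case 0
  then have "c (\<lambda>x\<in>b. Inl (s x)) = c' (\<lambda>x\<in>b. Inl (s x))" if "s \<in> Surj b A" for s
    using Inl_surj[OF that] by blast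
  then show ?case by auto
next
  case (Suc n)
  have "nestify A n b' (\<lambda>l. c (ext_lab b b' (Suc n) l)) = nestify A n b' (\<lambda>l. c' (ext_lab b b' (Suc n) l))"
    if "b' \<subseteq> b" for b'
    by (rule Suc.IH) (use Suc.prems ext_lab_surj that in blast)
  then show ?case by (auto intro!: restrict_ext)
qed

lemma unnest_nestify: "l \<in> surj_labels A n b \<Longrightarrow> unnest n b (nestify A n b c) l = c l"
proof (induction n arbitrary: b c l)
  case 0
  then show ?case using projl_surj[OF 0] by simp
next
  case (Suc n)
  let ?b = "{x \<in> b. l x \<noteq> Inr (Suc n)}"
  have "?b \<in> Pow b" by auto
  then have "component (nestify A (Suc n) b c) ?b = nestify A n ?b (\<lambda>l. c (ext_lab b ?b (Suc n) l))"
    by simp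
  then have "unnest (Suc n) b (nestify A (Suc n) b c) l =
      unnest n ?b (nestify A n ?b (\<lambda>l. c (ext_lab b ?b (Suc n) l))) (restrict l ?b)"
    by (simp only: unnest.simps Let_def)
  also have "\<dots> = c (ext_lab b ?b (Suc n) (restrict l ?b))"
    by (rule Suc.IH[OF restrict_surj(1)[OF Suc.prems]])
  also have "\<dots> = c l" by (simp only: restrict_surj(2)[OF Suc.prems])
  finally show ?case .
qed

abbreviation rhs_level where
  "rhs_level A n \<equiv> (botS ^^ n) (leaf_functor (k_Surj R A))"

lemma leaf_mod_carrier: "carrier (leaf_mod M) = Leaf ` carrier M"
  by (simp add: leaf_mod_def)

lemma rhs_fob_0: "fob (rhs_level A 0) b = leaf_mod (free_mod R (Surj b A))"
  by (simp add: leaf_functor_def k_Surj_def)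

lemma rhs_fob_Suc: "fob (rhs_level A (Suc n)) b = dir_sum (Pow b) (fob (rhs_level A n))"
  by (simp add: botS_def)

lemma finite_Surj: "finite b \<Longrightarrow> finite A \<Longrightarrow> finite (Surj b A)"
  unfolding Surj_def by (rule finite_subset[OF _ finite_PiE[of b "\<lambda>_. A"]]) auto

lemma nestify_0_free:
  assumes "finite A" "finite b" "\<And>l. l \<in> surj_labels A 0 b \<Longrightarrow> c l \<in> carrier R"
  shows "(\<lambda>s. if s \<in> Surj b A then c (\<lambda>x\<in>b. Inl (s x)) else \<zero>) \<in> carrier (free_mod R (Surj b A))"
    (is "?v \<in> _")
proof -
  have "{s. ?v s \<noteq> \<zero>} \<subseteq> Surj b A" by auto
  then have "finite {s. ?v s \<noteq> \<zero>}" using finite_Surj[OF assms(2,1)] by (rule finite_subset)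
  moreover have "?v s \<in> carrier R" for s
  proof (cases "s \<in> Surj b A")
    case True
    then show ?thesis using assms(3)[OF Inl_surj[OF True]] by (simp only: if_True)
  qed simp
  ultimately show ?thesis unfolding free_mod_carrier by auto
qed

lemma nestify_closed:
  assumes "finite A" "finite b" "\<And>l. l \<in> surj_labels A n b \<Longrightarrow> c l \<in> carrier R"
  shows "nestify A n b c \<in> carrier (fob (rhs_level A n) b)"
  using assms(2,3)
proof (induction n arbitrary: b c)
  case 0
  show ?case
    unfolding rhs_fob_0 nestify.simps leaf_mod_carrier by (intro imageI nestify_0_free[OF assms(1) 0])
next
  case (Suc n)
  have "nestify A n b' (\<lambda>l. c (ext_lab b b' (Suc n) l)) \<in> carrier (fob (rhs_level A n) b')"
    if "b' \<subseteq> b" for b'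
    by (rule Suc.IH[OF finite_subset[OF that Suc.prems(1)] Suc.prems(2)[OF ext_lab_surj[OF _ that]]])
  then show ?case unfolding rhs_fob_Suc nestify.simps by (auto simp: dir_sum_def intro!: imageI)
qed

lemma nestify_add:
  "nestify A n b c \<oplus>\<^bsub>fob (rhs_level A n) b\<^esub> nestify A n b c' = nestify A n b (\<lambda>l. c l \<oplus> c' l)"
proof (induction n arbitrary: b c c')
  case 0
  show ?case unfolding rhs_fob_0 by (auto simp: leaf_mod_def)
next
  case (Suc n)
  show ?case unfolding rhs_fob_Suc nestify.simps by (auto simp: dir_sum_def Suc.IH intro!: restrict_ext)
qed

lemma nestify_smult:
  "r \<in> carrier R \<Longrightarrow> r \<odot>\<^bsub>fob (rhs_level A n) b\<^esub> nestify A n b c = nestify A n b (\<lambda>l. r \<otimes> c l)"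
proof (induction n arbitrary: b c)
  case 0
  then show ?case unfolding rhs_fob_0 by (auto simp: leaf_mod_def)
next
  case (Suc n)
  show ?case unfolding rhs_fob_Suc nestify.simps
    by (auto simp: dir_sum_def Suc.IH[OF Suc.prems] intro!: restrict_ext)
qed

lemma nestify_zero: "\<zero>\<^bsub>fob (rhs_level A n) b\<^esub> = nestify A n b (\<lambda>l. \<zero>)"
proof (induction n arbitrary: b)
  case 0
  show ?case unfolding rhs_fob_0 by (auto simp: leaf_mod_def)
next
  case (Suc n)
  show ?case unfolding rhs_fob_Suc nestify.simps by (auto simp: dir_sum_def Suc.IH intro!: restrict_ext)
qed

lemma unnest_closed:
  assumes "u \<in> carrier (fob (rhs_level A n) b)"
  shows "unnest n b u l \<in> carrier R"
  using assms
proof (induction n arbitrary: b u l)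
  case 0
  then show ?case unfolding rhs_fob_0 by (auto simp: leaf_mod_def free_mod_carrier)
next
  case (Suc n)
  let ?b = "{x \<in> b. l x \<noteq> Inr (Suc n)}"
  have "component u ?b \<in> carrier (fob (rhs_level A n) ?b)"
    using Suc.prems unfolding rhs_fob_Suc by (auto simp: dir_sum_def)
  then show ?case using Suc.IH by (simp add: Let_def)
qed

lemma nestify_unnest:
  assumes "u \<in> carrier (fob (rhs_level A n) b)"
  shows "nestify A n b (unnest n b u) = u"
  using assms
proof (induction n arbitrary: b u)
  case 0
  then obtain v where v: "u = Leaf v" "v \<in> carrier (free_mod R (Surj b A))"
    unfolding rhs_fob_0 by (auto simp: leaf_mod_def)
  have e: "(\<lambda>x\<in>b. projl ((\<lambda>x\<in>b. Inl (s x)) x)) = s" if "s \<in> Surj b A" for s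
    using that by (auto simp: Surj_def PiE_iff extensional_def)
  then have "(if s \<in> Surj b A then unnest 0 b u (\<lambda>x\<in>b. Inl (s x)) else \<zero>) = v s" for s
  proof (cases "s \<in> Surj b A")
    case True
    then show ?thesis by (simp only: unnest.simps v(1) nest.sel if_True e[OF True])
  next
    case False
    then show ?thesis using v(2) by (simp add: free_mod_carrier)
  qed
  then show ?case by (simp only: nestify.simps v(1))
next
  case (Suc n)
  then obtain g where u: "u = Fam g" and g: "g \<in> (\<Pi>\<^sub>E b'\<in>Pow b. carrier (fob (rhs_level A n) b'))"
    unfolding rhs_fob_Suc by (auto simp: dir_sum_def)
  have "nestify A n b' (\<lambda>l. unnest (Suc n) b u (ext_lab b b' (Suc n) l)) = g b'" if b': "b' \<subseteq> b" for b'
  proof -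
    have "nestify A n b' (\<lambda>l. unnest (Suc n) b u (ext_lab b b' (Suc n) l)) = nestify A n b' (unnest n b' (g b'))"
    proof (rule nestify_cong)
      fix l assume "l \<in> surj_labels A n b'"
      then have "l \<in> b' \<rightarrow>\<^sub>E labels A n" by (simp add: surj_labels_def)
      from ext_lab_restrict[OF this b']
      show "unnest (Suc n) b u (ext_lab b b' (Suc n) l) = unnest n b' (g b') l"
        by (simp add: Let_def u)
    qed
    also have "\<dots> = g b'" by (rule Suc.IH) (use g b' in auto)
    finally show ?thesis .
  qed
  then have "(\<lambda>b'\<in>Pow b. nestify A n b' (\<lambda>l. unnest (Suc n) b u (ext_lab b b' (Suc n) l))) = g"
    using g by (auto simp: PiE_iff extensional_def)
  then show ?case using u by simp
qed

subsection \<open>Structure maps in terms of labellings\<close>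

lemma k_Surj_far_val:
  assumes "finite b" "finite A" "v \<in> carrier (free_mod R (Surj b A))" "s' \<in> Surj b' A"
  shows "far (k_Surj R A) b b' f v s' = (\<Oplus>s \<in> {s \<in> Surj b A. compose b' s f = s'}. v s)"
proof -
  let ?h = "\<lambda>s. if compose b' s f \<in> Surj b' A then gen R (compose b' s f) else \<zero>\<^bsub>free_mod R (Surj b' A)\<^esub>"
  let ?S = "{s \<in> Surj b A. compose b' s f = s'}"
  interpret F: Module.module R "free_mod R (Surj b' A)" by (rule module_free_mod)
  have hc: "?h s \<in> carrier (free_mod R (Surj b' A))" for s
    using gen_carrier[of "compose b' s f" "Surj b' A"] F.zero_closed by (simp del: free_mod_ops)
  have hom: "lin_ext R (free_mod R (Surj b' A)) ?h \<in> mod_hom R (free_mod R (Surj b A)) (free_mod R (Surj b' A))"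
    by (rule lin_ext_hom[OF module_free_mod hc])
  have ev: "(\<lambda>y. y s') \<in> mod_hom R (free_mod R (Surj b' A)) scalar_mod"
    by (rule mod_homI) (auto simp: free_mod_carrier)
  have fin: "finite ?S" using finite_Surj[OF assms(1,2)] by simp
  have "lin_ext R (free_mod R (Surj b' A)) ?h v s' = psum ?S v"
  proof (rule free_mod_hom_eq[OF module_scalar_mod mod_hom_comp[OF hom ev] psum_hom[OF fin] _ assms(3)])
    fix s assume s: "s \<in> Surj b A"
    have "lin_ext R (free_mod R (Surj b' A)) ?h (gen R s) = ?h s"
      by (rule lin_ext_gen[where \<phi> = ?h and y = s, OF module_free_mod hc])
    moreover have "?h s s' = (if compose b' s f = s' then \<one> else \<zero>)"
      using assms(4) by (auto simp: gen_def)
    ultimately show "lin_ext R (free_mod R (Surj b' A)) ?h (gen R s) s' = psum ?S (gen R s)"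
      using s by (simp only: psum_gen[OF fin]) simp
  qed
  then show ?thesis by (simp add: k_Surj_def psum_def)
qed

lemma k_Surj_far_zero:
  assumes "v \<in> carrier (free_mod R (Surj b A))" "s' \<notin> Surj b' A"
  shows "far (k_Surj R A) b b' f v s' = \<zero>"
proof -
  let ?h = "\<lambda>s. if compose b' s f \<in> Surj b' A then gen R (compose b' s f) else \<zero>\<^bsub>free_mod R (Surj b' A)\<^esub>"
  interpret F: Module.module R "free_mod R (Surj b' A)" by (rule module_free_mod)
  have hc: "?h s \<in> carrier (free_mod R (Surj b' A))" for s
    using gen_carrier[of "compose b' s f" "Surj b' A"] F.zero_closed by (simp del: free_mod_ops)
  have "lin_ext R (free_mod R (Surj b' A)) ?h v \<in> carrier (free_mod R (Surj b' A))"
    by (rule mod_hom_closed[OF lin_ext_hom[OF module_free_mod hc] assms(1)])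
  then show ?thesis using assms(2) by (simp add: k_Surj_def free_mod_carrier)
qed

lemma rhs_far_0: "far (rhs_level A 0) b l f u = Leaf (far (k_Surj R A) b l f (the_leaf u))"
  by (simp add: leaf_functor_def)

lemma far_nestify:
  assumes "finite A" "finite b" "bij_betw f l b" "\<And>p. p \<in> surj_labels A n b \<Longrightarrow> c p \<in> carrier R"
  shows "far (rhs_level A n) b l f (nestify A n b c) = nestify A n l (\<lambda>p. c (\<lambda>x\<in>b. p (inv_into l f x)))"
  using assms(2-4)
proof (induction n arbitrary: b l f c)
  case 0
  let ?v = "\<lambda>s. if s \<in> Surj b A then c (\<lambda>x\<in>b. Inl (s x)) else \<zero>"
  have v: "?v \<in> carrier (free_mod R (Surj b A))" by (rule nestify_0_free[OF assms(1) 0(1,3)])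
  have fl: "f ` l = b" "inj_on f l" using 0(2) by (auto simp: bij_betw_def)
  have inv: "inv_into l f x \<in> l" "f (inv_into l f x) = x" if "x \<in> b" for x
    using that fl by (auto intro: inv_into_into f_inv_into_f)
  have "far (k_Surj R A) b l f ?v s' = (if s' \<in> Surj l A then
      c (\<lambda>x\<in>b. (\<lambda>x\<in>l. Inl (s' x)) (inv_into l f x)) else \<zero>)" for s'
  proof (cases "s' \<in> Surj l A")
    case True
    let ?s = "\<lambda>x\<in>b. s' (inv_into l f x)"
    have s'l: "s' \<in> l \<rightarrow>\<^sub>E A" "s' ` l = A" using True by (auto simp: Surj_def)
    have "?s ` b = A"
    proof
      show "?s ` b \<subseteq> A" using s'l inv by auto
      show "A \<subseteq> ?s ` b"
      proof
        fix i assume "i \<in> A"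
        then obtain j where j: "j \<in> l" "s' j = i" using s'l by auto
        then have "?s (f j) = i" "f j \<in> b" using fl by auto
        then show "i \<in> ?s ` b" by force
      qed
    qed
    then have s: "?s \<in> Surj b A" using s'l inv by (auto simp: Surj_def restrict_PiE_iff)
    have cs: "compose l ?s f = s'"
    proof
      fix j show "compose l ?s f j = s' j"
        using s'l fl by (cases "j \<in> l") (auto simp: compose_def PiE_iff extensional_def)
    qed
    have "{s \<in> Surj b A. compose l s f = s'} = {?s}"
    proof (intro equalityI subsetI)
      fix t assume t: "t \<in> {s \<in> Surj b A. compose l s f = s'}"
      have "t x = ?s x" for x
      proof (cases "x \<in> b")
        case True
        have "?s x = compose l t f (inv_into l f x)" using t True by simp
        also have "\<dots> = t x" using inv[OF True] by (simp add: compose_def)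
        finally show ?thesis by simp
      next
        case False
        then show ?thesis using t by (auto simp: Surj_def PiE_iff extensional_def)
      qed
      then show "t \<in> {?s}" by auto
    qed (use s cs in auto)
    then have "far (k_Surj R A) b l f ?v s' = (\<Oplus>s\<in>{?s}. ?v s)"
      using k_Surj_far_val[OF 0(1) assms(1) v True, of f] by simp
    also have "\<dots> = ?v ?s"
    proof -
      have "?v ?s \<in> carrier R" using v by (simp only: free_mod_carrier)
      then show ?thesis using add.finprod_insert[of "{}" ?s ?v] by (simp del: restrict_apply)
    qed
    also have "\<dots> = c (\<lambda>x\<in>b. Inl (?s x))" by (simp only: s if_True)
    also have "(\<lambda>x\<in>b. Inl (?s x)) = (\<lambda>x\<in>b. (\<lambda>x\<in>l. Inl (s' x)) (inv_into l f x))"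
      using inv by (intro restrict_ext) simp
    finally show ?thesis by (simp only: True if_True)
  next
    case False
    then show ?thesis using k_Surj_far_zero[OF v False] by simp
  qed
  then have "far (k_Surj R A) b l f ?v = (\<lambda>s'. if s' \<in> Surj l A then
      c (\<lambda>x\<in>b. (\<lambda>x\<in>l. Inl (s' x)) (inv_into l f x)) else \<zero>)" by (rule ext)
  then show ?case by (simp only: rhs_far_0 nestify.simps nest.sel)
next
  case (Suc n)
  have fl: "f ` l = b" "inj_on f l" using Suc.prems(2) by (auto simp: bij_betw_def)
  have "far (rhs_level A n) (f ` l') l' (restrict f l')
        (nestify A n (f ` l') (\<lambda>p. c (ext_lab b (f ` l') (Suc n) p))) =
      nestify A n l' (\<lambda>p. c (\<lambda>x\<in>b. ext_lab l l' (Suc n) p (inv_into l f x)))" if l': "l' \<subseteq> l" for l'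
  proof -
    have sub: "f ` l' \<subseteq> b" using fl l' by auto
    have bij: "bij_betw (restrict f l') l' (f ` l')"
      using fl l' by (auto simp: bij_betw_def inj_on_def)
    have "far (rhs_level A n) (f ` l') l' (restrict f l')
        (nestify A n (f ` l') (\<lambda>p. c (ext_lab b (f ` l') (Suc n) p))) =
      nestify A n l' (\<lambda>p. c (ext_lab b (f ` l') (Suc n) (\<lambda>x\<in>f ` l'. p (inv_into l' (restrict f l') x))))"
      by (rule Suc.IH[OF finite_subset[OF sub Suc.prems(1)] bij])
        (rule Suc.prems(3)[OF ext_lab_surj[OF _ sub]])
    also have "(\<lambda>p. c (ext_lab b (f ` l') (Suc n) (\<lambda>x\<in>f ` l'. p (inv_into l' (restrict f l') x)))) =
        (\<lambda>p. c (\<lambda>x\<in>b. ext_lab l l' (Suc n) p (inv_into l f x)))"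
    proof (intro ext arg_cong[where f = c])
      fix p :: "_ \<Rightarrow> _ + nat" and x
      show "ext_lab b (f ` l') (Suc n) (\<lambda>x\<in>f ` l'. p (inv_into l' (restrict f l') x)) x =
          (\<lambda>x\<in>b. ext_lab l l' (Suc n) p (inv_into l f x)) x"
      proof (cases "x \<in> b")
        case True
        then obtain j where j: "j \<in> l" "x = f j" using fl by auto
        then have i: "inv_into l f x = j" using fl by simp
        have m: "x \<in> f ` l' \<longleftrightarrow> j \<in> l'" using j fl l' by (auto simp: inj_on_def)
        have "inv_into l' (restrict f l') x = j" if "j \<in> l'"
          using bij_betw_inv_into_left[OF bij that] j that by simp
        then show ?thesis using True i m j by (simp add: ext_lab_def)
      qed (simp add: ext_lab_def)
    qed
    finally show ?thesis .
  qed
  note * = this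
  have "far (rhs_level A (Suc n)) b l f (nestify A (Suc n) b c) =
      Fam (\<lambda>l'\<in>Pow l. far (rhs_level A n) (f ` l') l' (restrict f l')
        (nestify A n (f ` l') (\<lambda>p. c (ext_lab b (f ` l') (Suc n) p))))"
  proof -
    have "component (nestify A (Suc n) b c) (f ` l') = nestify A n (f ` l') (\<lambda>p. c (ext_lab b (f ` l') (Suc n) p))"
      if "l' \<subseteq> l" for l'
      using that fl(1) image_mono[OF that, of f] by simp
    then show ?thesis by (auto simp: botS_def simp del: nestify.simps intro!: restrict_ext)
  qed
  also have "\<dots> = nestify A (Suc n) l (\<lambda>p. c (\<lambda>x\<in>b. p (inv_into l f x)))"
    using * by (auto intro!: restrict_ext)
  finally show ?case .
qed

text \<open>The induction step for structure maps that act inside the outermost subset: such a map cannot affect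
  the largest label other than by renaming it.\<close>

lemma botS_map_nestify:
  assumes "\<And>b'. b' \<subseteq> b \<Longrightarrow> T b' (nestify A n b' (\<lambda>l. c (ext_lab b b' (Suc n) l))) =
      nestify A m b' (\<lambda>l. c (ext_lab b b' (Suc n) (relab b' \<phi> l)))"
    and "\<phi> (Suc m) = Suc n"
  shows "botS_map T b (nestify A (Suc n) b c) = nestify A (Suc m) b (\<lambda>l. c (relab b \<phi> l))"
proof -
  have e: "ext_lab b b' (Suc n) (relab b' \<phi> l) = relab b \<phi> (ext_lab b b' (Suc m) l)"
    if "b' \<subseteq> b" for b' and l :: "_ \<Rightarrow> _ + nat"
    using assms(2) that by (auto simp: ext_lab_def relab_def)
  show ?thesis
    using assms(1) by (auto simp: botS_map_def e intro!: restrict_ext)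
qed

lemma relab_id:
  assumes "l \<in> b \<rightarrow>\<^sub>E labels A n" "\<And>s. s \<le> n \<Longrightarrow> \<phi> s = s"
  shows "relab b \<phi> l = l"
proof
  fix x show "relab b \<phi> l x = l x"
  proof (cases "x \<in> b")
    case True
    then have "l x \<in> labels A n" using assms(1) by auto
    then show ?thesis using True assms(2) by (auto simp: relab_def labels_def)
  next
    case False
    then show ?thesis using assms(1) by (auto simp: relab_def PiE_iff extensional_def)
  qed
qed

lemma ext_lab_same: "l \<in> b \<rightarrow>\<^sub>E S \<Longrightarrow> ext_lab b b m l = l"
  by (auto simp: ext_lab_def PiE_iff extensional_def)

text \<open>The outermost subset is proper exactly if the largest label occurs.\<close>

lemma etaS_nestify:
  assumes "\<And>l. l \<in> b \<rightarrow>\<^sub>E labels A (Suc n) \<Longrightarrow> Inr (Suc n) \<in> l ` b \<Longrightarrow> c l = \<zero>"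
  shows "etaS (rhs_level A n) b (nestify A n b c) = nestify A (Suc n) b c"
proof -
  have "(if b' = b then nestify A n b c else \<zero>\<^bsub>fob (rhs_level A n) b'\<^esub>) =
      nestify A n b' (\<lambda>l. c (ext_lab b b' (Suc n) l))" if b': "b' \<subseteq> b" for b'
  proof (cases "b' = b")
    case True
    have "nestify A n b c = nestify A n b (\<lambda>l. c (ext_lab b b (Suc n) l))"
      by (rule nestify_cong) (auto simp: surj_labels_def ext_lab_same)
    then show ?thesis using True by simp
  next
    case False
    then obtain x where x: "x \<in> b" "x \<notin> b'" using b' by blast
    have "nestify A n b' (\<lambda>l. \<zero>) = nestify A n b' (\<lambda>l. c (ext_lab b b' (Suc n) l))"
    proof (rule nestify_cong)
      fix l assume "l \<in> surj_labels A n b'"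
      from ext_lab_surj[OF this b'] have "ext_lab b b' (Suc n) l \<in> b \<rightarrow>\<^sub>E labels A (Suc n)"
        by (simp add: surj_labels_def)
      moreover have "ext_lab b b' (Suc n) l x = Inr (Suc n)" using x by (simp add: ext_lab_def)
      ultimately show "\<zero> = c (ext_lab b b' (Suc n) l)" using assms x(1) by (metis imageI)
    qed
    then show ?thesis using False by (simp add: nestify_zero)
  qed
  then show ?thesis by (auto simp: etaS_def intro!: restrict_ext)
qed

text \<open>The component of the comultiplication at \<open>b'' \<subseteq> b' \<subseteq> b\<close> does not depend on \<open>b'\<close>, so the label of the points that
  leave first and the label of those that leave second have the same effect.\<close>

lemma DeltaS_nestify:
  assumes "1 \<le> i"
  shows "(botS_map ^^ d) DeltaS b (nestify A (i + d) b c) =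
    nestify A (Suc (i + d)) b (\<lambda>l. c (relab b (coface_relab i) l))"
proof (induction d arbitrary: b c)
  case 0
  obtain m where i: "i = Suc m" using assms by (cases i) auto
  have "nestify A m b'' (\<lambda>l. c (ext_lab b b'' (Suc m) l)) =
      nestify A m b'' (\<lambda>l. c (relab b (coface_relab i)
        (ext_lab b b' (Suc (Suc m)) (ext_lab b' b'' (Suc m) l))))"
    if b: "b' \<subseteq> b" "b'' \<subseteq> b'" for b' b''
  proof (rule nestify_cong)
    fix l assume "l \<in> surj_labels A m b''"
    then have l: "l \<in> b'' \<rightarrow>\<^sub>E labels A m" by (simp add: surj_labels_def)
    have "map_sum id (coface_relab i) (l x) = l x" if "x \<in> b''" for x
      using PiE_mem[OF l that] i by (auto simp: labels_def coface_relab_def)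
    note fixed = this
    have "ext_lab b b'' (Suc m) l =
        relab b (coface_relab i) (ext_lab b b' (Suc (Suc m)) (ext_lab b' b'' (Suc m) l))"
    proof
      fix x
      consider "x \<in> b''" "x \<in> b'" "x \<in> b" | "x \<notin> b''" "x \<in> b'" "x \<in> b" | "x \<notin> b''" "x \<notin> b'" "x \<in> b" | "x \<notin> b"
        using b by blast
      then show "ext_lab b b'' (Suc m) l x =
          relab b (coface_relab i) (ext_lab b b' (Suc (Suc m)) (ext_lab b' b'' (Suc m) l)) x"
        by cases (simp_all add: ext_lab_def relab_def fixed, simp_all add: coface_relab_def i)
    qed
    then show "c (ext_lab b b'' (Suc m) l) = c (relab b (coface_relab i)
        (ext_lab b b' (Suc (Suc m)) (ext_lab b' b'' (Suc m) l)))" by simp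
  qed
  note * = this
  have "DeltaS b (nestify A (Suc m) b c) = Fam (\<lambda>b'\<in>Pow b. Fam (\<lambda>b''\<in>Pow b'.
      nestify A m b'' (\<lambda>l. c (ext_lab b b'' (Suc m) l))))"
    unfolding DeltaS_def nestify.simps nest.sel
    by (intro arg_cong[where f = Fam] restrict_ext) auto
  also have "\<dots> = Fam (\<lambda>b'\<in>Pow b. Fam (\<lambda>b''\<in>Pow b'. nestify A m b'' (\<lambda>l. c (relab b (coface_relab i)
        (ext_lab b b' (Suc (Suc m)) (ext_lab b' b'' (Suc m) l))))))"
    by (intro arg_cong[where f = Fam] restrict_ext) (simp add: *)
  finally show ?case by (simp only: i nestify.simps add_0_right funpow_0)
next
  case (Suc d)
  have "botS_map ((botS_map ^^ d) DeltaS) b (nestify A (Suc (i + d)) b c) =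
      nestify A (Suc (Suc (i + d))) b (\<lambda>l. c (relab b (coface_relab i) l))"
    by (rule botS_map_nestify, rule Suc.IH) (simp add: coface_relab_def)
  then show ?case by simp
qed

text \<open>The component at \<open>b' = b\<close> is the one whose labellings avoid the label of this step; the larger labels
  skip it.\<close>

lemma epsS_nestify:
  "(botS_map ^^ d) epsS b (nestify A (Suc (j + d)) b c) =
    nestify A (j + d) b (\<lambda>l. c (relab b (codeg_relab j) l))"
proof (induction d arbitrary: b c)
  case 0
  have "nestify A j b (\<lambda>l. c (ext_lab b b (Suc j) l)) = nestify A j b (\<lambda>l. c (relab b (codeg_relab j) l))"
  proof (rule nestify_cong)
    fix l assume "l \<in> surj_labels A j b"
    then have l: "l \<in> b \<rightarrow>\<^sub>E labels A j" by (simp add: surj_labels_def)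
    have "relab b (codeg_relab j) l = l" by (rule relab_id[OF l]) (simp add: codeg_relab_def)
    then show "c (ext_lab b b (Suc j) l) = c (relab b (codeg_relab j) l)"
      by (simp add: ext_lab_same[OF l])
  qed
  then show ?case by (simp add: epsS_def)
next
  case (Suc d)
  have "botS_map ((botS_map ^^ d) epsS) b (nestify A (Suc (Suc (j + d))) b c) =
      nestify A (Suc (j + d)) b (\<lambda>l. c (relab b (codeg_relab j) l))"
    by (rule botS_map_nestify, rule Suc.IH) (simp add: codeg_relab_def)
  then show ?case by simp
qed

text \<open>The label \<open>Inr 0\<close> is a placeholder for the sum over all labels \<open>Inl i\<close>: the set for which it stands
  is the disjoint union of the \<open>{\<iota> i}\<close>. The choices for \<open>l\<close> are the ways to fill the placeholders.\<close>

definition choices :: "'i set \<Rightarrow> 'v set \<Rightarrow> ('v \<Rightarrow> 'i + nat) \<Rightarrow> ('v \<Rightarrow> 'i + nat) set" where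
  "choices A b l = (\<Pi>\<^sub>E x\<in>b. if l x = Inr 0 then Inl ` A else {l x})"

definition expands :: "'i set \<Rightarrow> nat \<Rightarrow> 'v set \<Rightarrow> (('v \<Rightarrow> 'i + nat) \<Rightarrow> 'a) \<Rightarrow> bool" where
  "expands A n b c \<longleftrightarrow> (\<forall>q \<in> b \<rightarrow>\<^sub>E labels A n. c q \<in> carrier R) \<and>
     (\<forall>l \<in> b \<rightarrow>\<^sub>E insert (Inr 0) (labels A n). c l = (\<Oplus>q \<in> choices A b l. c q))"

lemma ext_lab_PiE:
  assumes "l \<in> b' \<rightarrow>\<^sub>E S" "b' \<subseteq> b"
  shows "ext_lab b b' m l \<in> b \<rightarrow>\<^sub>E insert (Inr m) S"
  using PiE_mem[OF assms(1)] by (auto simp: ext_lab_def restrict_PiE_iff)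

lemma ext_lab_inj:
  assumes "l \<in> b' \<rightarrow>\<^sub>E S" "l' \<in> b' \<rightarrow>\<^sub>E S" "b' \<subseteq> b" "ext_lab b b' m l = ext_lab b b' m l'"
  shows "l = l'"
proof
  fix x show "l x = l' x"
  proof (cases "x \<in> b'")
    case True
    then show ?thesis using assms(3) fun_cong[OF assms(4), of x] by (auto simp: ext_lab_def)
  next
    case False
    then show ?thesis using assms(1,2) by (auto simp: PiE_iff extensional_def)
  qed
qed

lemma choices_labels:
  assumes "l \<in> b \<rightarrow>\<^sub>E insert (Inr 0) (labels A n)" "q \<in> choices A b l"
  shows "q \<in> b \<rightarrow>\<^sub>E labels A n"
proof (rule PiE_I)
  fix x assume x: "x \<in> b"
  have "q x \<in> (if l x = Inr 0 then Inl ` A else {l x})"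
    using assms(2) x by (auto simp: choices_def dest: PiE_mem)
  then show "q x \<in> labels A n"
    using PiE_mem[OF assms(1) x] by (auto simp: labels_def split: if_splits)
next
  show "q x = undefined" if "x \<notin> b" for x
    using assms(2) that by (auto simp: choices_def PiE_iff extensional_def)
qed

text \<open>Points outside \<open>b'\<close> keep their label, so a labelling and its extension to \<open>b\<close> leave the same choices.\<close>

lemma expands_ext:
  assumes e: "expands A (Suc n) b c" and b': "b' \<subseteq> b"
  shows "expands A n b' (\<lambda>l. c (ext_lab b b' (Suc n) l))"
  unfolding expands_def
proof (intro conjI ballI)
  let ?e = "ext_lab b b' (Suc n)"
  fix q assume "q \<in> b' \<rightarrow>\<^sub>E labels A n"
  then have "?e q \<in> b \<rightarrow>\<^sub>E labels A (Suc n)"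
    using ext_lab_PiE[OF _ b'] by (simp add: labels_Suc)
  then show "c (?e q) \<in> carrier R" using e by (simp add: expands_def)
next
  let ?e = "ext_lab b b' (Suc n)"
  fix l assume l: "l \<in> b' \<rightarrow>\<^sub>E insert (Inr 0) (labels A n)"
  have el: "?e l \<in> b \<rightarrow>\<^sub>E insert (Inr 0) (labels A (Suc n))"
    using ext_lab_PiE[OF l b', of "Suc n"] by (simp add: labels_Suc insert_commute)
  have ch: "choices A b (?e l) = ?e ` choices A b' l"
  proof (intro equalityI subsetI)
    fix q assume q: "q \<in> choices A b (?e l)"
    have qx: "q x \<in> (if ?e l x = Inr 0 then Inl ` A else {?e l x})" if "x \<in> b" for x
      using q that by (auto simp: choices_def dest: PiE_mem)
    have "restrict q b' \<in> choices A b' l"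
      unfolding choices_def restrict_PiE_iff
    proof
      fix x assume "x \<in> b'"
      then show "q x \<in> (if l x = Inr 0 then Inl ` A else {l x})"
        using qx[of x] b' by (auto simp: ext_lab_def)
    qed
    moreover have "?e (restrict q b') = q"
    proof
      fix x
      consider "x \<in> b'" | "x \<in> b" "x \<notin> b'" | "x \<notin> b" using b' by blast
      then show "?e (restrict q b') x = q x"
      proof cases
        case 1
        then show ?thesis using b' by (auto simp: ext_lab_def)
      next
        case 2
        then show ?thesis using qx[of x] by (simp add: ext_lab_def)
      next
        case 3
        then show ?thesis using q by (auto simp: ext_lab_def choices_def PiE_iff extensional_def)
      qed
    qed
    ultimately show "q \<in> ?e ` choices A b' l" by (metis imageI)
  next
    fix q assume "q \<in> ?e ` choices A b' l"
    then obtain q' where q': "q' \<in> choices A b' l" "q = ?e q'" by auto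
    show "q \<in> choices A b (?e l)"
      unfolding choices_def q'(2)
    proof (rule PiE_I)
      fix x assume "x \<in> b"
      then show "?e q' x \<in> (if ?e l x = Inr 0 then Inl ` A else {?e l x})"
        using q'(1) by (auto simp: ext_lab_def choices_def dest: PiE_mem)
    qed (simp add: ext_lab_def)
  qed
  have "c (?e l) = (\<Oplus>q \<in> choices A b (?e l). c q)"
    using e el by (simp add: expands_def)
  also have "\<dots> = (\<Oplus>q \<in> choices A b' l. c (?e q))"
    unfolding ch
  proof (rule finsum_reindex)
    show "c \<in> ?e ` choices A b' l \<rightarrow> carrier R"
      using e choices_labels[OF el] by (auto simp: expands_def ch)
    show "inj_on ?e (choices A b' l)"
      using ext_lab_inj[OF choices_labels[OF l] choices_labels[OF l] b'] by (intro inj_onI)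
  qed
  finally show "c (?e l) = (\<Oplus>q \<in> choices A b' l. c (?e q))" .
qed

text \<open>The component at \<open>s' : b' \<rightarrow> A\<close> of the image under \<open>\<psi>\<close> is the sum of the components at all \<open>s : b \<rightarrow> A\<close> that
  extend \<open>s'\<close>; these are the ways to choose a label \<open>Inl i\<close> for every point outside \<open>b'\<close>.\<close>

lemma psiS_nestify_0:
  assumes "finite A" "finite b" "expands A 0 b c"
  shows "psiS (leaf_functor (k_Surj R A)) b (nestify A 0 b c) =
    nestify A (Suc 0) b (\<lambda>l. c (relab b (coface_relab 0) l))"
proof -
  have cc: "c q \<in> carrier R" if "q \<in> b \<rightarrow>\<^sub>E labels A 0" for q
    using assms(3) that by (simp add: expands_def)
  let ?v = "\<lambda>s. if s \<in> Surj b A then c (\<lambda>x\<in>b. Inl (s x)) else \<zero>"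
  have v: "?v \<in> carrier (free_mod R (Surj b A))"
    by (rule nestify_0_free[OF assms(1) assms(2)]) (auto simp: surj_labels_def intro: cc)
  have "far (k_Surj R A) b b' (\<lambda>j\<in>b'. j) ?v s' = (if s' \<in> Surj b' A then
      c (relab b (coface_relab 0) (ext_lab b b' (Suc 0) (\<lambda>x\<in>b'. Inl (s' x)))) else \<zero>)"
    if b': "b' \<subseteq> b" for b' s'
  proof (cases "s' \<in> Surj b' A")
    case False
    then show ?thesis using k_Surj_far_zero[OF v False] by simp
  next
    case True
    then have s': "s' \<in> b' \<rightarrow>\<^sub>E A" "s' ` b' = A" by (auto simp: Surj_def)
    let ?S = "{s \<in> Surj b A. compose b' s (\<lambda>j\<in>b'. j) = s'}"
    define l where "l = (\<lambda>x\<in>b. if x \<in> b' then Inl (s' x) else Inr 0 :: _ + nat)"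
    have l: "l \<in> b \<rightarrow>\<^sub>E insert (Inr 0) (labels A 0)"
      using s' by (auto simp: l_def labels_def restrict_PiE_iff)
    have lr: "relab b (coface_relab 0) (ext_lab b b' (Suc 0) (\<lambda>x\<in>b'. Inl (s' x))) = l"
      by (auto simp: l_def relab_def ext_lab_def coface_relab_def)
    let ?I = "\<lambda>s. \<lambda>x\<in>b. Inl (s x) :: _ + nat"
    have "choices A b l = ?I ` ?S"
    proof (intro equalityI subsetI)
      fix q assume q: "q \<in> choices A b l"
      have qx: "q x \<in> (if l x = Inr 0 then Inl ` A else {l x})" if "x \<in> b" for x
        using q that by (auto simp: choices_def dest: PiE_mem)
      define s where "s = (\<lambda>x\<in>b. projl (q x))"
      have sb': "s x = s' x" if "x \<in> b'" for x
        using qx[of x] that b' by (auto simp: s_def l_def)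
      have qs: "q x = Inl (s x) \<and> s x \<in> A" if "x \<in> b" for x
        using qx[OF that] that s' by (cases "x \<in> b'") (auto simp: s_def l_def)
      have "s \<in> b \<rightarrow>\<^sub>E A" using qs by (auto simp: s_def restrict_PiE_iff)
      moreover have "A \<subseteq> s ` b"
      proof
        fix i assume "i \<in> A"
        then obtain x where "x \<in> b'" "s' x = i" using s' by auto
        then show "i \<in> s ` b" using sb'[of x] b' by (metis imageI subsetD)
      qed
      ultimately have "s \<in> Surj b A" by (auto simp: Surj_def)
      moreover have "compose b' s (\<lambda>j\<in>b'. j) = s'"
      proof
        fix x show "compose b' s (\<lambda>j\<in>b'. j) x = s' x"
          using sb'[of x] s' by (cases "x \<in> b'") (auto simp: compose_def PiE_iff extensional_def)
      qed
      moreover have "?I s = q"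
      proof
        fix x show "?I s x = q x"
          using qs[of x] q by (cases "x \<in> b") (auto simp: choices_def PiE_iff extensional_def)
      qed
      ultimately show "q \<in> ?I ` ?S" by blast
    next
      fix q assume "q \<in> ?I ` ?S"
      then obtain s where s: "s \<in> Surj b A" "compose b' s (\<lambda>j\<in>b'. j) = s'" "q = ?I s" by auto
      have "s x = s' x" if "x \<in> b'" for x
        using fun_cong[OF s(2), of x] that by (simp add: compose_def)
      moreover have "s x \<in> A" if "x \<in> b" for x using s(1) that by (auto simp: Surj_def)
      ultimately show "q \<in> choices A b l"
        unfolding s(3) choices_def restrict_PiE_iff by (auto simp: l_def)
    qed
    then have "c l = (\<Oplus>q \<in> ?I ` ?S. c q)"
      using assms(3) l by (simp add: expands_def)
    also have "\<dots> = (\<Oplus>s \<in> ?S. c (?I s))"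
    proof (rule finsum_reindex)
      show "c \<in> ?I ` ?S \<rightarrow> carrier R"
        using Inl_surj by (fastforce simp: surj_labels_def intro: cc)
      show "inj_on ?I ?S"
      proof (rule inj_onI)
        fix s t assume st: "s \<in> ?S" "t \<in> ?S" "?I s = ?I t"
        show "s = t"
        proof
          fix x show "s x = t x"
          proof (cases "x \<in> b")
            case True
            then show ?thesis using fun_cong[OF st(3), of x] by simp
          next
            case False
            then show ?thesis using st(1,2) by (auto simp: Surj_def PiE_iff extensional_def)
          qed
        qed
      qed
    qed
    also have "\<dots> = (\<Oplus>s \<in> ?S. ?v s)"
    proof (rule finsum_cong'[OF refl])
      show "?v \<in> ?S \<rightarrow> carrier R" using v by (auto simp: free_mod_carrier)
    qed auto
    also have "\<dots> = far (k_Surj R A) b b' (\<lambda>j\<in>b'. j) ?v s'"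
      by (rule k_Surj_far_val[OF assms(2) assms(1) v True, symmetric])
    finally show ?thesis using True lr by simp
  qed
  then have "far (k_Surj R A) b b' (\<lambda>j\<in>b'. j) ?v = (\<lambda>s'. if s' \<in> Surj b' A then
      c (relab b (coface_relab 0) (ext_lab b b' (Suc 0) (\<lambda>x\<in>b'. Inl (s' x)))) else \<zero>)"
    if "b' \<subseteq> b" for b' using that by (intro ext)
  note * = this
  have "psiS (rhs_level A 0) b (nestify A 0 b c) = Fam (\<lambda>b'\<in>Pow b. Leaf (far (k_Surj R A) b b' (\<lambda>j\<in>b'. j) ?v))"
    by (simp only: psiS_def rhs_far_0 nestify.simps nest.sel)
  also have "\<dots> = nestify A (Suc 0) b (\<lambda>l. c (relab b (coface_relab 0) l))"
    unfolding nestify.simps by (intro arg_cong[where f = Fam] restrict_ext) (simp only: Pow_iff *)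
  finally show ?thesis unfolding funpow_0 .
qed

lemma psiS_nestify:
  assumes "finite A"
  shows "finite b \<Longrightarrow> expands A n b c \<Longrightarrow>
    (botS_map ^^ n) (psiS (leaf_functor (k_Surj R A))) b (nestify A n b c) =
    nestify A (Suc n) b (\<lambda>l. c (relab b (coface_relab 0) l))"
proof (induction n arbitrary: b c)
  case 0
  show ?case unfolding funpow_0 by (rule psiS_nestify_0[OF assms 0])
next
  case (Suc n)
  have "(botS_map ^^ n) (psiS (leaf_functor (k_Surj R A))) b' (nestify A n b' (\<lambda>l. c (ext_lab b b' (Suc n) l))) =
        nestify A (Suc n) b' (\<lambda>l. c (ext_lab b b' (Suc n) (relab b' (coface_relab 0) l)))"
    if b': "b' \<subseteq> b" for b'
    by (rule Suc.IH[OF finite_subset[OF b' Suc.prems(1)] expands_ext[OF Suc.prems(2) b']])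
  note step = botS_map_nestify[where \<phi> = "coface_relab 0" and c = c and b = b and n = n and m = "Suc n"
      and A = A and T = "(botS_map ^^ n) (psiS (leaf_functor (k_Surj R A)))", OF this]
  show ?case unfolding funpow.simps o_apply by (rule step) (simp_all add: coface_relab_def)
qed

section \<open>Coordinates of natural transformations\<close>

lemma form_cong:
  fixes X :: "'u::infinite pset"
  assumes "finite (fst X)" "finite b" "\<And>i. i \<in> b \<Longrightarrow> p i \<subseteq> fst X" "\<And>i. i \<in> b \<Longrightarrow> q i = p i"
    and t: "t \<in> carrier (tens b X)"
  shows "form b q t = form b p t"
  unfolding form_def
proof (rule tensor_form_cong[OF module_reduced _ _ _ t])
  show "psum (p i) \<in> mod_hom R (reduced X) scalar_mod" if "i \<in> b" for i
    using assms(1) assms(3)[OF that] by (meson finite_subset psum_reduced_hom)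
qed (use assms in auto)

lemma form_empty:
  fixes X :: "'u::infinite pset"
  assumes "finite (fst X)" "finite b" "\<And>i. i \<in> b \<Longrightarrow> p i \<subseteq> fst X" "i \<in> b" "p i = {}"
    and t: "t \<in> carrier (tens b X)"
  shows "form b p t = \<zero>"
  unfolding form_def
proof (rule tensor_form_zero[OF module_reduced _ _ _ _ t])
  show "psum (p i) \<in> mod_hom R (reduced X) scalar_mod" if "i \<in> b" for i
    using assms(1) assms(3)[OF that] by (meson finite_subset psum_reduced_hom)
  show "psum (p i) v = \<zero>" for v using assms(5) by (simp add: psum_def)
qed fact+

lemma dual_basis_points:
  fixes X :: "'u::infinite pset"
  assumes X: "X \<in> obj Gamma"
  shows "dual_basis (reduced X) (fst X - {snd X}) (\<lambda>w. psum {w}) (\<lambda>w. diff w (snd X))"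
proof -
  have "bij_betw id (fst X - {snd X}) (fst X - {snd X})" by simp
  from dual_basis_reduced[OF X this, of 0]
  have d: "dual_basis (reduced X) (Inl ` (fst X - {snd X})) (\<lambda>l. psum (lab id X l)) (bas id X)"
    by (simp add: labels_def)
  have "finite (fst X - {snd X})" using X by (simp add: obj_Gamma)
  then show ?thesis
    using d by (simp add: dual_basis_def lab_simps bas_def image_image)
qed

definition point_tensor :: "'i set \<Rightarrow> 'u::infinite pset \<Rightarrow> ('i \<Rightarrow> 'u) \<Rightarrow> (('i \<Rightarrow> 'u \<Rightarrow> 'a) \<Rightarrow> 'a) set" where
  "point_tensor A X g = pure_tensor A (reduced X) (\<lambda>i\<in>A. diff (g i) (snd X))"

lemma point_tensor_closed:
  fixes X :: "'u::infinite pset"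
  shows "X \<in> obj Gamma \<Longrightarrow> (\<And>i. i \<in> A \<Longrightarrow> g i \<in> fst X) \<Longrightarrow> point_tensor A X g \<in> carrier (tens A X)"
  unfolding point_tensor_def
  by (rule pure_tensor_closed) (auto simp: restrict_PiE_iff obj_Gamma intro!: diff_closed)

lemma point_tensor_zero:
  fixes X :: "'u::infinite pset"
  assumes X: "X \<in> obj Gamma" and g: "\<And>i. i \<in> A \<Longrightarrow> g i \<in> fst X" and i: "i \<in> A" "g i = snd X"
  shows "point_tensor A X g = \<zero>\<^bsub>tens A X\<^esub>"
  unfolding point_tensor_def
proof (rule pure_tensor_zero[OF module_reduced _ i(1)])
  show "finite (fst X)" using X by (simp add: obj_Gamma)
  show "(\<lambda>i\<in>A. diff (g i) (snd X)) \<in> A \<rightarrow>\<^sub>E carrier (reduced X)"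
    using X g by (auto simp: restrict_PiE_iff obj_Gamma intro!: diff_closed)
  show "(\<lambda>i\<in>A. diff (g i) (snd X)) i = \<zero>\<^bsub>reduced X\<^esub>" using i by (simp add: diff_self)
qed

lemma push_point_tensor:
  fixes X X' :: "'u::infinite pset"
  assumes X: "X \<in> obj Gamma" and X': "X' \<in> obj Gamma" and f: "f \<in> arr Gamma X X'"
    and g: "\<And>i. i \<in> A \<Longrightarrow> g i \<in> fst X"
  shows "push A X' f (point_tensor A X g) = point_tensor A X' (\<lambda>i. f (g i))"
proof -
  have "f \<in> fst X \<rightarrow> fst X'" "f (snd X) = snd X'" using f by (auto simp: arr_Gamma)
  then show ?thesis
    unfolding point_tensor_def using X X' g by (subst push_diffs[where X = X]) (auto simp: obj_Gamma)
qed

lemma hom_eq_on_points: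
  fixes X :: "'u::infinite pset"
  assumes X: "X \<in> obj Gamma" and A: "finite A" and N: "Module.module R N"
    and h: "\<phi> \<in> mod_hom R (tens A X) N" "\<psi> \<in> mod_hom R (tens A X) N"
    and eq: "\<And>g. g \<in> A \<rightarrow>\<^sub>E fst X - {snd X} \<Longrightarrow> \<phi> (point_tensor A X g) = \<psi> (point_tensor A X g)"
    and t: "t \<in> carrier (tens A X)"
  shows "\<phi> t = \<psi> t"
  by (rule tensor_basis_hom_eq[OF module_reduced A dual_basis_points[OF X] N h _ t])
    (use X eq in \<open>auto simp: obj_Gamma point_tensor_def\<close>)

lemma hom_expansion:
  fixes X :: "'u::infinite pset"
  assumes X: "X \<in> obj Gamma" and A: "finite A" and N: "Module.module R N"
    and h: "\<phi> \<in> mod_hom R (tens A X) N" and t: "t \<in> carrier (tens A X)"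
  shows "\<phi> t = (\<Oplus>\<^bsub>N\<^esub>g \<in> A \<rightarrow>\<^sub>E fst X - {snd X}.
    form A (\<lambda>i. {g i}) t \<odot>\<^bsub>N\<^esub> \<phi> (point_tensor A X g))"
proof -
  let ?G = "A \<rightarrow>\<^sub>E fst X - {snd X}"
  have fX: "finite (fst X)" using X by (simp add: obj_Gamma)
  note T = module_tensor_pow[OF module_reduced[OF fX], of A]
  interpret T: Module.module R "tens A X" by (rule T)
  interpret N: Module.module R N by (rule N)
  have p: "point_tensor A X g \<in> carrier (tens A X)" if "g \<in> ?G" for g
    using that by (intro point_tensor_closed[OF X]) auto
  have f: "form A (\<lambda>i. {g i}) t \<in> carrier R" if "g \<in> ?G" for g
  proof -
    have "form A (\<lambda>i. {g i}) \<in> mod_hom R (tens A X) scalar_mod"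
      by (rule form_hom[OF fX A]) (use that in auto)
    from mod_hom_closed[OF this t] show ?thesis by simp
  qed
  have "t = (\<Oplus>\<^bsub>tens A X\<^esub>g \<in> ?G. form A (\<lambda>i. {g i}) t \<odot>\<^bsub>tens A X\<^esub> point_tensor A X g)"
    using tensor_expansion[OF module_reduced[OF fX] A dual_basis_points[OF X] t]
    by (simp add: form_def point_tensor_def)
  then have "\<phi> t = \<phi> (\<Oplus>\<^bsub>tens A X\<^esub>g \<in> ?G. form A (\<lambda>i. {g i}) t \<odot>\<^bsub>tens A X\<^esub> point_tensor A X g)"
    by simp
  also have "\<dots> = (\<Oplus>\<^bsub>N\<^esub>g \<in> ?G. \<phi> (form A (\<lambda>i. {g i}) t \<odot>\<^bsub>tens A X\<^esub> point_tensor A X g))"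
    by (rule mod_hom_finsum[OF T N h]) (use p f in auto)
  also have "\<dots> = (\<Oplus>\<^bsub>N\<^esub>g \<in> ?G. form A (\<lambda>i. {g i}) t \<odot>\<^bsub>N\<^esub> \<phi> (point_tensor A X g))"
  proof (rule N.finsum_cong'[OF refl])
    show "(\<lambda>g. form A (\<lambda>i. {g i}) t \<odot>\<^bsub>N\<^esub> \<phi> (point_tensor A X g)) \<in> ?G \<rightarrow> carrier N"
      using p f mod_hom_closed[OF h] by auto
  qed (use p f in \<open>simp add: mod_hom_smult[OF h]\<close>)
  finally show ?thesis .
qed

end

text \<open>A copy of \<open>A\<close> with an added base point inside the type of points, which represents tuples indexed by \<open>A\<close>: a pointed map
  \<open>Y \<rightarrow> X\<close> is the same thing as a map \<open>A \<rightarrow> X\<close>.\<close>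

locale pointed_enumeration = cring R for R :: "('a, 'b) ring_scheme" (structure) +
  fixes A :: "'i set" and Y :: "'u::infinite pset" and \<iota> :: "'i \<Rightarrow> 'u"
  assumes A: "finite A" and Y: "Y \<in> obj Gamma" and \<iota>: "bij_betw \<iota> A (fst Y - {snd Y})"
begin

lemma finY: "finite (fst ((plus_pt ^^ n) Y))"
  by (rule finite_iter_plus[OF Y])

lemma iota: "i \<in> A \<Longrightarrow> \<iota> i \<in> fst Y" "i \<in> A \<Longrightarrow> \<iota> i \<noteq> snd Y"
  using \<iota> by (auto simp: bij_betw_def)

lemma iota_inj: "i \<in> A \<Longrightarrow> j \<in> A \<Longrightarrow> \<iota> i = \<iota> j \<longleftrightarrow> i = j"
  using \<iota> by (auto simp: bij_betw_def inj_on_def)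

lemma iota_cases:
  assumes "w \<in> fst Y"
  obtains "w = snd Y" | i where "i \<in> A" "w = \<iota> i"
  using assms \<iota> by (auto simp: bij_betw_def image_iff)

lemma mark_iota: "i \<in> A \<Longrightarrow> 0 < r \<Longrightarrow> mark Y r \<noteq> \<iota> i"
  using iota mark_notin_base[OF Y] by metis

lemma snd_Y: "snd Y \<in> fst Y"
  using Y by (simp add: obj_Gamma)

text \<open>The generic tensor: every tensor of differences with the base point is its image under a pointed map.\<close>

definition univ :: "(('i \<Rightarrow> 'u \<Rightarrow> 'a) \<Rightarrow> 'a) set" where
  "univ = point_tensor A Y \<iota>"

lemma univ_closed: "univ \<in> carrier (tens A Y)"
  unfolding univ_def by (rule point_tensor_closed[OF Y iota(1)])

text \<open>The coordinate of \<open>\<gamma>\<close> at the labelling \<open>l\<close>. For \<open>l\<close> with values in \<open>labels A n\<close> these are the coordinates of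
  \<open>\<gamma> Y univ\<close> in a basis; the value \<open>Inr 0\<close> is admitted too, in order to express the zeroth coface.\<close>

definition coef :: "'v set \<Rightarrow> ('u pset \<Rightarrow> (('i \<Rightarrow> 'u \<Rightarrow> 'a) \<Rightarrow> 'a) set \<Rightarrow> (('v \<Rightarrow> 'u \<Rightarrow> 'a) \<Rightarrow> 'a) set) \<Rightarrow>
    ('v \<Rightarrow> 'i + nat) \<Rightarrow> 'a" where
  "coef b \<gamma> l = form b (\<lambda>x. lab \<iota> Y (l x)) (\<gamma> Y univ)"

lemma lab_subset:
  assumes "l \<in> insert (Inr 0) (labels A (Suc n))"
  shows "lab \<iota> Y l \<subseteq> fst ((plus_pt ^^ n) Y)"
proof (cases l)
  case (Inl i)
  then have "i \<in> A" using assms by (auto simp: labels_def)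
  then show ?thesis using Inl iota fst_subset_iter_plus[of Y n] by (auto simp: lab_simps)
next
  case (Inr s)
  then have "s \<le> Suc n" using assms by (auto simp: labels_def)
  then show ?thesis using Inr by (cases s) (auto simp: lab_simps fst_iter_plus)
qed

lemma coef_closed:
  assumes "finite b" "\<gamma> \<in> carrier (homs A n b)" "l \<in> b \<rightarrow>\<^sub>E labels A n"
  shows "coef b \<gamma> l \<in> carrier R"
proof -
  have "lab \<iota> Y (l x) \<subseteq> fst ((plus_pt ^^ n) Y)" if "x \<in> b" for x
    using PiE_mem[OF assms(3) that] by (intro lab_subset) (auto simp: labels_Suc)
  from mod_hom_closed[OF form_hom[OF finY assms(1) this] homs_closed[OF assms(2) Y univ_closed]]
  show ?thesis by (simp add: coef_def)
qed

lemma
  assumes "finite b" "l \<in> b \<rightarrow>\<^sub>E labels A n" "\<gamma> \<in> carrier (homs A n b)"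
  shows coef_add: "\<gamma>' \<in> carrier (homs A n b) \<Longrightarrow>
      coef b (\<gamma> \<oplus>\<^bsub>homs A n b\<^esub> \<gamma>') l = coef b \<gamma> l \<oplus> coef b \<gamma>' l"
    and coef_smult: "r \<in> carrier R \<Longrightarrow> coef b (r \<odot>\<^bsub>homs A n b\<^esub> \<gamma>) l = r \<otimes> coef b \<gamma> l"
proof -
  have "lab \<iota> Y (l x) \<subseteq> fst ((plus_pt ^^ n) Y)" if "x \<in> b" for x
    using PiE_mem[OF assms(2) that] by (intro lab_subset) (auto simp: labels_Suc)
  note h = form_hom[OF finY assms(1) this]
  have u: "univ \<in> carrier (fob (tfun A) Y)" using univ_closed by (simp add: tfun_fob)
  note c = homs_closed[OF _ Y univ_closed]
  show "\<gamma>' \<in> carrier (homs A n b) \<Longrightarrow>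
      coef b (\<gamma> \<oplus>\<^bsub>homs A n b\<^esub> \<gamma>') l = coef b \<gamma> l \<oplus> coef b \<gamma>' l"
    unfolding coef_def nat_mod_add_val[OF Y u] tfun_iter_fob
    using mod_hom_add[OF h c[OF assms(3)] c] by simp
  show "r \<in> carrier R \<Longrightarrow> coef b (r \<odot>\<^bsub>homs A n b\<^esub> \<gamma>) l = r \<otimes> coef b \<gamma> l"
    unfolding coef_def nat_mod_smult_val[OF Y u] tfun_iter_fob
    using mod_hom_smult[OF h _ c[OF assms(3)]] by simp
qed

text \<open>In degree \<open>n\<close> the label \<open>Inr (Suc n)\<close> stands for the whole of \<open>Y\<close> with all \<open>n\<close> added points.\<close>

lemma coef_whole:
  assumes b: "finite b" and \<gamma>: "\<gamma> \<in> carrier (homs A n b)" and l: "l \<in> b \<rightarrow>\<^sub>E labels A (Suc n)"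
    and "Inr (Suc n) \<in> l ` b"
  shows "coef b \<gamma> l = \<zero>"
proof -
  obtain x where x: "x \<in> b" "l x = Inr (Suc n)" using assms(4) by fastforce
  show ?thesis unfolding coef_def
  proof (rule form_whole[OF finY b _ x(1) _ homs_closed[OF \<gamma> Y univ_closed]])
    show "lab \<iota> Y (l x) \<subseteq> fst ((plus_pt ^^ n) Y)" if "x \<in> b" for x
      using PiE_mem[OF l that] by (intro lab_subset) simp
    show "lab \<iota> Y (l x) = fst ((plus_pt ^^ n) Y)" by (simp add: x lab_simps)
  qed
qed

lemma psum_nonbase_bas:
  assumes "m \<in> labels A n"
  shows "psum (lab \<iota> Y (Inr 0)) (bas \<iota> Y m) = (if m \<in> Inl ` A then \<one> else \<zero>)"
proof -
  have fin: "finite (fst Y - {snd Y})" using Y by (simp add: obj_Gamma)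
  have z: "\<one> \<ominus> \<zero> = \<one>" "\<zero> \<ominus> \<zero> = \<zero>" by (auto simp: a_minus_def)
  show ?thesis
  proof (cases m)
    case (Inl i)
    then have "i \<in> A" using assms by (auto simp: labels_def)
    then show ?thesis using Inl iota by (simp add: lab_simps bas_def psum_diff[OF fin] z)
  next
    case (Inr s)
    then obtain r where r: "s = Suc r" using assms by (cases s) (auto simp: labels_def)
    have "mark Y r \<notin> fst Y - {snd Y}"
      using mark_notin_base[OF Y, of r] by (cases "r = 0") (auto simp: mark_0)
    moreover have "mark Y (Suc r) \<notin> fst Y - {snd Y}" using mark_notin_base[OF Y, of "Suc r"] by simp
    ultimately show ?thesis using Inr r
      by (auto simp: lab_simps bas_def psum_diff[OF fin] z)
  qed
qed

text \<open>Both sides are linear, and on basis tensors the factor for a label \<open>Inr 0\<close> is the indicator of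
  the labels \<open>Inl i\<close>, because the set without base point is the union of the \<open>{\<iota> i}\<close>.\<close>

lemma form_expands:
  assumes b: "finite b" and t: "t \<in> carrier (tens b ((plus_pt ^^ n) Y))"
  shows "expands A n b (\<lambda>l. form b (\<lambda>x. lab \<iota> Y (l x)) t)"
  unfolding expands_def
proof (intro conjI ballI)
  let ?T = "tens b ((plus_pt ^^ n) Y)"
  let ?f = "\<lambda>l. form b (\<lambda>x. lab \<iota> Y (l x))"
  have hom: "?f l \<in> mod_hom R ?T scalar_mod" if l: "l \<in> b \<rightarrow>\<^sub>E insert (Inr 0) (labels A n)" for l
  proof (rule form_hom[OF finY b])
    show "lab \<iota> Y (l x) \<subseteq> fst ((plus_pt ^^ n) Y)" if "x \<in> b" for x
      using PiE_mem[OF l that] by (intro lab_subset) (auto simp: labels_Suc)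
  qed
  have hom': "?f l \<in> mod_hom R ?T scalar_mod" if "l \<in> b \<rightarrow>\<^sub>E labels A n" for l
    by (rule hom) (use that in auto)
  show "?f q t \<in> carrier R" if "q \<in> b \<rightarrow>\<^sub>E labels A n" for q
    using mod_hom_closed[OF hom'[OF that] t] by simp
  fix l assume l: "l \<in> b \<rightarrow>\<^sub>E insert (Inr 0) (labels A n)"
  note d = dual_basis_reduced[OF Y \<iota>, of n]
  note mr = module_reduced[OF finY[of n]]
  have finC: "finite (choices A b l)" unfolding choices_def using A b by (intro finite_PiE) auto
  have "?f l t = (\<Oplus>\<^bsub>scalar_mod\<^esub>q \<in> choices A b l. ?f q t)"
  proof (rule tensor_basis_hom_eq[OF mr b d module_scalar_mod hom[OF l] _ _ t])
    show "(\<lambda>t. \<Oplus>\<^bsub>scalar_mod\<^esub>q \<in> choices A b l. ?f q t) \<in> mod_hom R ?T scalar_mod"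
      by (rule finsum_hom[OF module_tensor_pow[OF mr] module_scalar_mod hom'[OF choices_labels[OF l]]])
    fix m assume m: "m \<in> b \<rightarrow>\<^sub>E labels A n"
    let ?e = "pure_tensor b (reduced ((plus_pt ^^ n) Y)) (\<lambda>i\<in>b. bas \<iota> Y (m i))"
    have "?f l ?e = (\<Otimes>x\<in>b. psum (lab \<iota> Y (l x)) ((\<lambda>i\<in>b. bas \<iota> Y (m i)) x))"
      unfolding form_def
      by (rule tensor_form_pure[OF mr b psum_reduced_hom[OF finite_lab[OF Y]] basis_tuple[OF d m]])
    also have "\<dots> = (\<Otimes>x\<in>b. if m x \<in> (if l x = Inr 0 then Inl ` A else {l x}) then \<one> else \<zero>)"
    proof (rule finprod_cong'[OF refl])
      fix x assume x: "x \<in> b"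
      then have mx: "m x \<in> labels A n" using m by auto
      show "psum (lab \<iota> Y (l x)) ((\<lambda>i\<in>b. bas \<iota> Y (m i)) x) =
          (if m x \<in> (if l x = Inr 0 then Inl ` A else {l x}) then \<one> else \<zero>)"
      proof (cases "l x = Inr 0")
        case True
        then show ?thesis using x psum_nonbase_bas[OF mx] by simp
      next
        case False
        then have "l x \<in> labels A n" using l x by auto
        then show ?thesis using False x d mx by (auto simp: dual_basis_def)
      qed
    qed auto
    also have "\<dots> = (if m \<in> choices A b l then \<one> else \<zero>)"
      using m by (auto simp: finprod_indicator[OF b] choices_def PiE_iff)
    also have "\<dots> = (\<Oplus>q \<in> choices A b l. if m = q then \<one> else \<zero>)"
    proof (cases "m \<in> choices A b l")
      case True
      then show ?thesis using finsum_singleton[OF True finC, of "\<lambda>_. \<one>"] by simp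
    next
      case False
      then have "(\<Oplus>q \<in> choices A b l. if m = q then \<one> else \<zero>) = (\<Oplus>q \<in> choices A b l. \<zero>)"
        by (intro finsum_cong') auto
      then show ?thesis using False by simp
    qed
    also have "\<dots> = (\<Oplus>q \<in> choices A b l. ?f q ?e)"
    proof -
      have e: "(if m = q then \<one> else \<zero>) = ?f q ?e" if "q \<in> choices A b l" for q
        unfolding form_def using tensor_form_basis[OF mr b d choices_labels[OF l that] m] by simp
      show ?thesis
      proof (rule finsum_cong'[OF refl])
        show "(\<lambda>q. ?f q ?e) \<in> choices A b l \<rightarrow> carrier R"
          using e by (metis (no_types, lifting) Pi_I one_closed zero_closed)
      qed (rule e)
    qed
    also have "\<dots> = (\<Oplus>\<^bsub>scalar_mod\<^esub>q \<in> choices A b l. ?f q ?e)" by simp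
    finally show "?f l ?e = (\<Oplus>\<^bsub>scalar_mod\<^esub>q \<in> choices A b l. ?f q ?e)" .
  qed
  then show "?f l t = (\<Oplus>q \<in> choices A b l. ?f q t)" by simp
qed

lemma coef_expands: "finite b \<Longrightarrow> \<gamma> \<in> carrier (homs A n b) \<Longrightarrow> expands A n b (coef b \<gamma>)"
  using form_expands[OF _ homs_closed[OF _ Y univ_closed]] by (simp add: coef_def[abs_def])

subsection \<open>Structure maps in coordinates\<close>

lemma relab_val: "x \<in> b \<Longrightarrow> relab b \<phi> l x = map_sum id \<phi> (l x)"
  by (simp add: relab_def)

lemma lab_preimage:
  assumes P: "lab \<iota> Y l' \<subseteq> fst ((plus_pt ^^ n) Y)"
    and base: "\<And>w. w \<in> fst Y \<Longrightarrow> f w \<in> lab \<iota> Y l \<longleftrightarrow> w \<in> lab \<iota> Y l'"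
    and marks: "\<And>r. 1 \<le> r \<Longrightarrow> r \<le> n \<Longrightarrow> f (mark Y r) \<in> lab \<iota> Y l \<longleftrightarrow> mark Y r \<in> lab \<iota> Y l'"
  shows "{w \<in> fst ((plus_pt ^^ n) Y). f w \<in> lab \<iota> Y l} = lab \<iota> Y l'"
proof (intro equalityI subsetI)
  fix w assume "w \<in> {w \<in> fst ((plus_pt ^^ n) Y). f w \<in> lab \<iota> Y l}"
  then have w: "w \<in> fst ((plus_pt ^^ n) Y)" "f w \<in> lab \<iota> Y l" by auto
  from w(1) show "w \<in> lab \<iota> Y l'"
    by (cases rule: iter_plus_cases) (use w(2) base marks in auto)
next
  fix w assume w: "w \<in> lab \<iota> Y l'"
  then have w': "w \<in> fst ((plus_pt ^^ n) Y)" using P by blast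
  then have "f w \<in> lab \<iota> Y l"
    by (cases rule: iter_plus_cases) (use w base marks in auto)
  then show "w \<in> {w \<in> fst ((plus_pt ^^ n) Y). f w \<in> lab \<iota> Y l}" using w' by simp
qed

lemma mark_lab: "0 < r \<Longrightarrow> mark Y r \<in> lab \<iota> Y (Inr s) \<longleftrightarrow> Suc r \<le> s"
  using mark_notin_base[OF Y, of r] by (cases s) (auto simp: lab_simps mark_in_iff[OF Y])

lemma mark_lab_Inl: "i \<in> A \<Longrightarrow> 0 < r \<Longrightarrow> mark Y r \<notin> lab \<iota> Y (Inl i)"
  using mark_iota by (simp add: lab_simps)

lemma base_lab: "w \<in> fst Y \<Longrightarrow> 0 < s \<Longrightarrow> w \<in> lab \<iota> Y (Inr s)"
  using fst_subset_iter_plus[of Y "s - 1"] by (cases s) (auto simp: lab_simps)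

lemma labels_cases:
  assumes "l \<in> labels A n"
  obtains i where "i \<in> A" "l = Inl i" | s where "1 \<le> s" "s \<le> n" "l = Inr s"
  using assms by (auto simp: labels_def)

lemma coface_relab_label:
  assumes "i \<le> Suc n" "l \<in> labels A (Suc n)"
  shows "map_sum id (coface_relab i) l \<in> insert (Inr 0) (labels A (Suc n))"
  using assms(2) by (cases rule: labels_cases) (auto simp: coface_relab_def labels_def image_iff)

lemma lab_preimage_face:
  assumes i: "1 \<le> i" "i \<le> Suc n" and l: "l \<in> labels A (Suc n)"
  shows "{w \<in> fst ((plus_pt ^^ n) Y). renum Y (face i) w \<in> lab \<iota> Y l} = lab \<iota> Y (map_sum id (coface_relab i) l)"
  using l
proof (cases rule: labels_cases)
  case (1 j)
  show ?thesis
    by (rule lab_preimage[OF lab_subset[OF coface_relab_label[OF i(2) l]]])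
      (use 1 in \<open>auto simp: renum_base renum_mark[OF Y] mark_lab_Inl face_def\<close>)
next
  case (2 s)
  have s: "0 < coface_relab i s" using 2 i by (auto simp: coface_relab_def)
  show ?thesis
  proof (rule lab_preimage[OF lab_subset[OF coface_relab_label[OF i(2) l]]])
    fix r assume r: "1 \<le> r" "r \<le> n"
    have "renum Y (face i) (mark Y r) \<in> lab \<iota> Y l \<longleftrightarrow> Suc (face i r) \<le> s"
      using r 2 by (simp add: renum_mark[OF Y] mark_lab face_def)
    also have "\<dots> \<longleftrightarrow> Suc r \<le> coface_relab i s" by (auto simp: face_def coface_relab_def)
    finally show "renum Y (face i) (mark Y r) \<in> lab \<iota> Y l \<longleftrightarrow> mark Y r \<in> lab \<iota> Y (map_sum id (coface_relab i) l)"
      using r 2 by (simp add: mark_lab)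
  qed (use 2 s in \<open>simp add: renum_base base_lab\<close>)
qed

lemma codeg_relab_label:
  assumes "j \<le> n" "l \<in> labels A n"
  shows "map_sum id (codeg_relab j) l \<in> labels A (Suc n)"
  using assms(2) by (cases rule: labels_cases) (auto simp: codeg_relab_def labels_def)

lemma lab_preimage_degen:
  assumes j: "j \<le> n" and l: "l \<in> labels A n"
  shows "{w \<in> fst ((plus_pt ^^ Suc n) Y). renum Y (degen j) w \<in> lab \<iota> Y l} = lab \<iota> Y (map_sum id (codeg_relab j) l)"
proof -
  have sub: "lab \<iota> Y (map_sum id (codeg_relab j) l) \<subseteq> fst ((plus_pt ^^ Suc n) Y)"
    using codeg_relab_label[OF j l] by (intro lab_subset) (simp add: labels_Suc)
  have m: "renum Y (degen j) (mark Y r) = mark Y (degen j r)" for r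
    by (rule renum_mark'[OF Y]) (simp add: degen_def)
  from l show ?thesis
  proof (cases rule: labels_cases)
    case (1 i)
    have "mark Y r \<noteq> \<iota> i" for r
      using mark_iota[OF 1(1), of r] iota(2)[OF 1(1)] by (cases "r = 0") (auto simp: mark_0)
    note mi = this
    show ?thesis
      by (rule lab_preimage[OF sub]) (use 1 mi in \<open>auto simp: renum_base m lab_simps\<close>)
  next
    case (2 s)
    have s: "0 < codeg_relab j s" using 2 by (auto simp: codeg_relab_def)
    show ?thesis
    proof (rule lab_preimage[OF sub])
      fix r assume r: "1 \<le> r" "r \<le> Suc n"
      have "renum Y (degen j) (mark Y r) \<in> lab \<iota> Y l \<longleftrightarrow> Suc (degen j r) \<le> s"
      proof (cases "degen j r = 0")
        case True
        then show ?thesis using 2 base_lab[OF snd_Y] by (simp add: m mark_0)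
      next
        case False
        then show ?thesis using 2 by (simp add: m mark_lab)
      qed
      also have "\<dots> \<longleftrightarrow> Suc r \<le> codeg_relab j s" using r by (auto simp: degen_def codeg_relab_def)
      finally show "renum Y (degen j) (mark Y r) \<in> lab \<iota> Y l \<longleftrightarrow> mark Y r \<in> lab \<iota> Y (map_sum id (codeg_relab j) l)"
        using r 2 by (simp add: mark_lab)
    qed (use 2 s in \<open>simp add: renum_base base_lab\<close>)
  qed
qed

lemma coef_coface_pos:
  assumes b: "finite b" and \<gamma>: "\<gamma> \<in> carrier (homs A n b)" and i: "1 \<le> i" "i \<le> Suc n"
    and l: "l \<in> b \<rightarrow>\<^sub>E labels A (Suc n)"
  shows "coef b (coface (lhs A) n i b \<gamma>) l = coef b \<gamma> (relab b (coface_relab i) l)"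
proof -
  note t = homs_closed[OF \<gamma> Y univ_closed]
  have lx: "l x \<in> labels A (Suc n)" if "x \<in> b" for x using l that by auto
  have "coef b (coface (lhs A) n i b \<gamma>) l =
      form b (\<lambda>x. lab \<iota> Y (l x)) (push b ((plus_pt ^^ Suc n) Y) (renum Y (face i)) (\<gamma> Y univ))"
    unfolding coef_def lhs_coface_val[OF i \<gamma> Y univ_closed] ..
  also have "\<dots> = form b (\<lambda>x. {w \<in> fst ((plus_pt ^^ n) Y). renum Y (face i) w \<in> lab \<iota> Y (l x)}) (\<gamma> Y univ)"
  proof (rule form_push[OF finY finY renum_funcset[OF Y face_bound] b _ t])
    show "lab \<iota> Y (l x) \<subseteq> fst ((plus_pt ^^ Suc n) Y)" if "x \<in> b" for x
      using lx[OF that] by (intro lab_subset) (auto simp: labels_Suc)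
  qed
  also have "\<dots> = coef b \<gamma> (relab b (coface_relab i) l)"
    unfolding coef_def
    by (rule form_cong[OF finY b _ _ t])
      (use lab_preimage_face[OF i lx] lab_subset[OF coface_relab_label[OF i(2) lx]] in \<open>simp_all add: relab_val\<close>)
  finally show ?thesis .
qed

lemma coef_codeg:
  assumes b: "finite b" and \<gamma>: "\<gamma> \<in> carrier (homs A (Suc n) b)" and j: "j \<le> n"
    and l: "l \<in> b \<rightarrow>\<^sub>E labels A n"
  shows "coef b (codeg (lhs A) n j b \<gamma>) l = coef b \<gamma> (relab b (codeg_relab j) l)"
proof -
  note t = homs_closed[OF \<gamma> Y univ_closed]
  have lx: "l x \<in> labels A n" if "x \<in> b" for x using l that by auto
  have "coef b (codeg (lhs A) n j b \<gamma>) l =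
      form b (\<lambda>x. lab \<iota> Y (l x)) (push b ((plus_pt ^^ n) Y) (renum Y (degen j)) (\<gamma> Y univ))"
    unfolding coef_def lhs_codeg_val[OF j \<gamma> Y univ_closed] ..
  also have "\<dots> = form b (\<lambda>x. {w \<in> fst ((plus_pt ^^ Suc n) Y). renum Y (degen j) w \<in> lab \<iota> Y (l x)}) (\<gamma> Y univ)"
  proof (rule form_push[OF finY finY renum_funcset[OF Y degen_bound[OF j]] b _ t])
    show "lab \<iota> Y (l x) \<subseteq> fst ((plus_pt ^^ n) Y)" if "x \<in> b" for x
      using lx[OF that] by (intro lab_subset) (auto simp: labels_Suc)
  qed
  also have "\<dots> = coef b \<gamma> (relab b (codeg_relab j) l)"
    unfolding coef_def
  proof (rule form_cong[OF finY b _ _ t])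
    fix x assume x: "x \<in> b"
    show "lab \<iota> Y (relab b (codeg_relab j) l x) \<subseteq> fst ((plus_pt ^^ Suc n) Y)"
      unfolding relab_val[OF x] using codeg_relab_label[OF j lx[OF x]]
      by (intro lab_subset) (simp add: labels_Suc)
    show "{w \<in> fst ((plus_pt ^^ Suc n) Y). renum Y (degen j) w \<in> lab \<iota> Y (l x)} =
        lab \<iota> Y (relab b (codeg_relab j) l x)"
      unfolding relab_val[OF x] by (rule lab_preimage_degen[OF j lx[OF x]])
  qed
  finally show ?thesis .
qed

lemma coef_far:
  assumes b: "finite b" and \<gamma>: "\<gamma> \<in> carrier (homs A n b)" and f: "bij_betw f m b"
    and l: "l \<in> m \<rightarrow>\<^sub>E labels A n"
  shows "coef m (far (level (lhs A) n) b m f \<gamma>) l = coef b \<gamma> (\<lambda>x\<in>b. l (inv_into m f x))"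
proof -
  note t = homs_closed[OF \<gamma> Y univ_closed]
  have m: "finite m" using f b bij_betw_finite by blast
  have sub: "lab \<iota> Y (l x) \<subseteq> fst ((plus_pt ^^ n) Y)" if "x \<in> m" for x
    using PiE_mem[OF l that] by (intro lab_subset) (auto simp: labels_Suc)
  have "coef m (far (level (lhs A) n) b m f \<gamma>) l =
      form m (\<lambda>x. lab \<iota> Y (l x)) (tensor_perm R m (reduced ((plus_pt ^^ n) Y)) f (\<gamma> Y univ))"
    unfolding coef_def lhs_far_val[OF Y univ_closed] ..
  also have "\<dots> = form b (\<lambda>x. lab \<iota> Y (l (inv_into m f x))) (\<gamma> Y univ)"
    by (rule form_perm[OF finY f m sub t])
  also have "\<dots> = coef b \<gamma> (\<lambda>x\<in>b. l (inv_into m f x))"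
    unfolding coef_def
  proof (rule form_cong[OF finY b _ _ t])
    fix x assume x: "x \<in> b"
    then have "inv_into m f x \<in> m" using f by (auto simp: bij_betw_def inv_into_into)
    then show "lab \<iota> Y ((\<lambda>x\<in>b. l (inv_into m f x)) x) \<subseteq> fst ((plus_pt ^^ n) Y)"
      using sub x by simp
  qed simp
  finally show ?thesis .
qed

subsection \<open>The Yoneda lemma\<close>

definition classify :: "'u pset \<Rightarrow> ('i \<Rightarrow> 'u) \<Rightarrow> 'u \<Rightarrow> 'u" where
  "classify X g = (\<lambda>w\<in>fst Y. if w = snd Y then snd X else g (inv_into A \<iota> w))"

lemma classify_values:
  "classify X g (snd Y) = snd X" "i \<in> A \<Longrightarrow> classify X g (\<iota> i) = g i"
  using snd_Y iota \<iota> by (auto simp: classify_def bij_betw_def)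

lemma classify_arr:
  assumes "X \<in> obj Gamma" "\<And>i. i \<in> A \<Longrightarrow> g i \<in> fst X"
  shows "classify X g \<in> arr Gamma Y X"
proof -
  have "classify X g w \<in> fst X" if "w \<in> fst Y" for w
    using that by (cases rule: iota_cases) (use assms in \<open>auto simp: classify_values obj_Gamma\<close>)
  then have "classify X g \<in> fst Y \<rightarrow>\<^sub>E fst X" by (auto simp: PiE_iff classify_def)
  then show ?thesis by (simp add: arr_Gamma classify_values)
qed

lemma push_univ:
  assumes "X \<in> obj Gamma" "\<And>i. i \<in> A \<Longrightarrow> g i \<in> fst X"
  shows "push A X (classify X g) univ = point_tensor A X g"
proof -
  have "push A X (classify X g) univ = point_tensor A X (\<lambda>i. classify X g (\<iota> i))"
    unfolding univ_def by (rule push_point_tensor[OF Y assms(1) classify_arr[OF assms] iota(1)])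
  also have "\<dots> = point_tensor A X g"
    unfolding point_tensor_def
    by (rule arg_cong[where f = "pure_tensor A (reduced X)"]) (auto simp: classify_values)
  finally show ?thesis .
qed

text \<open>Naturality along the pointed map that sends the generic tensor to the given one.\<close>

lemma yoneda:
  assumes \<gamma>: "\<gamma> \<in> carrier (homs A n b)" and X: "X \<in> obj Gamma" and g: "\<And>i. i \<in> A \<Longrightarrow> g i \<in> fst X"
  shows "\<gamma> X (point_tensor A X g) = push b ((plus_pt ^^ n) X) (plus_iter n Y X (classify X g)) (\<gamma> Y univ)"
proof -
  have e: "push A X (classify X g) univ = point_tensor A X g" by (rule push_univ[OF X]) (rule g)
  have "classify X g \<in> arr Gamma Y X" by (rule classify_arr[OF X]) (rule g)
  from homs_natural[OF \<gamma> Y X this univ_closed] show ?thesis by (simp add: e)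
qed

subsection \<open>The coface that adds a point to the argument\<close>

text \<open>The image of the generic tensor in \<open>Y\<^sub>+\<close> is the tensor product of the differences \<open>[\<iota> i] - [y]\<close>, in which \<open>y\<close> is an
  ordinary point. In terms of the base point \<open>+\<close> it is the tensor product of \<open>([\<iota> i] - [+]) - ([y] - [+])\<close>,
  hence a combination of the tensors of differences given by maps \<open>g\<close> from \<open>A\<close> to the \<open>\<iota> i\<close> and \<open>y\<close>. If \<open>g\<close> omits some
  \<open>\<iota> i\<close>, then the preimage of \<open>{\<iota> i}\<close> under the map classifying \<open>g\<close> is empty, and the label \<open>Inl i\<close>,
  which occurs in \<open>l\<close>, annihilates the term. If \<open>g\<close> omits none, it avoids \<open>y\<close> by counting, and then \<open>g\<close> has a non-zero
  coefficient only if it is \<open>\<iota>\<close>. Within \<open>Y\<close>, the map that classifies \<open>\<iota>\<close> moves only the base point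
  \<open>y\<close>, to the first added point, so that the preimage of \<open>Y\<close> consists of all \<open>\<iota> i\<close>.\<close>

lemma coef_coface_0:
  assumes b: "finite b" and \<gamma>: "\<gamma> \<in> carrier (homs A n b)" and l: "l \<in> surj_labels A (Suc n) b"
  shows "coef b (coface (lhs A) n 0 b \<gamma>) l = coef b \<gamma> (relab b (coface_relab 0) l)"
proof -
  let ?X = "plus_pt Y" and ?T = "tens b ((plus_pt ^^ Suc n) Y)"
  note X = plus_pt_obj[OF Y]
  have fX: "finite (fst ?X)" using X by (simp add: obj_Gamma)
  note t = homs_closed[OF \<gamma> Y univ_closed]
  have l': "l \<in> b \<rightarrow>\<^sub>E labels A (Suc n)" using l by (simp add: surj_labels_def)
  then have lx: "l x \<in> labels A (Suc n)" if "x \<in> b" for x using that by auto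
  have sub: "lab \<iota> Y (l x) \<subseteq> fst ((plus_pt ^^ Suc n) Y)" if "x \<in> b" for x
    using lx[OF that] by (intro lab_subset) (auto simp: labels_Suc)
  have sX: "snd ?X = mark Y 1" by (simp add: mark_def)
  have sXn: "snd ?X \<notin> fst Y" using mark_notin_base[OF Y, of 1] by (simp add: sX)
  have YX: "fst Y \<subseteq> fst ?X" by (auto simp: fst_plus_pt)
  define e where "e = push A ?X (\<lambda>w. w) univ"
  have e: "e \<in> carrier (tens A ?X)" unfolding e_def by (rule mod_hom_closed[OF incl_hom[OF Y] univ_closed])
  have e_pure: "e = pure_tensor A (reduced ?X) (\<lambda>i\<in>A. diff (\<iota> i) (snd Y))"
    unfolding e_def univ_def point_tensor_def
    by (rule push_diffs) (use Y fX YX iota snd_Y in \<open>auto simp: obj_Gamma\<close>)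
  \<comment> \<open>the coordinate \<open>l\<close> as a linear form on the tensor power at \<open>Y\<^sub>+\<close>, to be applied to the expansion of \<open>e\<close>\<close>
  define L where "L = (\<lambda>t. form b (\<lambda>x. lab \<iota> Y (l x)) (\<gamma> ?X t))"
  have L: "L \<in> mod_hom R (tens A ?X) scalar_mod"
    unfolding L_def
    by (rule mod_hom_comp[OF homs_hom[OF \<gamma> X, unfolded iter_plus_plus] form_hom[OF finY b sub]])
  let ?h = "\<lambda>g. plus_iter n Y ?X (classify ?X g)"
  have val: "L (point_tensor A ?X g) =
      form b (\<lambda>x. {w \<in> fst ((plus_pt ^^ n) Y). ?h g w \<in> lab \<iota> Y (l x)}) (\<gamma> Y univ)"
    if g: "\<And>i. i \<in> A \<Longrightarrow> g i \<in> fst ?X" for g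
  proof -
    have "classify ?X g \<in> arr Gamma Y ?X" by (rule classify_arr[OF X]) (rule g)
    then have "classify ?X g \<in> fst Y \<rightarrow> fst ?X" by (auto simp: arr_Gamma)
    note fs = plus_iter_funcset[OF Y X this, of n, unfolded iter_plus_plus]
    have "\<gamma> ?X (point_tensor A ?X g) = push b ((plus_pt ^^ Suc n) Y) (?h g) (\<gamma> Y univ)"
      using yoneda[where g = g, OF \<gamma> X g] unfolding iter_plus_plus by blast
    then show ?thesis unfolding L_def using form_push[OF finY finY fs b sub t] by simp
  qed
  have hmark: "?h g (mark Y r) = mark Y (Suc r)" if "1 \<le> r" "r \<le> n" for g r
    using that by (simp add: plus_iter_values[OF Y X] mark_plus_pt)
  have hbase: "?h g w = classify ?X g w" if "w \<in> fst Y" for g w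
    using that by (simp add: plus_iter_values[OF Y X])
  let ?G = "A \<rightarrow>\<^sub>E fst ?X - {snd ?X}" and ?\<iota> = "restrict \<iota> A"
  have G: "g i \<in> fst ?X" if "g \<in> ?G" "i \<in> A" for g i using that by auto
  have \<iota>nX: "\<iota> i \<noteq> snd ?X" if "i \<in> A" for i using iota(1)[OF that] sXn by metis
  have \<iota>G: "?\<iota> \<in> ?G" using iota(1) YX \<iota>nX by (auto simp: restrict_PiE_iff)
  \<comment> \<open>the preimage of \<open>{\<iota> i}\<close> under the classifying map is empty if \<open>g\<close> omits \<open>\<iota> i\<close>\<close>
  have zero: "L (point_tensor A ?X g) = \<zero>" if g: "g \<in> ?G" and i: "i \<in> A" "\<iota> i \<notin> g ` A" for g i
  proof -
    have "Inl i \<in> l ` b" using l i(1) by (auto simp: surj_labels_def)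
    then obtain x where x: "x \<in> b" "l x = Inl i" by fastforce
    have "?h g w \<noteq> \<iota> i" if "w \<in> fst ((plus_pt ^^ n) Y)" for w
      using that
    proof (cases rule: iter_plus_cases)
      case 1
      from 1 show ?thesis
      proof (cases rule: iota_cases)
        case 1
        then show ?thesis using snd_Y mark_iota[OF i(1), of 1] by (simp add: hbase classify_values sX)
      next
        case (2 j)
        then have "g j \<noteq> \<iota> i" using i(2) by (metis imageI)
        then show ?thesis using 2 iota(1) by (simp add: hbase classify_values)
      qed
    next
      case (2 r)
      then show ?thesis using mark_iota[OF i(1), of "Suc r"] by (simp add: hmark)
    qed
    then have "{w \<in> fst ((plus_pt ^^ n) Y). ?h g w \<in> lab \<iota> Y (l x)} = {}"
      by (auto simp: x lab_simps)
    then have "form b (\<lambda>x. {w \<in> fst ((plus_pt ^^ n) Y). ?h g w \<in> lab \<iota> Y (l x)}) (\<gamma> Y univ) = \<zero>"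
      by (intro form_empty[OF finY b _ x(1) _ t]) auto
    then show ?thesis using val[of g, OF G[OF g]] by simp
  qed
  have pair: "form A (\<lambda>i. {g i}) e = (if \<forall>i\<in>A. g i = \<iota> i then \<one> else \<zero>)"
    if g: "g \<in> ?G" "\<And>i. i \<in> A \<Longrightarrow> g i \<noteq> snd Y" for g
  proof -
    have "form A (\<lambda>i. {g i}) e = (\<Otimes>i\<in>A. psum {g i} ((\<lambda>i\<in>A. diff (\<iota> i) (snd Y)) i))"
      unfolding form_def e_pure
      by (rule tensor_form_pure[OF module_reduced[OF fX] A psum_reduced_hom])
        (use iota YX snd_Y fX in \<open>auto simp: restrict_PiE_iff intro!: diff_closed\<close>)
    also have "\<dots> = (\<Otimes>i\<in>A. if g i = \<iota> i then \<one> else \<zero>)"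
    proof (rule finprod_cong'[OF refl])
      fix i assume i: "i \<in> A"
      then have "snd Y \<noteq> g i" using g(2)[OF i] by simp
      then show "psum {g i} ((\<lambda>i\<in>A. diff (\<iota> i) (snd Y)) i) = (if g i = \<iota> i then \<one> else \<zero>)"
        using i by (auto simp: psum_diff a_minus_def)
    qed auto
    finally show ?thesis by (simp add: finprod_indicator[OF A])
  qed
  have summand: "form A (\<lambda>i. {g i}) e \<otimes> L (point_tensor A ?X g) =
      (if ?\<iota> = g then L (point_tensor A ?X ?\<iota>) else \<zero>)" if g: "g \<in> ?G" for g
  proof -
    have Lc: "L (point_tensor A ?X g) \<in> carrier R" if "g \<in> ?G" for g
    proof -
      have "point_tensor A ?X g \<in> carrier (tens A ?X)"
        by (rule point_tensor_closed[OF X]) (rule G[OF that])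
      from mod_hom_closed[OF L this] show ?thesis by simp
    qed
    have fc: "form A (\<lambda>i. {g i}) e \<in> carrier R"
    proof -
      have "form A (\<lambda>i. {g i}) \<in> mod_hom R (tens A ?X) scalar_mod"
        by (rule form_hom[OF fX A]) (use g in auto)
      from mod_hom_closed[OF this e] show ?thesis by simp
    qed
    show ?thesis
    proof (cases "\<iota> ` A \<subseteq> g ` A")
      case False
      then obtain i where i: "i \<in> A" "\<iota> i \<notin> g ` A" by auto
      then have "?\<iota> \<noteq> g" by (metis imageI restrict_apply')
      then show ?thesis using zero[OF g i] fc by simp
    next
      case True
      have "card (\<iota> ` A) = card A" using \<iota> by (intro card_image) (simp add: bij_betw_def)
      then have "\<iota> ` A = g ` A"
        using card_image_le[OF A, of g] A by (intro card_seteq True) auto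
      then have nb: "g i \<noteq> snd Y" if "i \<in> A" for i
        using iota(2) that by (metis imageE imageI)
      have "?\<iota> = g \<longleftrightarrow> (\<forall>i\<in>A. g i = \<iota> i)"
        using PiE_eq_iff[OF \<iota>G g] by auto
      then show ?thesis using pair[OF g nb] Lc[OF g] by auto
    qed
  qed
  have finG: "finite ?G" using A fX by (intro finite_PiE) auto
  have L\<iota>: "L (point_tensor A ?X ?\<iota>) \<in> carrier R"
  proof -
    have "point_tensor A ?X ?\<iota> \<in> carrier (tens A ?X)"
      by (rule point_tensor_closed[OF X]) (rule G[OF \<iota>G])
    from mod_hom_closed[OF L this] show ?thesis by simp
  qed
  have "coef b (coface (lhs A) n 0 b \<gamma>) l = L e"
    unfolding coef_def lhs_coface_0_val[OF Y univ_closed] L_def e_def ..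
  also have "\<dots> = (\<Oplus>g \<in> ?G. form A (\<lambda>i. {g i}) e \<otimes> L (point_tensor A ?X g))"
    using hom_expansion[OF X A module_scalar_mod L e] by simp
  also have "\<dots> = (\<Oplus>g \<in> ?G. if ?\<iota> = g then L (point_tensor A ?X ?\<iota>) else \<zero>)"
    by (rule finsum_cong'[OF refl _ summand]) (use L\<iota> in auto)
  also have "\<dots> = L (point_tensor A ?X ?\<iota>)"
    using finsum_singleton[OF \<iota>G finG, of "\<lambda>_. L (point_tensor A ?X ?\<iota>)"] L\<iota> by simp
  also have "\<dots> = form b (\<lambda>x. {w \<in> fst ((plus_pt ^^ n) Y). ?h ?\<iota> w \<in> lab \<iota> Y (l x)}) (\<gamma> Y univ)"
    by (rule val[of ?\<iota>, OF G[OF \<iota>G]])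
  also have "\<dots> = coef b \<gamma> (relab b (coface_relab 0) l)"
    unfolding coef_def
  proof (rule form_cong[OF finY b _ _ t])
    fix x assume x: "x \<in> b"
    have s: "lab \<iota> Y (map_sum id (coface_relab 0) (l x)) \<subseteq> fst ((plus_pt ^^ n) Y)"
      by (rule lab_subset[OF coface_relab_label[OF le0 lx[OF x]]])
    then show "lab \<iota> Y (relab b (coface_relab 0) l x) \<subseteq> fst ((plus_pt ^^ n) Y)"
      by (simp add: relab_val[OF x])
    have cl: "classify ?X ?\<iota> (snd Y) = mark Y 1" "i \<in> A \<Longrightarrow> classify ?X ?\<iota> (\<iota> i) = \<iota> i" for i
      by (simp_all add: classify_values sX)
    have "{w \<in> fst ((plus_pt ^^ n) Y). ?h ?\<iota> w \<in> lab \<iota> Y (l x)} = lab \<iota> Y (map_sum id (coface_relab 0) (l x))"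
    proof (rule lab_preimage[OF s])
      fix w assume w: "w \<in> fst Y"
      from lx[OF x] show "?h ?\<iota> w \<in> lab \<iota> Y (l x) \<longleftrightarrow> w \<in> lab \<iota> Y (map_sum id (coface_relab 0) (l x))"
      proof (cases rule: labels_cases)
        case l: (1 i)
        from w show ?thesis
        proof (cases rule: iota_cases)
          case 1
          have "mark Y 1 \<noteq> \<iota> i" "snd Y \<noteq> \<iota> i" using mark_iota[OF l(1), of 1] iota(2)[OF l(1)] by auto
          then show ?thesis using w l 1 by (simp add: hbase cl lab_simps)
        next
          case (2 j)
          then show ?thesis using w l by (simp add: hbase cl lab_simps)
        qed
      next
        case l: (2 s)
        from w show ?thesis
        proof (cases rule: iota_cases)
          case 1
          have "mark Y 1 \<in> lab \<iota> Y (Inr s) \<longleftrightarrow> 2 \<le> s" by (simp add: mark_lab numeral_2_eq_2)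
          moreover have "snd Y \<in> lab \<iota> Y (Inr (s - 1)) \<longleftrightarrow> 2 \<le> s"
          proof (cases "s = 1")
            case True
            then show ?thesis by (simp add: lab_simps)
          next
            case False
            then show ?thesis using l base_lab[OF snd_Y, of "s - 1"] by simp
          qed
          ultimately show ?thesis using l w 1 by (simp add: hbase cl coface_relab_def)
        next
          case (2 i)
          have "\<iota> i \<in> lab \<iota> Y (Inr s)" using l 2 iota by (intro base_lab) auto
          moreover have "\<iota> i \<in> lab \<iota> Y (Inr (s - 1))"
          proof (cases "s = 1")
            case True
            then show ?thesis using 2 iota by (simp add: lab_simps)
          next
            case False
            then show ?thesis using l 2 iota by (intro base_lab) auto
          qed
          ultimately show ?thesis using l w 2 by (simp add: hbase cl coface_relab_def)
        qed
      qed
    next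
      fix r assume r: "1 \<le> r" "r \<le> n"
      from lx[OF x] show "?h ?\<iota> (mark Y r) \<in> lab \<iota> Y (l x) \<longleftrightarrow>
          mark Y r \<in> lab \<iota> Y (map_sum id (coface_relab 0) (l x))"
        by (cases rule: labels_cases) (use r in \<open>auto simp: hmark mark_lab mark_lab_Inl coface_relab_def\<close>)
    qed
    then show "{w \<in> fst ((plus_pt ^^ n) Y). ?h ?\<iota> w \<in> lab \<iota> Y (l x)} = lab \<iota> Y (relab b (coface_relab 0) l x)"
      by (simp add: relab_val[OF x])
  qed
  finally show ?thesis .
qed

lemma coef_coface:
  assumes "finite b" "\<gamma> \<in> carrier (homs A n b)" "l \<in> surj_labels A (Suc n) b" "i \<le> Suc n"
  shows "coef b (coface (lhs A) n i b \<gamma>) l = coef b \<gamma> (relab b (coface_relab i) l)"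
proof (cases "i = 0")
  case True
  then show ?thesis using coef_coface_0[OF assms(1-3)] by simp
next
  case False
  then show ?thesis
    using coef_coface_pos[OF assms(1,2) _ assms(4)] assms(3) by (simp add: surj_labels_def)
qed

subsection \<open>A natural transformation is determined by its coordinates\<close>

text \<open>Suppose that \<open>Inl i\<close> does not occur. The pointed self-map of \<open>Y\<close> that collapses \<open>\<iota> i\<close> to the base point kills
  the generic tensor, but the preimage of every other labelled set under it is that set itself. So the
  coordinate is computed from zero as well.\<close>

lemma coef_nonsurj:
  assumes b: "finite b" and \<gamma>: "\<gamma> \<in> carrier (homs A n b)" and l: "l \<in> b \<rightarrow>\<^sub>E labels A n"
    and ns: "l \<notin> surj_labels A n b"
  shows "coef b \<gamma> l = \<zero>"
proof -
  obtain i where i: "i \<in> A" "Inl i \<notin> l ` b" using l ns by (auto simp: surj_labels_def)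
  define g where "g = (\<lambda>j. if j = i then snd Y else \<iota> j)"
  let ?f = "classify Y g"
  have g: "g j \<in> fst Y" if "j \<in> A" for j using that iota snd_Y by (simp add: g_def)
  have f: "?f \<in> arr Gamma Y Y" by (rule classify_arr[OF Y]) (rule g)
  note t = homs_closed[OF \<gamma> Y univ_closed] and h = homs_hom[OF \<gamma> Y]
  have sub: "lab \<iota> Y (l x) \<subseteq> fst ((plus_pt ^^ n) Y)" if "x \<in> b" for x
    using PiE_mem[OF l that] by (intro lab_subset) (auto simp: labels_Suc)
  have fs: "plus_iter n Y Y ?f \<in> fst ((plus_pt ^^ n) Y) \<rightarrow> fst ((plus_pt ^^ n) Y)"
    using f by (intro plus_iter_funcset[OF Y Y]) (auto simp: arr_Gamma)
  have "push b ((plus_pt ^^ n) Y) (plus_iter n Y Y ?f) (\<gamma> Y univ) = \<gamma> Y (point_tensor A Y g)"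
    using yoneda[where g = g, OF \<gamma> Y g] by simp
  also have "\<dots> = \<gamma> Y \<zero>\<^bsub>tens A Y\<^esub>"
    using point_tensor_zero[where g = g, OF Y g i(1)] by (simp add: g_def)
  also have "\<dots> = \<zero>\<^bsub>tens b ((plus_pt ^^ n) Y)\<^esub>"
    by (rule mod_hom_zero[OF module_tens_0[OF Y] module_tens[OF Y] h])
  finally have z: "push b ((plus_pt ^^ n) Y) (plus_iter n Y Y ?f) (\<gamma> Y univ) = \<zero>\<^bsub>tens b ((plus_pt ^^ n) Y)\<^esub>" .
  have "coef b \<gamma> l = form b (\<lambda>x. {w \<in> fst ((plus_pt ^^ n) Y). plus_iter n Y Y ?f w \<in> lab \<iota> Y (l x)}) (\<gamma> Y univ)"
    unfolding coef_def
  proof (rule form_cong[OF finY b _ _ t])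
    fix x assume x: "x \<in> b"
    then have "l x \<in> labels A n" using l by auto
    then have "{w \<in> fst ((plus_pt ^^ n) Y). plus_iter n Y Y ?f w \<in> lab \<iota> Y (l x)} = lab \<iota> Y (l x)"
    proof (cases rule: labels_cases)
      case (1 j)
      then have ji: "j \<noteq> i" using i(2) x by (metis imageI)
      show ?thesis
      proof (rule lab_preimage[OF sub[OF x]])
        fix w assume w: "w \<in> fst Y"
        from w show "plus_iter n Y Y ?f w \<in> lab \<iota> Y (l x) \<longleftrightarrow> w \<in> lab \<iota> Y (l x)"
        proof (cases rule: iota_cases)
          case 1
          then show ?thesis using w by (simp add: plus_iter_values[OF Y Y] classify_values)
        next
          case (2 q)
          then have "plus_iter n Y Y ?f w = g q" using w by (simp add: plus_iter_values[OF Y Y] classify_values)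
          then show ?thesis
            using 2 \<open>l x = Inl j\<close> ji iota_inj[of q j] iota(2)[OF \<open>j \<in> A\<close>] \<open>j \<in> A\<close>
            by (auto simp: g_def lab_simps)
        qed
      qed (simp add: plus_iter_values[OF Y Y])
    next
      case (2 s)
      show ?thesis
      proof (rule lab_preimage[OF sub[OF x]])
        fix w assume w: "w \<in> fst Y"
        then have "plus_iter n Y Y ?f w \<in> fst Y" using f by (auto simp: plus_iter_values[OF Y Y] arr_Gamma)
        then show "plus_iter n Y Y ?f w \<in> lab \<iota> Y (l x) \<longleftrightarrow> w \<in> lab \<iota> Y (l x)"
          using 2 w by (simp add: base_lab)
      qed (simp add: plus_iter_values[OF Y Y])
    qed
    then show "lab \<iota> Y (l x) = {w \<in> fst ((plus_pt ^^ n) Y). plus_iter n Y Y ?f w \<in> lab \<iota> Y (l x)}" by simp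
  qed auto
  also have "\<dots> = form b (\<lambda>x. lab \<iota> Y (l x)) (push b ((plus_pt ^^ n) Y) (plus_iter n Y Y ?f) (\<gamma> Y univ))"
    by (rule form_push[OF finY finY fs b sub t, symmetric])
  also have "\<dots> = \<zero>"
    unfolding z using mod_hom_zero[OF module_tens[OF Y] module_scalar_mod form_hom[OF finY b sub]] by simp
  finally show ?thesis .
qed

lemma homs_eq_if_coef_eq:
  assumes b: "finite b" and \<gamma>: "\<gamma> \<in> carrier (homs A n b)" "\<gamma>' \<in> carrier (homs A n b)"
    and eq: "\<And>l. l \<in> surj_labels A n b \<Longrightarrow> coef b \<gamma> l = coef b \<gamma>' l"
  shows "\<gamma> = \<gamma>'"
proof (rule homs_eqI[OF \<gamma>])
  have "coef b \<gamma> l = coef b \<gamma>' l" if "l \<in> b \<rightarrow>\<^sub>E labels A n" for l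
    using eq coef_nonsurj[OF b \<gamma>(1) that] coef_nonsurj[OF b \<gamma>(2) that] by (cases "l \<in> surj_labels A n b") auto
  then have u: "\<gamma> Y univ = \<gamma>' Y univ"
    using tensor_eqI[OF module_reduced[OF finY] b dual_basis_reduced[OF Y \<iota>]
        homs_closed[OF \<gamma>(1) Y univ_closed] homs_closed[OF \<gamma>(2) Y univ_closed]]
    by (simp add: coef_def form_def)
  fix X :: "'u pset" and x assume X: "X \<in> obj Gamma" and x: "x \<in> carrier (tens A X)"
  show "\<gamma> X x = \<gamma>' X x"
  proof (rule hom_eq_on_points[OF X A module_tens[OF X] homs_hom[OF \<gamma>(1) X] homs_hom[OF \<gamma>(2) X] _ x])
    fix g assume "g \<in> A \<rightarrow>\<^sub>E fst X - {snd X}"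
    then have "g i \<in> fst X" if "i \<in> A" for i using that by auto
    then show "\<gamma> X (point_tensor A X g) = \<gamma>' X (point_tensor A X g)"
      using yoneda[OF \<gamma>(1) X] yoneda[OF \<gamma>(2) X] u by simp
  qed
qed

subsection \<open>Every family of coordinates is attained\<close>

text \<open>The combination \<open>x0\<close> of basis tensors with the given coordinates should be the value at the generic tensor.
  This prescribes a linear map \<open>\<theta> X\<close> on the basis of tensors of differences \<open>[g i] - [x]\<close> where no
  \<open>g i\<close> is the base point \<open>x\<close>. For naturality the prescribed formula has to hold when some \<open>g i\<close> is the base
  point too. Then the tensor of differences is zero, and so is the image of \<open>x0\<close>: every
  basis tensor with non-zero coefficient has a factor \<open>[\<iota> i] - [y]\<close>, whose two points are
  identified.\<close>

lemma exists_homs_with_coef: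
  assumes b: "finite b" and c: "\<And>l. l \<in> b \<rightarrow>\<^sub>E labels A n \<Longrightarrow> c l \<in> carrier R"
    and ns: "\<And>l. l \<in> b \<rightarrow>\<^sub>E labels A n \<Longrightarrow> l \<notin> surj_labels A n b \<Longrightarrow> c l = \<zero>"
  shows "\<exists>\<gamma> \<in> carrier (homs A n b). \<forall>l \<in> b \<rightarrow>\<^sub>E labels A n. coef b \<gamma> l = c l"
proof -
  let ?Y = "(plus_pt ^^ n) Y" and ?L = "b \<rightarrow>\<^sub>E labels A n"
  let ?T = "tens b ?Y"
  note mr = module_reduced[OF finY[of n]] and d = dual_basis_reduced[OF Y \<iota>, of n]
  note T = module_tensor_pow[OF mr, of b]
  interpret T: Module.module R ?T by (rule T)
  have finL: "finite ?L" using d b by (intro finite_PiE) (auto simp: dual_basis_def)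
  let ?e = "\<lambda>l. pure_tensor b (reduced ?Y) (\<lambda>x\<in>b. bas \<iota> Y (l x))"
  have e: "?e l \<in> carrier ?T" if "l \<in> ?L" for l by (rule pure_tensor_closed[OF basis_tuple[OF d that]])
  \<comment> \<open>the prospective value at the generic tensor\<close>
  define x0 where "x0 = (\<Oplus>\<^bsub>?T\<^esub>l \<in> ?L. c l \<odot>\<^bsub>?T\<^esub> ?e l)"
  have terms: "(\<lambda>l. c l \<odot>\<^bsub>?T\<^esub> ?e l) \<in> ?L \<rightarrow> carrier ?T" using c e by auto
  have x0: "x0 \<in> carrier ?T" unfolding x0_def by (rule T.finsum_closed[OF terms])
  have hom_x0: "\<phi> x0 = (\<Oplus>\<^bsub>N\<^esub>l \<in> ?L. c l \<odot>\<^bsub>N\<^esub> \<phi> (?e l))"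
    if N: "Module.module R N" and h: "\<phi> \<in> mod_hom R ?T N" for N :: "('a, 'z) module" and \<phi>
  proof -
    interpret N: Module.module R N by (rule N)
    have "\<phi> x0 = (\<Oplus>\<^bsub>N\<^esub>l \<in> ?L. \<phi> (c l \<odot>\<^bsub>?T\<^esub> ?e l))"
      unfolding x0_def by (rule mod_hom_finsum[OF T N h terms])
    also have "\<dots> = (\<Oplus>\<^bsub>N\<^esub>l \<in> ?L. c l \<odot>\<^bsub>N\<^esub> \<phi> (?e l))"
    proof (rule N.finsum_cong'[OF refl])
      show "(\<lambda>l. c l \<odot>\<^bsub>N\<^esub> \<phi> (?e l)) \<in> ?L \<rightarrow> carrier N" using c e mod_hom_closed[OF h] by auto
    qed (simp add: mod_hom_smult[OF h c e])
    finally show ?thesis .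
  qed
  have form_x0: "form b (\<lambda>x. lab \<iota> Y (l x)) x0 = c l" if l: "l \<in> ?L" for l
  proof -
    have sub: "lab \<iota> Y (l x) \<subseteq> fst ?Y" if "x \<in> b" for x
      using PiE_mem[OF l that] by (intro lab_subset) (auto simp: labels_Suc)
    have "form b (\<lambda>x. lab \<iota> Y (l x)) x0 = (\<Oplus>m \<in> ?L. c m \<otimes> form b (\<lambda>x. lab \<iota> Y (l x)) (?e m))"
      using hom_x0[OF module_scalar_mod form_hom[OF finY b sub]] by simp
    also have "\<dots> = (\<Oplus>m \<in> ?L. if l = m then c m else \<zero>)"
      by (rule finsum_cong'[OF refl]) (use c in \<open>auto simp: form_def tensor_form_basis[OF mr b d l]\<close>)
    also have "\<dots> = c l" using finsum_singleton[OF l finL, of c] c by auto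
    finally show ?thesis .
  qed
  \<comment> \<open>every basis tensor that occurs in \<open>x0\<close> has a factor \<open>[\<iota> i] - [y]\<close>, which \<open>h\<close> annihilates\<close>
  have vanish: "push b Z h x0 = \<zero>\<^bsub>tens b Z\<^esub>"
    if Z: "finite (fst Z)" and h: "h \<in> fst ?Y \<rightarrow> fst Z" and i: "i \<in> A" "h (\<iota> i) = h (snd Y)"
    for Z :: "'u pset" and h i
  proof -
    note mZ = module_tensor_pow[OF module_reduced[OF Z], of b]
    interpret Z: Module.module R "tens b Z" by (rule mZ)
    note ph = push_hom[OF finY Z h, of b]
    have "c l \<odot>\<^bsub>tens b Z\<^esub> push b Z h (?e l) = \<zero>\<^bsub>tens b Z\<^esub>" if l: "l \<in> ?L" for l
    proof (cases "l \<in> surj_labels A n b")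
      case False
      then show ?thesis using ns[OF l] mod_hom_closed[OF ph e[OF l]] by simp
    next
      case True
      then have "Inl i \<in> l ` b" using i(1) by (auto simp: surj_labels_def)
      then obtain x where x: "x \<in> b" "l x = Inl i" by fastforce
      note bt = basis_tuple[OF d l]
      have "push b Z h (?e l) = pure_tensor b (reduced Z) (\<lambda>j\<in>b. free_map R (fst Z) h ((\<lambda>x\<in>b. bas \<iota> Y (l x)) j))"
        by (rule push_pure[OF finY Z h bt])
      also have "\<dots> = \<zero>\<^bsub>tens b Z\<^esub>"
      proof (rule pure_tensor_zero[OF module_reduced[OF Z] _ x(1)])
        show "(\<lambda>j\<in>b. free_map R (fst Z) h ((\<lambda>x\<in>b. bas \<iota> Y (l x)) j)) \<in> b \<rightarrow>\<^sub>E carrier (reduced Z)"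
          unfolding restrict_PiE_iff
          using mod_hom_closed[OF free_map_reduced_hom[OF finY Z h]] PiE_mem[OF bt] by blast
        have "\<iota> i \<in> fst ?Y" "snd Y \<in> fst ?Y" using iota(1)[OF i(1)] snd_Y fst_subset_iter_plus[of Y n] by auto
        then show "(\<lambda>j\<in>b. free_map R (fst Z) h ((\<lambda>x\<in>b. bas \<iota> Y (l x)) j)) x = \<zero>\<^bsub>reduced Z\<^esub>"
          using x i by (simp add: bas_def free_map_diff[OF h] diff_self)
      qed
      finally show ?thesis using c[OF l] by simp
    qed
    then have "(\<Oplus>\<^bsub>tens b Z\<^esub>l \<in> ?L. c l \<odot>\<^bsub>tens b Z\<^esub> push b Z h (?e l)) = (\<Oplus>\<^bsub>tens b Z\<^esub>l \<in> ?L. \<zero>\<^bsub>tens b Z\<^esub>)"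
      by (intro Z.finsum_cong') auto
    then show ?thesis using hom_x0[OF mZ ph] by simp
  qed
  let ?h = "\<lambda>X g. plus_iter n Y X (classify X g)"
  have hfs: "?h X g \<in> fst ?Y \<rightarrow> fst ((plus_pt ^^ n) X)"
    if X: "X \<in> obj Gamma" and g: "\<And>i. i \<in> A \<Longrightarrow> g i \<in> fst X" for X g
  proof (rule plus_iter_funcset[OF Y X])
    have "classify X g \<in> arr Gamma Y X" by (rule classify_arr[OF X]) (rule g)
    then show "classify X g \<in> fst Y \<rightarrow> fst X" by (auto simp: arr_Gamma)
  qed
  \<comment> \<open>the linear extension of the formula forced by naturality on the basis\<close>
  define \<theta> where "\<theta> = (\<lambda>X t. \<Oplus>\<^bsub>tens b ((plus_pt ^^ n) X)\<^esub>g \<in> A \<rightarrow>\<^sub>E fst X - {snd X}.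
    form A (\<lambda>i. {g i}) t \<odot>\<^bsub>tens b ((plus_pt ^^ n) X)\<^esub> push b ((plus_pt ^^ n) X) (?h X g) x0)"
  have pc: "push b ((plus_pt ^^ n) X) (?h X g) x0 \<in> carrier (tens b ((plus_pt ^^ n) X))"
    if X: "X \<in> obj Gamma" and g: "\<And>i. i \<in> A \<Longrightarrow> g i \<in> fst X" for X g
    by (rule mod_hom_closed[OF push_hom[OF finY finite_iter_plus[OF X] hfs[OF X]] x0]) (rule g)
  have form_g: "form A (\<lambda>i. {g i}) \<in> mod_hom R (tens A X) scalar_mod"
    if X: "X \<in> obj Gamma" and g: "g \<in> A \<rightarrow>\<^sub>E fst X - {snd X}" for X :: "'u pset" and g
    by (rule form_hom[OF _ A]) (use X g in \<open>auto simp: obj_Gamma\<close>)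
  have \<theta>_hom: "\<theta> X \<in> mod_hom R (tens A X) (tens b ((plus_pt ^^ n) X))" if X: "X \<in> obj Gamma" for X
    unfolding \<theta>_def
  proof (rule finsum_hom[OF module_tens_0[OF X] module_tens[OF X]])
    interpret N: Module.module R "tens b ((plus_pt ^^ n) X)" by (rule module_tens[OF X])
    fix g assume g: "g \<in> A \<rightarrow>\<^sub>E fst X - {snd X}"
    have p: "push b ((plus_pt ^^ n) X) (?h X g) x0 \<in> carrier (tens b ((plus_pt ^^ n) X))"
      by (rule pc[OF X]) (use g in auto)
    note f = form_g[OF X g]
    have fc: "form A (\<lambda>i. {g i}) t \<in> carrier R" if "t \<in> carrier (tens A X)" for t
      using mod_hom_closed[OF f that] by simp
    show "(\<lambda>t. form A (\<lambda>i. {g i}) t \<odot>\<^bsub>tens b ((plus_pt ^^ n) X)\<^esub> push b ((plus_pt ^^ n) X) (?h X g) x0)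
        \<in> mod_hom R (tens A X) (tens b ((plus_pt ^^ n) X))"
      by (rule mod_homI)
        (simp_all add: p fc mod_hom_add[OF f] mod_hom_smult[OF f] N.smult_l_distr N.smult_assoc1)
  qed
  have \<theta>_basis: "\<theta> X (point_tensor A X g) = push b ((plus_pt ^^ n) X) (?h X g) x0"
    if X: "X \<in> obj Gamma" and g: "g \<in> A \<rightarrow>\<^sub>E fst X - {snd X}" for X g
  proof -
    let ?N = "tens b ((plus_pt ^^ n) X)" and ?G = "A \<rightarrow>\<^sub>E fst X - {snd X}"
    interpret N: Module.module R ?N by (rule module_tens[OF X])
    have fX: "finite (fst X)" using X by (simp add: obj_Gamma)
    have finG: "finite ?G" using A fX by (intro finite_PiE) auto
    have p: "push b ((plus_pt ^^ n) X) (?h X g') x0 \<in> carrier ?N" if "g' \<in> ?G" for g'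
      by (rule pc[OF X]) (use that in auto)
    have "form A (\<lambda>i. {g' i}) (point_tensor A X g) = (if g' = g then \<one> else \<zero>)" if "g' \<in> ?G" for g'
      unfolding form_def point_tensor_def
      by (rule tensor_form_basis[OF module_reduced[OF fX] A dual_basis_points[OF X] that g])
    then have "\<theta> X (point_tensor A X g) =
        (\<Oplus>\<^bsub>?N\<^esub>g' \<in> ?G. if g = g' then push b ((plus_pt ^^ n) X) (?h X g') x0 else \<zero>\<^bsub>?N\<^esub>)"
      unfolding \<theta>_def by (intro N.finsum_cong'[OF refl]) (use p in auto)
    also have "\<dots> = push b ((plus_pt ^^ n) X) (?h X g) x0"
      by (rule N.finsum_singleton[OF g finG]) (use p in auto)
    finally show ?thesis .
  qed
  \<comment> \<open>the formula persists for tuples that hit the base point, where both sides vanish\<close>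
  have \<theta>_point: "\<theta> X (point_tensor A X g) = push b ((plus_pt ^^ n) X) (?h X g) x0"
    if X: "X \<in> obj Gamma" and g: "\<And>i. i \<in> A \<Longrightarrow> g i \<in> fst X" for X g
  proof (cases "\<exists>i\<in>A. g i = snd X")
    case True
    then obtain i where i: "i \<in> A" "g i = snd X" by auto
    have "\<theta> X (point_tensor A X g) = \<theta> X \<zero>\<^bsub>tens A X\<^esub>" using point_tensor_zero[where g = g, OF X g i] by simp
    also have "\<dots> = \<zero>\<^bsub>tens b ((plus_pt ^^ n) X)\<^esub>"
      by (rule mod_hom_zero[OF module_tens_0[OF X] module_tens[OF X] \<theta>_hom[OF X]])
    also have "\<dots> = push b ((plus_pt ^^ n) X) (?h X g) x0"
    proof (rule vanish[OF finite_iter_plus[OF X] hfs[of X g, OF X g] i(1), symmetric])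
      show "?h X g (\<iota> i) = ?h X g (snd Y)"
        using i iota(1) snd_Y by (simp add: plus_iter_values[OF Y X] classify_values)
    qed
    finally show ?thesis .
  next
    case False
    then have "restrict g A \<in> A \<rightarrow>\<^sub>E fst X - {snd X}" using g by (auto simp: restrict_PiE_iff)
    from \<theta>_basis[OF X this]
    have "\<theta> X (point_tensor A X (restrict g A)) = push b ((plus_pt ^^ n) X) (?h X (restrict g A)) x0" .
    moreover have "point_tensor A X (restrict g A) = point_tensor A X g"
      unfolding point_tensor_def by (rule arg_cong[where f = "pure_tensor A (reduced X)"]) auto
    moreover have "classify X (restrict g A) w = classify X g w" for w
    proof (cases "w \<in> fst Y")
      case True
      then show ?thesis by (cases rule: iota_cases) (simp_all add: classify_values)
    qed (simp add: classify_def)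
    then have "classify X (restrict g A) = classify X g" by (rule ext)
    ultimately show ?thesis by simp
  qed
  have nat: "is_nat Gamma R (tfun A) ((botG ^^ n) (tfun b)) \<theta>"
    unfolding is_nat_def tfun_fob tfun_far tfun_iter_fob tfun_iter_far
  proof (intro conjI ballI)
    fix X :: "'u pset" assume X: "X \<in> obj Gamma"
    show "\<theta> X \<in> mod_hom R (tens A X) (tens b ((plus_pt ^^ n) X))" by (rule \<theta>_hom[OF X])
    fix X' f t assume X': "X' \<in> obj Gamma" and f: "f \<in> arr Gamma X X'" and t: "t \<in> carrier (tens A X)"
    show "\<theta> X' (push A X' f t) = push b ((plus_pt ^^ n) X') (plus_iter n X X' f) (\<theta> X t)"
    proof (rule hom_eq_on_points[OF X A module_tens[OF X']
          mod_hom_comp[OF push_arr_hom[OF X X' f] \<theta>_hom[OF X']]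
          mod_hom_comp[OF \<theta>_hom[OF X] push_iter_hom[OF X X' f]] _ t])
      fix g assume "g \<in> A \<rightarrow>\<^sub>E fst X - {snd X}"
      then have g: "g i \<in> fst X" if "i \<in> A" for i using that by auto
      have ff: "f \<in> fst X \<rightarrow> fst X'" "f (snd X) = snd X'" using f by (auto simp: arr_Gamma)
      have fg: "f (g i) \<in> fst X'" if "i \<in> A" for i using ff g[OF that] by auto
      note fs = hfs[of X g, OF X g] and fs' = hfs[of X' "\<lambda>i. f (g i)", OF X' fg] and pf = plus_iter_funcset[OF X X' ff(1), of n]
      note fin = finite_iter_plus[OF X, of n] finite_iter_plus[OF X', of n]
      have "\<theta> X' (push A X' f (point_tensor A X g)) = \<theta> X' (point_tensor A X' (\<lambda>i. f (g i)))"
        using push_point_tensor[where g = g, OF X X' f g] by simp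
      also have "\<dots> = push b ((plus_pt ^^ n) X') (?h X' (\<lambda>i. f (g i))) x0"
        by (rule \<theta>_point[of X' "\<lambda>i. f (g i)", OF X' fg])
      also have "\<dots> = push b ((plus_pt ^^ n) X') (\<lambda>w. plus_iter n X X' f (?h X g w)) x0"
      proof (rule push_cong[OF finY fin(2) _ _ x0])
        show "(\<lambda>w. plus_iter n X X' f (?h X g w)) \<in> fst ?Y \<rightarrow> fst ((plus_pt ^^ n) X')"
          using Pi_mem[OF fs] Pi_mem[OF pf] by blast
        fix w assume "w \<in> fst ?Y"
        then show "?h X' (\<lambda>i. f (g i)) w = plus_iter n X X' f (?h X g w)"
        proof (cases rule: iter_plus_cases)
          case w: 1
          from w show ?thesis
          proof (cases rule: iota_cases)
            case 1
            then show ?thesis using w X ff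
              by (simp add: plus_iter_values[OF Y X'] plus_iter_values[OF Y X] plus_iter_values[OF X X']
                  classify_values obj_Gamma)
          next
            case (2 i)
            then show ?thesis using w g
              by (simp add: plus_iter_values[OF Y X'] plus_iter_values[OF Y X] plus_iter_values[OF X X']
                  classify_values)
          qed
        next
          case (2 r)
          then show ?thesis
            by (simp add: plus_iter_values[OF Y X'] plus_iter_values[OF Y X] plus_iter_values[OF X X'])
        qed
      qed
      also have "\<dots> = push b ((plus_pt ^^ n) X') (plus_iter n X X' f) (push b ((plus_pt ^^ n) X) (?h X g) x0)"
        by (rule push_comp[OF finY fin fs pf x0, symmetric])
      also have "push b ((plus_pt ^^ n) X) (?h X g) x0 = \<theta> X (point_tensor A X g)"
        by (rule \<theta>_point[of X g, OF X g, symmetric])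
      finally show "\<theta> X' (push A X' f (point_tensor A X g)) =
          push b ((plus_pt ^^ n) X') (plus_iter n X X' f) (\<theta> X (point_tensor A X g))" .
    qed
  qed
  let ?\<gamma> = "nat_restrict Gamma (tfun A) \<theta>"
  have \<gamma>: "?\<gamma> \<in> carrier (homs A n b)" by (rule nat_restrict_carrier[OF nat tfun_conditions])
  have "?\<gamma> Y univ = \<theta> Y (point_tensor A Y \<iota>)"
    by (simp add: restrict_val[OF Y univ_closed]) (simp add: univ_def)
  also have "\<dots> = push b ?Y (?h Y \<iota>) x0" by (rule \<theta>_point[of Y \<iota>, OF Y iota(1)])
  also have "\<dots> = x0"
  proof (rule push_id[OF finY _ x0])
    fix w assume "w \<in> fst ?Y"
    then show "?h Y \<iota> w = w"
    proof (cases rule: iter_plus_cases)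
      case w: 1
      from w show ?thesis
        by (cases rule: iota_cases) (use w in \<open>simp_all add: plus_iter_values[OF Y Y] classify_values\<close>)
    next
      case (2 r)
      then show ?thesis by (simp add: plus_iter_values[OF Y Y])
    qed
  qed
  finally have "coef b ?\<gamma> l = c l" if "l \<in> ?L" for l
    using form_x0[OF that] by (simp add: coef_def)
  then show ?thesis using \<gamma> by blast
qed

end

section \<open>Transport of cosimplicial structure\<close>

text \<open>A levelwise bijection that respects all operations carries the axioms of a cosimplicial object from \<open>X\<close> to
  \<open>Y\<close>, as each of them is an equation between composites of structure maps.\<close>

lemma cosimp_isomorphic_by_transport:
  fixes C :: "('o, 'm) cat" and k :: "('k, 'r) ring_scheme"
    and X :: "('o, 'm, 'k, 'e) cosimp" and Y :: "('o, 'm, 'k, 'f) cosimp"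
  assumes X: "is_cosimplicial C k X"
    and idn: "\<And>b. b \<in> obj C \<Longrightarrow> idn C b \<in> arr C b b"
    and cmp: "\<And>b l m f g. b \<in> obj C \<Longrightarrow> l \<in> obj C \<Longrightarrow> m \<in> obj C \<Longrightarrow> f \<in> arr C b l \<Longrightarrow>
      g \<in> arr C l m \<Longrightarrow> cmp C b l m g f \<in> arr C b m"
    and bij: "\<And>n b. b \<in> obj C \<Longrightarrow>
      bij_betw (\<Phi> n b) (carrier (fob (level X n) b)) (carrier (fob (level Y n) b))"
    and zero: "\<And>n b. b \<in> obj C \<Longrightarrow> \<Phi> n b \<zero>\<^bsub>fob (level X n) b\<^esub> = \<zero>\<^bsub>fob (level Y n) b\<^esub>"
    and add: "\<And>n b x y. b \<in> obj C \<Longrightarrow> x \<in> carrier (fob (level X n) b) \<Longrightarrow> y \<in> carrier (fob (level X n) b) \<Longrightarrow>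
      \<Phi> n b (x \<oplus>\<^bsub>fob (level X n) b\<^esub> y) = \<Phi> n b x \<oplus>\<^bsub>fob (level Y n) b\<^esub> \<Phi> n b y"
    and smult: "\<And>n b c x. b \<in> obj C \<Longrightarrow> c \<in> carrier k \<Longrightarrow> x \<in> carrier (fob (level X n) b) \<Longrightarrow>
      \<Phi> n b (c \<odot>\<^bsub>fob (level X n) b\<^esub> x) = c \<odot>\<^bsub>fob (level Y n) b\<^esub> \<Phi> n b x"
    and far: "\<And>n b l f x. b \<in> obj C \<Longrightarrow> l \<in> obj C \<Longrightarrow> f \<in> arr C b l \<Longrightarrow> x \<in> carrier (fob (level X n) b) \<Longrightarrow>
      \<Phi> n l (far (level X n) b l f x) = far (level Y n) b l f (\<Phi> n b x)"
    and coface: "\<And>n i b x. i \<le> n + 1 \<Longrightarrow> b \<in> obj C \<Longrightarrow> x \<in> carrier (fob (level X n) b) \<Longrightarrow>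
      \<Phi> (n + 1) b (coface X n i b x) = coface Y n i b (\<Phi> n b x)"
    and codeg: "\<And>n j b x. j \<le> n \<Longrightarrow> b \<in> obj C \<Longrightarrow> x \<in> carrier (fob (level X (n + 1)) b) \<Longrightarrow>
      \<Phi> n b (codeg X n j b x) = codeg Y n j b (\<Phi> (n + 1) b x)"
  shows "cosimp_isomorphic C k X Y"
proof -
  let ?cX = "\<lambda>n b. carrier (fob (level X n) b)" and ?cY = "\<lambda>n b. carrier (fob (level Y n) b)"
  note Xd = X[unfolded is_cosimplicial_def nat_eq_def nat_comp_def nat_id_def]
  have Xfun: "is_functor C k (level X n)" for n using Xd by (elim conjE) (erule allE)
  have Xface: "is_nat C k (level X n) (level X (n + 1)) (coface X n i)" if "i \<le> n + 1" for n i
    using Xd that by (elim conjE) simp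
  have Xdeg: "is_nat C k (level X (n + 1)) (level X n) (codeg X n j)" if "j \<le> n" for n j
    using Xd that by (elim conjE) simp
  have Xmod: "Module.module k (fob (level X n) b)" if "b \<in> obj C" for n b
    using Xfun[of n] that unfolding is_functor_def by blast
  have Xfar: "far (level X n) b l f \<in> mod_hom k (fob (level X n) b) (fob (level X n) l)"
    if "b \<in> obj C" "l \<in> obj C" "f \<in> arr C b l" for n b l f
    using Xfun[of n] that unfolding is_functor_def by blast
  have Xid: "far (level X n) b b (idn C b) x = x" if "b \<in> obj C" "x \<in> ?cX n b" for n b x
    using Xfun[of n] that unfolding is_functor_def by blast
  have Xcmp: "far (level X n) b m (cmp C b l m g f) x = far (level X n) l m g (far (level X n) b l f x)"
    if "b \<in> obj C" "l \<in> obj C" "m \<in> obj C" "f \<in> arr C b l" "g \<in> arr C l m" "x \<in> ?cX n b" for n b l m f g x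
    using Xfun[of n] that unfolding is_functor_def by blast
  have Xcf: "coface X n i b \<in> mod_hom k (fob (level X n) b) (fob (level X (n + 1)) b)"
    if "i \<le> n + 1" "b \<in> obj C" for n i b
    using Xface[of i n] that unfolding is_nat_def by blast
  have Xcfn: "coface X n i l (far (level X n) b l f x) = far (level X (n + 1)) b l f (coface X n i b x)"
    if "i \<le> n + 1" "b \<in> obj C" "l \<in> obj C" "f \<in> arr C b l" "x \<in> ?cX n b" for n i b l f x
    using Xface[of i n] that unfolding is_nat_def by blast
  have Xcd: "codeg X n j b \<in> mod_hom k (fob (level X (n + 1)) b) (fob (level X n) b)"
    if "j \<le> n" "b \<in> obj C" for n j b
    using Xdeg[of j n] that unfolding is_nat_def by blast
  have Xcdn: "codeg X n j l (far (level X (n + 1)) b l f x) = far (level X n) b l f (codeg X n j b x)"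
    if "j \<le> n" "b \<in> obj C" "l \<in> obj C" "f \<in> arr C b l" "x \<in> ?cX (n + 1) b" for n j b l f x
    using Xdeg[of j n] that unfolding is_nat_def by blast
  have cl: "\<Phi> n b x \<in> ?cY n b" if "b \<in> obj C" "x \<in> ?cX n b" for n b x
    using bij[OF that(1)] that(2) by (rule bij_betw_apply)
  have ex: "\<exists>x \<in> ?cX n b. y = \<Phi> n b x" if "b \<in> obj C" "y \<in> ?cY n b" for n b y
    using bij[OF that(1), of n] that(2) by (auto simp: bij_betw_def)
  note fcl = mod_hom_closed[OF Xfar] and cfcl = mod_hom_closed[OF Xcf] and cdcl = mod_hom_closed[OF Xcd]
  have \<Phi>hom: "\<Phi> n b \<in> mod_hom k (fob (level X n) b) (fob (level Y n) b)" if "b \<in> obj C" for n b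
    by (rule mod_homI) (auto simp: cl add smult that)
  have Ymod: "Module.module k (fob (level Y n) b)" if "b \<in> obj C" for n b
    by (rule module_image[OF Xmod[OF that] \<Phi>hom[OF that] _ zero[OF that]])
      (use bij[OF that, of n] in \<open>simp add: bij_betw_def\<close>)
  \<comment> \<open>a map that corresponds to a linear map under \<open>\<Phi>\<close> is linear\<close>
  have hom_transfer: "\<beta> \<in> mod_hom k (fob (level Y n) b) (fob (level Y m) l)"
    if b: "b \<in> obj C" "l \<in> obj C" and \<alpha>: "\<alpha> \<in> mod_hom k (fob (level X n) b) (fob (level X m) l)"
      and \<beta>: "\<And>x. x \<in> ?cX n b \<Longrightarrow> \<Phi> m l (\<alpha> x) = \<beta> (\<Phi> n b x)" for \<alpha> \<beta> n m b l
  proof (rule mod_homI)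
    interpret M: Module.module k "fob (level X n) b" by (rule Xmod[OF b(1)])
    note a = mod_hom_closed[OF \<alpha>]
    fix y assume "y \<in> ?cY n b"
    then obtain x where x: "x \<in> ?cX n b" "y = \<Phi> n b x" using ex[OF b(1)] by blast
    show "\<beta> y \<in> ?cY m l" unfolding x(2) \<beta>[OF x(1), symmetric] by (rule cl[OF b(2) a[OF x(1)]])
    show "\<beta> (c \<odot>\<^bsub>fob (level Y n) b\<^esub> y) = c \<odot>\<^bsub>fob (level Y m) l\<^esub> \<beta> y" if c: "c \<in> carrier k" for c
      unfolding x(2) smult[OF b(1) c x(1), symmetric] \<beta>[OF x(1), symmetric]
        \<beta>[OF M.smult_closed[OF c x(1)], symmetric] mod_hom_smult[OF \<alpha> c x(1)]
      by (rule smult[OF b(2) c a[OF x(1)]])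
    fix y' assume "y' \<in> ?cY n b"
    then obtain x' where x': "x' \<in> ?cX n b" "y' = \<Phi> n b x'" using ex[OF b(1)] by blast
    show "\<beta> (y \<oplus>\<^bsub>fob (level Y n) b\<^esub> y') = \<beta> y \<oplus>\<^bsub>fob (level Y m) l\<^esub> \<beta> y'"
      unfolding x(2) x'(2) add[OF b(1) x(1) x'(1), symmetric] \<beta>[OF x(1), symmetric] \<beta>[OF x'(1), symmetric]
        \<beta>[OF M.add.m_closed[OF x(1) x'(1)], symmetric] mod_hom_add[OF \<alpha> x(1) x'(1)]
      by (rule add[OF b(2) a[OF x(1)] a[OF x'(1)]])
  qed
  have Yfunctor: "is_functor C k (level Y n)" for n
    unfolding is_functor_def
  proof (intro conjI ballI)
    fix b assume b: "b \<in> obj C"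
    show "Module.module k (fob (level Y n) b)" by (rule Ymod[OF b])
    show "far (level Y n) b b (idn C b) y = y" if "y \<in> ?cY n b" for y
    proof -
      obtain x where x: "x \<in> ?cX n b" "y = \<Phi> n b x" using ex[OF b \<open>y \<in> ?cY n b\<close>] by blast
      show ?thesis unfolding x(2) far[OF b b idn[OF b] x(1), symmetric] Xid[OF b x(1)] ..
    qed
    fix l assume l: "l \<in> obj C"
    show "far (level Y n) b l f \<in> mod_hom k (fob (level Y n) b) (fob (level Y n) l)" if f: "f \<in> arr C b l" for f
      by (rule hom_transfer[OF b l Xfar[OF b l f] far[OF b l f]])
    fix m f g y assume m: "m \<in> obj C" and fg: "f \<in> arr C b l" "g \<in> arr C l m" and y: "y \<in> ?cY n b"
    obtain x where x: "x \<in> ?cX n b" "y = \<Phi> n b x" using ex[OF b y] by blast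
    show "far (level Y n) b m (cmp C b l m g f) y = far (level Y n) l m g (far (level Y n) b l f y)"
      unfolding x(2) far[OF b l fg(1) x(1), symmetric] far[OF l m fg(2) fcl[OF b l fg(1) x(1)], symmetric]
        far[OF b m cmp[OF b l m fg] x(1), symmetric] Xcmp[OF b l m fg x(1)] ..
  qed
  have Ycf: "is_nat C k (level Y n) (level Y (n + 1)) (coface Y n i)" if i: "i \<le> n + 1" for n i
    unfolding is_nat_def
  proof (intro conjI ballI)
    fix b assume b: "b \<in> obj C"
    show "coface Y n i b \<in> mod_hom k (fob (level Y n) b) (fob (level Y (n + 1)) b)"
      by (rule hom_transfer[OF b b Xcf[OF i b] coface[OF i b]])
    fix l f y assume l: "l \<in> obj C" and f: "f \<in> arr C b l" and y: "y \<in> ?cY n b"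
    obtain x where x: "x \<in> ?cX n b" "y = \<Phi> n b x" using ex[OF b y] by blast
    show "coface Y n i l (far (level Y n) b l f y) = far (level Y (n + 1)) b l f (coface Y n i b y)"
      unfolding x(2) far[OF b l f x(1), symmetric] coface[OF i b x(1), symmetric]
        coface[OF i l fcl[OF b l f x(1)], symmetric] far[OF b l f cfcl[OF i b x(1)], symmetric]
        Xcfn[OF i b l f x(1)] ..
  qed
  have Ycd: "is_nat C k (level Y (n + 1)) (level Y n) (codeg Y n j)" if j: "j \<le> n" for n j
    unfolding is_nat_def
  proof (intro conjI ballI)
    fix b assume b: "b \<in> obj C"
    show "codeg Y n j b \<in> mod_hom k (fob (level Y (n + 1)) b) (fob (level Y n) b)"
      by (rule hom_transfer[OF b b Xcd[OF j b] codeg[OF j b]])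
    fix l f y assume l: "l \<in> obj C" and f: "f \<in> arr C b l" and y: "y \<in> ?cY (n + 1) b"
    obtain x where x: "x \<in> ?cX (n + 1) b" "y = \<Phi> (n + 1) b x" using ex[OF b y] by blast
    show "codeg Y n j l (far (level Y (n + 1)) b l f y) = far (level Y n) b l f (codeg Y n j b y)"
      unfolding x(2) far[OF b l f x(1), symmetric] codeg[OF j b x(1), symmetric]
        codeg[OF j l fcl[OF b l f x(1)], symmetric] far[OF b l f cdcl[OF j b x(1)], symmetric]
        Xcdn[OF j b l f x(1)] ..
  qed
  have Y: "is_cosimplicial C k Y"
    unfolding is_cosimplicial_def nat_eq_def nat_comp_def nat_id_def
  proof (intro conjI allI impI ballI, goal_cases)
    case (1 n)
    show ?case by (rule Yfunctor)
  next
    case (2 n i)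
    then show ?case by (rule Ycf)
  next
    case (3 n j)
    then show ?case by (rule Ycd)
  next
    case (4 n i j b y)
    then have ij: "i < j" "j \<le> n + 1 + 1" "i \<le> n + 1" "i \<le> n + 1 + 1" "j - 1 \<le> n + 1" by auto
    note b = 4(2)
    obtain x where x: "x \<in> ?cX n b" "y = \<Phi> n b x" using ex[OF b 4(3)] by blast
    have "coface X (n + 1) j b (coface X n i b x) = coface X (n + 1) i b (coface X n (j - 1) b x)"
      using Xd by (elim conjE) (use ij b x(1) in simp)
    then show ?case
      unfolding x(2) coface[OF ij(3) b x(1), symmetric] coface[OF ij(5) b x(1), symmetric]
        coface[OF ij(2) b cfcl[OF ij(3) b x(1)], symmetric] coface[OF ij(4) b cfcl[OF ij(5) b x(1)], symmetric]
      by (rule arg_cong)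
  next
    case (5 n i j b y)
    then have ij: "i \<le> j" "j \<le> n" "i \<le> n + 1" "i \<le> n" "j + 1 \<le> n + 1" by auto
    note b = 5(2)
    have y: "y \<in> ?cY (n + 1 + 1) b" using 5(3) by simp
    obtain x where x: "x \<in> ?cX (n + 1 + 1) b" "y = \<Phi> (n + 1 + 1) b x" using ex[OF b y] by blast
    have "codeg X n j b (codeg X (n + 1) i b x) = codeg X n i b (codeg X (n + 1) (j + 1) b x)"
      using Xd by (elim conjE) (use ij b x(1) in simp)
    then show ?case
      unfolding x(2) codeg[OF ij(3) b x(1), symmetric] codeg[OF ij(5) b x(1), symmetric]
        codeg[OF ij(2) b cdcl[OF ij(3) b x(1)], symmetric] codeg[OF ij(4) b cdcl[OF ij(5) b x(1)], symmetric]
      by (rule arg_cong)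
  next
    case (6 n i j b y)
    then have ij: "j \<le> n" "i = j \<or> i = j + 1" "i \<le> n + 1" by auto
    note b = 6(2)
    obtain x where x: "x \<in> ?cX n b" "y = \<Phi> n b x" using ex[OF b 6(3)] by blast
    have "codeg X n j b (coface X n i b x) = x"
      using Xd by (elim conjE) (use ij b x(1) in simp)
    then show ?case
      unfolding x(2) coface[OF ij(3) b x(1), symmetric] codeg[OF ij(1) b cfcl[OF ij(3) b x(1)], symmetric]
      by (rule arg_cong)
  next
    case (7 n i j b y)
    then have ij: "i < j" "j \<le> n + 1" "i \<le> n + 1 + 1" "i \<le> n + 1" "j - 1 \<le> n" by auto
    note b = 7(2)
    obtain x where x: "x \<in> ?cX (n + 1) b" "y = \<Phi> (n + 1) b x" using ex[OF b 7(3)] by blast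
    have "codeg X (n + 1) j b (coface X (n + 1) i b x) = coface X n i b (codeg X n (j - 1) b x)"
      using Xd by (elim conjE) (use ij b x(1) in simp)
    then show ?case
      unfolding x(2) coface[OF ij(3) b x(1), symmetric] codeg[OF ij(5) b x(1), symmetric]
        codeg[OF ij(2) b cfcl[OF ij(3) b x(1)], symmetric] coface[OF ij(4) b cdcl[OF ij(5) b x(1)], symmetric]
      by (rule arg_cong)
  next
    case (8 n i j b y)
    then have ij: "j + 1 < i" "i \<le> n + 1 + 1" "j \<le> n + 1" "i - 1 \<le> n + 1" "j \<le> n" "i \<le> n + 2" by auto
    note b = 8(2)
    obtain x where x: "x \<in> ?cX (n + 1) b" "y = \<Phi> (n + 1) b x" using ex[OF b 8(3)] by blast
    have "codeg X (n + 1) j b (coface X (n + 1) i b x) = coface X n (i - 1) b (codeg X n j b x)"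
      using Xd by (elim conjE) (use ij(1,6) b x(1) in simp)
    then show ?case
      unfolding x(2) coface[OF ij(2) b x(1), symmetric] codeg[OF ij(5) b x(1), symmetric]
        codeg[OF ij(3) b cfcl[OF ij(2) b x(1)], symmetric] coface[OF ij(4) b cdcl[OF ij(5) b x(1)], symmetric]
      by (rule arg_cong)
  qed
  let ?\<Psi> = "\<lambda>n b. inv_into (?cX n b) (\<Phi> n b)"
  have inv: "?\<Psi> n b (\<Phi> n b x) = x" if "b \<in> obj C" "x \<in> ?cX n b" for n b x
    using bij[OF that(1), of n] that(2) by (simp add: bij_betw_def)
  have \<Phi>map: "is_cosimp_map C k X Y \<Phi>"
    unfolding is_cosimp_map_def is_nat_def nat_eq_def nat_comp_def
    by (intro conjI allI impI ballI \<Phi>hom far coface codeg)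
  have \<Psi>map: "is_cosimp_map C k Y X ?\<Psi>"
    unfolding is_cosimp_map_def is_nat_def nat_eq_def nat_comp_def
  proof (intro conjI allI impI ballI, goal_cases)
    case (1 n b)
    note b = 1
    interpret M: Module.module k "fob (level X n) b" by (rule Xmod[OF b])
    show ?case
    proof (rule mod_homI)
      fix y assume "y \<in> ?cY n b"
      then obtain x where x: "x \<in> ?cX n b" "y = \<Phi> n b x" using ex[OF b] by blast
      show "?\<Psi> n b y \<in> ?cX n b" using x by (simp add: inv[OF b])
      show "?\<Psi> n b (c \<odot>\<^bsub>fob (level Y n) b\<^esub> y) = c \<odot>\<^bsub>fob (level X n) b\<^esub> ?\<Psi> n b y" if c: "c \<in> carrier k" for c
        unfolding x(2) smult[OF b c x(1), symmetric] inv[OF b x(1)] by (rule inv[OF b M.smult_closed[OF c x(1)]])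
      fix y' assume "y' \<in> ?cY n b"
      then obtain x' where x': "x' \<in> ?cX n b" "y' = \<Phi> n b x'" using ex[OF b] by blast
      show "?\<Psi> n b (y \<oplus>\<^bsub>fob (level Y n) b\<^esub> y') = ?\<Psi> n b y \<oplus>\<^bsub>fob (level X n) b\<^esub> ?\<Psi> n b y'"
        unfolding x(2) x'(2) add[OF b x(1) x'(1), symmetric] inv[OF b x(1)] inv[OF b x'(1)]
        by (rule inv[OF b M.add.m_closed[OF x(1) x'(1)]])
    qed
  next
    case (2 n b l f y)
    obtain x where x: "x \<in> ?cX n b" "y = \<Phi> n b x" using ex[OF 2(1,4)] by blast
    show ?case
      unfolding x(2) far[OF 2(1-3) x(1), symmetric] inv[OF 2(1) x(1)] by (rule inv[OF 2(2) fcl[OF 2(1-3) x(1)]])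
  next
    case (3 n i b y)
    obtain x where x: "x \<in> ?cX n b" "y = \<Phi> n b x" using ex[OF 3(2,3)] by blast
    show ?case
      unfolding x(2) coface[OF 3(1,2) x(1), symmetric] inv[OF 3(2) x(1)]
      by (rule inv[OF 3(2) cfcl[OF 3(1,2) x(1)]])
  next
    case (4 n j b y)
    obtain x where x: "x \<in> ?cX (n + 1) b" "y = \<Phi> (n + 1) b x" using ex[OF 4(2,3)] by blast
    show ?case
      unfolding x(2) codeg[OF 4(1,2) x(1), symmetric] inv[OF 4(2) x(1)]
      by (rule inv[OF 4(2) cdcl[OF 4(1,2) x(1)]])
  qed
  have "nat_eq C (level X n) (?\<Psi> n \<bullet> \<Phi> n) nat_id" for n
    by (simp add: nat_eq_def nat_comp_def nat_id_def inv)
  moreover have "nat_eq C (level Y n) (\<Phi> n \<bullet> ?\<Psi> n) nat_id" for n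
    using bij[THEN bij_betw_inv_into_right] by (simp add: nat_eq_def nat_comp_def nat_id_def)
  ultimately show ?thesis
    unfolding cosimp_isomorphic_def using X Y \<Phi>map \<Psi>map by blast
qed

section \<open>The isomorphism\<close>

context pointed_enumeration
begin

abbreviation rhs where
  "rhs \<equiv> cosimp_op (C_cosimp (k_Surj R A))"

lemma rhs_level_eq: "level rhs n = rhs_level A n"
  by (simp add: cosimp_op_def C_cosimp_def Let_def)

lemma rhs_coface:
  assumes b: "finite b" and \<gamma>: "\<gamma> \<in> carrier (homs A n b)" and i: "i \<le> Suc n"
  shows "coface rhs n i b (nestify A n b (coef b \<gamma>)) =
    nestify A (Suc n) b (\<lambda>l. coef b \<gamma> (relab b (coface_relab i) l))"
proof -
  consider "i = Suc n" | "i = 0" | "1 \<le> i" "i \<le> n" using i by linarith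
  then show ?thesis
  proof cases
    case 1
    have "coface rhs n i b (nestify A n b (coef b \<gamma>)) = etaS (rhs_level A n) b (nestify A n b (coef b \<gamma>))"
      by (simp add: cosimp_op_def C_cosimp_def Let_def 1)
    also have "\<dots> = nestify A (Suc n) b (coef b \<gamma>)"
      by (rule etaS_nestify) (rule coef_whole[OF b \<gamma>])
    also have "\<dots> = nestify A (Suc n) b (\<lambda>l. coef b \<gamma> (relab b (coface_relab i) l))"
    proof (rule nestify_cong)
      fix l assume "l \<in> surj_labels A (Suc n) b"
      then have "l \<in> b \<rightarrow>\<^sub>E labels A (Suc n)" by (simp add: surj_labels_def)
      then have "relab b (coface_relab i) l = l" by (rule relab_id) (simp add: coface_relab_def 1)
      then show "coef b \<gamma> l = coef b \<gamma> (relab b (coface_relab i) l)" by simp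
    qed
    finally show ?thesis .
  next
    case 2
    have "coface rhs n i b (nestify A n b (coef b \<gamma>)) =
        (botS_map ^^ n) (psiS (leaf_functor (k_Surj R A))) b (nestify A n b (coef b \<gamma>))"
      by (simp add: cosimp_op_def C_cosimp_def Let_def 2)
    then show ?thesis using psiS_nestify[OF A b coef_expands[OF b \<gamma>]] 2 by simp
  next
    case 3
    have "Suc n - i \<noteq> Suc n" "Suc n - i \<noteq> 0" using 3 by linarith+
    then have "coface rhs n i b (nestify A n b (coef b \<gamma>)) =
        (botS_map ^^ (n - i)) DeltaS b (nestify A n b (coef b \<gamma>))"
      using 3 by (simp add: cosimp_op_def C_cosimp_def Let_def)
    then show ?thesis using DeltaS_nestify[OF 3(1), of "n - i" b A "coef b \<gamma>"] 3 by simp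
  qed
qed

lemma rhs_codeg:
  assumes "j \<le> n"
  shows "codeg rhs n j b (nestify A (Suc n) b c) = nestify A n b (\<lambda>l. c (relab b (codeg_relab j) l))"
proof -
  have "codeg rhs n j b (nestify A (Suc n) b c) = (botS_map ^^ (n - j)) epsS b (nestify A (Suc n) b c)"
    by (simp add: cosimp_op_def C_cosimp_def Let_def)
  then show ?thesis using epsS_nestify[of "n - j" b A j c] assms by simp
qed

definition to_nest where
  "to_nest n b \<gamma> = nestify A n b (coef b \<gamma>)"

lemma surj_labelsD: "l \<in> surj_labels A n b \<Longrightarrow> l \<in> b \<rightarrow>\<^sub>E labels A n"
  by (simp add: surj_labels_def)

lemma to_nest_bij:
  assumes b: "finite b"
  shows "bij_betw (to_nest n b) (carrier (homs A n b)) (carrier (fob (rhs_level A n) b))"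
  unfolding bij_betw_def
proof
  show "inj_on (to_nest n b) (carrier (homs A n b))"
  proof (rule inj_onI)
    fix \<gamma> \<gamma>' assume \<gamma>: "\<gamma> \<in> carrier (homs A n b)" "\<gamma>' \<in> carrier (homs A n b)"
      and eq: "to_nest n b \<gamma> = to_nest n b \<gamma>'"
    show "\<gamma> = \<gamma>'"
    proof (rule homs_eq_if_coef_eq[OF b \<gamma>])
      fix l assume l: "l \<in> surj_labels A n b"
      show "coef b \<gamma> l = coef b \<gamma>' l"
        using unnest_nestify[OF l, of "coef b \<gamma>"] unnest_nestify[OF l, of "coef b \<gamma>'"] eq
        by (simp add: to_nest_def)
    qed
  qed
  show "to_nest n b ` carrier (homs A n b) = carrier (fob (rhs_level A n) b)"
  proof (intro equalityI subsetI)
    fix u assume "u \<in> to_nest n b ` carrier (homs A n b)"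
    then obtain \<gamma> where \<gamma>: "\<gamma> \<in> carrier (homs A n b)" "u = to_nest n b \<gamma>" by auto
    show "u \<in> carrier (fob (rhs_level A n) b)"
      unfolding \<gamma>(2) to_nest_def by (rule nestify_closed[OF A b coef_closed[OF b \<gamma>(1) surj_labelsD]])
  next
    fix u assume u: "u \<in> carrier (fob (rhs_level A n) b)"
    define c where "c = (\<lambda>l. if l \<in> surj_labels A n b then unnest n b u l else \<zero>)"
    have "c l \<in> carrier R" for l using unnest_closed[OF u] by (simp add: c_def)
    then obtain \<gamma> where \<gamma>: "\<gamma> \<in> carrier (homs A n b)" "\<forall>l \<in> b \<rightarrow>\<^sub>E labels A n. coef b \<gamma> l = c l"
      using exists_homs_with_coef[OF b, of n c] by (auto simp: c_def)
    have "to_nest n b \<gamma> = nestify A n b (unnest n b u)"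
      unfolding to_nest_def
    proof (rule nestify_cong)
      fix l assume l: "l \<in> surj_labels A n b"
      then show "coef b \<gamma> l = unnest n b u l" using bspec[OF \<gamma>(2) surj_labelsD[OF l]] by (simp add: c_def)
    qed
    also have "\<dots> = u" by (rule nestify_unnest[OF u])
    finally show "u \<in> to_nest n b ` carrier (homs A n b)" using \<gamma>(1) by blast
  qed
qed

lemma lhs_isomorphic_rhs:
  "cosimp_isomorphic (op_cat Sigma_cat) R
    (lhs A :: ('v::infinite set, 'v \<Rightarrow> 'v, 'a, 'u pset \<Rightarrow>
      (('i \<Rightarrow> 'u \<Rightarrow> 'a) \<Rightarrow> 'a) set \<Rightarrow> (('v \<Rightarrow> 'u \<Rightarrow> 'a) \<Rightarrow> 'a) set) cosimp) rhs"
proof (rule cosimp_isomorphic_by_transport[where \<Phi> = to_nest, OF lhs_is_cosimplicial],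
    unfold lhs_fob rhs_level_eq obj_Sigma Suc_eq_plus1[symmetric], goal_cases)
  case (1 b)
  show ?case by (auto simp: arr_Sigma idn_Sigma bij_betw_def inj_on_def)
next
  case (2 b l m f g)
  then have "bij_betw (compose m f g) m b" by (auto simp: arr_Sigma intro: bij_betw_compose)
  then show ?case by (auto simp: arr_Sigma cmp_Sigma compose_def bij_betw_def)
next
  case (3 n b)
  then show ?case by (rule to_nest_bij)
next
  case (4 n b)
  interpret H: Module.module R "homs A n b" by (rule module_homs)
  note c = coef_closed[OF 4 H.zero_closed surj_labelsD]
  have "to_nest n b \<zero>\<^bsub>homs A n b\<^esub> = to_nest n b (\<zero> \<odot>\<^bsub>homs A n b\<^esub> \<zero>\<^bsub>homs A n b\<^esub>)" by simp
  also have "\<dots> = nestify A n b (\<lambda>l. \<zero>)"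
    unfolding to_nest_def
  proof (rule nestify_cong)
    fix l assume l: "l \<in> surj_labels A n b"
    show "coef b (\<zero> \<odot>\<^bsub>homs A n b\<^esub> \<zero>\<^bsub>homs A n b\<^esub>) l = \<zero>"
      unfolding coef_smult[OF 4 surj_labelsD[OF l] H.zero_closed zero_closed] by (rule l_null[OF c[OF l]])
  qed
  finally show ?case by (simp add: nestify_zero)
next
  case (5 n b \<gamma> \<gamma>')
  show ?case unfolding to_nest_def nestify_add
    by (rule nestify_cong) (rule coef_add[OF 5(1) surj_labelsD 5(2,3)])
next
  case (6 n b c \<gamma>)
  show ?case unfolding to_nest_def nestify_smult[OF 6(2)]
    by (rule nestify_cong) (rule coef_smult[OF 6(1) surj_labelsD 6(3,2)])
next
  case (7 n b l f \<gamma>)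
  then have f: "bij_betw f l b" by (simp add: arr_Sigma)
  show ?case
    unfolding to_nest_def
  proof (rule trans)
    show "nestify A n l (coef l (far (level (lhs A) n) b l f \<gamma>)) =
        nestify A n l (\<lambda>p. coef b \<gamma> (\<lambda>x\<in>b. p (inv_into l f x)))"
      by (rule nestify_cong) (rule coef_far[OF 7(1,4) f], rule surj_labelsD)
    show "\<dots> = far (rhs_level A n) b l f (nestify A n b (coef b \<gamma>))"
      by (rule far_nestify[symmetric, OF A 7(1) f]) (rule coef_closed[OF 7(1,4)], rule surj_labelsD)
  qed
next
  case (8 n i b \<gamma>)
  show ?case
    unfolding to_nest_def rhs_coface[OF 8(2,3,1)]
  proof (rule nestify_cong)
    fix l assume "l \<in> surj_labels A (Suc n) b"
    then show "coef b (coface (lhs A) n i b \<gamma>) l = coef b \<gamma> (relab b (coface_relab i) l)"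
      by (rule coef_coface[OF 8(2,3) _ 8(1)])
  qed
next
  case (9 n j b \<gamma>)
  show ?case
    unfolding to_nest_def rhs_codeg[OF 9(1)]
  proof (rule nestify_cong)
    fix l assume l: "l \<in> surj_labels A n b"
    show "coef b (codeg (lhs A) n j b \<gamma>) l = coef b \<gamma> (relab b (codeg_relab j) l)"
      by (rule coef_codeg[OF 9(2,3,1) surj_labelsD[OF l]])
  qed
qed

end

lemma ex_pointed_enumeration:
  fixes A :: "'i set"
  assumes "finite A"
  obtains Y :: "'u::infinite pset" and \<iota> where "Y \<in> obj Gamma" "bij_betw \<iota> A (fst Y - {snd Y})"
proof -
  obtain U :: "'u set" where U: "finite U" "card U = Suc (card A)"
    using infinite_arbitrarily_large[OF infinite_UNIV, of "Suc (card A)"] by blast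
  then obtain y where y: "y \<in> U" by fastforce
  have "finite (U - {y})" "card A = card (U - {y})" using U y by simp_all
  then obtain \<iota> where "bij_betw \<iota> A (U - {y})"
    using finite_same_card_bij[OF assms] by blast
  then show thesis using U y by (intro that[of "(U, y)" \<iota>]) (simp_all add: obj_Gamma)
qed

theorem theorem5p1:
  fixes k :: "('k, 'r) ring_scheme" and a :: nat
  assumes "cring k"
  shows "cosimp_isomorphic (op_cat Sigma_cat) k
    (tstar_hom_cosimp k {1..a} ::
      ('v::infinite set, 'v \<Rightarrow> 'v, 'k, 'u::infinite pset \<Rightarrow>
        ((nat \<Rightarrow> 'u \<Rightarrow> 'k) \<Rightarrow> 'k) set \<Rightarrow> (('v \<Rightarrow> 'u \<Rightarrow> 'k) \<Rightarrow> 'k) set) cosimp)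
    (cosimp_op (C_cosimp (k_Surj k {1..a})))"
proof -
  obtain Y :: "'u pset" and \<iota> where Y: "Y \<in> obj Gamma" "bij_betw \<iota> {1..a} (fst Y - {snd Y})"
    by (rule ex_pointed_enumeration[of "{1..a}"]) auto
  interpret pointed_enumeration k "{1..a}" Y \<iota>
    by (intro pointed_enumeration.intro pointed_enumeration_axioms.intro assms Y finite_atLeastAtMost)
  show ?thesis by (rule lhs_isomorphic_rhs)
qed

end
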